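(* Let $\bar x=(\bar\kappa,\bar b)\in\mathcal S_+$. Assume that the $(J+N)\times(J+N)$ matrix $A$ is invertible and that $\mathbb I_* A=A\,\mathbb I_*$ on $\mathbb C^J\times \mathbf X_0^K$. Let $r^*=(r_1^*,r_2^* )\in\mathbb R_+^2$ with $r_1^*<1$. Let $Y^{[i]},Z^{[i]}_{i'},W^{[i]}_{i'i''}\in\mathbb R_+$ ($i,i',i''\in\{1,2\}$) satisfy $$|\pi_\kappa[T(\bar x)-\bar x]|_{\mathbb C^J}\le Y^{[1]},\qquad \|\pi_b[T(\bar x)-\bar x]\|_{\mathbf X_0}\le Y^{[2]},$$ $$\|\pi_\kappa D_\kappa T(\bar x)\|_{B(\mathbb C^J,\mathbb C^J)}\le Z^{[1]}_1,\quad \|\pi_\kappa D_bT(\bar x)\|_{B(\mathbf X_0,\mathbb C^J)}\le Z^{[1]}_2,$$ $$\|\pi_b D_\kappa T(\bar x)\|_{B(\mathbb C^J,\mathbf X_0)}\le Z^{[2]}_1,\quad \|\pi_b D_bT(\bar x)\|_{B(\mathbf X_0,\mathbf X_0)}\le Z^{[2]}_2,$$ and, for all $r=(r_1,r_2)$ with $0\le r_1\le r_1^*$, $0\le r_2\le r_2^*$ and all $x\in\mathcal B^{\mathcal S}_r(\bar x)$, $$\|\pi_\kappa[D_\kappa T(x)-D_\kappa T(\bar x)]\|_{B(\mathbb C^J,\mathbb C^J)}\le W^{[1]}_{11}r_1+W^{[1]}_{12}r_2,$$ $$\|\pi_\kappa[D_bT(x)-D_bT(\bar x)]\|_{B(\mathbf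 X_0,\mathbb C^J)}\le W^{[1]}_{21}r_1+W^{[1]}_{22}r_2,$$ $$\|\pi_b[D_\kappa T(x)-D_\kappa T(\bar x)]\|_{B(\mathbb C^J,\mathbf X_0)}\le W^{[2]}_{11}r_1+W^{[2]}_{12}r_2,$$ $$\|\pi_b[D_bT(x)-D_bT(\bar x)]\|_{B(\mathbf X_0,\mathbf X_0)}\le W^{[2]}_{21}r_1+W^{[2]}_{22}r_2.$$ Write $W^{[i]}_{i'}(r)=W^{[i]}_{i'1}r_1+W^{[i]}_{i'2}r_2$ and define $$p_1(r)=Y^{[1]}+r_1\bigl[Z^{[1]}_1+\tfrac12W^{[1]}_1(r)-1\bigr]+r_2\bigl[Z^{[1]}_2+\tfrac12W^{[1]}_2(r)\bigr],$$ $$p_2(r)=Y^{[2]}+r_1\bigl[Z^{[2]}_1+\tfrac12W^{[2]}_1(r)\bigr]+r_2\bigl[Z^{[2]}_2+\tfrac12W^{[2]}_2(r)-1\bigr],$$ $$\mathcal M(r)=\begin{pmatrix}Z^{[1]}_1+W^{[1]}_1(r)&Z^{[1]}_2+W^{[1]}_2(r)\\ Z^{[2]}_1+W^{[2]}_1(r)&Z^{[2]}_2+W^{[2]}_2(r)\end{pmatrix},$$ $$\tilde p_3(r)=\operatorname{tr}\mathcal M(r)-2,\qquad \tilde p_4(r)=\operatorname{tr}\mathcal M(r)-\det\mathcal M(r)-1 .$$ If $\hat r=(\hat r_1,\hat r_2)$ satisfies $0<\hat r_i\le r_i^*$ ($i=1,2$) and $$p_1(\hat r)<0,\quad p_2(\hat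 r)<0,\quad \tilde p_3(\hat r)<0,\quad \tilde p_4(\hat r)<0,$$ then: (a) $\mathcal F$ has a unique zero $\hat x=(\hat\kappa,\hat b)$ in $\mathcal B^{\mathcal S}_{\hat r}(\bar x)$; (b) $\hat b$ corresponds to a $\mathcal G$-invariant real-valued periodic solution $$\hat u(\mathrm x)=\sum_{k\in\mathbb Z^3}\bigl(\sigma(m\mathrm e_0+\hat b)\bigr)_k\exp(\mathrm i\,\mathcal L_{\hat\kappa}k\cdot \mathrm x)$$ of the PDE $-\Delta\bigl(\gamma^{-2}\Delta u+u-u^3\bigr)-(u-m)=0$; (c) the domain of periodicity $\Omega_{\hat\kappa}=\{2\pi(\mathcal L_{\hat\kappa}^{-1})^T\tilde{\mathrm x}:\tilde{\mathrm x}\in[0,1]^3\}$ is such that the energy is stationary with respect to variations in its ($\mathcal G$-symmetry respecting) proportions, i.e. $\frac{\partial E}{\partial\kappa_j}(\hat\kappa,\sigma(m\mathrm e_0+\hat b))=0$ for $1\le j\le J$.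
   Context: Parameters: $\gamma>0$, $m\in[-1,1]$, $\nu>1$. $\mathbb R_+$ denotes the positive reals and $\mathbb C^J_+=\{\kappa\in\mathbb C^J:\operatorname{Re}\kappa_j>0\}$. Space group. $\mathcal G$ is one of the following three-dimensional crystallographic space groups (numbering of the International Tables), taken modulo translations by the period lattice, so that it is a finite group: orthorhombic 16–24, 47–74; tetragonal 81–98, 111–142; trigonal 147–155, 162–167; hexagonal 174–182, 187–194; cubic 195–230. The number of independent length scales is $J=3$ (orthorhombic), $J=2$ (tetragonal, trigonal, hexagonal), $J=1$ (cubic). For $l\in\mathbb R^J_+$ put $\widehat{\mathcal L}_l=\mathrm{diag}(l_1,l_2,l_3)$, $\mathrm{diag}(l_1,l_1,l_2)$, $\mathrm{diag}(l_1,l_1,l_1)$ for $J=3,2,1$ respectively. $\widetilde{\mathcal L}$ is the identity for orthorhombic, tetragonal and cubic groups, and $\widetilde{\mathcal L}=\begin{pmatrix}1&1/2&0\\0&\sqrt3/2&0\\0&0&1\end{pmatrix}$ for trigonal and hexagonal groups. For $\kappa\in\mathbb R_+^J$, $\mathcal L_\kappa=\widetilde{\mathcal L}\,\widehat{\mathcal L}_{\sqrt\kappa}$ with componentwise square root. Each $g\in\mathcal G$ acts on $\mathbb R^3$ by $\mathrm x\mapsto C_g\mathrm x+2\pi(\mathcal L_\kappa^{-1})^TD_g$ with $C_g$ orthogonal (independent of $\kappa$) and $D_g\in[0,1]^3$; a function $u$ is $\mathcal G$-invariant if $u(C_g\mathrm x+2\pi(\mathcal L_\kappa^{-1})^TD_g)=u(\mathrm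 x)$ for all $g$. $C_g$ commutes with all $\widehat{\mathcal L}_l$ and maps $\widetilde{\mathcal L}\mathbb Z^3$ to itself. Laplacian symbol. For $k\in\mathbb Z^3$, $\Delta_k\kappa=\sum_{j=1}^J\Delta_k^j\kappa_j$ is given by $\kappa_1k_1^2+\kappa_2k_2^2+\kappa_3k_3^2$ (orthorhombic), $\kappa_1(k_1^2+k_2^2)+\kappa_2k_3^2$ (tetragonal), $\kappa_1(k_1^2+k_1k_2+k_2^2)+\kappa_2k_3^2$ (trigonal, hexagonal), $\kappa_1(k_1^2+k_2^2+k_3^2)$ (cubic). It satisfies $\Delta^j_{\beta_g(k)}=\Delta^j_k$, with $\beta_g$ as below. Group action on Fourier coefficients. $g.k=\beta_g(k)=\widetilde{\mathcal L}^{-1}C_g\widetilde{\mathcal L}k\in\mathbb Z^3$, $\alpha_g(k)=\exp(2\pi\mathrm i\,\beta_g(k)\cdot D_g)$, $(\gamma_gc)_k=\alpha_g(k)c_{\beta_g(k)}$. $\mathcal G.k$ is the orbit of $k$, $\mathcal G_k$ its stabilizer. $\mathcal Z_{\rm sym}=\{k\in\mathbb Z^3:\sum_{g\in\mathcal G_k}\alpha_g(k)=|\mathcal G_k|\}$; $\mathcal Z_{\rm dom}\subset\mathbb Z^3$ is a fixed set containing exactly one element of each orbit; $\mathcal Z=\mathcal Z_{\rm sym}\cap\mathcal Z_{\rm dom}$, $\mathcal Z_0=\mathcal Z\setminus\{0\}$. For $k\in\mathcal Z$ and $k'\in\mathcal G.k$, choose $\tilde g$ with $\tilde g.k=k'$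 and put $\widetilde\alpha(k,k')=\alpha_{\tilde g}(k)^{-1}$ (independent of the choice). Norms and spaces. With $\bar\kappa\in\mathbb R^J_+$ (the first component of $\bar x$): $|k|_{\bar\kappa}=\sqrt{\Delta_k\bar\kappa}$, $|\kappa|_{\mathbb C^J}=\max_j|\kappa_j|/\bar\kappa_j$, $\omega_k=|\mathcal G.k|\,\nu^{|k|_{\bar\kappa}}$. $\mathbf X=\{b=(b_k)_{k\in\mathcal Z}\subset\mathbb C:\|b\|_{\mathbf X}=\sum_{k\in\mathcal Z}|b_k|\omega_k<\infty\}$, $\mathbf X_0=\{b\in\mathbf X:b_0=0\}$ (identified with $(b_k)_{k\in\mathcal Z_0}$) with induced norm $\|\cdot\|_{\mathbf X_0}$. $\mathrm e_k$ is the standard basis element. $\sigma(b)=\sum_{k\in\mathcal Z}b_k\sum_{k'\in\mathcal G.k}\widetilde\alpha(k,k')\mathrm e_{k'}$, a sequence on $\mathbb Z^3$. $\langle cc'\rangle_k=\sum_{k_1+k_2=k}c_{k_1}c'_{k_2}$ is the discrete convolution, similarly for powers. $B(X,X')$ is the space of bounded linear operators with operator norm; $\pi_\kappa,\pi_b$ are the projections of $\mathbb C^J\times\mathbf X_0$ (and of $\mathbb C^J\times\mathbb C^{\mathcal Z_0}$) onto its two factors. Conjugation. $(\mathbb I_*\kappa)_j=\overline{\kappa_j}$, $(\mathbb I_*b)_k=\overline{\sigma(b)_{-k}}$ for $k\in\mathcal Z$, $\mathbb I_*(\kappa,b)=(\mathbb I_*\kappa,\mathbb I_*b)$. $\mathcal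 S=\{x\in\mathbb C^J\times\mathbf X:\mathbb I_*x=x\}$ and $\mathcal S_+=\mathcal S\cap(\mathbb C^J_+\times\mathbf X_0)$ (so $\kappa\in\mathbb R^J_+$ for $(\kappa,b)\in\mathcal S_+$). For $x\in\mathbb C^J\times\mathbf X_0$, $\mathcal B_r(x)=\{(\kappa,b)\in\mathbb C^J\times\mathbf X_0:|\kappa-\pi_\kappa x|_{\mathbb C^J}\le r_1,\ \|b-\pi_bx\|_{\mathbf X_0}\le r_2\}$ and $\mathcal B^{\mathcal S}_r(x)=\mathcal B_r(x)\cap\mathcal S$. Energy and zero finding map. $P(y)=\gamma^{-2}y-1+y^{-1}$. With $c_0=m$, $$E(\kappa,c)=\tfrac12\sum_{k\in\mathbb Z^3\setminus\{0\}}P(\Delta_k\kappa)c_kc_{-k}+\tfrac14\langle c^4\rangle_0+\tfrac{1-2m^2}{4}.$$ $\mathcal F(\kappa,b)=[H(\kappa,b),F(\kappa,b)]$ for $(\kappa,b)\in\mathbb C^J_+\times\mathbf X_0$, where, with $c=\sigma(m\mathrm e_0+b)$, $$H_j(\kappa,b)=\tfrac12\sum_{k\in\mathbb Z^3\setminus\{0\}}P'(\Delta_k\kappa)\Delta_k^jc_kc_{-k}\ (1\le j\le J),\qquad F_k(\kappa,b)=|\mathcal G.k|\bigl(P(\Delta_k\kappa)c_k+\langle c^3\rangle_k\bigr)\ (k\in\mathcal Z_0).$$ Fixed point map. Let $y_P=\gamma$ if $\gamma\le2$ and $y_P=\frac12(\gamma^2+\sqrt{\gamma^4-4\gamma^2})$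 if $\gamma>2$, and fix $K>\sqrt{y_P}$ (so $P(\Delta_k\bar\kappa)>0$ for $|k|_{\bar\kappa}>K$). $\mathcal Z_0^K=\{k\in\mathcal Z_0:|k|_{\bar\kappa}\le K\}$, $N$ is its cardinality, $\mathbf X_0^K=\{b\in\mathbf X_0:b_k=0\text{ for }k\notin\mathcal Z_0^K\}$; $\pi_K$ is truncation to the indices in $\mathcal Z_0^K$ and $\pi_\infty$ is truncation to the indices in $\mathcal Z_0\setminus\mathcal Z_0^K$. $A$ is a complex $(J+N)\times(J+N)$ matrix, acting on $\mathbb C^J\times\mathbf X_0^K$ (in practice a numerical approximate inverse of the Jacobian at $\bar x$ of the truncation of $\mathcal F$). The linear operator $\mathcal A$ is defined by $(\pi_\kappa+\pi_K)\mathcal Ax=A(\pi_\kappa+\pi_K)x$ and $(\mathcal Ax)_k=\frac{(\pi_bx)_k}{P(\Delta_k\bar\kappa)|\mathcal G.k|}$ for $k\in\mathcal Z_0$, $|k|_{\bar\kappa}>K$. The map $T:\mathbb C^J_+\times\mathbf X_0\to\mathbb C^J\times\mathbf X_0$ is $T(x)=x-\mathcal A\mathcal F(x)$, and $D_\kappa T$, $D_bT$ are its partial Fréchet derivatives. *)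

theory Defs
  imports
    "HOL-Analysis.Analysis"
    "HOL-Algebra.Group_Action"
    "HOL-Library.Function_Algebras"
begin

section \<open>Crystal systems and lattices\<close>

datatype crystal_system = Orthorhombic | Tetragonal | Trigonal | Hexagonal | Cubic

text \<open>Tuples indexed by \<open>1, ..., J\<close> are functions on \<open>nat\<close>; only the arguments
  \<open>1, ..., J\<close> matter, and complex tuples are required to vanish elsewhere (see \<open>CJ\<close>).\<close>

definition num_scales :: "crystal_system \<Rightarrow> nat" where
  "num_scales s = (case s of Orthorhombic \<Rightarrow> 3 | Cubic \<Rightarrow> 1 | _ \<Rightarrow> 2)"

definition diag3 :: "real \<Rightarrow> real \<Rightarrow> real \<Rightarrow> real^3^3" where
  "diag3 a b c = vector [vector [a, 0, 0], vector [0, b, 0], vector [0, 0, c]]"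

definition Lhat :: "crystal_system \<Rightarrow> (nat \<Rightarrow> real) \<Rightarrow> real^3^3" where
  "Lhat s l = (case s of
      Orthorhombic \<Rightarrow> diag3 (l 1) (l 2) (l 3)
    | Cubic \<Rightarrow> diag3 (l 1) (l 1) (l 1)
    | _ \<Rightarrow> diag3 (l 1) (l 1) (l 2))"

definition Ltilde :: "crystal_system \<Rightarrow> real^3^3" where
  "Ltilde s = (if s = Trigonal \<or> s = Hexagonal
     then vector [vector [1, 1/2, 0], vector [0, sqrt 3 / 2, 0], vector [0, 0, 1]]
     else mat 1)"

definition Lmat :: "crystal_system \<Rightarrow> (nat \<Rightarrow> real) \<Rightarrow> real^3^3" where
  "Lmat s \<kappa> = Ltilde s ** Lhat s (\<lambda>j. sqrt (\<kappa> j))"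

definition ivec :: "int^3 \<Rightarrow> real^3" where
  "ivec k = (\<chi> i. of_int (k $ i))"

definition Delta_coef :: "crystal_system \<Rightarrow> int^3 \<Rightarrow> nat \<Rightarrow> int" where
  "Delta_coef s k j = (case s of
      Orthorhombic \<Rightarrow> [(k$1)^2, (k$2)^2, (k$3)^2]
    | Tetragonal \<Rightarrow> [(k$1)^2 + (k$2)^2, (k$3)^2]
    | Cubic \<Rightarrow> [(k$1)^2 + (k$2)^2 + (k$3)^2]
    | _ \<Rightarrow> [(k$1)^2 + k$1 * k$2 + (k$2)^2, (k$3)^2]) ! (j - 1)"

definition Delta :: "crystal_system \<Rightarrow> int^3 \<Rightarrow> (nat \<Rightarrow> 'a::comm_ring_1) \<Rightarrow> 'a" where
  "Delta s k \<kappa> = (\<Sum>j = 1..num_scales s. of_int (Delta_coef s k j) * \<kappa> j)"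


section \<open>Space groups modulo the period lattice\<close>

inductive_set mat_closure :: "(real^3^3) set \<Rightarrow> (real^3^3) set" for M where
  one: "mat 1 \<in> mat_closure M"
| step: "A \<in> M \<Longrightarrow> B \<in> mat_closure M \<Longrightarrow> A ** B \<in> mat_closure M"

definition rot_z :: "real \<Rightarrow> real^3^3" where
  "rot_z t = vector [vector [cos t, - sin t, 0], vector [sin t, cos t, 0], vector [0, 0, 1]]"

text \<open>Half turn about the horizontal axis \<open>(cos t, sin t, 0)\<close>.\<close>

definition half_turn :: "real \<Rightarrow> real^3^3" where
  "half_turn t = vector [vector [cos (2*t), sin (2*t), 0],
                         vector [sin (2*t), - cos (2*t), 0], vector [0, 0, -1]]"

definition rot_111 :: "real^3^3" where
  "rot_111 = vector [vector [0, 0, 1], vector [1, 0, 0], vector [0, 1, 0]]"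

definition minv :: "real^3^3" where
  "minv = - mat 1"

text \<open>The International Tables order space groups by geometric crystal class, and the ranges
  16-24, 47-74, 81-98, 111-142, 147-155, 162-167, 174-182, 187-194, 195-230 consist of all space
  groups of the classes below (the classes of the five systems that fix no direction).
  A class appears twice if it has two inequivalent orientations relative to the lattice.
  The generated matrix groups are finite, so closure under products suffices.\<close>

definition point_groups :: "crystal_system \<Rightarrow> (real^3^3) set set" where
  "point_groups s = mat_closure ` (case s of
      Orthorhombic \<Rightarrow>
       {{rot_z pi, half_turn 0},                    \<comment> \<open>222: 16-24\<close>
        {rot_z pi, half_turn 0, minv}}              \<comment> \<open>mmm: 47-74\<close>
    | Tetragonal \<Rightarrow>
       {{- rot_z (pi/2)},                           \<comment> \<open>-4: 81-82\<close>
        {rot_z (pi/2), minv},                       \<comment> \<open>4/m: 83-88\<close>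
        {rot_z (pi/2), half_turn 0},                \<comment> \<open>422: 89-98\<close>
        {- rot_z (pi/2), half_turn 0},              \<comment> \<open>-42m: 111-122\<close>
        {- rot_z (pi/2), half_turn (pi/4)},         \<comment> \<open>-4m2: 111-122\<close>
        {rot_z (pi/2), half_turn 0, minv}}          \<comment> \<open>4/mmm: 123-142\<close>
    | Trigonal \<Rightarrow>
       {{rot_z (2*pi/3), minv},                     \<comment> \<open>-3: 147-148\<close>
        {rot_z (2*pi/3), half_turn 0},              \<comment> \<open>32: 149-155\<close>
        {rot_z (2*pi/3), half_turn (pi/6)},         \<comment> \<open>32: 149-155\<close>
        {rot_z (2*pi/3), half_turn 0, minv},        \<comment> \<open>-3m: 162-167\<close>
        {rot_z (2*pi/3), half_turn (pi/6), minv}}   \<comment> \<open>-3m: 162-167\<close>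
    | Hexagonal \<Rightarrow>
       {{- rot_z (pi/3)},                           \<comment> \<open>-6: 174\<close>
        {rot_z (pi/3), minv},                       \<comment> \<open>6/m: 175-176\<close>
        {rot_z (pi/3), half_turn 0},                \<comment> \<open>622: 177-182\<close>
        {- rot_z (pi/3), half_turn 0},              \<comment> \<open>-62m: 187-190\<close>
        {- rot_z (pi/3), half_turn (pi/6)},         \<comment> \<open>-6m2: 187-190\<close>
        {rot_z (pi/3), half_turn 0, minv}}          \<comment> \<open>6/mmm: 191-194\<close>
    | Cubic \<Rightarrow>
       {{rot_z pi, rot_111},                        \<comment> \<open>23: 195-199\<close>
        {rot_z pi, rot_111, minv},                  \<comment> \<open>m-3: 200-206\<close>
        {rot_z (pi/2), rot_111},                    \<comment> \<open>432: 207-214\<close>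
        {- rot_z (pi/2), rot_111},                  \<comment> \<open>-43m: 215-220\<close>
        {rot_z (pi/2), rot_111, minv}}            \<comment> \<open>m-3m: 221-230\<close>)"

text \<open>\<open>lin S g\<close> and \<open>shift S g\<close> are \<open>C\<^sub>g\<close> and \<open>D\<^sub>g\<close>; \<open>fdom S\<close> is the set of orbit representatives.\<close>

record 'g crystal_group = "'g monoid" +
  csys :: crystal_system
  lin :: "'g \<Rightarrow> real^3^3"
  shift :: "'g \<Rightarrow> real^3"
  fdom :: "(int^3) set"

definition act :: "'g crystal_group \<Rightarrow> (nat \<Rightarrow> real) \<Rightarrow> 'g \<Rightarrow> real^3 \<Rightarrow> real^3" where
  "act S \<kappa> g x = lin S g *v x
     + (2 * pi) *\<^sub>R (transpose (matrix_inv (Lmat (csys S) \<kappa>)) *v shift S g)"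

definition period_lattice :: "crystal_system \<Rightarrow> (nat \<Rightarrow> real) \<Rightarrow> (real^3) set" where
  "period_lattice s \<kappa> =
     range (\<lambda>n. (2 * pi) *\<^sub>R (transpose (matrix_inv (Lmat s \<kappa>)) *v ivec n))"

definition pos_scales :: "crystal_system \<Rightarrow> (nat \<Rightarrow> real) \<Rightarrow> bool" where
  "pos_scales s \<kappa> \<longleftrightarrow> (\<forall>j\<in>{1..num_scales s}. 0 < \<kappa> j)"

text \<open>The clauses on \<open>lin\<close> after \<open>point_groups\<close> are consequences of that one.
  Distinct elements of the group are distinct modulo the period lattice.\<close>

definition space_group_mod :: "'g crystal_group \<Rightarrow> bool" where
  "space_group_mod S \<longleftrightarrow>
     group S \<and> finite (carrier S) \<and>
     lin S ` carrier S \<in> point_groups (csys S) \<and>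
     (\<forall>g\<in>carrier S. orthogonal_matrix (lin S g) \<and>
        (\<forall>l. pos_scales (csys S) l \<longrightarrow> lin S g ** Lhat (csys S) l = Lhat (csys S) l ** lin S g) \<and>
        (\<forall>k. lin S g *v (Ltilde (csys S) *v ivec k) \<in> range (\<lambda>n. Ltilde (csys S) *v ivec n)) \<and>
        (\<forall>i. 0 \<le> shift S g $ i \<and> shift S g $ i \<le> 1)) \<and>
     (\<forall>g\<in>carrier S. \<forall>h\<in>carrier S. lin S (g \<otimes>\<^bsub>S\<^esub> h) = lin S g ** lin S h \<and>
        (\<forall>\<kappa> x. pos_scales (csys S) \<kappa> \<longrightarrow>
           act S \<kappa> (g \<otimes>\<^bsub>S\<^esub> h) x - act S \<kappa> g (act S \<kappa> h x) \<in> period_lattice (csys S) \<kappa>)) \<and>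
     (\<forall>g\<in>carrier S. \<forall>h\<in>carrier S.
        lin S g = lin S h \<and> shift S g - shift S h \<in> range ivec \<longrightarrow> g = h)"

definition beta :: "'g crystal_group \<Rightarrow> 'g \<Rightarrow> int^3 \<Rightarrow> int^3" where
  "beta S g k = (THE n. ivec n =
     matrix_inv (Ltilde (csys S)) *v (lin S g *v (Ltilde (csys S) *v ivec k)))"

definition alpha :: "'g crystal_group \<Rightarrow> 'g \<Rightarrow> int^3 \<Rightarrow> complex" where
  "alpha S g k = exp (2 * of_real pi * \<i> * of_real (ivec (beta S g k) \<bullet> shift S g))"

abbreviation Orb :: "'g crystal_group \<Rightarrow> int^3 \<Rightarrow> (int^3) set" where
  "Orb S k \<equiv> orbit S (beta S) k"

definition Zsym :: "'g crystal_group \<Rightarrow> (int^3) set" where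
  "Zsym S = {k. (\<Sum>g\<in>stabilizer S (beta S) k. alpha S g k)
                 = of_nat (card (stabilizer S (beta S) k))}"

definition is_dom :: "'g crystal_group \<Rightarrow> bool" where
  "is_dom S \<longleftrightarrow> (\<forall>k. \<exists>!k'. k' \<in> fdom S \<and> k' \<in> Orb S k)"

definition Zind :: "'g crystal_group \<Rightarrow> (int^3) set" where
  "Zind S = Zsym S \<inter> fdom S"

definition Z0 :: "'g crystal_group \<Rightarrow> (int^3) set" where
  "Z0 S = Zind S - {0}"

definition alpha_tilde :: "'g crystal_group \<Rightarrow> int^3 \<Rightarrow> int^3 \<Rightarrow> complex" where
  "alpha_tilde S k k' = inverse (alpha S (SOME g. g \<in> carrier S \<and> beta S g k = k') k)"

definition unit_vec :: "int^3 \<Rightarrow> int^3 \<Rightarrow> complex" where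
  "unit_vec k l = (if l = k then 1 else 0)"

definition sigma :: "'g crystal_group \<Rightarrow> (int^3 \<Rightarrow> complex) \<Rightarrow> int^3 \<Rightarrow> complex" where
  "sigma S b l = (\<Sum>\<^sub>\<infinity>k\<in>Zind S. b k * (\<Sum>k'\<in>Orb S k. alpha_tilde S k k' * unit_vec k' l))"


section \<open>Normed spaces on explicit carriers\<close>

text \<open>The spaces below depend on the group, on \<open>\<nu>\<close> and on \<open>\<kappa>\<close>-bar, so they are not types;
  addition is that of the ambient type.\<close>

record 'v cnspace =
  vcarrier :: "'v set"
  vscale :: "complex \<Rightarrow> 'v \<Rightarrow> 'v"
  vnorm :: "'v \<Rightarrow> real"

definition bounded_op :: "'v::ab_group_add cnspace \<Rightarrow> 'w::ab_group_add cnspace \<Rightarrow> ('v \<Rightarrow> 'w) \<Rightarrow> bool" where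
  "bounded_op V W L \<longleftrightarrow>
     (\<forall>v\<in>vcarrier V. L v \<in> vcarrier W) \<and>
     (\<forall>u\<in>vcarrier V. \<forall>v\<in>vcarrier V. L (u + v) = L u + L v) \<and>
     (\<forall>a. \<forall>v\<in>vcarrier V. L (vscale V a v) = vscale W a (L v)) \<and>
     (\<exists>B. \<forall>v\<in>vcarrier V. vnorm W (L v) \<le> B * vnorm V v)"

definition op_norm :: "'v::ab_group_add cnspace \<Rightarrow> 'w::ab_group_add cnspace \<Rightarrow> ('v \<Rightarrow> 'w) \<Rightarrow> real" where
  "op_norm V W L = (SUP v\<in>vcarrier V. vnorm W (L v) / vnorm V v)"

definition has_fderiv ::
  "'v::ab_group_add cnspace \<Rightarrow> 'w::ab_group_add cnspace \<Rightarrow> 'v set \<Rightarrow> ('v \<Rightarrow> 'w) \<Rightarrow> ('v \<Rightarrow> 'w) \<Rightarrow> 'v \<Rightarrow> bool" where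
  "has_fderiv V W U f L x \<longleftrightarrow> x \<in> U \<and> bounded_op V W L \<and>
     (\<forall>\<epsilon>>0. \<exists>\<delta>>0. \<forall>h\<in>vcarrier V. vnorm V h < \<delta> \<longrightarrow>
        x + h \<in> U \<and> f (x + h) - f x - L h \<in> vcarrier W \<and>
        vnorm W (f (x + h) - f x - L h) \<le> \<epsilon> * vnorm V h)"

definition fderiv ::
  "'v::ab_group_add cnspace \<Rightarrow> 'w::ab_group_add cnspace \<Rightarrow> 'v set \<Rightarrow> ('v \<Rightarrow> 'w) \<Rightarrow> 'v \<Rightarrow> 'v \<Rightarrow> 'w" where
  "fderiv V W U f x = (SOME L. has_fderiv V W U f L x)"

text \<open>The maximum norm; every equivalent norm on the product yields the same derivatives.\<close>

definition prod_space :: "'v cnspace \<Rightarrow> 'w cnspace \<Rightarrow> ('v \<times> 'w) cnspace" where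
  "prod_space V W = \<lparr> vcarrier = vcarrier V \<times> vcarrier W,
     vscale = (\<lambda>a (v, w). (vscale V a v, vscale W a w)),
     vnorm = (\<lambda>(v, w). max (vnorm V v) (vnorm W w)) \<rparr>"

type_synonym coeffs = "int^3 \<Rightarrow> complex"
type_synonym state = "(nat \<Rightarrow> complex) \<times> coeffs"

definition CJ :: "'g crystal_group \<Rightarrow> (nat \<Rightarrow> complex) set" where
  "CJ S = {\<kappa>. \<forall>j. j \<notin> {1..num_scales (csys S)} \<longrightarrow> \<kappa> j = 0}"

definition CJ_pos :: "'g crystal_group \<Rightarrow> (nat \<Rightarrow> complex) set" where
  "CJ_pos S = {\<kappa> \<in> CJ S. \<forall>j\<in>{1..num_scales (csys S)}. 0 < Re (\<kappa> j)}"

definition knorm :: "'g crystal_group \<Rightarrow> (nat \<Rightarrow> real) \<Rightarrow> int^3 \<Rightarrow> real" where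
  "knorm S kb k = sqrt (Delta (csys S) k kb)"

definition CJ_norm :: "'g crystal_group \<Rightarrow> (nat \<Rightarrow> real) \<Rightarrow> (nat \<Rightarrow> complex) \<Rightarrow> real" where
  "CJ_norm S kb \<kappa> = (MAX j\<in>{1..num_scales (csys S)}. cmod (\<kappa> j) / kb j)"

definition omega :: "'g crystal_group \<Rightarrow> real \<Rightarrow> (nat \<Rightarrow> real) \<Rightarrow> int^3 \<Rightarrow> real" where
  "omega S \<nu> kb k = real (card (Orb S k)) * \<nu> powr knorm S kb k"

text \<open>Sequences indexed by \<open>Zind S\<close> are functions vanishing off \<open>Zind S\<close>.\<close>

definition Xs :: "'g crystal_group \<Rightarrow> real \<Rightarrow> (nat \<Rightarrow> real) \<Rightarrow> coeffs set" where
  "Xs S \<nu> kb = {b. (\<forall>k. k \<notin> Zind S \<longrightarrow> b k = 0) \<and>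
                  (\<lambda>k. cmod (b k) * omega S \<nu> kb k) summable_on Zind S}"

definition X_norm :: "'g crystal_group \<Rightarrow> real \<Rightarrow> (nat \<Rightarrow> real) \<Rightarrow> coeffs \<Rightarrow> real" where
  "X_norm S \<nu> kb b = (\<Sum>\<^sub>\<infinity>k\<in>Zind S. cmod (b k) * omega S \<nu> kb k)"

definition X0s :: "'g crystal_group \<Rightarrow> real \<Rightarrow> (nat \<Rightarrow> real) \<Rightarrow> coeffs set" where
  "X0s S \<nu> kb = {b \<in> Xs S \<nu> kb. b 0 = 0}"

definition CJ_space :: "'g crystal_group \<Rightarrow> (nat \<Rightarrow> real) \<Rightarrow> (nat \<Rightarrow> complex) cnspace" where
  "CJ_space S kb = \<lparr> vcarrier = CJ S, vscale = (\<lambda>a \<kappa> j. a * \<kappa> j), vnorm = CJ_norm S kb \<rparr>"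

definition X0_space :: "'g crystal_group \<Rightarrow> real \<Rightarrow> (nat \<Rightarrow> real) \<Rightarrow> coeffs cnspace" where
  "X0_space S \<nu> kb = \<lparr> vcarrier = X0s S \<nu> kb, vscale = (\<lambda>a b k. a * b k), vnorm = X_norm S \<nu> kb \<rparr>"


section \<open>Conjugation symmetry\<close>

definition conj_b :: "'g crystal_group \<Rightarrow> coeffs \<Rightarrow> coeffs" where
  "conj_b S b k = (if k \<in> Zind S then cnj (sigma S b (- k)) else 0)"

definition conj_x :: "'g crystal_group \<Rightarrow> state \<Rightarrow> state" where
  "conj_x S x = (\<lambda>j. cnj (fst x j), conj_b S (snd x))"

definition Sinv :: "'g crystal_group \<Rightarrow> real \<Rightarrow> (nat \<Rightarrow> real) \<Rightarrow> state set" where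
  "Sinv S \<nu> kb = {x \<in> CJ S \<times> Xs S \<nu> kb. conj_x S x = x}"

definition Sinv_pos :: "'g crystal_group \<Rightarrow> real \<Rightarrow> (nat \<Rightarrow> real) \<Rightarrow> state set" where
  "Sinv_pos S \<nu> kb = Sinv S \<nu> kb \<inter> (CJ_pos S \<times> X0s S \<nu> kb)"

definition cball2 ::
  "'g crystal_group \<Rightarrow> real \<Rightarrow> (nat \<Rightarrow> real) \<Rightarrow> real^2 \<Rightarrow> state \<Rightarrow> state set" where
  "cball2 S \<nu> kb r x = {y \<in> CJ S \<times> X0s S \<nu> kb.
     CJ_norm S kb (fst y - fst x) \<le> r $ 1 \<and> X_norm S \<nu> kb (snd y - snd x) \<le> r $ 2}"

definition cball2_S ::
  "'g crystal_group \<Rightarrow> real \<Rightarrow> (nat \<Rightarrow> real) \<Rightarrow> real^2 \<Rightarrow> state \<Rightarrow> state set" where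
  "cball2_S S \<nu> kb r x = cball2 S \<nu> kb r x \<inter> Sinv S \<nu> kb"


section \<open>Energy, zero finding map and fixed point map\<close>

definition Pfun :: "real \<Rightarrow> complex \<Rightarrow> complex" where
  "Pfun \<gamma> y = y / (of_real \<gamma>)^2 - 1 + inverse y"

definition dconv :: "coeffs \<Rightarrow> coeffs \<Rightarrow> coeffs" where
  "dconv c d k = (\<Sum>\<^sub>\<infinity>(p, q)\<in>{(p, q). p + q = k}. c p * d q)"

definition Energy :: "crystal_system \<Rightarrow> real \<Rightarrow> real \<Rightarrow> (nat \<Rightarrow> complex) \<Rightarrow> coeffs \<Rightarrow> complex" where
  "Energy s \<gamma> m \<kappa> c =
     1/2 * (\<Sum>\<^sub>\<infinity>k\<in>UNIV - {0}. Pfun \<gamma> (Delta s k \<kappa>) * c k * c (- k))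
     + 1/4 * dconv c (dconv c (dconv c c)) 0 + (1 - 2 * (of_real m)^2) / 4"

definition full_coeffs :: "'g crystal_group \<Rightarrow> real \<Rightarrow> coeffs \<Rightarrow> coeffs" where
  "full_coeffs S m b = sigma S (\<lambda>k. of_real m * unit_vec 0 k + b k)"

definition Hmap :: "'g crystal_group \<Rightarrow> real \<Rightarrow> real \<Rightarrow> state \<Rightarrow> nat \<Rightarrow> complex" where
  "Hmap S \<gamma> m x j = (let \<kappa> = fst x; c = full_coeffs S m (snd x) in
     if j \<in> {1..num_scales (csys S)} then
       1/2 * (\<Sum>\<^sub>\<infinity>k\<in>UNIV - {0}. deriv (Pfun \<gamma>) (Delta (csys S) k \<kappa>)
                * of_int (Delta_coef (csys S) k j) * c k * c (- k))
     else 0)"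

definition Fmap :: "'g crystal_group \<Rightarrow> real \<Rightarrow> real \<Rightarrow> state \<Rightarrow> coeffs" where
  "Fmap S \<gamma> m x k = (let \<kappa> = fst x; c = full_coeffs S m (snd x) in
     if k \<in> Z0 S then
       of_nat (card (Orb S k)) * (Pfun \<gamma> (Delta (csys S) k \<kappa>) * c k + dconv c (dconv c c) k)
     else 0)"

definition zmap :: "'g crystal_group \<Rightarrow> real \<Rightarrow> real \<Rightarrow> state \<Rightarrow> state" where
  "zmap S \<gamma> m x = (Hmap S \<gamma> m x, Fmap S \<gamma> m x)"

definition y_P :: "real \<Rightarrow> real" where
  "y_P \<gamma> = (if \<gamma> \<le> 2 then \<gamma> else (\<gamma>^2 + sqrt (\<gamma>^4 - 4 * \<gamma>^2)) / 2)"

definition Z0K :: "'g crystal_group \<Rightarrow> (nat \<Rightarrow> real) \<Rightarrow> real \<Rightarrow> (int^3) set" where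
  "Z0K S kb K = {k \<in> Z0 S. knorm S kb k \<le> K}"

definition X0Ks :: "'g crystal_group \<Rightarrow> real \<Rightarrow> (nat \<Rightarrow> real) \<Rightarrow> real \<Rightarrow> coeffs set" where
  "X0Ks S \<nu> kb K = {b \<in> X0s S \<nu> kb. \<forall>k. k \<notin> Z0K S kb K \<longrightarrow> b k = 0}"

text \<open>The rows and columns of the matrix \<open>A\<close> are indexed by the disjoint union of
  \<open>{1..J}\<close> and the truncated index set, which has \<open>J + N\<close> elements; other entries are ignored.\<close>

type_synonym cmatrix = "(nat + int^3) \<Rightarrow> (nat + int^3) \<Rightarrow> complex"

definition mat_idx :: "'g crystal_group \<Rightarrow> (nat \<Rightarrow> real) \<Rightarrow> real \<Rightarrow> (nat + int^3) set" where
  "mat_idx S kb K = {1..num_scales (csys S)} <+> Z0K S kb K"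

definition invertible_on :: "'i set \<Rightarrow> ('i \<Rightarrow> 'i \<Rightarrow> complex) \<Rightarrow> bool" where
  "invertible_on I A \<longleftrightarrow> (\<exists>B. \<forall>i\<in>I. \<forall>j\<in>I.
     (\<Sum>l\<in>I. A i l * B l j) = (if i = j then 1 else 0) \<and>
     (\<Sum>l\<in>I. B i l * A l j) = (if i = j then 1 else 0))"

definition mat_act :: "'g crystal_group \<Rightarrow> (nat \<Rightarrow> real) \<Rightarrow> real \<Rightarrow> cmatrix \<Rightarrow> state \<Rightarrow> state" where
  "mat_act S kb K A x =
     (let y = (\<lambda>i. \<Sum>l\<in>mat_idx S kb K. A i l * case_sum (fst x) (snd x) l) in
      (\<lambda>j. if j \<in> {1..num_scales (csys S)} then y (Inl j) else 0,
       \<lambda>k. if k \<in> Z0K S kb K then y (Inr k) else 0))"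

definition Acal ::
  "'g crystal_group \<Rightarrow> real \<Rightarrow> (nat \<Rightarrow> real) \<Rightarrow> real \<Rightarrow> cmatrix \<Rightarrow> state \<Rightarrow> state" where
  "Acal S \<gamma> kb K A x =
     (fst (mat_act S kb K A x),
      \<lambda>k. if k \<in> Z0K S kb K then snd (mat_act S kb K A x) k
          else if k \<in> Z0 S then
            snd x k / (Pfun \<gamma> (of_real (Delta (csys S) k kb)) * of_nat (card (Orb S k)))
          else 0)"

definition Tmap ::
  "'g crystal_group \<Rightarrow> real \<Rightarrow> real \<Rightarrow> (nat \<Rightarrow> real) \<Rightarrow> real \<Rightarrow> cmatrix \<Rightarrow> state \<Rightarrow> state" where
  "Tmap S \<gamma> m kb K A x = x - Acal S \<gamma> kb K A (zmap S \<gamma> m x)"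

definition D_kappa ::
  "'g crystal_group \<Rightarrow> real \<Rightarrow> (nat \<Rightarrow> real) \<Rightarrow> (state \<Rightarrow> state) \<Rightarrow> state \<Rightarrow> (nat \<Rightarrow> complex) \<Rightarrow> state" where
  "D_kappa S \<nu> kb T x =
     fderiv (CJ_space S kb) (prod_space (CJ_space S kb) (X0_space S \<nu> kb)) (CJ_pos S)
       (\<lambda>\<kappa>. T (\<kappa>, snd x)) (fst x)"

definition D_b ::
  "'g crystal_group \<Rightarrow> real \<Rightarrow> (nat \<Rightarrow> real) \<Rightarrow> (state \<Rightarrow> state) \<Rightarrow> state \<Rightarrow> coeffs \<Rightarrow> state" where
  "D_b S \<nu> kb T x =
     fderiv (X0_space S \<nu> kb) (prod_space (CJ_space S kb) (X0_space S \<nu> kb)) (X0s S \<nu> kb)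
       (\<lambda>b. T (fst x, b)) (snd x)"


section \<open>Radii polynomials\<close>

text \<open>\<open>Y $ i\<close>, \<open>Z $ i $ i'\<close>, \<open>W $ i $ i' $ i''\<close>: the superscript of the bounds comes first.\<close>

definition Wr :: "real^2^2^2 \<Rightarrow> 2 \<Rightarrow> 2 \<Rightarrow> real^2 \<Rightarrow> real" where
  "Wr W i i' r = W $ i $ i' $ 1 * r $ 1 + W $ i $ i' $ 2 * r $ 2"

definition p1 :: "real^2 \<Rightarrow> real^2^2 \<Rightarrow> real^2^2^2 \<Rightarrow> real^2 \<Rightarrow> real" where
  "p1 Y Z W r = Y $ 1 + r $ 1 * (Z $ 1 $ 1 + 1/2 * Wr W 1 1 r - 1)
                      + r $ 2 * (Z $ 1 $ 2 + 1/2 * Wr W 1 2 r)"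

definition p2 :: "real^2 \<Rightarrow> real^2^2 \<Rightarrow> real^2^2^2 \<Rightarrow> real^2 \<Rightarrow> real" where
  "p2 Y Z W r = Y $ 2 + r $ 1 * (Z $ 2 $ 1 + 1/2 * Wr W 2 1 r)
                      + r $ 2 * (Z $ 2 $ 2 + 1/2 * Wr W 2 2 r - 1)"

definition Mr :: "real^2^2 \<Rightarrow> real^2^2^2 \<Rightarrow> real^2 \<Rightarrow> real^2^2" where
  "Mr Z W r = (\<chi> i i'. Z $ i $ i' + Wr W i i' r)"

definition p3 :: "real^2^2 \<Rightarrow> real^2^2^2 \<Rightarrow> real^2 \<Rightarrow> real" where
  "p3 Z W r = trace (Mr Z W r) - 2"

definition p4 :: "real^2^2 \<Rightarrow> real^2^2^2 \<Rightarrow> real^2 \<Rightarrow> real" where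
  "p4 Z W r = trace (Mr Z W r) - det (Mr Z W r) - 1"


section \<open>Classical solutions of the PDE\<close>

definition partial :: "3 \<Rightarrow> (real^3 \<Rightarrow> real) \<Rightarrow> real^3 \<Rightarrow> real" where
  "partial i u x = deriv (\<lambda>t. u (x + t *\<^sub>R axis i 1)) 0"

primrec C_diff :: "nat \<Rightarrow> (real^3 \<Rightarrow> real) \<Rightarrow> bool" where
  "C_diff 0 u \<longleftrightarrow> continuous_on UNIV u"
| "C_diff (Suc n) u \<longleftrightarrow> (\<forall>x. u differentiable (at x)) \<and> (\<forall>i. C_diff n (partial i u))"

definition laplacian :: "(real^3 \<Rightarrow> real) \<Rightarrow> real^3 \<Rightarrow> real" where
  "laplacian u x = (\<Sum>i\<in>UNIV. partial i (partial i u) x)"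

definition solves_pde :: "real \<Rightarrow> real \<Rightarrow> (real^3 \<Rightarrow> real) \<Rightarrow> bool" where
  "solves_pde \<gamma> m u \<longleftrightarrow> C_diff 4 u \<and>
     (\<forall>x. - laplacian (\<lambda>y. laplacian u y / \<gamma>^2 + u y - (u y)^3) x - (u x - m) = 0)"

definition group_invariant :: "'g crystal_group \<Rightarrow> (nat \<Rightarrow> real) \<Rightarrow> (real^3 \<Rightarrow> real) \<Rightarrow> bool" where
  "group_invariant S \<kappa> u \<longleftrightarrow> (\<forall>g\<in>carrier S. \<forall>x. u (act S \<kappa> g x) = u x)"

definition Omega :: "crystal_system \<Rightarrow> (nat \<Rightarrow> real) \<Rightarrow> (real^3) set" where
  "Omega s \<kappa> = {(2 * pi) *\<^sub>R (transpose (matrix_inv (Lmat s \<kappa>)) *v y) | y. \<forall>i. 0 \<le> y $ i \<and> y $ i \<le> 1}"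

definition period_domain :: "(real^3) set \<Rightarrow> (real^3) set \<Rightarrow> (real^3 \<Rightarrow> real) \<Rightarrow> bool" where
  "period_domain \<Lambda> D u \<longleftrightarrow>
     (\<forall>v\<in>\<Lambda>. \<forall>x. u (x + v) = u x) \<and> (\<Union>v\<in>\<Lambda>. (\<lambda>y. y + v) ` D) = UNIV"

end

theory Submission imports Defs "HOL-Probability.Characteristic_Functions"
begin

text \<open>A self-conjugate zero of \<open>zmap\<close> is a symmetric real Fourier series that solves
  the differential equation and at which the energy is stationary in the length scales. The zero
  is the fixed point of \<open>T x = x - Acal (zmap x)\<close>, written \<open>Tmap\<close>,
  which is found by the contraction principle in a ball around \<open>xbar\<close>.

  Contraction. The hypotheses bound the four blocks of the derivative of \<open>T\<close> on the
  ball by the entries of the positive matrix \<open>M = Mr Z W rhat\<close>, so the mean value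
  inequality makes \<open>M\<close> a matrix of componentwise Lipschitz constants. The last two
  polynomials say that \<open>trace M < 2\<close> and \<open>det (1 - M) > 0\<close>; then some
  positive vector \<open>q\<close> satisfies \<open>M q < q\<close>, and \<open>T\<close>
  contracts the maximum norm whose components are weighted by \<open>q\<close>
  (\<open>perov_fixed_point\<close>). Along the segment from \<open>xbar\<close> to a point of
  the ball the bounds \<open>W\<close> grow linearly, so their integral contributes one half of
  the end value; the first two polynomials therefore say that \<open>T\<close> maps the ball
  into itself (\<open>radii_polynomials\<close>). The spaces depend on the data and are carrier
  sets, and the mean value inequality is reduced to functions of one real variable by explicit
  norming functionals.

  Differentiability. The operators \<open>D_kappa\<close> and \<open>D_b\<close> are chosen by
  \<open>SOME\<close>, so bounds on them say something about \<open>T\<close> only once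
  \<open>T\<close> is known to be Frechet differentiable (\<open>T_has_fderiv\<close>). The
  Laplacian symbol is unbounded, and \<open>zmap\<close> takes its values in a larger space,
  where the weight of the index \<open>k\<close> is divided by the size of the symbol. There it
  has a quadratic Taylor remainder (\<open>zmap_remainder\<close>), because the function
  \<open>P\<close> is linear up to a bounded analytic part and an exponential weight absorbs
  polynomial factors. On the tail, \<open>Acal\<close> divides by \<open>P\<close>, which grows
  like the symbol (\<open>tail_lower_bound\<close>), and so \<open>Acal\<close> leads back into
  the original space (\<open>Acal_bounded\<close>).

  Symmetry. Convolution preserves the symmetry under the group as well as hermitian symmetry,
  and \<open>A\<close> commutes with the conjugation; hence \<open>T\<close> preserves the
  closed convex set of self-conjugate points, in which the contraction principle is applied
  (\<open>T_conj\<close>). Since \<open>Acal\<close> is injective, fixed points are zeros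
  (\<open>zero_iff_fixed_point\<close>).

  Solution. The equations \<open>F\<^sub>k = 0\<close> for the orbit representatives extend to
  all nonzero indices, because a symmetric sequence is determined by its values at
  representatives (\<open>sigma_symmetric\<close>, \<open>Ffull_zero\<close>). The coefficients
  decay exponentially, so the series may be differentiated termwise, and products of series
  become convolutions; multiplying the \<open>k\<close>-th equation by the symbol gives the
  \<open>k\<close>-th Fourier coefficient of the differential equation
  (\<open>fourier_solves_pde\<close>). Finally \<open>H\<^sub>j\<close> is the derivative of the
  energy with respect to \<open>\<kappa>\<^sub>j\<close> (\<open>Energy_stationary\<close>).\<close>

section \<open>Wave vectors and the symbol of the Laplacian\<close>

lemma num_scales_ge_1: "1 \<le> num_scales s"
  by (cases s) (simp_all add: num_scales_def)

lemma Lmat_mult_vec: "Lmat s \<kappa> *v x = Ltilde s *v (Lhat s (\<lambda>j. sqrt (\<kappa> j)) *v x)"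
  by (simp add: Lmat_def matrix_vector_mul_assoc)

lemma Ltilde_Lhat_commute: "Ltilde s ** Lhat s l = Lhat s l ** Ltilde s"
  by (cases s) (simp_all add: Ltilde_def Lhat_def diag3_def mat_def matrix_matrix_mult_def vec_eq_iff
      forall_3 sum_3)

lemma invertible_Ltilde: "invertible (Ltilde s)"
  by (cases s) (simp_all add: Ltilde_def mat_def invertible_det_nz det_3)

lemma invertible_Lmat:
  assumes "pos_scales s \<kappa>" shows "invertible (Lmat s \<kappa>)"
proof -
  have "invertible (Lhat s (\<lambda>j. sqrt (\<kappa> j)))"
    using assms by (cases s) (auto simp: Lhat_def diag3_def invertible_det_nz det_3
        pos_scales_def num_scales_def numeral_3_eq_3 numeral_2_eq_2 atLeastAtMostSuc_conv)
  then show ?thesis using invertible_Ltilde by (simp add: Lmat_def invertible_mult)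
qed

lemma Lmat_one: "Lmat s (\<lambda>_. 1) = Ltilde s"
proof -
  have "Lhat s (\<lambda>_. 1) = mat 1"
    by (cases s) (simp_all add: Lhat_def diag3_def mat_def vec_eq_iff forall_3)
  then show ?thesis by (simp add: Lmat_def)
qed

text \<open>The symbol is the squared length of the wave vector. This connects the integer formula for
  \<open>Delta\<close> with the derivatives of plane waves and with the orthogonal action of the
  group.\<close>

lemma norm_Lmat_ivec:
  assumes "pos_scales s \<kappa>"
  shows "(norm (Lmat s \<kappa> *v ivec k))\<^sup>2 = Delta s k \<kappa>"
proof -
  have sq3: "sqrt 3 * (sqrt 3 * x) = 3 * x" for x
    by (simp flip: mult.assoc)
  define r where "r j = sqrt (\<kappa> j)" for j
  have r: "j \<in> {1..num_scales s} \<Longrightarrow> \<kappa> j = r j * r j" for j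
    using assms by (auto simp: r_def pos_scales_def less_imp_le)
  show ?thesis using r unfolding Lmat_mult_vec power2_norm_eq_inner r_def[symmetric]
    by (cases s)
      (simp_all add: num_scales_def Delta_def Delta_coef_def Lhat_def mat_def sq3
       Ltilde_def diag3_def inner_vec_def sum_3 matrix_vector_mult_def ivec_def
       numeral_3_eq_3 numeral_2_eq_2 atLeastAtMostSuc_conv power2_eq_square algebra_simps)
qed

lemma matrix_inv_mult:
  fixes A :: "real^'n^'n"
  assumes "invertible A" shows "A ** matrix_inv A = mat 1" "matrix_inv A ** A = mat 1"
  using someI_ex[OF assms[unfolded invertible_def]] unfolding matrix_inv_def by auto

text \<open>Translations are expressed in the basis dual to the wave vectors, so the phase that a
  translation produces is an inner product of an integer vector with the shift.\<close>

lemma inner_dual_lattice: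
  fixes L :: "real^'n^'n"
  assumes "invertible L"
  shows "(L *v a) \<bullet> (transpose (matrix_inv L) *v d) = a \<bullet> d"
proof -
  have "(L *v a) \<bullet> (transpose (matrix_inv L) *v d) = d \<bullet> (matrix_inv L *v (L *v a))"
    by (simp add: inner_commute[of "L *v a"] dot_lmul_matrix)
  then show ?thesis
    by (simp add: matrix_vector_mul_assoc matrix_inv_mult[OF assms] inner_commute)
qed

lemma ivec_simps [simp]: "ivec (k + l) = ivec k + ivec l" "ivec 0 = 0" "ivec (- k) = - ivec k"
  "ivec k = ivec l \<longleftrightarrow> k = l"
  by (auto simp: ivec_def vec_eq_iff)

lemma inner_ivec_Ints: "ivec k \<bullet> ivec n \<in> \<int>"
proof -
  have "ivec k \<bullet> ivec n = of_int (\<Sum>i\<in>UNIV. k $ i * n $ i)"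
    by (simp add: inner_vec_def ivec_def)
  then show ?thesis by (simp only: Ints_of_int)
qed

lemma Delta_of_real: "Delta s k (\<lambda>j. of_real (\<kappa> j)) = (of_real (Delta s k \<kappa>) :: complex)"
  by (simp add: Delta_def)

lemma Delta_coef_nonneg:
  assumes "j \<in> {1..num_scales s}" shows "0 \<le> Delta_coef s k j"
proof -
  have "0 \<le> a\<^sup>2 + a * b + b\<^sup>2" for a b :: int
  proof -
    \<comment> \<open>completing the square, with a factor 4 to stay within the integers\<close>
    have "0 \<le> (2 * a + b)\<^sup>2 + 3 * b\<^sup>2" by simp
    also have "\<dots> = 4 * (a\<^sup>2 + a * b + b\<^sup>2)" by (simp add: power2_eq_square algebra_simps)
    finally show ?thesis by simp
  qed
  then show ?thesis using assms
    by (cases s) (auto simp: Delta_coef_def num_scales_def numeral_3_eq_3 numeral_2_eq_2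
        atLeastAtMostSuc_conv)
qed

text \<open>The symbol at unit scales, a measure of the size of \<open>k\<close> that does not depend on
  \<open>\<kappa>\<close>. For scales with positive real parts, the modulus of \<open>Delta s k
  \<kappa>\<close> lies between two multiples of it, uniformly in \<open>k\<close>.\<close>

definition lsize :: "crystal_system \<Rightarrow> int^3 \<Rightarrow> real" where
  "lsize s k = Delta s k (\<lambda>_. 1)"

lemma lsize_sum: "lsize s k = (\<Sum>j = 1..num_scales s. of_int (Delta_coef s k j))"
  by (simp add: lsize_def Delta_def)

lemma lsize_eq_norm: "lsize s k = (norm (Ltilde s *v ivec k))\<^sup>2"
  using norm_Lmat_ivec[of s "\<lambda>_. 1" k] by (simp add: lsize_def Lmat_one pos_scales_def)

lemma invertible_mult_eq_0:
  fixes L :: "real^'n^'n"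
  assumes "invertible L" "L *v a = 0" shows "a = 0"
  using matrix_inv_mult(2)[OF assms(1)] assms(2)
  by (metis matrix_vector_mul_assoc matrix_vector_mul_lid matrix_vector_mult_0_right)

text \<open>The squared length of a nonzero vector that happens to be an integer.\<close>

lemma lsize_ge_1: assumes "k \<noteq> 0" shows "1 \<le> lsize s k"
proof -
  have "Ltilde s *v ivec k \<noteq> 0"
    using invertible_mult_eq_0[OF invertible_Ltilde] assms ivec_simps(2,4) by metis
  then have "0 < lsize s k" by (simp add: lsize_eq_norm)
  moreover have "lsize s k = of_int (\<Sum>j = 1..num_scales s. Delta_coef s k j)"
    by (simp add: lsize_sum)
  ultimately have "1 \<le> (\<Sum>j = 1..num_scales s. Delta_coef s k j)"
    by (simp only: of_int_0_less_iff)
  then have "real_of_int 1 \<le> of_int (\<Sum>j = 1..num_scales s. Delta_coef s k j)"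
    by (simp only: of_int_le_iff)
  then show ?thesis by (simp add: lsize_sum)
qed

lemma lsize_nonneg: "0 \<le> lsize s k"
  by (simp add: lsize_eq_norm)

lemma Delta_coef_le_lsize:
  assumes "j \<in> {1..num_scales s}" shows "of_int (Delta_coef s k j) \<le> lsize s k"
  unfolding lsize_sum using assms Delta_coef_nonneg
  by (intro member_le_sum) auto

lemma cmod_Delta_le:
  assumes "\<And>j. j \<in> {1..num_scales s} \<Longrightarrow> cmod (\<kappa> j) \<le> d"
  shows "cmod (Delta s k \<kappa>) \<le> lsize s k * d"
proof -
  have "cmod (Delta s k \<kappa>) \<le> (\<Sum>j = 1..num_scales s. cmod (of_int (Delta_coef s k j) * \<kappa> j))"
    unfolding Delta_def by (rule norm_sum)
  also have "\<dots> \<le> (\<Sum>j = 1..num_scales s. of_int (Delta_coef s k j) * d)"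
  proof (rule sum_mono)
    fix j assume j: "j \<in> {1..num_scales s}"
    have "cmod (of_int (Delta_coef s k j) * \<kappa> j) = of_int (Delta_coef s k j) * cmod (\<kappa> j)"
      using Delta_coef_nonneg[OF j] by (simp add: norm_mult)
    then show "cmod (of_int (Delta_coef s k j) * \<kappa> j) \<le> of_int (Delta_coef s k j) * d"
      using Delta_coef_nonneg[OF j, of k] assms[OF j] by (simp add: mult_left_mono)
  qed
  finally show ?thesis by (simp add: lsize_sum sum_distrib_right)
qed

lemma Re_Delta_ge:
  assumes "\<And>j. j \<in> {1..num_scales s} \<Longrightarrow> a \<le> Re (\<kappa> j)"
  shows "lsize s k * a \<le> Re (Delta s k \<kappa>)"
  unfolding lsize_sum Delta_def sum_distrib_right Re_sum
  by (intro sum_mono) (use assms Delta_coef_nonneg in \<open>auto intro!: mult_left_mono\<close>)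

lemma Delta_add: "Delta s k (\<kappa> + \<eta>) = Delta s k \<kappa> + Delta s k \<eta>"
  by (simp add: Delta_def algebra_simps sum.distrib)

lemma Delta_scale: "Delta s k (\<lambda>j. a * \<kappa> j) = a * Delta s k \<kappa>"
  by (simp add: Delta_def algebra_simps sum_distrib_left)

lemma Delta_uminus: "Delta s (- k) \<kappa> = Delta s k \<kappa>"
proof -
  have "Delta_coef s (- k) j = Delta_coef s k j" for j
    by (cases s) (simp_all add: Delta_coef_def)
  then show ?thesis by (simp add: Delta_def)
qed

text \<open>All quadratic forms in question dominate half of the sum of squares, so a bound on the size
  confines the entries of \<open>k\<close>.\<close>

lemma finite_lsize_le: "finite {k. lsize s k \<le> R}"
proof -
  define N where "N = {k :: int^3. \<forall>i. \<bar>k $ i\<bar> \<le> 2 * \<lceil>\<bar>R\<bar>\<rceil>}"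
  have sq: "\<bar>a\<bar> \<le> a\<^sup>2" for a :: int
  proof (cases "a = 0")
    case False
    then have "\<bar>a\<bar> * 1 \<le> \<bar>a\<bar> * \<bar>a\<bar>" by (intro mult_left_mono) auto
    then show ?thesis by (simp add: power2_eq_square)
  qed simp
  have hx: "a\<^sup>2 + b\<^sup>2 \<le> 2 * (a\<^sup>2 + a * b + b\<^sup>2)" for a b :: int
  proof -
    have "0 \<le> (a + b)\<^sup>2" by simp
    then show ?thesis by (simp add: power2_eq_square algebra_simps)
  qed
  have bound: "(k$1)\<^sup>2 + (k$2)\<^sup>2 + (k$3)\<^sup>2 \<le> 2 * (\<Sum>j = 1..num_scales s. Delta_coef s k j)" for k
    using hx[of "k$1" "k$2"]
    by (cases s) (simp_all add: num_scales_def Delta_coef_def numeral_3_eq_3 numeral_2_eq_2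
        atLeastAtMostSuc_conv)
  have "k \<in> N" if "lsize s k \<le> R" for k
    unfolding N_def
  proof safe
    fix i
    have "of_int (\<Sum>j = 1..num_scales s. Delta_coef s k j) \<le> \<bar>R\<bar>"
      using that by (simp add: lsize_sum)
    then have "(\<Sum>j = 1..num_scales s. Delta_coef s k j) \<le> \<lceil>\<bar>R\<bar>\<rceil>" by linarith
    moreover have "(k$i)\<^sup>2 \<le> (k$1)\<^sup>2 + (k$2)\<^sup>2 + (k$3)\<^sup>2"
      using exhaust_3[of i] by auto
    ultimately show "\<bar>k $ i\<bar> \<le> 2 * \<lceil>\<bar>R\<bar>\<rceil>" using bound[of k] sq[of "k$i"] by linarith
  qed
  moreover have "finite N"
  proof -
    define m where "m = 2 * \<lceil>\<bar>R\<bar>\<rceil>"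
    have "N \<subseteq> (\<lambda>(a,b,c). vector [a, b, c]) ` ({-m..m} \<times> {-m..m} \<times> {-m..m})"
    proof
      fix k assume "k \<in> N"
      then have "\<bar>k $ i\<bar> \<le> m" for i by (auto simp: N_def m_def)
      then have "k $ i \<in> {-m..m}" for i by (simp add: abs_le_iff) (meson abs_le_D2 minus_le_iff)
      moreover have "k = vector [k$1, k$2, k$3]" by (simp add: vec_eq_iff forall_3)
      ultimately show "k \<in> (\<lambda>(a,b,c). vector [a, b, c]) ` ({-m..m} \<times> {-m..m} \<times> {-m..m})"
        by (intro rev_image_eqI[of "(k$1, k$2, k$3)"]) auto
    qed
    then show ?thesis by (rule finite_subset) simp
  qed
  ultimately show ?thesis by (metis (no_types, lifting) finite_subset mem_Collect_eq subsetI)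
qed

section \<open>The group action on indices and coefficients\<close>

locale space_group =
  fixes S :: "'g crystal_group"
  assumes sg: "space_group_mod S" and dom: "is_dom S"
begin

sublocale group S using sg by (simp add: space_group_mod_def)

lemma
  assumes "g \<in> carrier S"
  shows lin_orthogonal: "orthogonal_matrix (lin S g)"
    and lin_Lhat_commute: "pos_scales (csys S) l \<Longrightarrow>
      lin S g ** Lhat (csys S) l = Lhat (csys S) l ** lin S g"
    and lin_lattice: "lin S g *v (Ltilde (csys S) *v ivec k) \<in> range (\<lambda>n. Ltilde (csys S) *v ivec n)"
  by (insert sg assms, unfold space_group_mod_def, elim conjE, drule (1) bspec, simp)+

lemma
  assumes "g \<in> carrier S" "h \<in> carrier S"
  shows lin_mult: "lin S (g \<otimes>\<^bsub>S\<^esub> h) = lin S g ** lin S h"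
    and act_mult: "pos_scales (csys S) \<kappa> \<Longrightarrow>
      act S \<kappa> (g \<otimes>\<^bsub>S\<^esub> h) x - act S \<kappa> g (act S \<kappa> h x) \<in> period_lattice (csys S) \<kappa>"
  by (insert sg assms, unfold space_group_mod_def, elim conjE, simp)+

lemma finite_carrier: "finite (carrier S)"
  using sg by (simp add: space_group_mod_def)

lemma Ltilde_beta:
  assumes "g \<in> carrier S"
  shows "Ltilde (csys S) *v ivec (beta S g k) = lin S g *v (Ltilde (csys S) *v ivec k)"
proof -
  obtain n where n: "lin S g *v (Ltilde (csys S) *v ivec k) = Ltilde (csys S) *v ivec n"
    using lin_lattice[OF assms, of k] by blast
  have "matrix_inv (Ltilde (csys S)) *v (Ltilde (csys S) *v ivec n) = ivec n"
    by (simp add: matrix_vector_mul_assoc matrix_inv_mult[OF invertible_Ltilde])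
  then have "beta S g k = n" unfolding beta_def n by (intro the_equality) auto
  then show ?thesis using n by simp
qed

lemma Ltilde_inj:
  assumes "Ltilde (csys S) *v ivec k = Ltilde (csys S) *v ivec l" shows "k = l"
proof -
  have "Ltilde (csys S) *v (ivec k - ivec l) = 0" using assms by (simp add: algebra_simps)
  then show ?thesis using invertible_mult_eq_0[OF invertible_Ltilde] by fastforce
qed

lemma inner_lin: "g \<in> carrier S \<Longrightarrow> (lin S g *v x) \<bullet> (lin S g *v y) = x \<bullet> y"
  using lin_orthogonal[of g] orthogonal_transformation_matrix[of "(*v) (lin S g)"]
  by (simp add: orthogonal_transformation_def)

lemma norm_lin: "g \<in> carrier S \<Longrightarrow> norm (lin S g *v x) = norm x"
  using inner_lin[of g x x] by (simp add: norm_eq)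

lemma lin_one: "lin S \<one>\<^bsub>S\<^esub> = mat 1"
proof -
  let ?C = "lin S \<one>\<^bsub>S\<^esub>"
  have "?C ** ?C = ?C" using lin_mult[of "\<one>\<^bsub>S\<^esub>" "\<one>\<^bsub>S\<^esub>"] by simp
  moreover have "transpose ?C ** ?C = mat 1" using lin_orthogonal[of "\<one>\<^bsub>S\<^esub>"] by (simp add: orthogonal_matrix_def)
  ultimately show ?thesis by (metis matrix_mul_assoc matrix_mul_lid)
qed

lemma beta_one: "beta S \<one>\<^bsub>S\<^esub> k = k"
  using Ltilde_beta[of "\<one>\<^bsub>S\<^esub>" k] by (auto simp: lin_one intro: Ltilde_inj)

lemma beta_mult:
  assumes "g \<in> carrier S" "h \<in> carrier S"
  shows "beta S (g \<otimes>\<^bsub>S\<^esub> h) k = beta S g (beta S h k)"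
  using Ltilde_beta[of "g \<otimes>\<^bsub>S\<^esub> h" k] assms
  by (intro Ltilde_inj) (simp add: Ltilde_beta lin_mult matrix_vector_mul_assoc matrix_mul_assoc)

lemma beta_inv:
  assumes "g \<in> carrier S"
  shows "beta S (inv\<^bsub>S\<^esub> g) (beta S g k) = k" "beta S g (beta S (inv\<^bsub>S\<^esub> g) k) = k"
  using beta_mult[of "inv\<^bsub>S\<^esub> g" g k] beta_mult[of g "inv\<^bsub>S\<^esub> g" k] assms beta_one by simp_all

lemma beta_add: "g \<in> carrier S \<Longrightarrow> beta S g (k + l) = beta S g k + beta S g l"
  by (intro Ltilde_inj) (simp add: Ltilde_beta algebra_simps)

lemma beta_minus: "g \<in> carrier S \<Longrightarrow> beta S g (- k) = - beta S g k"
  by (intro Ltilde_inj) (simp add: Ltilde_beta linear_neg[OF matrix_vector_mul_linear])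

lemma beta_zero: "g \<in> carrier S \<Longrightarrow> beta S g 0 = 0"
  using beta_add[of g 0 0] by simp

lemma bij_beta: "g \<in> carrier S \<Longrightarrow> bij (beta S g)"
  by (rule bij_betw_byWitness[where f' = "beta S (inv\<^bsub>S\<^esub> g)"]) (auto simp: beta_inv)

lemma Lmat_beta:
  assumes "g \<in> carrier S" "pos_scales (csys S) \<kappa>"
  shows "Lmat (csys S) \<kappa> *v ivec (beta S g k) = lin S g *v (Lmat (csys S) \<kappa> *v ivec k)"
proof -
  let ?H = "Lhat (csys S) (\<lambda>j. sqrt (\<kappa> j))"
  have "lin S g ** ?H = ?H ** lin S g"
    using lin_Lhat_commute[OF assms(1), of "\<lambda>j. sqrt (\<kappa> j)"] assms(2) by (simp add: pos_scales_def)
  then have comm: "?H *v (lin S g *v x) = lin S g *v (?H *v x)" for x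
    by (simp add: matrix_vector_mul_assoc)
  have "Lmat (csys S) \<kappa> *v x = ?H *v (Ltilde (csys S) *v x)" for x
    by (simp add: Lmat_def Ltilde_Lhat_commute matrix_vector_mul_assoc)
  then show ?thesis using comm by (simp only: Ltilde_beta[OF assms(1)])
qed

lemma Delta_beta_real:
  assumes "g \<in> carrier S" "pos_scales (csys S) \<kappa>"
  shows "Delta (csys S) (beta S g k) \<kappa> = Delta (csys S) k \<kappa>"
  using norm_Lmat_ivec[OF assms(2), of k] norm_Lmat_ivec[OF assms(2), of "beta S g k"]
  by (simp add: Lmat_beta[OF assms] norm_lin[OF assms(1)])

text \<open>Lengths of wave vectors are invariant at every choice of scales. Raising only the
  \<open>j\<close>-th scale from 1 to 2 changes the symbol by its \<open>j\<close>-th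
  coefficient, which is therefore invariant.\<close>

lemma Delta_coef_beta:
  assumes "g \<in> carrier S" "j \<in> {1..num_scales (csys S)}"
  shows "Delta_coef (csys S) (beta S g k) j = Delta_coef (csys S) k j"
proof -
  \<comment> \<open>scale 2 at \<open>j\<close> and 1 elsewhere\<close>
  define \<kappa> :: "nat \<Rightarrow> real" where "\<kappa> = (\<lambda>i. 1 + (if i = j then 1 else 0))"
  have "Delta (csys S) l \<kappa> = Delta (csys S) l (\<lambda>_. 1) + of_int (Delta_coef (csys S) l j)" for l
  proof -
    have "Delta (csys S) l \<kappa> = (\<Sum>i = 1..num_scales (csys S). of_int (Delta_coef (csys S) l i) * 1
        + (if i = j then of_int (Delta_coef (csys S) l i) else 0))"
      unfolding Delta_def \<kappa>_def by (intro sum.cong) auto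
    then show ?thesis using assms(2) by (simp add: sum.distrib Delta_def)
  qed
  then have "real_of_int (Delta_coef (csys S) (beta S g k) j) = of_int (Delta_coef (csys S) k j)"
    using Delta_beta_real[OF assms(1), of "\<lambda>_. 1" k] Delta_beta_real[OF assms(1), of \<kappa> k]
    by (simp add: pos_scales_def \<kappa>_def)
  then show ?thesis by simp
qed

lemma Delta_beta: "g \<in> carrier S \<Longrightarrow> Delta (csys S) (beta S g k) \<kappa> = Delta (csys S) k \<kappa>"
  unfolding Delta_def by (intro sum.cong) (simp_all add: Delta_coef_beta)

lemma cmod_alpha: "cmod (alpha S g k) = 1"
  by (simp add: alpha_def)

lemma alpha_nz: "alpha S g k \<noteq> 0"
  using cmod_alpha[of g k] by force

lemma alpha_add: "g \<in> carrier S \<Longrightarrow> alpha S g (k + l) = alpha S g k * alpha S g l"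
  by (simp add: alpha_def beta_add inner_add_left ring_distribs exp_add)

lemma alpha_zero: "g \<in> carrier S \<Longrightarrow> alpha S g 0 = 1"
  by (simp add: alpha_def beta_zero)

lemma alpha_minus: "g \<in> carrier S \<Longrightarrow> alpha S g (- k) = cnj (alpha S g k)"
  by (simp add: alpha_def beta_minus exp_cnj)

text \<open>Group elements compose modulo periods, and a period contributes an integer multiple of
  \<open>2 * pi\<close> to the phase. The rule is read off from the images of the origin at unit
  scales.\<close>

lemma alpha_mult:
  assumes g: "g \<in> carrier S" and h: "h \<in> carrier S"
  shows "alpha S (g \<otimes>\<^bsub>S\<^esub> h) k = alpha S g (beta S h k) * alpha S h k"
proof -
  let ?L = "Ltilde (csys S)" let ?gh = "g \<otimes>\<^bsub>S\<^esub> h"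
  \<comment> \<open>\<open>B\<close> maps shifts to translations at unit scales, up to the factor \<open>2
    * pi\<close>\<close>
  define B where "B = transpose (matrix_inv ?L)"
  have one: "pos_scales (csys S) (\<lambda>_. 1)" by (simp add: pos_scales_def)
  have "act S (\<lambda>_. 1) ?gh 0 - act S (\<lambda>_. 1) g (act S (\<lambda>_. 1) h 0)
      \<in> period_lattice (csys S) (\<lambda>_. 1)"
    by (rule act_mult[OF g h one])
  then obtain n where "(2 * pi) *\<^sub>R (B *v shift S ?gh)
      - (lin S g *v ((2 * pi) *\<^sub>R (B *v shift S h)) + (2 * pi) *\<^sub>R (B *v shift S g))
      = (2 * pi) *\<^sub>R (B *v ivec n)"
    by (auto simp: act_def period_lattice_def Lmat_one B_def simp del: transpose_matrix_vector)
  then have "(2 * pi) *\<^sub>R (B *v shift S ?gh) = (2 * pi) *\<^sub>R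
      (lin S g *v (B *v shift S h) + B *v shift S g + B *v ivec n)"
    by (simp add: algebra_simps matrix_vector_mult_scaleR)
  then have eq: "B *v shift S ?gh = lin S g *v (B *v shift S h) + B *v shift S g + B *v ivec n"
    using pi_neq_zero by (simp only: scaleR_cancel_left) simp
  have dual: "(?L *v a) \<bullet> (B *v d) = a \<bullet> d" for a d
    unfolding B_def by (rule inner_dual_lattice[OF invertible_Ltilde])
  have bgh: "beta S ?gh k = beta S g (beta S h k)" using g h by (rule beta_mult)
  have "ivec (beta S ?gh k) \<bullet> shift S ?gh = (?L *v ivec (beta S ?gh k)) \<bullet> (B *v shift S ?gh)"
    by (simp only: dual)
  also have "\<dots> = (lin S g *v (?L *v ivec (beta S h k))) \<bullet> (lin S g *v (B *v shift S h))
      + ivec (beta S ?gh k) \<bullet> shift S g + ivec (beta S ?gh k) \<bullet> ivec n"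
    unfolding eq inner_add_right dual by (simp add: bgh Ltilde_beta[OF g])
  also have "\<dots> = ivec (beta S h k) \<bullet> shift S h + ivec (beta S g (beta S h k)) \<bullet> shift S g
      + ivec (beta S ?gh k) \<bullet> ivec n"
    by (simp only: inner_lin[OF g] dual bgh)
  finally have *: "ivec (beta S ?gh k) \<bullet> shift S ?gh = ivec (beta S h k) \<bullet> shift S h
      + ivec (beta S g (beta S h k)) \<bullet> shift S g + ivec (beta S ?gh k) \<bullet> ivec n" .
  obtain z where z: "ivec (beta S ?gh k) \<bullet> ivec n = of_int z"
    using inner_ivec_Ints by (metis Ints_cases)
  have "exp (2 * of_real pi * \<i> * of_real (of_int z :: real)) = 1"
    using exp_integer_2pi[of "of_int z"] by (simp add: algebra_simps)
  then show ?thesis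
    unfolding alpha_def * z by (simp add: ring_distribs exp_add mult.commute)
qed

lemma alpha_one: "alpha S \<one>\<^bsub>S\<^esub> k = 1"
  using alpha_mult[of "\<one>\<^bsub>S\<^esub>" "\<one>\<^bsub>S\<^esub>" k] alpha_nz by (simp add: beta_one)

subsection \<open>Orbits and representatives\<close>

lemma finite_Orb: "finite (Orb S k)"
  using finite_carrier by (simp add: orbit_def Setcompr_eq_image)

lemma beta_in_Orb: "g \<in> carrier S \<Longrightarrow> beta S g k \<in> Orb S k"
  unfolding orbit_def by auto

lemma Orb_refl: "k \<in> Orb S k"
  using beta_in_Orb[OF one_closed, of k] by (simp add: beta_one)

lemma Orb_eqI: assumes "l \<in> Orb S k" shows "Orb S l = Orb S k"
proof -
  obtain g where g: "g \<in> carrier S" "l = beta S g k" using assms by (auto simp: orbit_def)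
  show ?thesis
  proof safe
    fix x assume "x \<in> Orb S l"
    then obtain h where "h \<in> carrier S" "x = beta S h l" by (auto simp: orbit_def)
    then show "x \<in> Orb S k" using g beta_in_Orb[of "h \<otimes>\<^bsub>S\<^esub> g" k] by (simp add: beta_mult)
  next
    fix x assume "x \<in> Orb S k"
    then obtain h where "h \<in> carrier S" "x = beta S h k" by (auto simp: orbit_def)
    then show "x \<in> Orb S l"
      using g(1) beta_in_Orb[of "h \<otimes>\<^bsub>S\<^esub> inv\<^bsub>S\<^esub> g" l]
      unfolding g(2) by (simp add: beta_mult beta_inv)
  qed
qed

lemma card_Orb_pos: "0 < card (Orb S k)"
  using Orb_refl finite_Orb by (auto simp: card_gt_0_iff)

lemma card_Orb_le: "card (Orb S k) \<le> card (carrier S)"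
  using finite_carrier by (simp add: orbit_def Setcompr_eq_image card_image_le)

definition rep :: "int^3 \<Rightarrow> int^3" where
  "rep k = (THE k'. k' \<in> fdom S \<and> k' \<in> Orb S k)"

lemma rep: "rep k \<in> fdom S" "rep k \<in> Orb S k"
proof -
  have "\<exists>!k'. k' \<in> fdom S \<and> k' \<in> Orb S k" using dom unfolding is_dom_def by (rule spec)
  from theI'[OF this] show "rep k \<in> fdom S" "rep k \<in> Orb S k" unfolding rep_def by simp_all
qed

lemma rep_unique:
  assumes "k' \<in> fdom S" "k' \<in> Orb S k" shows "rep k = k'"
proof -
  have "\<exists>!k'. k' \<in> fdom S \<and> k' \<in> Orb S k" using dom unfolding is_dom_def by (rule spec)
  then show ?thesis using rep[of k] assms by blast
qed

lemma rep_fdom: "k \<in> fdom S \<Longrightarrow> rep k = k"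
  using rep_unique[OF _ Orb_refl] .

lemma rep_beta: "g \<in> carrier S \<Longrightarrow> rep (beta S g k) = rep k"
  using rep_unique[OF rep(1)[of k], of "beta S g k"] rep(2)[of k] Orb_eqI[OF beta_in_Orb, of g k]
  by simp

lemma rep_obtain: obtains g where "g \<in> carrier S" "beta S g (rep k) = k"
proof -
  have "k \<in> Orb S (rep k)" using Orb_eqI[OF rep(2)] Orb_refl by blast
  then show ?thesis using that by (auto simp: orbit_def)
qed

lemma mem_Orb_iff_rep: "k \<in> fdom S \<Longrightarrow> l \<in> Orb S k \<longleftrightarrow> rep l = k"
  using rep_unique[of k l] Orb_eqI[of k l] Orb_eqI[of l k] Orb_refl[of k] Orb_refl[of l] rep(2)[of l]
  by auto

lemma rep_zero: "rep 0 = 0"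
proof -
  obtain g where "g \<in> carrier S" "rep 0 = beta S g 0"
    using rep(2)[of 0] unfolding orbit_def by blast
  then show ?thesis by (simp add: beta_zero)
qed

lemma rep_eq_0_iff: "rep k = 0 \<longleftrightarrow> k = 0"
proof
  assume "rep k = 0"
  moreover obtain g where "g \<in> carrier S" "beta S g (rep k) = k" by (rule rep_obtain)
  ultimately show "k = 0" by (simp add: beta_zero)
qed (simp add: rep_zero)

lemma Zind_iff: "k \<in> Zind S \<longleftrightarrow> k \<in> Zsym S \<and> rep k = k"
  using rep(1)[of k] rep_fdom[of k] by (auto simp: Zind_def)

text \<open>A sum of unit complex numbers equals the number of its terms only if each term is 1.\<close>

lemma Zsym_alpha:
  assumes "k \<in> Zsym S" "g \<in> carrier S" "beta S g k = k"
  shows "alpha S g k = 1"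
proof -
  let ?T = "stabilizer S (beta S) k"
  have fin: "finite ?T" using finite_carrier by (simp add: stabilizer_def)
  have le: "Re (alpha S h k) \<le> 1" for h using complex_Re_le_cmod[of "alpha S h k"] by (simp add: cmod_alpha)
  have "(\<Sum>h\<in>?T. 1 - Re (alpha S h k)) = 0"
    using arg_cong[OF assms(1)[unfolded Zsym_def, simplified], of Re] by (simp add: sum_subtractf)
  then have "1 - Re (alpha S g k) = 0"
    using le assms by (subst (asm) sum_nonneg_eq_0_iff[OF fin]) (auto simp: stabilizer_def)
  then have Re: "Re (alpha S g k) = 1" by simp
  then have "Im (alpha S g k) = 0" using cmod_power2[of "alpha S g k"] by (simp add: cmod_alpha)
  with Re show ?thesis by (simp add: complex_eq_iff)
qed

lemma zero_in_Zind: "0 \<in> Zind S"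
proof -
  have "stabilizer S (beta S) 0 = carrier S" by (auto simp: stabilizer_def beta_zero)
  then have "0 \<in> Zsym S" by (simp add: Zsym_def alpha_zero)
  then show ?thesis by (simp add: Zind_iff rep_zero)
qed

subsection \<open>Symmetric sequences\<close>

text \<open>Invariance of the Fourier series under the group, in terms of its coefficients.\<close>

definition symmetric :: "coeffs \<Rightarrow> bool" where
  "symmetric c \<longleftrightarrow> (\<forall>g\<in>carrier S. \<forall>k. alpha S g k * c (beta S g k) = c k)"

text \<open>Averaging the invariance over the stabilizer multiplies \<open>c k\<close> by the mean of the
  phases, and this mean differs from 1 outside \<open>Zsym\<close>.\<close>

lemma symmetric_zero:
  assumes "symmetric c" "k \<notin> Zsym S" shows "c k = 0"
proof -
  let ?T = "stabilizer S (beta S) k"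
  have "(\<Sum>g\<in>?T. alpha S g k) * c k = (\<Sum>g\<in>?T. alpha S g k * c (beta S g k))"
    by (simp add: sum_distrib_right stabilizer_def)
  also have "\<dots> = (\<Sum>g\<in>?T. c k)"
    using assms(1) by (intro sum.cong refl) (unfold symmetric_def stabilizer_def, blast)
  finally have "((\<Sum>g\<in>?T. alpha S g k) - of_nat (card ?T)) * c k = 0" by (simp add: algebra_simps)
  then show ?thesis using assms(2) by (auto simp: Zsym_def)
qed

text \<open>The choice hidden in \<open>alpha_tilde\<close> is immaterial: two candidates differ by an
  element of the stabilizer, whose phase is 1.\<close>

lemma alpha_tilde_beta:
  assumes k: "k \<in> Zsym S" and g: "g \<in> carrier S"
  shows "alpha_tilde S k (beta S g k) = inverse (alpha S g k)"
proof -
  define h where "h = (SOME h. h \<in> carrier S \<and> beta S h k = beta S g k)"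
  have h: "h \<in> carrier S" "beta S h k = beta S g k"
    using someI[of "\<lambda>h. h \<in> carrier S \<and> beta S h k = beta S g k" g] g unfolding h_def by auto
  have f: "inv\<^bsub>S\<^esub> g \<otimes>\<^bsub>S\<^esub> h \<in> carrier S" using g h by simp
  have "beta S (inv\<^bsub>S\<^esub> g \<otimes>\<^bsub>S\<^esub> h) k = k" using g h by (simp add: beta_mult beta_inv)
  then have 1: "alpha S (inv\<^bsub>S\<^esub> g) (beta S g k) * alpha S h k = 1"
    using Zsym_alpha[OF k f] alpha_mult[of "inv\<^bsub>S\<^esub> g" h k] g h by simp
  have 2: "alpha S (inv\<^bsub>S\<^esub> g) (beta S g k) * alpha S g k = 1"
    using alpha_mult[of "inv\<^bsub>S\<^esub> g" g k] g alpha_one by simp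
  have "alpha S h k = alpha S g k" using 1 2 by (metis alpha_nz mult_cancel_left)
  then show ?thesis by (simp add: alpha_tilde_def h_def)
qed

lemma sigma_eq:
  "sigma S b l = (if rep l \<in> Zind S then b (rep l) * alpha_tilde S (rep l) l else 0)"
proof -
  have inner: "(\<Sum>k'\<in>Orb S k. alpha_tilde S k k' * unit_vec k' l)
      = (if l \<in> Orb S k then alpha_tilde S k l else 0)" for k
    using finite_Orb[of k] by (simp add: unit_vec_def if_distrib sum.delta' cong: if_cong)
  have mem: "l \<in> Orb S k \<longleftrightarrow> k = rep l" if "k \<in> Zind S" for k
    using that mem_Orb_iff_rep by (auto simp: Zind_def)
  have "sigma S b l = (\<Sum>\<^sub>\<infinity>k\<in>Zind S. if k = rep l then b k * alpha_tilde S k l else 0)"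
    unfolding sigma_def inner by (intro infsum_cong) (simp add: mem)
  also have "\<dots> = (\<Sum>\<^sub>\<infinity>k\<in>Zind S \<inter> {rep l}. b k * alpha_tilde S k l)"
    by (rule infsum_cong_neutral) auto
  finally show ?thesis by (cases "rep l \<in> Zind S") auto
qed

lemma cmod_sigma: "cmod (sigma S b l) = (if rep l \<in> Zind S then cmod (b (rep l)) else 0)"
  by (simp add: sigma_eq norm_mult alpha_tilde_def norm_inverse cmod_alpha)

lemma sigma_Zind: assumes "k \<in> Zind S" shows "sigma S b k = b k"
  using assms alpha_tilde_beta[of k "\<one>\<^bsub>S\<^esub>"] by (simp add: sigma_eq Zind_iff beta_one alpha_one)

lemma sigma_add: "sigma S (\<lambda>k. b k + b' k) l = sigma S b l + sigma S b' l"
  by (simp add: sigma_eq algebra_simps)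

lemma sigma_scale: "sigma S (\<lambda>k. a * b k) l = a * sigma S b l"
  by (simp add: sigma_eq)

lemma symmetric_sigma: "symmetric (sigma S b)"
  unfolding symmetric_def
proof (intro ballI allI)
  fix g l assume g: "g \<in> carrier S"
  obtain h where h: "h \<in> carrier S" "beta S h (rep l) = l" by (rule rep_obtain)
  show "alpha S g l * sigma S b (beta S g l) = sigma S b l"
  proof (cases "rep l \<in> Zind S")
    case True
    then have Z: "rep l \<in> Zsym S" by (simp add: Zind_def)
    have 1: "alpha_tilde S (rep l) l = inverse (alpha S h (rep l))"
      using alpha_tilde_beta[OF Z h(1)] h by simp
    have "alpha_tilde S (rep l) (beta S g l) = inverse (alpha S g l * alpha S h (rep l))"
      using alpha_tilde_beta[OF Z, of "g \<otimes>\<^bsub>S\<^esub> h"] g h by (simp add: beta_mult alpha_mult)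
    then show ?thesis using True 1 alpha_nz by (simp add: sigma_eq rep_beta[OF g])
  qed (simp add: sigma_eq rep_beta[OF g])
qed

text \<open>Together with \<open>symmetric_sigma\<close> this identifies symmetric sequences on the whole
  lattice with sequences on \<open>Zind\<close>: along an orbit one value determines the others,
  and off \<open>Zsym\<close> all values vanish.\<close>

lemma sigma_symmetric:
  assumes "symmetric c" "\<And>k. k \<in> Zind S \<Longrightarrow> b k = c k"
  shows "sigma S b = c"
proof
  fix l
  obtain h where h: "h \<in> carrier S" "beta S h (rep l) = l" by (rule rep_obtain)
  have c: "alpha S h (rep l) * c l = c (rep l)"
    using assms(1) h unfolding symmetric_def by metis
  show "sigma S b l = c l"
  proof (cases "rep l \<in> Zind S")
    case True
    then have Z: "rep l \<in> Zsym S" by (simp add: Zind_def)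
    have "alpha_tilde S (rep l) l = inverse (alpha S h (rep l))"
      using alpha_tilde_beta[OF Z h(1)] h by simp
    then show ?thesis using True assms(2)[OF True] c[symmetric] alpha_nz by (simp add: sigma_eq)
  next
    case False
    then have "rep l \<notin> Zsym S" using rep(1) by (simp add: Zind_def)
    then have "c (rep l) = 0" using symmetric_zero[OF assms(1)] by blast
    then show ?thesis using c False alpha_nz by (simp add: sigma_eq)
  qed
qed

end

no_notation Infinite_Set_Sum.abs_summable_on (infix \<open>abs'_summable'_on\<close> 50)

section \<open>Convolution in weighted summable sequences\<close>

lemma
  fixes a :: "'a \<Rightarrow> real" and b :: "'b \<Rightarrow> real"
  assumes "a summable_on A" "b summable_on B" "\<And>x. 0 \<le> a x" "\<And>y. 0 \<le> b y"
  shows summable_on_product: "(\<lambda>(x, y). a x * b y) summable_on A \<times> B"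
    and infsum_product: "infsum (\<lambda>(x, y). a x * b y) (A \<times> B) = infsum a A * infsum b B"
proof -
  have "(\<lambda>(x, y). a x * b y) abs_summable_on A \<times> B"
    by (rule Infinite_Sum.abs_summable_on_Sigma_iff[THEN iffD2])
       (use assms in \<open>auto simp: infsum_cmult_right' infsum_nonneg abs_mult
        intro!: summable_on_cmult_right summable_on_cmult_left\<close>)
  then show s: "(\<lambda>(x, y). a x * b y) summable_on A \<times> B" by (rule abs_summable_summable)
  show "infsum (\<lambda>(x, y). a x * b y) (A \<times> B) = infsum a A * infsum b B"
    using infsum_Sigma'_banach[OF s] by (simp add: infsum_cmult_right' infsum_cmult_left')
qed

lemma dconv_eq: "dconv c d k = (\<Sum>\<^sub>\<infinity>p. c p * d (k - p))"
proof -
  have "bij_betw (\<lambda>p. (p, k - p)) UNIV {(p, q). p + q = k}"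
    by (rule bij_betw_byWitness[where f' = fst]) auto
  from infsum_reindex_bij_betw[OF this, of "\<lambda>(p, q). c p * d q"] show ?thesis
    by (simp add: dconv_def)
qed

text \<open>A submultiplicative weight turns the weighted summable sequences into a Banach algebra under
  convolution. The weight of the problem is exponential; the constant weight 1 serves for
  products of Fourier series.\<close>

locale conv_weight =
  fixes w :: "int^3 \<Rightarrow> real"
  assumes w_ge_1: "1 \<le> w k" and w_add: "w (k + l) \<le> w k * w l"
begin

definition l1 :: "coeffs \<Rightarrow> bool" where
  "l1 c \<longleftrightarrow> (\<lambda>k. cmod (c k) * w k) summable_on UNIV"

definition N :: "coeffs \<Rightarrow> real" where
  "N c = (\<Sum>\<^sub>\<infinity>k. cmod (c k) * w k)"

lemma w_pos: "0 < w k" using w_ge_1[of k] by linarith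

lemma N_nonneg: "0 \<le> N c"
  unfolding N_def using w_pos by (intro infsum_nonneg) (simp add: less_imp_le)

lemma
  assumes "l1 c" "\<And>k. cmod (d k) \<le> C * cmod (c k)"
  shows l1_bound: "l1 d" and N_bound: "N d \<le> C * N c"
proof -
  have le: "cmod (d k) * w k \<le> C * (cmod (c k) * w k)" for k
    using mult_right_mono[OF assms(2)[of k], of "w k"] w_pos[of k] by simp
  have s: "(\<lambda>k. C * (cmod (c k) * w k)) summable_on UNIV"
    using assms(1) unfolding l1_def by (rule summable_on_cmult_right)
  show l: "l1 d" unfolding l1_def
    by (rule summable_on_comparison_test[OF s le]) (simp add: less_imp_le w_pos)
  have "N d \<le> (\<Sum>\<^sub>\<infinity>k. C * (cmod (c k) * w k))"
    unfolding N_def by (rule infsum_mono) (use l s le in \<open>auto simp: l1_def\<close>)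
  then show "N d \<le> C * N c" by (simp add: N_def infsum_cmult_right')
qed

lemma
  assumes "l1 c" "l1 d"
  shows l1_add: "l1 (\<lambda>k. c k + d k)" and N_add: "N (\<lambda>k. c k + d k) \<le> N c + N d"
proof -
  have le: "cmod (c k + d k) * w k \<le> cmod (c k) * w k + cmod (d k) * w k" for k
    using mult_right_mono[OF norm_triangle_ineq[of "c k" "d k"], of "w k"] w_pos[of k]
    by (simp add: algebra_simps)
  have s: "(\<lambda>k. cmod (c k) * w k + cmod (d k) * w k) summable_on UNIV"
    using assms unfolding l1_def by (rule summable_on_add)
  show l: "l1 (\<lambda>k. c k + d k)" unfolding l1_def
    by (rule summable_on_comparison_test[OF s le]) (simp add: less_imp_le w_pos)
  have "N (\<lambda>k. c k + d k) \<le> (\<Sum>\<^sub>\<infinity>k. cmod (c k) * w k + cmod (d k) * w k)"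
    unfolding N_def by (rule infsum_mono) (use l s le in \<open>auto simp: l1_def\<close>)
  then show "N (\<lambda>k. c k + d k) \<le> N c + N d"
    using assms by (simp add: N_def l1_def infsum_add)
qed

lemma l1_scale: "l1 c \<Longrightarrow> l1 (\<lambda>k. a * c k)"
  by (rule l1_bound[of c _ "cmod a"]) (simp_all add: norm_mult)

lemma cmod_le_N: assumes "l1 c" shows "cmod (c k) * w k \<le> N c"
  using finite_sum_le_infsum[of "\<lambda>k. cmod (c k) * w k" UNIV "{k}"] assms w_pos
  by (simp add: l1_def N_def less_imp_le)

lemma finite_sum_le_N: assumes "l1 c" "finite F" shows "(\<Sum>k\<in>F. cmod (c k) * w k) \<le> N c"
  using finite_sum_le_infsum[of "\<lambda>k. cmod (c k) * w k" UNIV F] assms w_pos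
  by (simp add: l1_def N_def less_imp_le)

lemma l1_abs_summable: assumes "l1 c" shows "c abs_summable_on UNIV"
  by (rule summable_on_comparison_test[OF assms[unfolded l1_def]])
     (use w_ge_1 in \<open>auto simp: mult_le_cancel_left1\<close>)

lemma bij_shear: "bij_betw (\<lambda>(k, p). (p, k - p)) (UNIV \<times> UNIV) (UNIV \<times> UNIV :: ((int^3) \<times> (int^3)) set)"
  by (rule bij_betw_byWitness[where f' = "\<lambda>(p, q). (p + q, p)"]) auto

text \<open>The double series over \<open>(k, p)\<close> is the product series in the variables \<open>(p,
  k - p)\<close>. It dominates the convolution, and summing it in the other order gives the norm
  estimate.\<close>

lemma
  assumes c: "l1 c" and d: "l1 d"
  shows summable_weighted: "(\<lambda>(k, p). cmod (c p) * w p * (cmod (d (k - p)) * w (k - p)))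
      summable_on UNIV \<times> UNIV" (is "?s")
    and infsum_weighted: "infsum (\<lambda>(k, p). cmod (c p) * w p * (cmod (d (k - p)) * w (k - p)))
      (UNIV \<times> UNIV) = N c * N d" (is "?t")
    and dconv_abs_summable: "(\<lambda>p. c p * d (k - p)) abs_summable_on UNIV" (is "?u")
    and pair_abs_summable: "(\<lambda>(k, p). c p * d (k - p)) abs_summable_on UNIV \<times> UNIV" (is "?v")
proof -
  let ?f = "\<lambda>(p, q). cmod (c p) * w p * (cmod (d q) * w q)"
  have nn: "0 \<le> cmod z * w p" for z p using w_pos[of p] by simp
  note p = summable_on_product[OF c[unfolded l1_def] d[unfolded l1_def] nn nn]
    infsum_product[OF c[unfolded l1_def] d[unfolded l1_def] nn nn]
  have eq: "(\<lambda>x. ?f (case x of (k, p) \<Rightarrow> (p, k - p))) =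
    (\<lambda>(k, p). cmod (c p) * w p * (cmod (d (k - p)) * w (k - p)))" by (simp add: fun_eq_iff)
  show s: ?s using p(1) summable_on_reindex_bij_betw[OF bij_shear, of ?f] unfolding eq by blast
  show ?t using p(2) infsum_reindex_bij_betw[OF bij_shear, of ?f] unfolding eq N_def by simp
  have le: "norm (c p * d (k - p)) \<le> cmod (c p) * w p * (cmod (d (k - p)) * w (k - p))" for k p
  proof -
    have "cmod (c p) * 1 * (cmod (d (k - p)) * 1) \<le> cmod (c p) * w p * (cmod (d (k - p)) * w (k - p))"
      by (intro mult_mono mult_left_mono w_ge_1) (auto simp: nn)
    then show ?thesis by (simp add: norm_mult)
  qed
  show v: ?v
    by (rule summable_on_comparison_test[OF s]) (use le in auto)
  then show ?u using Infinite_Sum.abs_summable_on_Sigma_iff[THEN iffD1, OF v] by simp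
qed

lemma
  assumes c: "l1 c" and d: "l1 d"
  shows l1_dconv: "l1 (dconv c d)" and N_dconv: "N (dconv c d) \<le> N c * N d"
proof -
  let ?g = "\<lambda>k p. cmod (c p) * w p * (cmod (d (k - p)) * w (k - p))"
  have nn: "0 \<le> cmod z * w p" for z p using w_pos[of p] by simp
  note s = summable_weighted[OF c d] and t = infsum_weighted[OF c d]
  have row: "?g k summable_on UNIV" for k
    using summable_on_SigmaD1[OF s] nn by simp
  have le: "cmod (dconv c d k) * w k \<le> infsum (?g k) UNIV" for k
  proof -
    have "cmod (dconv c d k) \<le> (\<Sum>\<^sub>\<infinity>p. norm (c p * d (k - p)))"
      unfolding dconv_eq by (rule norm_infsum_bound[OF dconv_abs_summable[OF c d]])
    then have "cmod (dconv c d k) * w k \<le> (\<Sum>\<^sub>\<infinity>p. norm (c p * d (k - p)) * w k)"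
      using w_pos[of k] by (simp add: infsum_cmult_left' mult_right_mono)
    also have "\<dots> \<le> infsum (?g k) UNIV"
    proof (rule infsum_mono)
      show "(\<lambda>p. norm (c p * d (k - p)) * w k) summable_on UNIV"
        using dconv_abs_summable[OF c d] by (rule summable_on_cmult_left)
      fix p
      have "norm (c p * d (k - p)) * w k \<le> norm (c p * d (k - p)) * (w p * w (k - p))"
        using w_add[of p "k - p"] by (intro mult_left_mono) auto
      then show "norm (c p * d (k - p)) * w k \<le> ?g k p" by (simp add: norm_mult mult_ac)
    qed (rule row)
    finally show ?thesis .
  qed
  have ss: "(\<lambda>k. infsum (?g k) UNIV) summable_on UNIV"
    using s by (rule summable_on_Sigma_banach)
  show l: "l1 (dconv c d)" unfolding l1_def
    by (rule summable_on_comparison_test[OF ss le nn])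
  have "N (dconv c d) \<le> (\<Sum>\<^sub>\<infinity>k. infsum (?g k) UNIV)"
    unfolding N_def by (rule infsum_mono) (use l ss le in \<open>auto simp: l1_def\<close>)
  also have "\<dots> = N c * N d" using infsum_Sigma'_banach[OF s] t by simp
  finally show "N (dconv c d) \<le> N c * N d" .
qed

lemma infsum_dconv:
  assumes c: "l1 c" and d: "l1 d"
  shows "infsum (dconv c d) UNIV = infsum c UNIV * infsum d UNIV"
proof -
  have cs: "c abs_summable_on UNIV" "d abs_summable_on UNIV" using c d l1_abs_summable by auto
  have s: "(\<lambda>(k, p). c p * d (k - p)) summable_on UNIV \<times> UNIV"
    by (rule abs_summable_summable[OF pair_abs_summable[OF c d]])
  have 1: "infsum (dconv c d) UNIV = infsum (\<lambda>(k, p). c p * d (k - p)) (UNIV \<times> UNIV)"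
    using infsum_Sigma'_banach[OF s] unfolding dconv_eq[abs_def] .
  let ?f = "\<lambda>(p, q). c p * d q"
  have eq: "(\<lambda>x. ?f (case x of (k, p) \<Rightarrow> (p, k - p))) = (\<lambda>(k, p). c p * d (k - p))"
    by (simp add: fun_eq_iff)
  have sf: "?f summable_on UNIV \<times> UNIV"
    using s summable_on_reindex_bij_betw[OF bij_shear, of ?f] unfolding eq by blast
  have "infsum (\<lambda>(k, p). c p * d (k - p)) (UNIV \<times> UNIV) = infsum ?f (UNIV \<times> UNIV)"
    using infsum_reindex_bij_betw[OF bij_shear, of ?f] unfolding eq .
  also have "\<dots> = infsum c UNIV * infsum d UNIV"
    using infsum_Sigma'_banach[OF sf] cs
    by (simp add: infsum_cmult_right' infsum_cmult_left')
  finally show ?thesis using 1 by simp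
qed

lemma dconv_add_left:
  assumes "l1 c" "l1 c'" "l1 d"
  shows "dconv (\<lambda>k. c k + c' k) d = (\<lambda>k. dconv c d k + dconv c' d k)"
proof
  fix k
  have "(\<lambda>p. c p * d (k - p)) summable_on UNIV" "(\<lambda>p. c' p * d (k - p)) summable_on UNIV"
    by (intro abs_summable_summable[OF dconv_abs_summable] assms)+
  then show "dconv (\<lambda>k. c k + c' k) d k = dconv c d k + dconv c' d k"
    by (simp add: dconv_eq ring_distribs infsum_add)
qed

lemma dconv_add_right:
  assumes "l1 c" "l1 d" "l1 d'"
  shows "dconv c (\<lambda>k. d k + d' k) = (\<lambda>k. dconv c d k + dconv c d' k)"
proof
  fix k
  have "(\<lambda>p. c p * d (k - p)) summable_on UNIV" "(\<lambda>p. c p * d' (k - p)) summable_on UNIV"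
    by (intro abs_summable_summable[OF dconv_abs_summable] assms)+
  then show "dconv c (\<lambda>k. d k + d' k) k = dconv c d k + dconv c d' k"
    by (simp add: dconv_eq ring_distribs infsum_add)
qed

end

lemma dconv_scale_left: "dconv (\<lambda>k. a * c k) d = (\<lambda>k. a * dconv c d k)"
  by (rule ext) (simp add: dconv_eq mult.assoc infsum_cmult_right')

lemma dconv_scale_right: "dconv c (\<lambda>k. a * d k) = (\<lambda>k. a * dconv c d k)"
  by (rule ext) (simp add: dconv_eq mult.left_commute[of _ a] infsum_cmult_right')

section \<open>Operators and derivatives between normed carriers\<close>

text \<open>Addition is that of the ambient type, so the group laws come for free and only closure, scalar
  multiplication and the norm need axioms.\<close>

locale cn_space =
  fixes V :: "'v::ab_group_add cnspace"
  assumes zero_mem: "0 \<in> vcarrier V"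
    and add_mem: "u \<in> vcarrier V \<Longrightarrow> v \<in> vcarrier V \<Longrightarrow> u + v \<in> vcarrier V"
    and scale_mem: "v \<in> vcarrier V \<Longrightarrow> vscale V a v \<in> vcarrier V"
    and scale_add_left: "v \<in> vcarrier V \<Longrightarrow> vscale V (a + b) v = vscale V a v + vscale V b v"
    and scale_add_right: "u \<in> vcarrier V \<Longrightarrow> v \<in> vcarrier V \<Longrightarrow>
      vscale V a (u + v) = vscale V a u + vscale V a v"
    and scale_scale: "v \<in> vcarrier V \<Longrightarrow> vscale V a (vscale V b v) = vscale V (a * b) v"
    and scale_one: "v \<in> vcarrier V \<Longrightarrow> vscale V 1 v = v"
    and norm_scale: "v \<in> vcarrier V \<Longrightarrow> vnorm V (vscale V a v) = cmod a * vnorm V v"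
    and norm_triangle: "u \<in> vcarrier V \<Longrightarrow> v \<in> vcarrier V \<Longrightarrow>
      vnorm V (u + v) \<le> vnorm V u + vnorm V v"
    and norm_definite: "v \<in> vcarrier V \<Longrightarrow> vnorm V v = 0 \<Longrightarrow> v = 0"
begin

lemma scale_zero_left: assumes "v \<in> vcarrier V" shows "vscale V 0 v = 0"
  using scale_add_left[OF assms, of 0 0] by simp

lemma scale_minus_one: assumes "v \<in> vcarrier V" shows "vscale V (-1) v = - v"
proof -
  have "vscale V (-1) v + v = vscale V (-1 + 1) v"
    using scale_add_left[OF assms, of "-1" 1] scale_one[OF assms] by simp
  then show ?thesis using scale_zero_left[OF assms] by (simp add: eq_neg_iff_add_eq_0)
qed

lemma minus_mem: "v \<in> vcarrier V \<Longrightarrow> - v \<in> vcarrier V"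
  using scale_mem[of v "-1"] scale_minus_one by simp

lemma diff_mem: "u \<in> vcarrier V \<Longrightarrow> v \<in> vcarrier V \<Longrightarrow> u - v \<in> vcarrier V"
  using add_mem[of u "- v"] minus_mem by simp

lemma norm_minus: "v \<in> vcarrier V \<Longrightarrow> vnorm V (- v) = vnorm V v"
  using norm_scale[of v "-1"] scale_minus_one by simp

lemma norm_zero: "vnorm V 0 = 0"
  using norm_scale[OF zero_mem, of 0] scale_zero_left[OF zero_mem] by simp

lemma norm_nonneg: assumes "v \<in> vcarrier V" shows "0 \<le> vnorm V v"
  using norm_triangle[OF assms minus_mem[OF assms]] norm_minus[OF assms] norm_zero by simp

lemma scale_zero_right: "vscale V a 0 = 0"
  using scale_scale[OF zero_mem, of a 0] scale_zero_left[OF zero_mem] by simp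

lemma scale_minus_right:
  assumes "v \<in> vcarrier V" shows "vscale V a (- v) = - vscale V a v"
proof -
  have "vscale V a (- v) + vscale V a v = 0"
    using scale_add_right[OF minus_mem[OF assms] assms, of a] scale_zero_right by simp
  then show ?thesis by (simp add: eq_neg_iff_add_eq_0)
qed

lemma scale_diff_right:
  assumes "u \<in> vcarrier V" "v \<in> vcarrier V"
  shows "vscale V a (u - v) = vscale V a u - vscale V a v"
  using scale_add_right[OF assms(1) minus_mem[OF assms(2)], of a] scale_minus_right[OF assms(2)]
  by simp

lemma norm_diff_commute:
  assumes "u \<in> vcarrier V" "v \<in> vcarrier V"
  shows "vnorm V (u - v) = vnorm V (v - u)"
  using norm_minus[OF diff_mem[OF assms]] by simp

lemma norm_triangle_diff:
  assumes "u \<in> vcarrier V" "v \<in> vcarrier V" "w \<in> vcarrier V"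
  shows "vnorm V (u - w) \<le> vnorm V (u - v) + vnorm V (v - w)"
  using norm_triangle[OF diff_mem[OF assms(1,2)] diff_mem[OF assms(2,3)]] by simp

lemma norm_le_limit:
  assumes s: "\<And>n. s n \<in> vcarrier V" and v: "v \<in> vcarrier V" "(\<lambda>n. vnorm V (s n - v)) \<longlonglongrightarrow> 0"
    and c: "c \<in> vcarrier V" and R: "\<And>n::nat. vnorm V (s n - c) \<le> R"
  shows "vnorm V (v - c) \<le> R"
proof (rule LIMSEQ_le_const[where X = "\<lambda>n. vnorm V (s n - v) + R"])
  show "(\<lambda>n. vnorm V (s n - v) + R) \<longlonglongrightarrow> R"
    using tendsto_add[OF v(2) tendsto_const] by simp
  have "vnorm V (v - c) \<le> vnorm V (s n - v) + R" for n
    using norm_triangle_diff[OF v(1) s[of n] c] norm_diff_commute[OF v(1) s[of n]] R[of n] by simp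
  then show "\<exists>N. \<forall>n\<ge>N. vnorm V (v - c) \<le> vnorm V (s n - v) + R" by blast
qed

lemma norm_segment_le:
  assumes m: "a \<in> vcarrier V" "b \<in> vcarrier V" "c \<in> vcarrier V" and t: "0 \<le> t" "t \<le> 1"
    and R: "vnorm V (a - c) \<le> R" "vnorm V (b - c) \<le> R"
  shows "vnorm V (a + vscale V (of_real t) (b - a) - c) \<le> R"
proof -
  have d: "a - c \<in> vcarrier V" "b - c \<in> vcarrier V" using m diff_mem by auto
  have e1: "vscale V (of_real t) (b - a) = vscale V (of_real t) (b - c) - vscale V (of_real t) (a - c)"
    using scale_diff_right[OF d(2,1), of "of_real t"] by simp
  have e2: "vscale V (of_real (1 - t)) (a - c) = (a - c) - vscale V (of_real t) (a - c)"
    using scale_add_left[OF d(1), of "of_real (1 - t)" "of_real t"] scale_one[OF d(1)]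
    by (simp add: algebra_simps)
  have "a + vscale V (of_real t) (b - a) - c
      = vscale V (of_real (1 - t)) (a - c) + vscale V (of_real t) (b - c)"
    unfolding e1 e2 by (simp add: algebra_simps)
  then have "vnorm V (a + vscale V (of_real t) (b - a) - c)
      \<le> vnorm V (vscale V (of_real (1 - t)) (a - c)) + vnorm V (vscale V (of_real t) (b - c))"
    using norm_triangle scale_mem d by metis
  also have "\<dots> = (1 - t) * vnorm V (a - c) + t * vnorm V (b - c)"
    using t norm_scale[OF d(1), of "of_real (1 - t)"] norm_scale[OF d(2), of "of_real t"]
    by (simp del: of_real_diff)
  also have "\<dots> \<le> (1 - t) * R + t * R" using R t by (intro add_mono mult_left_mono) auto
  finally show ?thesis by (simp add: algebra_simps)
qed

end

lemma cn_space_prod: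
  assumes "cn_space V" "cn_space W"
  shows "cn_space (prod_space V W)"
proof -
  interpret V: cn_space V by fact
  interpret W: cn_space W by fact
  show ?thesis
  proof
    fix u v assume u: "u \<in> vcarrier (prod_space V W)" and v: "v \<in> vcarrier (prod_space V W)"
    show "vnorm (prod_space V W) (u + v) \<le> vnorm (prod_space V W) u + vnorm (prod_space V W) v"
      using u v V.norm_triangle[of "fst u" "fst v"] W.norm_triangle[of "snd u" "snd v"]
      by (force simp: prod_space_def split_beta)
  next
    fix v assume v: "v \<in> vcarrier (prod_space V W)" "vnorm (prod_space V W) v = 0"
    then have "vnorm V (fst v) = 0" "vnorm W (snd v) = 0"
      using V.norm_nonneg[of "fst v"] W.norm_nonneg[of "snd v"]
      by (auto simp: prod_space_def split_beta max_def split: if_splits)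
    then show "v = 0" using v V.norm_definite W.norm_definite
      by (auto simp: prod_space_def prod_eq_iff)
  next
    fix v a assume v: "v \<in> vcarrier (prod_space V W)"
    have *: "c * max x y = max (c * x) (c * y)" if "0 \<le> c" for c x y :: real
      using that by (simp add: max_mult_distrib_left)
    show "vnorm (prod_space V W) (vscale (prod_space V W) a v) = cmod a * vnorm (prod_space V W) v"
      using v by (simp add: prod_space_def split_beta mem_Times_iff V.norm_scale W.norm_scale *)
  qed (auto simp: prod_space_def V.zero_mem W.zero_mem V.add_mem W.add_mem V.scale_mem W.scale_mem
      V.scale_add_left W.scale_add_left V.scale_add_right W.scale_add_right
      V.scale_scale W.scale_scale V.scale_one W.scale_one zero_prod_def)
qed

text \<open>A supremum of an unbounded set of reals is an arbitrary number, so some bound \<open>B\<close>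
  must be known before \<open>op_norm\<close> estimates anything. Vectors of norm 0 contribute
  the quotient 0.\<close>

lemma op_norm_bound:
  assumes V: "cn_space V" and B: "\<And>u. u \<in> vcarrier V \<Longrightarrow> vnorm W (L u) \<le> B * vnorm V u"
    and v: "v \<in> vcarrier V"
  shows "vnorm W (L v) \<le> op_norm V W L * vnorm V v"
proof -
  interpret cn_space V by fact
  show ?thesis
  proof (cases "vnorm V v = 0")
    case True
    then show ?thesis using B[OF v] by simp
  next
    case False
    then have pos: "0 < vnorm V v" using norm_nonneg[OF v] by simp
    have "bdd_above ((\<lambda>u. vnorm W (L u) / vnorm V u) ` vcarrier V)"
    proof (rule bdd_aboveI2)
      fix u assume u: "u \<in> vcarrier V"
      show "vnorm W (L u) / vnorm V u \<le> \<bar>B\<bar>"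
      proof (cases "vnorm V u = 0")
        case False
        then have "0 < vnorm V u" using norm_nonneg[OF u] by simp
        then show ?thesis using B[OF u]
          by (smt (verit, best) divide_le_eq mult_right_mono)
      qed simp
    qed
    then have "vnorm W (L v) / vnorm V v \<le> op_norm V W L"
      unfolding op_norm_def using v by (rule cSUP_upper2) auto
    then show ?thesis using pos by (simp add: divide_le_eq)
  qed
qed

lemma op_norm_cong:
  "(\<And>v. v \<in> vcarrier V \<Longrightarrow> L v = M v) \<Longrightarrow> op_norm V W L = op_norm V W M"
  unfolding op_norm_def by (intro SUP_cong) auto

lemma bounded_op_diff:
  assumes V: "cn_space V" and W: "cn_space W" and L: "bounded_op V W L" and M: "bounded_op V W M"
  shows "bounded_op V W (\<lambda>v. L v - M v)"
proof -
  interpret V: cn_space V by fact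
  interpret W: cn_space W by fact
  obtain B where B: "\<And>v. v \<in> vcarrier V \<Longrightarrow> vnorm W (L v) \<le> B * vnorm V v"
    using L unfolding bounded_op_def by blast
  obtain B' where B': "\<And>v. v \<in> vcarrier V \<Longrightarrow> vnorm W (M v) \<le> B' * vnorm V v"
    using M unfolding bounded_op_def by blast
  have mem: "L v \<in> vcarrier W" "M v \<in> vcarrier W" if "v \<in> vcarrier V" for v
    using L M that by (auto simp: bounded_op_def)
  have "vnorm W (L v - M v) \<le> (B + B') * vnorm V v" if v: "v \<in> vcarrier V" for v
    using W.norm_triangle[OF mem(1)[OF v] W.minus_mem[OF mem(2)[OF v]]] W.norm_minus[OF mem(2)[OF v]]
      B[OF v] B'[OF v] by (simp add: algebra_simps)
  then have "\<exists>B. \<forall>v\<in>vcarrier V. vnorm W (L v - M v) \<le> B * vnorm V v" by blast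
  moreover have "vscale W a (L v - M v) = vscale W a (L v) - vscale W a (M v)" if "v \<in> vcarrier V" for a v
    using W.scale_diff_right[OF mem[OF that]] .
  ultimately show ?thesis
    using L M W.diff_mem unfolding bounded_op_def by simp
qed

lemma
  assumes "bounded_op P (prod_space V X) L"
  shows bounded_op_fst: "bounded_op P V (\<lambda>h. fst (L h))"
    and bounded_op_snd: "bounded_op P X (\<lambda>h. snd (L h))"
proof -
  obtain B where B: "\<And>h. h \<in> vcarrier P \<Longrightarrow> vnorm (prod_space V X) (L h) \<le> B * vnorm P h"
    using assms unfolding bounded_op_def by blast
  have "\<exists>B. \<forall>h\<in>vcarrier P. vnorm V (fst (L h)) \<le> B * vnorm P h"
    "\<exists>B. \<forall>h\<in>vcarrier P. vnorm X (snd (L h)) \<le> B * vnorm P h"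
    using B by (auto simp: prod_space_def split_beta intro!: exI[of _ B])
  then show "bounded_op P V (\<lambda>h. fst (L h))" "bounded_op P X (\<lambda>h. snd (L h))"
    using assms by (auto simp: bounded_op_def prod_space_def split_beta mem_Times_iff)
qed

lemma bounded_op_pair_bound:
  assumes V: "cn_space V" and X: "cn_space X" and W: "cn_space W"
    and L: "bounded_op (prod_space V X) W L"
    and a: "op_norm V W (\<lambda>h. L (h, 0)) \<le> a" and b: "op_norm X W (\<lambda>k. L (0, k)) \<le> b"
    and h: "h \<in> vcarrier V" and k: "k \<in> vcarrier X"
  shows "vnorm W (L (h, k)) \<le> a * vnorm V h + b * vnorm X k"
proof -
  interpret V: cn_space V by fact
  interpret X: cn_space X by fact
  interpret W: cn_space W by fact
  let ?P = "prod_space V X"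
  obtain B where B: "\<And>v. v \<in> vcarrier ?P \<Longrightarrow> vnorm W (L v) \<le> B * vnorm ?P v"
    using L unfolding bounded_op_def by blast
  have emb: "(u, 0) \<in> vcarrier ?P" "vnorm ?P (u, 0) = vnorm V u" if "u \<in> vcarrier V" for u
    using that V.norm_nonneg[OF that] by (simp_all add: prod_space_def X.zero_mem X.norm_zero)
  have emb': "(0, v) \<in> vcarrier ?P" "vnorm ?P (0, v) = vnorm X v" if "v \<in> vcarrier X" for v
    using that X.norm_nonneg[OF that] by (simp_all add: prod_space_def V.zero_mem V.norm_zero)
  have "L (h, k) = L (h, 0) + L (0, k)"
    using L emb(1)[OF h] emb'(1)[OF k] unfolding bounded_op_def by (metis add_0 add_0_right add_Pair)
  moreover have "L (h, 0) \<in> vcarrier W" "L (0, k) \<in> vcarrier W"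
    using L emb(1)[OF h] emb'(1)[OF k] by (auto simp: bounded_op_def)
  ultimately have "vnorm W (L (h, k)) \<le> vnorm W (L (h, 0)) + vnorm W (L (0, k))"
    using W.norm_triangle by simp
  moreover have "vnorm W (L (h, 0)) \<le> op_norm V W (\<lambda>h. L (h, 0)) * vnorm V h"
    by (rule op_norm_bound[OF V _ h, of W _ B]) (metis B emb)
  moreover have "vnorm W (L (0, k)) \<le> op_norm X W (\<lambda>k. L (0, k)) * vnorm X k"
    by (rule op_norm_bound[OF X _ k, of W _ B]) (metis B emb')
  ultimately show ?thesis
    using mult_right_mono[OF a V.norm_nonneg[OF h]] mult_right_mono[OF b X.norm_nonneg[OF k]] by linarith
qed

lemma has_fderiv_remainder:
  assumes "has_fderiv V W U f L x" "0 < e"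
  obtains d where "0 < d" and "\<And>k. k \<in> vcarrier V \<Longrightarrow> vnorm V k < d \<Longrightarrow>
    x + k \<in> U \<and> f (x + k) - f x - L k \<in> vcarrier W \<and>
    vnorm W (f (x + k) - f x - L k) \<le> e * vnorm V k"
  using assms unfolding has_fderiv_def by meson

text \<open>Uniqueness identifies the derivative chosen in \<open>fderiv\<close>. Along \<open>t v\<close>
  with \<open>t\<close> tending to 0 both remainders are small compared with \<open>t\<close>,
  and so is \<open>t\<close> times the difference of the operators.\<close>

lemma has_fderiv_unique:
  assumes V: "cn_space V" and W: "cn_space W"
    and L: "has_fderiv V W U f L x" and M: "has_fderiv V W U f M x" and v: "v \<in> vcarrier V"
  shows "L v = M v"
proof -
  interpret V: cn_space V by fact
  interpret W: cn_space W by fact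
  have mem: "L v \<in> vcarrier W" "M v \<in> vcarrier W"
    using L M v unfolding has_fderiv_def bounded_op_def by auto
  have "vnorm W (L v - M v) \<le> 0 + e" if e: "0 < e" for e
  proof -
    define n where "n = vnorm V v + 1"
    have n: "0 < n" "vnorm V v \<le> n" using V.norm_nonneg[OF v] unfolding n_def by auto
    define \<epsilon> where "\<epsilon> = e / (2 * n)"
    have \<epsilon>: "0 < \<epsilon>" using e n by (simp add: \<epsilon>_def)
    obtain d1 where d1: "0 < d1" "\<And>h. h \<in> vcarrier V \<Longrightarrow> vnorm V h < d1 \<Longrightarrow>
        f (x + h) - f x - L h \<in> vcarrier W \<and> vnorm W (f (x + h) - f x - L h) \<le> \<epsilon> * vnorm V h"
      using L \<epsilon> unfolding has_fderiv_def by meson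
    obtain d2 where d2: "0 < d2" "\<And>h. h \<in> vcarrier V \<Longrightarrow> vnorm V h < d2 \<Longrightarrow>
        f (x + h) - f x - M h \<in> vcarrier W \<and> vnorm W (f (x + h) - f x - M h) \<le> \<epsilon> * vnorm V h"
      using M \<epsilon> unfolding has_fderiv_def by meson
    define t where "t = min d1 d2 / (2 * n)"
    have t: "0 < t" using d1(1) d2(1) n by (simp add: t_def)
    define h where "h = vscale V (of_real t) v"
    have h: "h \<in> vcarrier V" using v by (simp add: h_def V.scale_mem)
    have nh: "vnorm V h = t * vnorm V v" using v t by (simp add: h_def V.norm_scale)
    have "t * vnorm V v \<le> t * n" using t n by simp
    also have "\<dots> < min d1 d2" using n d1(1) d2(1) by (simp add: t_def min_def)
    finally have small: "vnorm V h < d1" "vnorm V h < d2" using nh by auto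
    note r = d1(2)[OF h small(1)] d2(2)[OF h small(2)]
    have "L h - M h = (f (x + h) - f x - M h) - (f (x + h) - f x - L h)" by simp
    then have "vnorm W (L h - M h) \<le> vnorm W (f (x + h) - f x - M h) + vnorm W (- (f (x + h) - f x - L h))"
      using r W.norm_triangle W.minus_mem by (metis (no_types, lifting) add_uminus_conv_diff)
    also have "\<dots> \<le> 2 * \<epsilon> * vnorm V h" using conjunct2[OF r(1)] conjunct2[OF r(2)] W.norm_minus[OF conjunct1[OF r(1)]] by linarith
    finally have 1: "vnorm W (L h - M h) \<le> 2 * \<epsilon> * (t * vnorm V v)" using nh by simp
    have "L h - M h = vscale W (of_real t) (L v - M v)"
      using L M v mem unfolding has_fderiv_def bounded_op_def h_def by (simp add: W.scale_diff_right)
    then have "vnorm W (L h - M h) = t * vnorm W (L v - M v)"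
      using W.norm_scale[OF W.diff_mem[OF mem]] t by simp
    with 1 have "t * vnorm W (L v - M v) \<le> t * (2 * \<epsilon> * vnorm V v)" by (simp add: algebra_simps)
    then have "vnorm W (L v - M v) \<le> 2 * \<epsilon> * vnorm V v" using t by simp
    also have "\<dots> \<le> 2 * \<epsilon> * n" using n \<epsilon> by simp
    also have "\<dots> = e" using n by (simp add: \<epsilon>_def)
    finally show ?thesis by simp
  qed
  then have "vnorm W (L v - M v) \<le> 0" by (rule field_le_epsilon)
  then have "L v - M v = 0"
    using W.norm_definite W.norm_nonneg W.diff_mem mem by (metis order_antisym)
  then show ?thesis by simp
qed

lemma fderiv_eq:
  assumes "cn_space V" "cn_space W" "has_fderiv V W U f L x" "v \<in> vcarrier V"
  shows "fderiv V W U f x v = L v"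
proof -
  have "has_fderiv V W U f (fderiv V W U f x) x"
    unfolding fderiv_def by (rule someI[of _ L]) (rule assms(3))
  then show ?thesis using has_fderiv_unique assms by blast
qed

lemma has_fderiv_partial_fst:
  assumes V: "cn_space V" and X: "cn_space X"
    and L: "has_fderiv (prod_space V X) W (U \<times> U') T L (p, q)"
  shows "has_fderiv V W U (\<lambda>p. T (p, q)) (\<lambda>h. L (h, 0)) p"
proof -
  interpret V: cn_space V by fact
  interpret X: cn_space X by fact
  have car: "(h, 0) \<in> vcarrier (prod_space V X)" if "h \<in> vcarrier V" for h
    using that X.zero_mem by (simp add: prod_space_def)
  have nrm: "vnorm (prod_space V X) (h, 0) = vnorm V h" if "h \<in> vcarrier V" for h
    using V.norm_nonneg[OF that] by (simp add: prod_space_def X.norm_zero max_def)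
  have sc: "vscale (prod_space V X) a (h, 0) = (vscale V a h, 0)" for a h
    by (simp add: prod_space_def X.scale_zero_right)
  have b: "bounded_op V W (\<lambda>h. L (h, 0))"
    using L unfolding has_fderiv_def bounded_op_def
    by (metis (no_types, lifting) add_0 add_Pair car nrm sc)
  show ?thesis unfolding has_fderiv_def
  proof (intro conjI allI impI b)
    show "p \<in> U" using L by (simp add: has_fderiv_def)
    fix e :: real assume "0 < e"
    then obtain d where "0 < d" and d: "\<And>k. k \<in> vcarrier (prod_space V X) \<Longrightarrow>
      vnorm (prod_space V X) k < d \<Longrightarrow> (p, q) + k \<in> U \<times> U' \<and>
      T ((p, q) + k) - T (p, q) - L k \<in> vcarrier W \<and>
      vnorm W (T ((p, q) + k) - T (p, q) - L k) \<le> e * vnorm (prod_space V X) k"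
      using L unfolding has_fderiv_def by meson
    show "\<exists>d>0. \<forall>h\<in>vcarrier V. vnorm V h < d \<longrightarrow> p + h \<in> U \<and>
      T (p + h, q) - T (p, q) - L (h, 0) \<in> vcarrier W \<and>
      vnorm W (T (p + h, q) - T (p, q) - L (h, 0)) \<le> e * vnorm V h"
      using \<open>0 < d\<close> d[OF car] nrm by (intro exI[of _ d]) auto
  qed
qed

lemma has_fderiv_partial_snd:
  assumes V: "cn_space V" and X: "cn_space X"
    and L: "has_fderiv (prod_space V X) W (U \<times> U') T L (p, q)"
  shows "has_fderiv X W U' (\<lambda>q. T (p, q)) (\<lambda>h. L (0, h)) q"
proof -
  interpret V: cn_space V by fact
  interpret X: cn_space X by fact
  have car: "(0, h) \<in> vcarrier (prod_space V X)" if "h \<in> vcarrier X" for h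
    using that V.zero_mem by (simp add: prod_space_def)
  have nrm: "vnorm (prod_space V X) (0, h) = vnorm X h" if "h \<in> vcarrier X" for h
    using X.norm_nonneg[OF that] by (simp add: prod_space_def V.norm_zero max_def)
  have sc: "vscale (prod_space V X) a (0, h) = (0, vscale X a h)" for a h
    by (simp add: prod_space_def V.scale_zero_right)
  have b: "bounded_op X W (\<lambda>h. L (0, h))"
    using L unfolding has_fderiv_def bounded_op_def
    by (metis (no_types, lifting) add_0 add_Pair car nrm sc)
  show ?thesis unfolding has_fderiv_def
  proof (intro conjI allI impI b)
    show "q \<in> U'" using L by (simp add: has_fderiv_def)
    fix e :: real assume "0 < e"
    then obtain d where "0 < d" and d: "\<And>k. k \<in> vcarrier (prod_space V X) \<Longrightarrow>
      vnorm (prod_space V X) k < d \<Longrightarrow> (p, q) + k \<in> U \<times> U' \<and>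
      T ((p, q) + k) - T (p, q) - L k \<in> vcarrier W \<and>
      vnorm W (T ((p, q) + k) - T (p, q) - L k) \<le> e * vnorm (prod_space V X) k"
      using L unfolding has_fderiv_def by meson
    show "\<exists>d>0. \<forall>h\<in>vcarrier X. vnorm X h < d \<longrightarrow> q + h \<in> U' \<and>
      T (p, q + h) - T (p, q) - L (0, h) \<in> vcarrier W \<and>
      vnorm W (T (p, q + h) - T (p, q) - L (0, h)) \<le> e * vnorm X h"
      using \<open>0 < d\<close> d[OF car] nrm by (intro exI[of _ d]) auto
  qed
qed

lemma
  assumes "has_fderiv P (prod_space V X) U T L x"
  shows has_fderiv_fst: "has_fderiv P V U (\<lambda>x. fst (T x)) (\<lambda>h. fst (L h)) x"
    and has_fderiv_snd: "has_fderiv P X U (\<lambda>x. snd (T x)) (\<lambda>h. snd (L h)) x"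
proof -
  have rem: "\<exists>d>0. \<forall>h\<in>vcarrier P. vnorm P h < d \<longrightarrow> x + h \<in> U \<and>
      fst (T (x + h)) - fst (T x) - fst (L h) \<in> vcarrier V \<and>
      vnorm V (fst (T (x + h)) - fst (T x) - fst (L h)) \<le> e * vnorm P h \<and>
      snd (T (x + h)) - snd (T x) - snd (L h) \<in> vcarrier X \<and>
      vnorm X (snd (T (x + h)) - snd (T x) - snd (L h)) \<le> e * vnorm P h" if "0 < e" for e
    by (rule has_fderiv_remainder[OF assms that], rule exI, rule conjI, assumption)
       (force simp: prod_space_def split_beta mem_Times_iff)
  have bo: "bounded_op P (prod_space V X) L" and x: "x \<in> U" using assms by (auto simp: has_fderiv_def)
  show "has_fderiv P V U (\<lambda>x. fst (T x)) (\<lambda>h. fst (L h)) x"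
    "has_fderiv P X U (\<lambda>x. snd (T x)) (\<lambda>h. snd (L h)) x"
    unfolding has_fderiv_def using x bounded_op_fst[OF bo] bounded_op_snd[OF bo] rem
    by (intro conjI allI impI; meson)+
qed

section \<open>Mean value inequality and contraction\<close>

text \<open>The clause \<open>norming\<close> demands real-linear functionals below the norm that nearly
  attain it at a given vector. For maximum and summation norms they are weighted sums of rotated
  coordinates, which replaces the Hahn-Banach theorem on carriers.\<close>

locale cn_banach = cn_space V for V :: "'v::ab_group_add cnspace" +
  assumes norming: "v \<in> vcarrier V \<Longrightarrow> e < vnorm V v \<Longrightarrow> \<exists>l :: 'v \<Rightarrow> real.
      (\<forall>u\<in>vcarrier V. \<forall>w\<in>vcarrier V. l (u + w) = l u + l w) \<and>
      (\<forall>t. \<forall>u\<in>vcarrier V. l (vscale V (of_real t) u) = t * l u) \<and>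
      (\<forall>u\<in>vcarrier V. l u \<le> vnorm V u) \<and> e < l v"
    and complete: "(\<And>n::nat. X n \<in> vcarrier V) \<Longrightarrow>
      (\<And>e. 0 < e \<Longrightarrow> \<exists>N. \<forall>m\<ge>N. \<forall>n\<ge>N. vnorm V (X m - X n) < e) \<Longrightarrow>
      \<exists>x\<in>vcarrier V. (\<lambda>n. vnorm V (X n - x)) \<longlonglongrightarrow> 0"

text \<open>A norming functional \<open>l\<close> for the increment at \<open>t = 1\<close> reduces the
  claim to the real function \<open>l (f (x + t h) - f x)\<close>, whose slope at
  \<open>t\<close> is at most \<open>a + b t\<close>.\<close>

lemma mean_value:
  assumes V: "cn_space V" and W: "cn_banach W"
    and h: "h \<in> vcarrier V" "x \<in> vcarrier V"
    and der: "\<And>t. 0 \<le> t \<Longrightarrow> t \<le> 1 \<Longrightarrow> has_fderiv V W U f (L t) (x + vscale V (of_real t) h)"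
    and mem: "\<And>t. 0 \<le> t \<Longrightarrow> t \<le> 1 \<Longrightarrow> f (x + vscale V (of_real t) h) - f x \<in> vcarrier W"
    and bound: "\<And>t. 0 \<le> t \<Longrightarrow> t \<le> 1 \<Longrightarrow> vnorm W (L t h) \<le> a + b * t"
  shows "vnorm W (f (x + h) - f x) \<le> a + b / 2"
proof (rule ccontr)
  interpret V: cn_space V by fact
  interpret W: cn_banach W by fact
  define g where "g t = f (x + vscale V (of_real t) h) - f x" for t
  have g1: "g 1 = f (x + h) - f x" and g0: "g 0 = 0"
    using h by (simp_all add: g_def V.scale_one V.scale_zero_left)
  assume "\<not> ?thesis"
  then have "a + b / 2 < vnorm W (g 1)" by (simp add: g1)
  moreover have "g 1 \<in> vcarrier W" using mem[of 1] by (simp add: g_def)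
  ultimately obtain l :: "_ \<Rightarrow> real"
    where ladd: "\<And>u w. u \<in> vcarrier W \<Longrightarrow> w \<in> vcarrier W \<Longrightarrow> l (u + w) = l u + l w"
      and lscale: "\<And>t u. u \<in> vcarrier W \<Longrightarrow> l (vscale W (of_real t) u) = t * l u"
      and lle: "\<And>u. u \<in> vcarrier W \<Longrightarrow> l u \<le> vnorm W u" and lg: "a + b / 2 < l (g 1)"
    using W.norming by metis
  have l0: "l 0 = 0" using ladd[OF W.zero_mem W.zero_mem] by simp
  have lminus: "l (- u) = - l u" if "u \<in> vcarrier W" for u
    using ladd[OF that W.minus_mem[OF that]] l0 by simp
  have labs: "\<bar>l u\<bar> \<le> vnorm W u" if "u \<in> vcarrier W" for u
    using lle[OF that] lle[OF W.minus_mem[OF that]] lminus[OF that] W.norm_minus[OF that] by simp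
  have deriv: "((\<lambda>t. l (g t)) has_real_derivative l (L t h)) (at t)" if t: "0 \<le> t" "t \<le> 1" for t
    unfolding has_field_derivative_def has_derivative_at_alt
  proof (intro conjI allI impI)
    show "bounded_linear ((*) (l (L t h)))" by (rule bounded_linear_mult_right)
    fix e :: real assume e: "0 < e"
    define n where "n = vnorm V h + 1"
    have n: "0 < n" "vnorm V h \<le> n" using V.norm_nonneg[OF h(1)] by (auto simp: n_def)
    note D = der[OF t]
    obtain d where d: "0 < d" and rem: "\<And>k. k \<in> vcarrier V \<Longrightarrow> vnorm V k < d \<Longrightarrow>
        f (x + vscale V (of_real t) h + k) - f (x + vscale V (of_real t) h) - L t k \<in> vcarrier W \<and>
        vnorm W (f (x + vscale V (of_real t) h + k) - f (x + vscale V (of_real t) h) - L t k)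
          \<le> (e / n) * vnorm V k"
      using has_fderiv_remainder[OF D, of "e / n"] e n by (metis divide_pos_pos)
    have Lh: "L t h \<in> vcarrier W" and Lsc: "\<And>c. L t (vscale V c h) = vscale W c (L t h)"
      using D h unfolding has_fderiv_def bounded_op_def by auto
    show "\<exists>d>0. \<forall>y. norm (y - t) < d \<longrightarrow>
        norm (l (g y) - l (g t) - l (L t h) * (y - t)) \<le> e * norm (y - t)"
    proof (intro exI[of _ "d / n"] conjI allI impI)
      show "0 < d / n" using d n by simp
      fix y assume y: "norm (y - t) < d / n"
      define k where "k = vscale V (of_real (y - t)) h"
      have k: "k \<in> vcarrier V" using h by (simp add: k_def V.scale_mem)
      have nk: "vnorm V k = \<bar>y - t\<bar> * vnorm V h" using h by (simp only: k_def V.norm_scale norm_of_real)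
      also have "\<dots> \<le> \<bar>y - t\<bar> * n" using n by (simp add: mult_left_mono)
      finally have nk': "vnorm V k \<le> \<bar>y - t\<bar> * n" .
      also have "\<dots> < d" using y n by (simp add: pos_less_divide_eq)
      finally have small: "vnorm V k < d" .
      define r where "r = f (x + vscale V (of_real t) h + k) - f (x + vscale V (of_real t) h) - L t k"
      have rW: "r \<in> vcarrier W" "vnorm W r \<le> (e / n) * vnorm V k" using rem[OF k small] by (auto simp: r_def)
      have xy: "x + vscale V (of_real t) h + k = x + vscale V (of_real y) h"
        using V.scale_add_left[OF h(1), of "of_real t" "of_real (y - t)"]
        by (simp add: k_def add.assoc)
      have "g y = g t + (r + L t k)" unfolding g_def r_def xy by simp
      moreover have Lk: "L t k \<in> vcarrier W" "l (L t k) = (y - t) * l (L t h)"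
        using Lsc[of "of_real (y - t)"] lscale[OF Lh, of "y - t"] W.scale_mem[OF Lh, of "of_real (y-t)"]
        unfolding k_def by auto
      moreover have "g t \<in> vcarrier W" using mem[OF t] by (simp add: g_def)
      ultimately have "l (g y) = l (g t) + (l r + (y - t) * l (L t h))"
        using ladd rW(1) W.add_mem by metis
      then have "norm (l (g y) - l (g t) - l (L t h) * (y - t)) = \<bar>l r\<bar>" by (simp add: algebra_simps)
      also have "\<dots> \<le> (e / n) * vnorm V k" using labs[OF rW(1)] rW(2) by simp
      also have "\<dots> \<le> (e / n) * (\<bar>y - t\<bar> * n)" using nk' e n by (intro mult_left_mono) auto
      also have "\<dots> = e * norm (y - t)" using n by simp
      finally show "norm (l (g y) - l (g t) - l (L t h) * (y - t)) \<le> e * norm (y - t)" .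
    qed
  qed
  \<comment> \<open>a nonincreasing function, since its slope is at most 0\<close>
  define p where "p t = l (g t) - a * t - b / 2 * t\<^sup>2" for t
  have "p 1 \<le> p 0"
  proof (rule DERIV_nonpos_imp_nonincreasing[of 0 1 p])
    fix t :: real assume t: "0 \<le> t" "t \<le> 1"
    have "(p has_real_derivative (l (L t h) - a - b * t)) (at t)"
      unfolding p_def by (rule derivative_eq_intros deriv[OF t] refl | simp)+
    moreover have "L t h \<in> vcarrier W"
      using der[OF t] h unfolding has_fderiv_def bounded_op_def by auto
    then have "l (L t h) \<le> a + b * t" using lle bound[OF t] by fastforce
    ultimately show "\<exists>y. (p has_real_derivative y) (at t) \<and> y \<le> 0" by (intro exI) auto
  qed simp
  then show False using lg by (simp add: p_def g0 l0)
qed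

text \<open>A contraction principle with a matrix \<open>M\<close> of Lipschitz constants. The two
  conditions on \<open>M\<close> force its diagonal entries below 1 and \<open>det (1 - M) >
  0\<close>. Hence a positive vector \<open>q\<close> satisfies \<open>M q < q\<close>
  componentwise, and \<open>T\<close> is a contraction for the maximum of the two distances
  divided by \<open>q1\<close> and \<open>q2\<close>.\<close>

theorem perov_fixed_point:
  fixes M :: "real^2^2"
  assumes V: "cn_banach V" and X: "cn_banach X"
    and B: "B \<subseteq> vcarrier V \<times> vcarrier X" and ne: "B \<noteq> {}"
    and closed: "\<And>s v b. (\<And>n::nat. s n \<in> B) \<Longrightarrow>
      v \<in> vcarrier V \<Longrightarrow> (\<lambda>n. vnorm V (fst (s n) - v)) \<longlonglongrightarrow> 0 \<Longrightarrow>
      b \<in> vcarrier X \<Longrightarrow> (\<lambda>n. vnorm X (snd (s n) - b)) \<longlonglongrightarrow> 0 \<Longrightarrow> (v, b) \<in> B"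
    and self: "\<And>x. x \<in> B \<Longrightarrow> T x \<in> B"
    and Mpos: "\<And>i i'. 0 < M $ i $ i'"
    and lip: "\<And>x y. x \<in> B \<Longrightarrow> y \<in> B \<Longrightarrow>
        vnorm V (fst (T y) - fst (T x)) \<le> M$1$1 * vnorm V (fst (y - x)) + M$1$2 * vnorm X (snd (y - x))"
      "\<And>x y. x \<in> B \<Longrightarrow> y \<in> B \<Longrightarrow>
        vnorm X (snd (T y) - snd (T x)) \<le> M$2$1 * vnorm V (fst (y - x)) + M$2$2 * vnorm X (snd (y - x))"
    and tr: "trace M - 2 < 0" and det: "trace M - det M - 1 < 0"
  shows "\<exists>!x. x \<in> B \<and> T x = x"
proof -
  interpret V: cn_banach V by fact
  interpret X: cn_banach X by fact
  \<comment> \<open>in both components \<open>q - M q\<close> equals \<open>det (1 - M)\<close>\<close>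
  define q1 where "q1 = M$1$2 + (1 - M$2$2)"
  define q2 where "q2 = M$2$1 + (1 - M$1$1)"
  have tr': "M$1$1 + M$2$2 < 2" using tr by (simp add: trace_def sum_2)
  have dt: "M$1$2 * M$2$1 < (1 - M$1$1) * (1 - M$2$2)"
    using det by (simp add: trace_def sum_2 det_2 algebra_simps)
  have "0 < (1 - M$1$1) * (1 - M$2$2)"
    using dt Mpos[of 1 2] Mpos[of 2 1] by (meson less_trans mult_pos_pos)
  then have lt1: "M$1$1 < 1" "M$2$2 < 1" using tr' by (auto simp: zero_less_mult_iff)
  have q: "0 < q1" "0 < q2" using lt1 Mpos by (simp_all add: q1_def q2_def add_pos_pos)
  have Mq: "M$1$1 * q1 + M$1$2 * q2 < q1" "M$2$1 * q1 + M$2$2 * q2 < q2"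
    using dt by (simp_all add: q1_def q2_def algebra_simps)
  define c where "c = max ((M$1$1 * q1 + M$1$2 * q2) / q1) ((M$2$1 * q1 + M$2$2 * q2) / q2)"
  have c1: "c < 1" using Mq q by (simp add: c_def)
  \<comment> \<open>the value 0 off \<open>B\<close> makes \<open>d\<close> nonnegative and symmetric on
    the whole type\<close>
  define d where "d x y = (if x \<in> B \<and> y \<in> B
    then max (vnorm V (fst x - fst y) / q1) (vnorm X (snd x - snd y) / q2) else 0)" for x y
  have carB: "fst x \<in> vcarrier V" "snd x \<in> vcarrier X" if "x \<in> B" for x
    using that B by auto
  have con: "d (T x) (T y) \<le> c * d x y" if x: "x \<in> B" and y: "y \<in> B" for x y
  proof -
    have a: "vnorm V (fst (x - y)) \<le> q1 * d x y" "vnorm X (snd (x - y)) \<le> q2 * d x y"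
      using q x y by (simp_all add: d_def max_mult_distrib_left)
    have d0: "0 \<le> d x y"
      using V.norm_nonneg[OF V.diff_mem[OF carB(1)[OF x] carB(1)[OF y]]] q
      by (simp add: d_def le_max_iff_disj)
    have Txy: "T x \<in> B" "T y \<in> B" using self x y by auto
    have "vnorm V (fst (T x) - fst (T y)) \<le> M$1$1 * (q1 * d x y) + M$1$2 * (q2 * d x y)"
      using lip(1)[OF y x] mult_left_mono[OF a(1) less_imp_le[OF Mpos[of 1 1]]] mult_left_mono[OF a(2) less_imp_le[OF Mpos[of 1 2]]]
      by linarith
    then have "vnorm V (fst (T x) - fst (T y)) / q1 \<le> (M$1$1 * q1 + M$1$2 * q2) / q1 * d x y"
      using q by (simp add: field_simps)
    also have "\<dots> \<le> c * d x y" using d0 by (intro mult_right_mono) (simp_all add: c_def)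
    finally have 1: "vnorm V (fst (T x) - fst (T y)) / q1 \<le> c * d x y" .
    have "vnorm X (snd (T x) - snd (T y)) \<le> M$2$1 * (q1 * d x y) + M$2$2 * (q2 * d x y)"
      using lip(2)[OF y x] mult_left_mono[OF a(1) less_imp_le[OF Mpos[of 2 1]]] mult_left_mono[OF a(2) less_imp_le[OF Mpos[of 2 2]]]
      by linarith
    then have "vnorm X (snd (T x) - snd (T y)) / q2 \<le> (M$2$1 * q1 + M$2$2 * q2) / q2 * d x y"
      using q by (simp add: field_simps)
    also have "\<dots> \<le> c * d x y" using d0 by (intro mult_right_mono) (simp_all add: c_def)
    finally show ?thesis using 1 Txy by (simp add: d_def[of "T x"])
  qed
  interpret MS: Metric_space B d
  proof
    have nn: "0 \<le> d x y" if "x \<in> B" "y \<in> B" for x y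
      using V.norm_nonneg[OF V.diff_mem[OF carB(1)[OF that(1)] carB(1)[OF that(2)]]] q that
      by (simp add: d_def le_max_iff_disj)
    then show "0 \<le> d x y" for x y by (cases "x \<in> B \<and> y \<in> B") (auto simp: d_def)
    show "d x y = d y x" for x y
      using V.norm_diff_commute[of "fst x" "fst y"] X.norm_diff_commute[of "snd x" "snd y"] carB
      by (auto simp: d_def)
    show "d x y = 0 \<longleftrightarrow> x = y" if xy: "x \<in> B" "y \<in> B" for x y
    proof
      note m = V.diff_mem[OF carB(1)[OF xy(1)] carB(1)[OF xy(2)]] X.diff_mem[OF carB(2)[OF xy(1)] carB(2)[OF xy(2)]]
      assume "d x y = 0"
      then have "vnorm V (fst x - fst y) / q1 \<le> 0" "vnorm X (snd x - snd y) / q2 \<le> 0"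
        using xy unfolding d_def by (metis max.cobounded1 max.cobounded2)+
      then have "vnorm V (fst x - fst y) = 0" "vnorm X (snd x - snd y) = 0"
        using q V.norm_nonneg[OF m(1)] X.norm_nonneg[OF m(2)] by (auto simp: divide_le_0_iff)
      then show "x = y" using V.norm_definite[OF m(1)] X.norm_definite[OF m(2)] by (simp add: prod_eq_iff)
    qed (simp add: d_def V.norm_zero X.norm_zero)
    show "d x z \<le> d x y + d y z" if xyz: "x \<in> B" "y \<in> B" "z \<in> B" for x y z
    proof -
      have "vnorm V (fst x - fst z) / q1 \<le> vnorm V (fst x - fst y) / q1 + vnorm V (fst y - fst z) / q1"
        using V.norm_triangle_diff[OF carB(1)[OF xyz(1)] carB(1)[OF xyz(2)] carB(1)[OF xyz(3)]] q
        by (simp add: divide_right_mono flip: add_divide_distrib)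
      moreover have "vnorm X (snd x - snd z) / q2 \<le> vnorm X (snd x - snd y) / q2 + vnorm X (snd y - snd z) / q2"
        using X.norm_triangle_diff[OF carB(2)[OF xyz(1)] carB(2)[OF xyz(2)] carB(2)[OF xyz(3)]] q
        by (simp add: divide_right_mono flip: add_divide_distrib)
      moreover have maxle: "max a b \<le> max a1 b1 + max a2 b2" if "a \<le> a1 + a2" "b \<le> b1 + b2"
        for a b a1 a2 b1 b2 :: real using that by (auto simp: max_def)
      ultimately have "max (vnorm V (fst x - fst z) / q1) (vnorm X (snd x - snd z) / q2)
          \<le> max (vnorm V (fst x - fst y) / q1) (vnorm X (snd x - snd y) / q2) +
            max (vnorm V (fst y - fst z) / q1) (vnorm X (snd y - snd z) / q2)"
        using maxle by blast
      then show ?thesis using xyz by (simp add: d_def)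
    qed
  qed
  have dle: "vnorm V (fst x - fst y) \<le> q1 * d x y" "vnorm X (snd x - snd y) \<le> q2 * d x y"
    if "x \<in> B" "y \<in> B" for x y
    using q that by (simp_all add: d_def max_mult_distrib_left)
  have "MS.mcomplete"
    unfolding MS.mcomplete_def
  proof (intro allI impI)
    fix s assume "MS.MCauchy s"
    then have sB: "s n \<in> B" and cau: "0 < e \<Longrightarrow> \<exists>N. \<forall>m\<ge>N. \<forall>n\<ge>N. d (s m) (s n) < e" for n e
      unfolding MS.MCauchy_def by (auto simp: image_subset_iff)
    have lim: "\<exists>x\<in>vcarrier N. (\<lambda>n. vnorm N (f (s n) - x)) \<longlonglongrightarrow> 0"
      if N: "cn_banach N" and f: "\<And>x. x \<in> B \<Longrightarrow> f x \<in> vcarrier N" and q: "0 < (q::real)"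
        and le: "\<And>x y. x \<in> B \<Longrightarrow> y \<in> B \<Longrightarrow> vnorm N (f x - f y) \<le> q * d x y"
      for N :: "'n::ab_group_add cnspace" and f q
    proof (rule cn_banach.complete[OF N])
      show "f (s n) \<in> vcarrier N" for n using f sB by simp
      fix e :: real assume "0 < e"
      then obtain N0 where "\<forall>m\<ge>N0. \<forall>n\<ge>N0. d (s m) (s n) < e / q" using cau[of "e / q"] q by auto
      then have "\<forall>m\<ge>N0. \<forall>n\<ge>N0. vnorm N (f (s m) - f (s n)) < e"
        using le[OF sB sB] q by (metis (no_types, lifting) le_less_trans mult.commute pos_less_divide_eq)
      then show "\<exists>N0. \<forall>m\<ge>N0. \<forall>n\<ge>N0. vnorm N (f (s m) - f (s n)) < e" by blast
    qed
    obtain v where v: "v \<in> vcarrier V" "(\<lambda>n. vnorm V (fst (s n) - v)) \<longlonglongrightarrow> 0"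
      using lim[OF V carB(1) q(1) dle(1)] by blast
    obtain b where b: "b \<in> vcarrier X" "(\<lambda>n. vnorm X (snd (s n) - b)) \<longlonglongrightarrow> 0"
      using lim[OF X carB(2) q(2) dle(2)] by blast
    have vbB: "(v, b) \<in> B" by (rule closed[OF sB v b])
    have "(\<lambda>n. d (s n) (v, b)) \<longlonglongrightarrow> max (0 / q1) (0 / q2)"
      using sB vbB unfolding d_def
      by (simp only: if_True simp_thms fst_conv snd_conv)
         (intro tendsto_max tendsto_divide v b tendsto_const; use q in simp)
    then show "\<exists>x. limitin MS.mtopology s x sequentially"
      using vbB sB unfolding MS.limitin_metric_dist_null by (intro exI[of _ "(v, b)"]) auto
  qed
  then obtain x where x: "x \<in> B" "T x = x"
    using MS.Banach_fixedpoint_thm[of T c] self con c1 ne by (metis Pi_I empty_iff)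
  show ?thesis
  proof (rule ex1I[of _ x])
    fix y assume y: "y \<in> B \<and> T y = y"
    then have "d x y \<le> c * d x y" using con[OF x(1), of y] x(2) by simp
    then have "d x y = 0" using c1 MS.nonneg[of x y]
      by (metis mult_le_cancel_right1 not_less order_antisym)
    then show "y = x" using x y by simp
  qed (use x in simp)
qed

text \<open>On the segment from the centre to a point of the ball, the bounds \<open>W\<close> apply with
  radii proportional to the parameter, so integration halves them: this gives the self-map
  property from \<open>p1\<close> and \<open>p2\<close>. Between two arbitrary points only the
  bounds at \<open>rhat\<close> are available, and the Lipschitz matrix is \<open>Mr Z W
  rhat\<close>. The set \<open>C\<close> allows all this to happen inside a closed convex
  subset, on which alone the bounds are assumed.\<close>

theorem radii_polynomials:
  fixes V :: "'v::ab_group_add cnspace" and X :: "'x::ab_group_add cnspace"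
    and U :: "'v set" and T :: "'v \<times> 'x \<Rightarrow> 'v \<times> 'x" and C :: "('v \<times> 'x) set"
    and Y :: "real^2" and Z :: "real^2^2" and W :: "real^2^2^2" and rstar rhat :: "real^2"
  defines "P \<equiv> prod_space V X"
    and "Bl \<equiv> \<lambda>xbar r. {y \<in> C \<inter> vcarrier (prod_space V X).
        vnorm V (fst y - fst xbar) \<le> r $ 1 \<and> vnorm X (snd y - snd xbar) \<le> r $ (2::2)}"
    and "Dv \<equiv> \<lambda>x. fderiv V (prod_space V X) U (\<lambda>v. T (v, snd x)) (fst x)"
    and "Dx \<equiv> \<lambda>x. fderiv X (prod_space V X) (vcarrier X) (\<lambda>b. T (fst x, b)) (snd x)"
  assumes V: "cn_banach V" and X: "cn_banach X"
    and xbar: "xbar \<in> C" "xbar \<in> vcarrier P"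
    and convex: "\<And>x y t. x \<in> C \<Longrightarrow> y \<in> C \<Longrightarrow> x \<in> vcarrier P \<Longrightarrow> y \<in> vcarrier P \<Longrightarrow>
      0 \<le> t \<Longrightarrow> t \<le> 1 \<Longrightarrow> x + vscale P (of_real t) (y - x) \<in> C"
    and closed: "\<And>s y. (\<And>n::nat. s n \<in> C \<inter> vcarrier P) \<Longrightarrow> y \<in> vcarrier P \<Longrightarrow>
      (\<lambda>n. vnorm P (s n - y)) \<longlonglongrightarrow> 0 \<Longrightarrow> y \<in> C"
    and diff: "\<And>x. x \<in> Bl xbar rhat \<Longrightarrow> \<exists>L. has_fderiv P P (U \<times> vcarrier X) T L x"
    and self: "\<And>x. x \<in> Bl xbar rhat \<Longrightarrow> T x \<in> C \<inter> vcarrier P"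
    and pos: "\<And>i i'. 0 < Z $ i $ i'" "\<And>i i' i''. 0 < W $ i $ i' $ i''"
    and Y1: "vnorm V (fst (T xbar - xbar)) \<le> Y $ 1"
    and Y2: "vnorm X (snd (T xbar - xbar)) \<le> Y $ 2"
    and Z11: "op_norm V V (\<lambda>h. fst (Dv xbar h)) \<le> Z $ 1 $ 1"
    and Z12: "op_norm X V (\<lambda>h. fst (Dx xbar h)) \<le> Z $ 1 $ 2"
    and Z21: "op_norm V X (\<lambda>h. snd (Dv xbar h)) \<le> Z $ 2 $ 1"
    and Z22: "op_norm X X (\<lambda>h. snd (Dx xbar h)) \<le> Z $ 2 $ 2"
    and W11: "\<And>r x. 0 \<le> r $ 1 \<Longrightarrow> r $ 1 \<le> rstar $ 1 \<Longrightarrow> 0 \<le> r $ 2 \<Longrightarrow> r $ 2 \<le> rstar $ 2 \<Longrightarrow>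
       x \<in> Bl xbar r \<Longrightarrow> op_norm V V (\<lambda>h. fst (Dv x h - Dv xbar h)) \<le> Wr W 1 1 r"
    and W12: "\<And>r x. 0 \<le> r $ 1 \<Longrightarrow> r $ 1 \<le> rstar $ 1 \<Longrightarrow> 0 \<le> r $ 2 \<Longrightarrow> r $ 2 \<le> rstar $ 2 \<Longrightarrow>
       x \<in> Bl xbar r \<Longrightarrow> op_norm X V (\<lambda>h. fst (Dx x h - Dx xbar h)) \<le> Wr W 1 2 r"
    and W21: "\<And>r x. 0 \<le> r $ 1 \<Longrightarrow> r $ 1 \<le> rstar $ 1 \<Longrightarrow> 0 \<le> r $ 2 \<Longrightarrow> r $ 2 \<le> rstar $ 2 \<Longrightarrow>
       x \<in> Bl xbar r \<Longrightarrow> op_norm V X (\<lambda>h. snd (Dv x h - Dv xbar h)) \<le> Wr W 2 1 r"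
    and W22: "\<And>r x. 0 \<le> r $ 1 \<Longrightarrow> r $ 1 \<le> rstar $ 1 \<Longrightarrow> 0 \<le> r $ 2 \<Longrightarrow> r $ 2 \<le> rstar $ 2 \<Longrightarrow>
       x \<in> Bl xbar r \<Longrightarrow> op_norm X X (\<lambda>h. snd (Dx x h - Dx xbar h)) \<le> Wr W 2 2 r"
    and rhat: "\<And>i. 0 < rhat $ i \<and> rhat $ i \<le> rstar $ i"
    and p: "p1 Y Z W rhat < 0" "p2 Y Z W rhat < 0" "p3 Z W rhat < 0" "p4 Z W rhat < 0"
  shows "\<exists>!x. x \<in> Bl xbar rhat \<and> T x = x"
proof -
  interpret V: cn_banach V by fact
  interpret X: cn_banach X by fact
  have cnP: "cn_space P" unfolding P_def by (rule cn_space_prod) unfold_locales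
  interpret P: cn_space P by (rule cnP)
  have carP: "x \<in> vcarrier P \<longleftrightarrow> fst x \<in> vcarrier V \<and> snd x \<in> vcarrier X" for x
    by (simp add: P_def prod_space_def mem_Times_iff)
  have scP: "vscale P a x = (vscale V a (fst x), vscale X a (snd x))" for a x
    by (simp add: P_def prod_space_def split_beta)
  have nP: "vnorm P x = max (vnorm V (fst x)) (vnorm X (snd x))" for x
    by (simp add: P_def prod_space_def split_beta)
  let ?B = "Bl xbar rhat"
  have ball: "y \<in> Bl xbar r \<longleftrightarrow> y \<in> C \<and> y \<in> vcarrier P \<and>
      vnorm V (fst y - fst xbar) \<le> r $ 1 \<and> vnorm X (snd y - snd xbar) \<le> r $ 2" for y r
    by (auto simp: Bl_def P_def)
  have BV: "cn_space V" "cn_space X" by unfold_locales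
  obtain D where D: "\<And>x. x \<in> ?B \<Longrightarrow> has_fderiv P P (U \<times> vcarrier X) T (D x) x"
    using diff by metis
  have bD: "bounded_op P P (D x)" if "x \<in> ?B" for x using D[OF that] by (simp add: has_fderiv_def)
  have Dmem: "D x h \<in> vcarrier P" if "x \<in> ?B" "h \<in> vcarrier P" for x h
    using bD that by (auto simp: bounded_op_def)
  have Dv: "Dv x h = D x (h, 0)" if "x \<in> ?B" "h \<in> vcarrier V" for x h
    unfolding Dv_def
    by (rule fderiv_eq[OF BV(1) cnP[unfolded P_def] has_fderiv_partial_fst[OF BV] that(2)])
       (use D[OF that(1)] in \<open>simp add: P_def\<close>)
  have Dx: "Dx x h = D x (0, h)" if "x \<in> ?B" "h \<in> vcarrier X" for x h
    unfolding Dx_def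
    by (rule fderiv_eq[OF BV(2) cnP[unfolded P_def] has_fderiv_partial_snd[OF BV] that(2)])
       (use D[OF that(1)] in \<open>simp add: P_def\<close>)
  have xbB: "xbar \<in> Bl xbar r" if "0 \<le> r $ 1" "0 \<le> r $ 2" for r
    using xbar that by (simp add: ball V.norm_zero X.norm_zero)
  have xbar_in: "xbar \<in> ?B" using xbB rhat by (simp add: less_imp_le)
  have DZ: "vnorm V (fst (D xbar (h, k))) \<le> Z$1$1 * vnorm V h + Z$1$2 * vnorm X k"
    "vnorm X (snd (D xbar (h, k))) \<le> Z$2$1 * vnorm V h + Z$2$2 * vnorm X k"
    if hk: "h \<in> vcarrier V" "k \<in> vcarrier X" for h k
  proof -
    note bo = bD[OF xbar_in, unfolded P_def]
    show "vnorm V (fst (D xbar (h, k))) \<le> Z$1$1 * vnorm V h + Z$1$2 * vnorm X k"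
      using Z11 Z12
      by (intro bounded_op_pair_bound[OF BV BV(1) bounded_op_fst[OF bo] _ _ hk])
         (simp_all add: Dv[OF xbar_in] Dx[OF xbar_in] cong: op_norm_cong)
    show "vnorm X (snd (D xbar (h, k))) \<le> Z$2$1 * vnorm V h + Z$2$2 * vnorm X k"
      using Z21 Z22
      by (intro bounded_op_pair_bound[OF BV BV(2) bounded_op_snd[OF bo] _ _ hk])
         (simp_all add: Dv[OF xbar_in] Dx[OF xbar_in] cong: op_norm_cong)
  qed
  have DW: "vnorm V (fst (D x (h, k) - D xbar (h, k))) \<le> Wr W 1 1 r * vnorm V h + Wr W 1 2 r * vnorm X k"
    "vnorm X (snd (D x (h, k) - D xbar (h, k))) \<le> Wr W 2 1 r * vnorm V h + Wr W 2 2 r * vnorm X k"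
    if hk: "h \<in> vcarrier V" "k \<in> vcarrier X" and xr: "x \<in> Bl xbar r"
      and r: "0 \<le> r $ 1" "r $ 1 \<le> rhat $ 1" "0 \<le> r $ 2" "r $ 2 \<le> rhat $ 2" for h k x r
  proof -
    have xB: "x \<in> ?B" using xr r by (auto simp: ball)
    have rs: "r $ 1 \<le> rstar $ 1" "r $ 2 \<le> rstar $ 2" using r rhat by (meson order_trans)+
    note bo = bounded_op_diff[OF cnP cnP bD[OF xB] bD[OF xbar_in], unfolded P_def]
    note w = W11[OF r(1) rs(1) r(3) rs(2) xr] W12[OF r(1) rs(1) r(3) rs(2) xr]
      W21[OF r(1) rs(1) r(3) rs(2) xr] W22[OF r(1) rs(1) r(3) rs(2) xr]
    note eqs = Dv[OF xbar_in] Dx[OF xbar_in] Dv[OF xB] Dx[OF xB]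
    show "vnorm V (fst (D x (h, k) - D xbar (h, k))) \<le> Wr W 1 1 r * vnorm V h + Wr W 1 2 r * vnorm X k"
      using w(1,2)
      by (intro bounded_op_pair_bound[OF BV BV(1) bounded_op_fst[OF bo] _ _ hk])
         (simp_all add: eqs cong: op_norm_cong)
    show "vnorm X (snd (D x (h, k) - D xbar (h, k))) \<le> Wr W 2 1 r * vnorm V h + Wr W 2 2 r * vnorm X k"
      using w(3,4)
      by (intro bounded_op_pair_bound[OF BV BV(2) bounded_op_snd[OF bo] _ _ hk])
         (simp_all add: eqs cong: op_norm_cong)
  qed
  have Wpos: "0 \<le> Wr W i i' r" if "0 \<le> r $ 1" "0 \<le> r $ 2" for i i' r
    using that pos(2) by (simp add: Wr_def less_imp_le)
  have seg: "x + vscale P (of_real t) (y - x) \<in> ?B" if x: "x \<in> ?B" and y: "y \<in> ?B"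
    and t: "0 \<le> t" "t \<le> 1" for x y t
  proof -
    have car: "fst x \<in> vcarrier V" "fst y \<in> vcarrier V" "snd x \<in> vcarrier X" "snd y \<in> vcarrier X"
      "fst xbar \<in> vcarrier V" "snd xbar \<in> vcarrier X" and P: "x \<in> vcarrier P" "y \<in> vcarrier P"
      using x y xbar by (auto simp: ball carP)
    have "x + vscale P (of_real t) (y - x) \<in> C" using convex x y t by (auto simp: ball)
    moreover have "x + vscale P (of_real t) (y - x) \<in> vcarrier P"
      using P by (intro P.add_mem P.scale_mem P.diff_mem)
    ultimately show ?thesis
      using V.norm_segment_le[OF car(1,2,5) t] X.norm_segment_le[OF car(3,4,6) t] x y by (simp add: ball scP)
  qed
  have selfmap: "T x \<in> ?B" if x: "x \<in> ?B" for x
  proof -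
    define h where "h = x - xbar"
    have hP: "h \<in> vcarrier P" using x xbar by (auto simp: h_def ball intro: P.diff_mem)
    then have hc: "fst h \<in> vcarrier V" "snd h \<in> vcarrier X" by (auto simp: carP)
    have hn: "vnorm V (fst h) \<le> rhat $ 1" "vnorm X (snd h) \<le> rhat $ 2" using x by (auto simp: h_def ball)
    have inB: "xbar + vscale P (of_real t) h \<in> ?B" if "0 \<le> t" "t \<le> 1" for t
      using seg[OF xbar_in x that] by (simp add: h_def)
    \<comment> \<open>on the segment the bounds \<open>W\<close> apply with radii scaled by
      \<open>t\<close>\<close>
    have inBt: "xbar + vscale P (of_real t) h \<in> Bl xbar (t *\<^sub>R rhat)" if t: "0 \<le> t" "t \<le> 1" for t
    proof -
      have "cmod (of_real t) * vnorm V (fst h) \<le> t * rhat $ 1" "cmod (of_real t) * vnorm X (snd h) \<le> t * rhat $ 2"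
        using t hn by (simp_all add: mult_left_mono)
      then show ?thesis using inB[OF t] V.norm_scale[OF hc(1)] X.norm_scale[OF hc(2)]
        by (simp add: ball scP)
    qed
    have rt: "0 \<le> (t *\<^sub>R rhat) $ i" "(t *\<^sub>R rhat) $ i \<le> rhat $ i" if "0 \<le> t" "t \<le> 1" for t i
      using rhat[of i] that by (simp_all add: mult_left_le_one_le)
    have mem: "T (xbar + vscale P (of_real t) h) - T xbar \<in> vcarrier P" if "0 \<le> t" "t \<le> 1" for t
      using self[OF inB[OF that]] self[OF xbar_in] P.diff_mem by blast
    have est: "vnorm V (fst (D (xbar + vscale P (of_real t) h) h))
          \<le> (Z$1$1 * rhat$1 + Z$1$2 * rhat$2) + (Wr W 1 1 rhat * rhat$1 + Wr W 1 2 rhat * rhat$2) * t"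
      "vnorm X (snd (D (xbar + vscale P (of_real t) h) h))
          \<le> (Z$2$1 * rhat$1 + Z$2$2 * rhat$2) + (Wr W 2 1 rhat * rhat$1 + Wr W 2 2 rhat * rhat$2) * t"
      if t: "0 \<le> t" "t \<le> 1" for t
    proof -
      let ?x = "xbar + vscale P (of_real t) h"
      have wt: "Wr W i i' (t *\<^sub>R rhat) = t * Wr W i i' rhat" for i i' by (simp add: Wr_def algebra_simps)
      have zp: "0 \<le> Z $ i $ i'" "0 \<le> t * Wr W i i' rhat" for i i'
        using pos(1) Wpos[of rhat] rhat t by (simp_all add: less_imp_le)
      have e: "z1 * a + z2 * b + (t * w1 * a + t * w2 * b) \<le> z1 * rhat$1 + z2 * rhat$2 + (w1 * rhat$1 + w2 * rhat$2) * t"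
        if "0 \<le> z1" "0 \<le> z2" "0 \<le> t * w1" "0 \<le> t * w2" "a \<le> rhat$1" "b \<le> rhat$2" for z1 z2 w1 w2 a b
        using mult_left_mono[OF that(5,1)] mult_left_mono[OF that(6,2)]
          mult_left_mono[OF that(5,3)] mult_left_mono[OF that(6,4)] by (simp add: algebra_simps)
      have m: "D xbar h \<in> vcarrier P" "D ?x h - D xbar h \<in> vcarrier P"
        using Dmem inB[OF t] xbar_in hP P.diff_mem by auto
      have s: "D ?x h = D xbar h + (D ?x h - D xbar h)" by simp
      have "vnorm V (fst (D ?x h)) \<le> vnorm V (fst (D xbar h)) + vnorm V (fst (D ?x h - D xbar h))"
        using V.norm_triangle m s unfolding carP by (metis fst_add)
      also have "\<dots> \<le> (Z$1$1 * vnorm V (fst h) + Z$1$2 * vnorm X (snd h))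
          + (Wr W 1 1 (t *\<^sub>R rhat) * vnorm V (fst h) + Wr W 1 2 (t *\<^sub>R rhat) * vnorm X (snd h))"
        using DZ(1)[OF hc] DW(1)[OF hc inBt[OF t]] rt[OF t] by simp
      also have "\<dots> \<le> (Z$1$1 * rhat$1 + Z$1$2 * rhat$2) + (Wr W 1 1 rhat * rhat$1 + Wr W 1 2 rhat * rhat$2) * t"
        unfolding wt by (rule e) (use zp hn in auto)
      finally show "vnorm V (fst (D ?x h)) \<le> \<dots>" .
      have "vnorm X (snd (D ?x h)) \<le> vnorm X (snd (D xbar h)) + vnorm X (snd (D ?x h - D xbar h))"
        using X.norm_triangle m s unfolding carP by (metis snd_add)
      also have "\<dots> \<le> (Z$2$1 * vnorm V (fst h) + Z$2$2 * vnorm X (snd h))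
          + (Wr W 2 1 (t *\<^sub>R rhat) * vnorm V (fst h) + Wr W 2 2 (t *\<^sub>R rhat) * vnorm X (snd h))"
        using DZ(2)[OF hc] DW(2)[OF hc inBt[OF t]] rt[OF t] by simp
      also have "\<dots> \<le> (Z$2$1 * rhat$1 + Z$2$2 * rhat$2) + (Wr W 2 1 rhat * rhat$1 + Wr W 2 2 rhat * rhat$2) * t"
        unfolding wt by (rule e) (use zp hn in auto)
      finally show "vnorm X (snd (D ?x h)) \<le> \<dots>" .
    qed
    have dP: "has_fderiv P (prod_space V X) (U \<times> vcarrier X) T
        (D (xbar + vscale P (of_real t) h)) (xbar + vscale P (of_real t) h)" if "0 \<le> t" "t \<le> 1" for t
      using D[OF inB[OF that]] by (simp add: P_def)
    have m1: "vnorm V (fst (T (xbar + h)) - fst (T xbar)) \<le> (Z$1$1 * rhat$1 + Z$1$2 * rhat$2)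
        + (Wr W 1 1 rhat * rhat$1 + Wr W 1 2 rhat * rhat$2) / 2"
      by (rule mean_value[OF cnP V hP xbar(2) has_fderiv_fst[OF dP] _ est(1)])
         (use mem in \<open>auto simp: carP\<close>)
    have m2: "vnorm X (snd (T (xbar + h)) - snd (T xbar)) \<le> (Z$2$1 * rhat$1 + Z$2$2 * rhat$2)
        + (Wr W 2 1 rhat * rhat$1 + Wr W 2 2 rhat * rhat$2) / 2"
      by (rule mean_value[OF cnP X hP xbar(2) has_fderiv_snd[OF dP] _ est(2)])
         (use mem in \<open>auto simp: carP\<close>)
    have xh: "xbar + h = x" by (simp add: h_def)
    have c: "T x \<in> vcarrier P" "T xbar \<in> vcarrier P" "T x \<in> C" using self x xbar_in by auto
    have "vnorm V (fst (T x) - fst xbar) \<le> vnorm V (fst (T x) - fst (T xbar)) + vnorm V (fst (T xbar) - fst xbar)"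
      using V.norm_triangle_diff c xbar carP by auto
    also have "\<dots> \<le> rhat $ 1" using m1 Y1 p(1) unfolding xh p1_def by (simp add: field_simps)
    finally have n1: "vnorm V (fst (T x) - fst xbar) \<le> rhat $ 1" .
    have "vnorm X (snd (T x) - snd xbar) \<le> vnorm X (snd (T x) - snd (T xbar)) + vnorm X (snd (T xbar) - snd xbar)"
      using X.norm_triangle_diff c xbar carP by auto
    also have "\<dots> \<le> rhat $ 2" using m2 Y2 p(2) unfolding xh p2_def by (simp add: field_simps)
    finally show "T x \<in> ?B" using n1 c by (simp add: ball)
  qed
  define M where "M = Mr Z W rhat"
  have M: "M $ i $ i' = Z $ i $ i' + Wr W i i' rhat" for i i' by (simp add: M_def Mr_def)
  have Mpos: "0 < M $ i $ i'" for i i'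
    unfolding M using pos(1)[of i i'] Wpos[of rhat i i'] rhat by (simp add: add_pos_nonneg less_imp_le)
  have lip: "vnorm V (fst (T y) - fst (T x)) \<le> M$1$1 * vnorm V (fst (y - x)) + M$1$2 * vnorm X (snd (y - x))"
    "vnorm X (snd (T y) - snd (T x)) \<le> M$2$1 * vnorm V (fst (y - x)) + M$2$2 * vnorm X (snd (y - x))"
    if x: "x \<in> ?B" and y: "y \<in> ?B" for x y
  proof -
    define h where "h = y - x"
    have xP: "x \<in> vcarrier P" using x by (simp add: ball)
    have hP: "h \<in> vcarrier P" using x y by (auto simp: h_def ball intro: P.diff_mem)
    then have hc: "fst h \<in> vcarrier V" "snd h \<in> vcarrier X" by (auto simp: carP)
    have inB: "x + vscale P (of_real t) h \<in> ?B" if "0 \<le> t" "t \<le> 1" for t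
      using seg[OF x y that] by (simp add: h_def)
    have mem: "T (x + vscale P (of_real t) h) - T x \<in> vcarrier P" if "0 \<le> t" "t \<le> 1" for t
      using self[OF inB[OF that]] self[OF x] P.diff_mem by blast
    have est: "vnorm V (fst (D (x + vscale P (of_real t) h) h))
          \<le> (M$1$1 * vnorm V (fst h) + M$1$2 * vnorm X (snd h)) + 0 * t"
      "vnorm X (snd (D (x + vscale P (of_real t) h) h))
          \<le> (M$2$1 * vnorm V (fst h) + M$2$2 * vnorm X (snd h)) + 0 * t"
      if t: "0 \<le> t" "t \<le> 1" for t
    proof -
      let ?x = "x + vscale P (of_real t) h"
      have m: "D xbar h \<in> vcarrier P" "D ?x h - D xbar h \<in> vcarrier P"
        using Dmem inB[OF t] xbar_in hP P.diff_mem by auto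
      have s: "D ?x h = D xbar h + (D ?x h - D xbar h)" by simp
      have rh: "0 \<le> rhat $ 1" "0 \<le> rhat $ 2" using rhat by (simp_all add: less_imp_le)
      have "vnorm V (fst (D ?x h)) \<le> vnorm V (fst (D xbar h)) + vnorm V (fst (D ?x h - D xbar h))"
        using V.norm_triangle m s unfolding carP by (metis fst_add)
      then show "vnorm V (fst (D ?x h)) \<le> (M$1$1 * vnorm V (fst h) + M$1$2 * vnorm X (snd h)) + 0 * t"
        using DZ(1)[OF hc] DW(1)[OF hc inB[OF t]] rh by (simp add: M algebra_simps)
      have "vnorm X (snd (D ?x h)) \<le> vnorm X (snd (D xbar h)) + vnorm X (snd (D ?x h - D xbar h))"
        using X.norm_triangle m s unfolding carP by (metis snd_add)
      then show "vnorm X (snd (D ?x h)) \<le> (M$2$1 * vnorm V (fst h) + M$2$2 * vnorm X (snd h)) + 0 * t"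
        using DZ(2)[OF hc] DW(2)[OF hc inB[OF t]] rh by (simp add: M algebra_simps)
    qed
    have dP: "has_fderiv P (prod_space V X) (U \<times> vcarrier X) T
        (D (x + vscale P (of_real t) h)) (x + vscale P (of_real t) h)" if "0 \<le> t" "t \<le> 1" for t
      using D[OF inB[OF that]] by (simp add: P_def)
    have "vnorm V (fst (T (x + h)) - fst (T x)) \<le> (M$1$1 * vnorm V (fst h) + M$1$2 * vnorm X (snd h)) + 0 / 2"
      by (rule mean_value[OF cnP V hP xP has_fderiv_fst[OF dP] _ est(1)])
         (use mem in \<open>auto simp: carP\<close>)
    moreover have "vnorm X (snd (T (x + h)) - snd (T x)) \<le> (M$2$1 * vnorm V (fst h) + M$2$2 * vnorm X (snd h)) + 0 / 2"
      by (rule mean_value[OF cnP X hP xP has_fderiv_snd[OF dP] _ est(2)])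
         (use mem in \<open>auto simp: carP\<close>)
    ultimately show "vnorm V (fst (T y) - fst (T x)) \<le> M$1$1 * vnorm V (fst (y - x)) + M$1$2 * vnorm X (snd (y - x))"
      "vnorm X (snd (T y) - snd (T x)) \<le> M$2$1 * vnorm V (fst (y - x)) + M$2$2 * vnorm X (snd (y - x))"
      by (simp_all add: h_def)
  qed
  show ?thesis
  proof (rule perov_fixed_point[OF V X _ _ _ selfmap Mpos lip])
    show "?B \<subseteq> vcarrier V \<times> vcarrier X" by (auto simp: ball carP)
    show "?B \<noteq> {}" using xbar_in by blast
    show "trace M - 2 < 0" "trace M - det M - 1 < 0" using p(3,4) by (simp_all add: p3_def p4_def M_def)
    fix s :: "nat \<Rightarrow> 'v \<times> 'x" and v b
    assume sB: "\<And>n. s n \<in> ?B" and v: "v \<in> vcarrier V" "(\<lambda>n. vnorm V (fst (s n) - v)) \<longlonglongrightarrow> 0"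
      and b: "b \<in> vcarrier X" "(\<lambda>n. vnorm X (snd (s n) - b)) \<longlonglongrightarrow> 0"
    have car: "fst (s n) \<in> vcarrier V" "snd (s n) \<in> vcarrier X" for n using sB[of n] by (auto simp: ball carP)
    have xc: "fst xbar \<in> vcarrier V" "snd xbar \<in> vcarrier X" using xbar by (auto simp: carP)
    have vb: "(v, b) \<in> vcarrier P" using v b by (simp add: carP)
    have "(\<lambda>n. vnorm P (s n - (v, b))) \<longlonglongrightarrow> max 0 0"
      unfolding nP fst_diff snd_diff fst_conv snd_conv by (intro tendsto_max v b)
    then have "(v, b) \<in> C" using closed[of s "(v, b)"] sB vb by (auto simp: ball)
    moreover have "vnorm V (v - fst xbar) \<le> rhat $ 1"
    proof (rule V.norm_le_limit[OF car(1) v xc(1)])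
      show "vnorm V (fst (s n) - fst xbar) \<le> rhat $ 1" for n using sB[of n] by (simp add: ball)
    qed
    moreover have "vnorm X (b - snd xbar) \<le> rhat $ 2"
    proof (rule X.norm_le_limit[OF car(2) b xc(2)])
      show "vnorm X (snd (s n) - snd xbar) \<le> rhat $ 2" for n using sB[of n] by (simp add: ball)
    qed
    ultimately show "(v, b) \<in> ?B" using vb by (simp add: ball)
  qed
qed

section \<open>The weighted sequence space\<close>

lemma power_le_powr:
  fixes \<nu> t :: real
  assumes "1 < \<nu>" "0 \<le> t"
  shows "t ^ n \<le> fact n / ln \<nu> ^ n * \<nu> powr t"
proof -
  have l: "0 < ln \<nu>" using assms by simp
  have x0: "0 \<le> t * ln \<nu>" using assms l by simp
  have "(t * ln \<nu>) ^ n / fact n \<le> (\<Sum>i. (t * ln \<nu>) ^ i / fact i)"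
    using sum_le_suminf[OF summable_exp[of "t * ln \<nu>"], of "{n}"] x0 by (simp add: divide_inverse mult.commute)
  also have "\<dots> = exp (t * ln \<nu>)" by (simp add: exp_def divide_inverse mult.commute)
  finally have "(t * ln \<nu>) ^ n / fact n \<le> \<nu> powr t" using assms by (simp add: powr_def)
  then have "t ^ n * ln \<nu> ^ n \<le> \<nu> powr t * fact n"
    by (simp add: power_mult_distrib pos_divide_le_eq)
  then have "t ^ n \<le> \<nu> powr t * fact n / ln \<nu> ^ n" using l by (simp add: pos_le_divide_eq)
  then show ?thesis by (simp add: mult.commute)
qed

locale scaled_space_group = space_group S for S :: "'g crystal_group" +
  fixes \<nu> :: real and kb :: "nat \<Rightarrow> real"
  assumes nu: "1 < \<nu>" and kb: "pos_scales (csys S) kb"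
begin

abbreviation J :: "nat set" where "J \<equiv> {1..num_scales (csys S)}"

abbreviation w :: "int^3 \<Rightarrow> real" where "w \<equiv> \<lambda>k. \<nu> powr knorm S kb k"

lemma kb_pos: "j \<in> J \<Longrightarrow> 0 < kb j"
  using kb by (simp add: pos_scales_def)

lemma J_ne: "J \<noteq> {}"
  using num_scales_ge_1[of "csys S"] by auto

lemma knorm_eq: "knorm S kb k = norm (Lmat (csys S) kb *v ivec k)"
  unfolding knorm_def norm_Lmat_ivec[OF kb, symmetric] by simp

lemma knorm_nonneg: "0 \<le> knorm S kb k"
  by (simp add: knorm_eq)

lemma knorm_beta: "g \<in> carrier S \<Longrightarrow> knorm S kb (beta S g k) = knorm S kb k"
  by (simp add: knorm_def Delta_beta)

lemma knorm_minus: "knorm S kb (- k) = knorm S kb k"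
  by (simp add: knorm_def Delta_uminus)

lemma knorm_rep: "knorm S kb (rep k) = knorm S kb k"
  by (metis rep_obtain knorm_beta)

sublocale conv_weight w
proof
  show "1 \<le> w k" for k using nu knorm_nonneg by (simp add: ge_one_powr_ge_zero)
  fix k l
  have "knorm S kb (k + l) \<le> knorm S kb k + knorm S kb l"
    unfolding knorm_eq by (simp add: algebra_simps norm_triangle_ineq)
  then have "\<nu> powr knorm S kb (k + l) \<le> \<nu> powr (knorm S kb k + knorm S kb l)"
    using nu by simp
  then show "w (k + l) \<le> w k * w l" by (simp add: powr_add)
qed

lemma omega_eq: "omega S \<nu> kb k = real (card (Orb S k)) * w k"
  by (simp add: omega_def)

lemma omega_ge: "w k \<le> omega S \<nu> kb k" "1 \<le> omega S \<nu> kb k" "0 < omega S \<nu> kb k"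
proof -
  have "1 * w k \<le> real (card (Orb S k)) * w k"
    using card_Orb_pos[of k] w_pos[of k] by (intro mult_right_mono) auto
  then show 1: "w k \<le> omega S \<nu> kb k" by (simp add: omega_eq)
  then show "1 \<le> omega S \<nu> kb k" "0 < omega S \<nu> kb k" using w_ge_1[of k] by linarith+
qed

lemma Delta_kb_ge:
  obtains a where "0 < a" "\<forall>k. lsize (csys S) k * a \<le> Delta (csys S) k kb"
proof -
  define a where "a = Min (kb ` J)"
  have a: "0 < a" "\<And>j. j \<in> J \<Longrightarrow> a \<le> kb j" using J_ne kb_pos by (auto simp: a_def)
  have "lsize (csys S) k * a \<le> Delta (csys S) k kb" for k
    unfolding lsize_sum Delta_def sum_distrib_right
    by (intro sum_mono mult_left_mono) (use a Delta_coef_nonneg in auto)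
  then show ?thesis using that a(1) by blast
qed

subsection \<open>The finite dimensional factor\<close>

lemma CJ_norm_le_iff: "CJ_norm S kb \<kappa> \<le> R \<longleftrightarrow> (\<forall>j\<in>J. cmod (\<kappa> j) \<le> R * kb j)"
  unfolding CJ_norm_def using J_ne by (subst Max_le_iff) (auto simp: kb_pos pos_divide_le_eq)

lemma cmod_le_CJ_norm: "j \<in> J \<Longrightarrow> cmod (\<kappa> j) \<le> CJ_norm S kb \<kappa> * kb j"
  using CJ_norm_le_iff[of \<kappa> "CJ_norm S kb \<kappa>"] by simp

lemma CJ_norm_attained: obtains j where "j \<in> J" "CJ_norm S kb \<kappa> = cmod (\<kappa> j) / kb j"
proof -
  have "CJ_norm S kb \<kappa> \<in> (\<lambda>j. cmod (\<kappa> j) / kb j) ` J"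
    unfolding CJ_norm_def using J_ne by (intro Max_in) auto
  then show ?thesis using that by auto
qed

lemma CJ_norm_nonneg: "0 \<le> CJ_norm S kb \<kappa>"
  by (metis CJ_norm_attained divide_nonneg_pos kb_pos norm_ge_zero)

lemma cn_banach_CJ: "cn_banach (CJ_space S kb)"
proof
  show "0 \<in> vcarrier (CJ_space S kb)" by (simp add: CJ_space_def CJ_def)
next
  fix a :: complex and v :: "nat \<Rightarrow> complex"
  let ?av = "\<lambda>j. a * v j"
  have "CJ_norm S kb ?av = cmod a * CJ_norm S kb v"
  proof (rule antisym)
    show "CJ_norm S kb ?av \<le> cmod a * CJ_norm S kb v"
      using cmod_le_CJ_norm[of _ v] unfolding CJ_norm_le_iff
      by (simp add: norm_mult mult.assoc mult_left_mono)
    obtain j where j: "j \<in> J" "CJ_norm S kb v = cmod (v j) / kb j" by (rule CJ_norm_attained)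
    then have "cmod a * CJ_norm S kb v = cmod (?av j) / kb j" by (simp add: norm_mult)
    also have "\<dots> \<le> CJ_norm S kb ?av"
      using cmod_le_CJ_norm[OF j(1), of ?av] kb_pos[OF j(1)] by (simp add: pos_divide_le_eq)
    finally show "cmod a * CJ_norm S kb v \<le> CJ_norm S kb ?av" .
  qed
  then show "vnorm (CJ_space S kb) (vscale (CJ_space S kb) a v) = cmod a * vnorm (CJ_space S kb) v"
    by (simp add: CJ_space_def)
next
  fix u v
  have "CJ_norm S kb (u + v) \<le> CJ_norm S kb u + CJ_norm S kb v"
    unfolding CJ_norm_le_iff
  proof
    fix j assume j: "j \<in> J"
    show "cmod ((u + v) j) \<le> (CJ_norm S kb u + CJ_norm S kb v) * kb j"
      using norm_triangle_ineq[of "u j" "v j"] cmod_le_CJ_norm[OF j, of u] cmod_le_CJ_norm[OF j, of v]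
      by (simp add: algebra_simps)
  qed
  then show "vnorm (CJ_space S kb) (u + v) \<le> vnorm (CJ_space S kb) u + vnorm (CJ_space S kb) v"
    by (simp add: CJ_space_def)
next
  fix v assume "v \<in> vcarrier (CJ_space S kb)" "vnorm (CJ_space S kb) v = 0"
  then have v: "v \<in> CJ S" "CJ_norm S kb v = 0" by (simp_all add: CJ_space_def)
  have "v j = 0" for j
    using cmod_le_CJ_norm[of j v] v by (cases "j \<in> J") (auto simp: CJ_def)
  then show "v = 0" by (simp add: fun_eq_iff)
next
  fix v e assume e: "e < vnorm (CJ_space S kb) v"
  obtain j where j: "j \<in> J" "CJ_norm S kb v = cmod (v j) / kb j" by (rule CJ_norm_attained)
  \<comment> \<open>the coordinate that attains the norm, rotated to be real at \<open>v\<close>\<close>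
  define l where "l u = Re (cnj (sgn (v j)) * u j) / kb j" for u :: "nat \<Rightarrow> complex"
  have "l u \<le> CJ_norm S kb u" for u
  proof -
    have "Re (cnj (sgn (v j)) * u j) \<le> cmod (cnj (sgn (v j)) * u j)" by (rule complex_Re_le_cmod)
    also have "\<dots> \<le> cmod (u j)" by (simp add: norm_mult norm_sgn)
    also have "\<dots> \<le> CJ_norm S kb u * kb j" by (rule cmod_le_CJ_norm[OF j(1)])
    finally show ?thesis using kb_pos[OF j(1)] by (simp add: l_def pos_divide_le_eq)
  qed
  moreover have "cnj (sgn z) * z = of_real (cmod z)" for z
    by (cases "z = 0") (simp_all add: sgn_eq power2_eq_square complex_norm_square[symmetric] mult.commute)
  then have "l v = CJ_norm S kb v" using j by (simp add: l_def)
  ultimately show "\<exists>l. (\<forall>u\<in>vcarrier (CJ_space S kb). \<forall>w\<in>vcarrier (CJ_space S kb). l (u + w) = l u + l w) \<and>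
      (\<forall>t. \<forall>u\<in>vcarrier (CJ_space S kb). l (vscale (CJ_space S kb) (of_real t) u) = t * l u) \<and>
      (\<forall>u\<in>vcarrier (CJ_space S kb). l u \<le> vnorm (CJ_space S kb) u) \<and> e < l v"
    using e by (intro exI[of _ l])
      (auto simp: l_def CJ_space_def algebra_simps add_divide_distrib diff_divide_distrib)
next
  fix X :: "nat \<Rightarrow> nat \<Rightarrow> complex"
  assume X: "\<And>n. X n \<in> vcarrier (CJ_space S kb)"
    and cau: "\<And>e. 0 < e \<Longrightarrow> \<exists>N. \<forall>m\<ge>N. \<forall>n\<ge>N. vnorm (CJ_space S kb) (X m - X n) < e"
  have "\<exists>z. (\<lambda>n. X n j) \<longlonglongrightarrow> z" for j
  proof (cases "j \<in> J")
    case True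
    have "Cauchy (\<lambda>n. X n j)"
    proof (rule metric_CauchyI)
      fix e :: real assume "0 < e"
      then obtain N where N: "\<And>m n. m \<ge> N \<Longrightarrow> n \<ge> N \<Longrightarrow> CJ_norm S kb (X m - X n) < e / kb j"
        using cau[of "e / kb j"] kb_pos[OF True] by (auto simp: CJ_space_def)
      show "\<exists>N. \<forall>m\<ge>N. \<forall>n\<ge>N. dist (X m j) (X n j) < e"
      proof (intro exI allI impI)
        fix m n assume "m \<ge> N" "n \<ge> N"
        then have "CJ_norm S kb (X m - X n) * kb j < e"
          using N kb_pos[OF True] by (simp add: pos_less_divide_eq)
        then show "dist (X m j) (X n j) < e"
          using cmod_le_CJ_norm[OF True, of "X m - X n"] by (simp add: dist_norm)
      qed
    qed
    then show ?thesis by (simp add: Cauchy_convergent_iff convergent_def)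
  next
    case False
    then have "X n j = 0" for n using X[of n] by (auto simp: CJ_space_def CJ_def)
    then show ?thesis by auto
  qed
  then obtain x where x: "\<And>j. (\<lambda>n. X n j) \<longlonglongrightarrow> x j" by metis
  have "x j = 0" if "j \<notin> J" for j
  proof -
    have "(\<lambda>n. X n j) = (\<lambda>n. 0)" using X that by (auto simp: CJ_space_def CJ_def)
    then show ?thesis using x[of j] LIMSEQ_unique tendsto_const by metis
  qed
  then have "x \<in> vcarrier (CJ_space S kb)" by (simp add: CJ_space_def CJ_def)
  moreover have "(\<lambda>n. CJ_norm S kb (X n - x)) \<longlonglongrightarrow> 0"
  proof (rule tendsto_sandwich[where f = "\<lambda>n. 0" and h = "\<lambda>n. \<Sum>j\<in>J. cmod (X n j - x j) / kb j"])
    have "(\<lambda>n. \<Sum>j\<in>J. cmod (X n j - x j) / kb j) \<longlonglongrightarrow> (\<Sum>j\<in>J. cmod (x j - x j) / kb j)"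
      by (intro tendsto_intros x) (use kb_pos in force)
    then show "(\<lambda>n. \<Sum>j\<in>J. cmod (X n j - x j) / kb j) \<longlonglongrightarrow> 0" by simp
    have "CJ_norm S kb (X n - x) \<le> (\<Sum>j\<in>J. cmod (X n j - x j) / kb j)" for n
    proof -
      obtain j where j: "j \<in> J" "CJ_norm S kb (X n - x) = cmod ((X n - x) j) / kb j"
        by (rule CJ_norm_attained)
      have "cmod (X n j - x j) / kb j \<le> (\<Sum>j\<in>J. cmod (X n j - x j) / kb j)"
        by (rule member_le_sum[OF j(1)]) (use kb_pos in \<open>auto simp: less_imp_le\<close>)
      then show ?thesis using j by simp
    qed
    then show "\<forall>\<^sub>F n in sequentially. CJ_norm S kb (X n - x) \<le> (\<Sum>j\<in>J. cmod (X n j - x j) / kb j)"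
      by simp
  qed (use CJ_norm_nonneg in auto)
  ultimately show "\<exists>x\<in>vcarrier (CJ_space S kb). (\<lambda>n. vnorm (CJ_space S kb) (X n - x)) \<longlonglongrightarrow> 0"
    by (auto simp: CJ_space_def)
qed (auto simp: CJ_space_def CJ_def algebra_simps fun_eq_iff)

subsection \<open>The sequence space\<close>

abbreviation XN :: "coeffs \<Rightarrow> real" where "XN \<equiv> X_norm S \<nu> kb"

abbreviation om :: "int^3 \<Rightarrow> real" where "om \<equiv> omega S \<nu> kb"

lemma X0s_iff: "b \<in> X0s S \<nu> kb \<longleftrightarrow> (\<forall>k. k \<notin> Z0 S \<longrightarrow> b k = 0) \<and>
    (\<lambda>k. cmod (b k) * om k) summable_on Zind S"
  by (auto simp: X0s_def Xs_def Z0_def)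

lemma X0s_I:
  assumes "\<And>k. k \<notin> Z0 S \<Longrightarrow> b k = 0"
    and "\<And>F. finite F \<Longrightarrow> F \<subseteq> Zind S \<Longrightarrow> (\<Sum>k\<in>F. cmod (b k) * om k) \<le> B"
  shows "b \<in> X0s S \<nu> kb" "XN b \<le> B"
proof -
  have s: "(\<lambda>k. cmod (b k) * om k) summable_on Zind S"
    using assms(2) omega_ge(3)
    by (intro nonneg_bdd_above_summable_on bdd_aboveI2[where M = B]) (auto simp: less_imp_le)
  then show "b \<in> X0s S \<nu> kb" using assms(1) by (simp add: X0s_iff)
  show "XN b \<le> B" unfolding X_norm_def by (rule infsum_le_finite_sums[OF s assms(2)])
qed

lemma sum_le_XN:
  assumes "b \<in> Xs S \<nu> kb" "finite F" "F \<subseteq> Zind S"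
  shows "(\<Sum>k\<in>F. cmod (b k) * om k) \<le> XN b"
  unfolding X_norm_def using assms omega_ge(3)
  by (intro finite_sum_le_infsum) (auto simp: Xs_def less_imp_le)

lemma X0s_Xs: "b \<in> X0s S \<nu> kb \<Longrightarrow> b \<in> Xs S \<nu> kb"
  by (simp add: X0s_def)

lemma cmod_le_XN:
  assumes "b \<in> X0s S \<nu> kb" shows "cmod (b k) \<le> XN b"
proof (cases "k \<in> Zind S")
  case True
  have "cmod (b k) * 1 \<le> cmod (b k) * om k" using omega_ge by (intro mult_left_mono) auto
  also have "\<dots> \<le> XN b" using sum_le_XN[OF X0s_Xs[OF assms], of "{k}"] True by simp
  finally show ?thesis by simp
next
  case False
  then have "b k = 0" using assms by (auto simp: X0s_iff Z0_def)
  then show ?thesis unfolding X_norm_def using omega_ge(3) by (auto intro!: infsum_nonneg simp: less_imp_le)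
qed

lemma
  assumes "b \<in> X0s S \<nu> kb" "b' \<in> X0s S \<nu> kb"
  shows X0s_add: "b + b' \<in> X0s S \<nu> kb" and XN_add: "XN (b + b') \<le> XN b + XN b'"
proof -
  have "(\<Sum>k\<in>F. cmod ((b + b') k) * om k) \<le> XN b + XN b'" if F: "finite F" "F \<subseteq> Zind S" for F
  proof -
    have "(\<Sum>k\<in>F. cmod ((b + b') k) * om k) \<le> (\<Sum>k\<in>F. cmod (b k) * om k + cmod (b' k) * om k)"
      using omega_ge(3) norm_triangle_ineq
      by (intro sum_mono) (simp flip: ring_distribs add: mult_right_mono less_imp_le)
    also have "\<dots> \<le> XN b + XN b'"
      using sum_le_XN[OF X0s_Xs[OF assms(1)] F] sum_le_XN[OF X0s_Xs[OF assms(2)] F]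
      by (simp add: sum.distrib)
    finally show ?thesis .
  qed
  then show "b + b' \<in> X0s S \<nu> kb" "XN (b + b') \<le> XN b + XN b'"
    using X0s_I[of "b + b'" "XN b + XN b'"] assms by (auto simp: X0s_iff)
qed

lemma
  assumes "b \<in> X0s S \<nu> kb"
  shows X0s_scale: "(\<lambda>k. a * b k) \<in> X0s S \<nu> kb" and XN_scale: "XN (\<lambda>k. a * b k) = cmod a * XN b"
proof -
  show "(\<lambda>k. a * b k) \<in> X0s S \<nu> kb"
    using assms by (auto simp: X0s_iff norm_mult mult.assoc intro: summable_on_cmult_right)
  show "XN (\<lambda>k. a * b k) = cmod a * XN b"
    by (simp add: X_norm_def norm_mult mult.assoc infsum_cmult_right')
qed

lemma cn_banach_X0: "cn_banach (X0_space S \<nu> kb)"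
proof
  fix v assume v: "v \<in> vcarrier (X0_space S \<nu> kb)" "vnorm (X0_space S \<nu> kb) v = 0"
  then have "cmod (v k) \<le> 0" for k using cmod_le_XN[of v k] by (simp add: X0_space_def)
  then show "v = 0" by (simp add: fun_eq_iff)
next
  fix v e assume v: "v \<in> vcarrier (X0_space S \<nu> kb)" and e: "e < vnorm (X0_space S \<nu> kb) v"
  then have vX: "v \<in> Xs S \<nu> kb" and eX: "e < XN v" by (simp_all add: X0_space_def X0s_def)
  have "\<exists>F. finite F \<and> F \<subseteq> Zind S \<and> e < (\<Sum>k\<in>F. cmod (v k) * om k)"
  proof (rule ccontr)
    assume "\<not> ?thesis"
    then have "XN v \<le> e"
      unfolding X_norm_def using vX
      by (intro infsum_le_finite_sums) (auto simp: Xs_def not_less)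
    then show False using eX by simp
  qed
  then obtain F where F: "finite F" "F \<subseteq> Zind S" "e < (\<Sum>k\<in>F. cmod (v k) * om k)" by blast
  \<comment> \<open>finitely many coordinates already exceed \<open>e\<close>; each is rotated to be real
    at \<open>v\<close>\<close>
  define l where "l u = (\<Sum>k\<in>F. Re (cnj (sgn (v k)) * u k) * om k)" for u :: coeffs
  have "l u \<le> XN u" if "u \<in> X0s S \<nu> kb" for u
  proof -
    have "Re (cnj (sgn (v k)) * u k) \<le> cmod (u k)" for k
    proof -
      have "Re (cnj (sgn (v k)) * u k) \<le> cmod (cnj (sgn (v k)) * u k)" by (rule complex_Re_le_cmod)
      also have "\<dots> \<le> cmod (u k)" by (simp add: norm_mult norm_sgn)
      finally show ?thesis .
    qed
    then have "l u \<le> (\<Sum>k\<in>F. cmod (u k) * om k)"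
      unfolding l_def using omega_ge(3) by (intro sum_mono mult_right_mono) (auto simp: less_imp_le)
    also have "\<dots> \<le> XN u" using sum_le_XN[OF X0s_Xs[OF that] F(1,2)] .
    finally show ?thesis .
  qed
  moreover have "cnj (sgn z) * z = of_real (cmod z)" for z
    by (cases "z = 0") (simp_all add: sgn_eq power2_eq_square complex_norm_square[symmetric] mult.commute)
  then have "l v = (\<Sum>k\<in>F. cmod (v k) * om k)" by (simp add: l_def)
  ultimately show "\<exists>l. (\<forall>u\<in>vcarrier (X0_space S \<nu> kb). \<forall>w\<in>vcarrier (X0_space S \<nu> kb). l (u + w) = l u + l w) \<and>
      (\<forall>t. \<forall>u\<in>vcarrier (X0_space S \<nu> kb). l (vscale (X0_space S \<nu> kb) (of_real t) u) = t * l u) \<and>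
      (\<forall>u\<in>vcarrier (X0_space S \<nu> kb). l u \<le> vnorm (X0_space S \<nu> kb) u) \<and> e < l v"
    using F(3) by (intro exI[of _ l])
      (auto simp: l_def X0_space_def algebra_simps sum.distrib sum_distrib_left sum_subtractf)
next
  fix X :: "nat \<Rightarrow> coeffs"
  assume "\<And>n. X n \<in> vcarrier (X0_space S \<nu> kb)"
    and "\<And>e. 0 < e \<Longrightarrow> \<exists>N. \<forall>m\<ge>N. \<forall>n\<ge>N. vnorm (X0_space S \<nu> kb) (X m - X n) < e"
  then have X: "X n \<in> X0s S \<nu> kb"
    and cau: "0 < e \<Longrightarrow> \<exists>N. \<forall>m\<ge>N. \<forall>n\<ge>N. XN (X m - X n) < e" for n e
    by (simp_all add: X0_space_def)
  have D: "X m - X n \<in> X0s S \<nu> kb" for m n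
    using X0s_add[OF X[of m] X0s_scale[OF X[of n], of "-1"]]
    by (simp add: fun_eq_iff plus_fun_def fun_diff_def)
  have "Cauchy (\<lambda>n. X n k)" for k
  proof (rule metric_CauchyI)
    fix e :: real assume "0 < e"
    then obtain N where N: "\<And>m n. m \<ge> N \<Longrightarrow> n \<ge> N \<Longrightarrow> XN (X m - X n) < e" using cau by meson
    show "\<exists>N. \<forall>m\<ge>N. \<forall>n\<ge>N. dist (X m k) (X n k) < e"
    proof (intro exI allI impI)
      fix m n assume "m \<ge> N" "n \<ge> N"
      then show "dist (X m k) (X n k) < e"
        using N[of m n] cmod_le_XN[OF D[of m n], of k] by (simp add: dist_norm)
    qed
  qed
  then have "\<exists>z. (\<lambda>n. X n k) \<longlonglongrightarrow> z" for k by (simp add: Cauchy_convergent_iff convergent_def)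
  then obtain b where b: "\<And>k. (\<lambda>n. X n k) \<longlonglongrightarrow> b k" by metis
  have b0: "b k = 0" if "k \<notin> Z0 S" for k
  proof -
    have "(\<lambda>n. X n k) = (\<lambda>n. 0)" using X that by (auto simp: X0s_iff)
    then show ?thesis using b[of k] LIMSEQ_unique tendsto_const by metis
  qed
  have le: "X n - b \<in> X0s S \<nu> kb \<and> XN (X n - b) \<le> e"
    if N: "\<And>m n. m \<ge> N \<Longrightarrow> n \<ge> N \<Longrightarrow> XN (X m - X n) < e" and n: "n \<ge> N" for N n e
  proof -
    have "(\<Sum>k\<in>F. cmod ((X n - b) k) * om k) \<le> e" if F: "finite F" "F \<subseteq> Zind S" for F
    proof (rule LIMSEQ_le_const2)
      show "(\<lambda>m. \<Sum>k\<in>F. cmod ((X n - X m) k) * om k) \<longlonglongrightarrow> (\<Sum>k\<in>F. cmod ((X n - b) k) * om k)"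
        unfolding fun_diff_def by (intro tendsto_intros b)
      have "(\<Sum>k\<in>F. cmod ((X n - X m) k) * om k) \<le> e" if "m \<ge> N" for m
        using sum_le_XN[OF X0s_Xs[OF D[of n m]] F] N[OF n that] by simp
      then show "\<exists>N. \<forall>m\<ge>N. (\<Sum>k\<in>F. cmod ((X n - X m) k) * om k) \<le> e" by blast
    qed
    then show ?thesis using X0s_I[of "X n - b" e] b0 X by (auto simp: X0s_iff)
  qed
  obtain N where N: "\<And>m n. m \<ge> N \<Longrightarrow> n \<ge> N \<Longrightarrow> XN (X m - X n) < 1" using cau[of 1] by auto
  have "X N - b \<in> X0s S \<nu> kb" using le[OF N] by blast
  then have "X N + (\<lambda>k. -1 * (X N - b) k) \<in> X0s S \<nu> kb" using X0s_add[OF X X0s_scale] by blast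
  then have bX: "b \<in> X0s S \<nu> kb" by (simp add: plus_fun_def fun_diff_def)
  have "(\<lambda>n. XN (X n - b)) \<longlonglongrightarrow> 0"
  proof (rule LIMSEQ_I)
    fix e :: real assume e: "0 < e"
    then obtain N where N: "\<And>m n. m \<ge> N \<Longrightarrow> n \<ge> N \<Longrightarrow> XN (X m - X n) < e / 2"
      using cau[of "e / 2"] by auto
    have "norm (XN (X n - b) - 0) < e" if "n \<ge> N" for n
    proof -
      have "0 \<le> XN (X n - b)"
        using cmod_le_XN[of "X n - b" 0] le[OF N that] by (meson norm_ge_zero order_trans)
      then show ?thesis using le[OF N that] e by simp
    qed
    then show "\<exists>N. \<forall>n\<ge>N. norm (XN (X n - b) - 0) < e" by blast
  qed
  then show "\<exists>x\<in>vcarrier (X0_space S \<nu> kb). (\<lambda>n. vnorm (X0_space S \<nu> kb) (X n - x)) \<longlonglongrightarrow> 0"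
    using bX by (auto simp: X0_space_def)
qed (auto simp: X0_space_def X0s_add XN_add X0s_scale XN_scale algebra_simps fun_eq_iff,
     auto simp: X0s_iff)

subsection \<open>Symmetrization\<close>

text \<open>An orbit contributes equal terms, one for each of its elements; this is the factor \<open>card
  (Orb S k)\<close> in the weight \<open>omega\<close>.\<close>

lemma
  assumes "b \<in> Xs S \<nu> kb"
  shows l1_sigma: "l1 (sigma S b)" and N_sigma: "N (sigma S b) \<le> XN b"
proof -
  \<comment> \<open>the term at \<open>l\<close> depends only on the representative of its orbit\<close>
  define \<phi> where "\<phi> k = (if k \<in> Zind S then cmod (b k) * w k else 0)" for k
  have \<phi>: "0 \<le> \<phi> k" for k using w_pos[of k] by (simp add: \<phi>_def less_imp_le)
  have tm: "cmod (sigma S b l) * w l = \<phi> (rep l)" for l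
    by (simp add: cmod_sigma \<phi>_def knorm_rep)
  have le: "(\<Sum>l\<in>F. cmod (sigma S b l) * w l) \<le> XN b" if F: "finite F" for F
  proof -
    have "(\<Sum>l\<in>F. cmod (sigma S b l) * w l) = (\<Sum>k\<in>rep ` F. \<Sum>l\<in>{l\<in>F. rep l = k}. \<phi> (rep l))"
      unfolding tm by (rule sum.image_gen[OF F])
    also have "\<dots> = (\<Sum>k\<in>rep ` F. real (card {l\<in>F. rep l = k}) * \<phi> k)" by simp
    also have "\<dots> \<le> (\<Sum>k\<in>rep ` F. real (card (Orb S k)) * \<phi> k)"
    proof (rule sum_mono)
      fix k assume "k \<in> rep ` F"
      then have "k \<in> fdom S" using rep(1) by auto
      then have "{l\<in>F. rep l = k} \<subseteq> Orb S k" using mem_Orb_iff_rep by auto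
      then have "card {l\<in>F. rep l = k} \<le> card (Orb S k)" by (rule card_mono[OF finite_Orb])
      then show "real (card {l\<in>F. rep l = k}) * \<phi> k \<le> real (card (Orb S k)) * \<phi> k"
        using \<phi> by (intro mult_right_mono) auto
    qed
    also have "\<dots> = (\<Sum>k\<in>rep ` F \<inter> Zind S. cmod (b k) * om k)"
      using F by (intro sum.mono_neutral_cong_right) (auto simp: \<phi>_def omega_eq)
    also have "\<dots> \<le> XN b" using F by (intro sum_le_XN[OF assms]) auto
    finally show ?thesis .
  qed
  show l: "l1 (sigma S b)" unfolding l1_def
    using le w_pos by (intro nonneg_bdd_above_summable_on bdd_aboveI2[where M = "XN b"])
      (auto simp: less_imp_le)
  show "N (sigma S b) \<le> XN b" unfolding N_def
    using l le unfolding l1_def by (intro infsum_le_finite_sums) auto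
qed

lemma full_coeffs_eq: "full_coeffs S m b l = of_real m * unit_vec 0 l + sigma S b l"
proof -
  have "sigma S (\<lambda>k. of_real m * unit_vec 0 k) l = of_real m * unit_vec 0 l"
    using sigma_Zind[OF zero_in_Zind, of "\<lambda>k. of_real m * unit_vec 0 k"]
    by (cases "l = 0") (simp_all add: sigma_eq unit_vec_def rep_eq_0_iff)
  then show ?thesis
    using sigma_add[of "\<lambda>k. of_real m * unit_vec 0 k" b l] by (simp add: full_coeffs_def)
qed

lemma l1_full_coeffs: assumes "b \<in> Xs S \<nu> kb" shows "l1 (full_coeffs S m b)"
proof -
  have "l1 (unit_vec 0)" unfolding l1_def
    by (rule finite_nonzero_values_imp_summable_on, rule finite_subset[of _ "{0}"])
       (auto simp: unit_vec_def)
  then have "l1 (\<lambda>l. of_real m * unit_vec 0 l + sigma S b l)"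
    by (intro l1_add l1_scale l1_sigma assms)
  then show ?thesis unfolding full_coeffs_eq[abs_def] .
qed

definition size_const :: real where
  "size_const = (SOME C. 0 \<le> C \<and> (\<forall>k. lsize (csys S) k \<le> C * w k))"

text \<open>The exponential weight dominates the quadratic growth of the symbol. Factors of the size of
  the symbol in quadratic sums are absorbed in this way.\<close>

lemma lsize_le: "0 \<le> size_const" "lsize (csys S) k \<le> size_const * w k"
proof -
  obtain a where a: "0 < a" "\<forall>k. lsize (csys S) k * a \<le> Delta (csys S) k kb" by (rule Delta_kb_ge)
  define C where "C = 2 / (ln \<nu>)\<^sup>2 / a"
  have "lsize (csys S) k \<le> C * w k" for k
  proof -
    have "lsize (csys S) k * a \<le> Delta (csys S) k kb" using a(2) by (rule spec)
    also have "\<dots> = (knorm S kb k)\<^sup>2"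
      using norm_Lmat_ivec[OF kb, of k] by (simp add: knorm_eq)
    also have "\<dots> \<le> 2 / (ln \<nu>)\<^sup>2 * w k" using power_le_powr[OF nu knorm_nonneg, of k 2] by simp
    finally have "lsize (csys S) k \<le> (2 / (ln \<nu>)\<^sup>2 * w k) / a"
      using a(1) by (simp only: pos_le_divide_eq)
    then show ?thesis by (simp add: C_def mult.commute)
  qed
  moreover have "0 \<le> C" using a by (simp add: C_def)
  ultimately have "\<exists>C. 0 \<le> C \<and> (\<forall>k. lsize (csys S) k \<le> C * w k)" by blast
  from someI_ex[OF this] show "0 \<le> size_const" "lsize (csys S) k \<le> size_const * w k"
    unfolding size_const_def by blast+
qed

end

section \<open>Scalar estimates\<close>

definition dPfun :: "real \<Rightarrow> complex \<Rightarrow> complex" where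
  "dPfun \<gamma> y = 1 / (of_real \<gamma>)\<^sup>2 - 1 / y\<^sup>2"

definition ddPfun :: "complex \<Rightarrow> complex" where
  "ddPfun y = 2 / y ^ 3"

lemma Pfun_has_derivative:
  assumes "y \<noteq> 0" shows "(Pfun \<gamma> has_field_derivative dPfun \<gamma> y) (at y)"
proof -
  have "Pfun \<gamma> = (\<lambda>y. y * (1 / (of_real \<gamma>)\<^sup>2) - 1 + inverse y)"
    by (simp add: Pfun_def fun_eq_iff)
  moreover have "((\<lambda>y. y * (1 / (of_real \<gamma>)\<^sup>2) - 1 + inverse y) has_field_derivative dPfun \<gamma> y) (at y)"
    by (rule derivative_eq_intros refl assms)+ (simp add: dPfun_def divide_inverse power2_eq_square)
  ultimately show ?thesis by simp
qed

lemma deriv_Pfun: "y \<noteq> 0 \<Longrightarrow> deriv (Pfun \<gamma>) y = dPfun \<gamma> y"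
  by (rule DERIV_imp_deriv[OF Pfun_has_derivative])

text \<open>In terms of the reciprocals \<open>p\<close> and \<open>q\<close> of \<open>y\<close> and
  \<open>z\<close>, each identity is a polynomial consequence of \<open>p - q = (z - y) * p *
  q\<close>.\<close>

lemma
  fixes y z :: complex
  assumes "y \<noteq> 0" "z \<noteq> 0"
  shows Pfun_taylor: "Pfun \<gamma> z - Pfun \<gamma> y - dPfun \<gamma> y * (z - y) = (z - y)\<^sup>2 / (y\<^sup>2 * z)"
    and Pfun_diff: "Pfun \<gamma> z - Pfun \<gamma> y = (z - y) * (1 / (of_real \<gamma>)\<^sup>2 - 1 / (y * z))"
    and dPfun_diff: "dPfun \<gamma> z - dPfun \<gamma> y = (z - y) * (1 / (y * z\<^sup>2) + 1 / (y\<^sup>2 * z))"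
    and dPfun_taylor: "dPfun \<gamma> z - dPfun \<gamma> y - ddPfun y * (z - y)
      = - ((z - y)\<^sup>2) * (1 / (y\<^sup>2 * z\<^sup>2) + 2 / (y ^ 3 * z))"
proof -
  define p q where "p = inverse y" and "q = inverse z"
  have pq: "p - q = (z - y) * p * q" using assms by (simp add: p_def q_def field_simps)
  have 1: "q - p = - (z - y) * p * q" using pq by algebra
  have 2: "q - p + (z - y) * p\<^sup>2 = (z - y)\<^sup>2 * p\<^sup>2 * q" using pq by algebra
  have 3: "p\<^sup>2 - q\<^sup>2 = (z - y) * (p * q\<^sup>2 + p\<^sup>2 * q)" using pq by algebra
  have 4: "p\<^sup>2 - q\<^sup>2 - 2 * p ^ 3 * (z - y) = - ((z - y)\<^sup>2) * (p\<^sup>2 * q\<^sup>2 + 2 * p ^ 3 * q)"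
    using pq by algebra
  note inv = divide_inverse power_inverse[symmetric] p_def[symmetric] q_def[symmetric]
    inverse_mult_distrib
  show "Pfun \<gamma> z - Pfun \<gamma> y - dPfun \<gamma> y * (z - y) = (z - y)\<^sup>2 / (y\<^sup>2 * z)"
    using 2 unfolding Pfun_def dPfun_def inv by (simp add: algebra_simps)
  show "Pfun \<gamma> z - Pfun \<gamma> y = (z - y) * (1 / (of_real \<gamma>)\<^sup>2 - 1 / (y * z))"
    using 1 unfolding Pfun_def inv by (simp add: algebra_simps)
  show "dPfun \<gamma> z - dPfun \<gamma> y = (z - y) * (1 / (y * z\<^sup>2) + 1 / (y\<^sup>2 * z))"
    using 3 unfolding dPfun_def inv by simp
  show "dPfun \<gamma> z - dPfun \<gamma> y - ddPfun y * (z - y)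
      = - ((z - y)\<^sup>2) * (1 / (y\<^sup>2 * z\<^sup>2) + 2 / (y ^ 3 * z))"
    using 4 unfolding dPfun_def ddPfun_def inv by simp
qed

lemma inverse_product_le:
  fixes p q s a A B :: real
  assumes "0 < s" "0 < a" "s * a \<le> p" "s * a / 2 \<le> q"
  shows "1 / (p ^ i * q ^ j) \<le> 2 ^ j / (s * a) ^ (i + j)"
proof -
  have sa: "0 < s * a" using assms by simp
  then have pq: "0 \<le> p" "0 \<le> q" "0 \<le> s * a" "0 \<le> s * a / 2" using assms by linarith+
  have "(s * a) ^ i * (s * a / 2) ^ j \<le> p ^ i * q ^ j"
    by (intro mult_mono power_mono zero_le_power assms pq)
  moreover have "0 < (s * a) ^ i * (s * a / 2) ^ j" using sa by simp
  ultimately have "1 / (p ^ i * q ^ j) \<le> 1 / ((s * a) ^ i * (s * a / 2) ^ j)"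
    by (intro divide_left_mono) (auto intro: mult_pos_pos order_less_le_trans)
  then show ?thesis by (simp add: power_add power_divide)
qed

text \<open>Here \<open>s\<close> is the size of an index, \<open>y\<close> and \<open>z\<close> are
  values of the symbol before and after a perturbation of the scales, and \<open>d\<close>
  bounds that perturbation. As \<open>d \<le> a / 2\<close>, both moduli are at least \<open>s *
  a / 2\<close>, so every reciprocal compensates one factor \<open>s\<close>. The constants are
  therefore uniform in \<open>s\<close>, except in the second estimate, where the linear part of
  \<open>P\<close> contributes.\<close>

lemma scalar_estimates:
  fixes y z :: complex and s a d :: real
  assumes s: "1 \<le> s" and a: "0 < a" and y: "s * a \<le> Re y" and d: "cmod (z - y) \<le> s * d" "d \<le> a / 2"
  shows "cmod (Pfun \<gamma> z - Pfun \<gamma> y - dPfun \<gamma> y * (z - y)) \<le> 2 / a ^ 3 * d\<^sup>2"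
    and "cmod (Pfun \<gamma> z - Pfun \<gamma> y) \<le> s * (d * (1 / \<gamma>\<^sup>2 + 2 / a\<^sup>2))"
    and "cmod (dPfun \<gamma> z) \<le> 1 / \<gamma>\<^sup>2 + 4 / a\<^sup>2"
    and "cmod (dPfun \<gamma> z - dPfun \<gamma> y) \<le> 6 / a ^ 3 * d"
    and "cmod (dPfun \<gamma> z - dPfun \<gamma> y - ddPfun y * (z - y)) \<le> 8 / a ^ 4 * d\<^sup>2"
    and "y \<noteq> 0" "z \<noteq> 0" "0 \<le> d"
proof -
  have sa: "0 < s * a" using s a by simp
  have dn: "0 \<le> s * d" using d(1) norm_ge_zero order_trans by blast
  show d0: "0 \<le> d" using dn s by (simp add: zero_le_mult_iff)
  have p: "s * a \<le> cmod y" using y complex_Re_le_cmod[of y] by linarith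
  have "s * d \<le> s * (a / 2)" using d(2) s by (intro mult_left_mono) auto
  then have "cmod (z - y) \<le> s * a / 2" using d(1) by simp
  moreover have "cmod y \<le> cmod z + cmod (z - y)" using norm_triangle_ineq[of z "y - z"] by (simp add: norm_minus_commute)
  ultimately have q: "s * a / 2 \<le> cmod z" using p by linarith
  show nz: "y \<noteq> 0" "z \<noteq> 0" using p q sa by auto
  have sp: "0 < s" using s by simp
  note bnd = inverse_product_le[OF sp a p q]
  have red: "c / (s * a) ^ n * s ^ i \<le> c / a ^ n" if "i \<le> n" "0 \<le> c" for n i and c :: real
  proof -
    have "s ^ i \<le> s ^ n" using s that by (intro power_increasing) auto
    then have "c * s ^ i / (s ^ n * a ^ n) \<le> c * s ^ n / (s ^ n * a ^ n)"
      using that sp a by (intro divide_right_mono mult_left_mono) auto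
    also have "\<dots> = c / a ^ n" using sp by simp
    finally show ?thesis by (simp add: power_mult_distrib)
  qed
  have comb: "cmod (z - y) ^ i * (1 / (cmod y ^ p * cmod z ^ q)) \<le> 2 ^ q / a ^ (p + q) * d ^ i"
    if "i \<le> p + q" for i p q
  proof -
    have "cmod (z - y) ^ i * (1 / (cmod y ^ p * cmod z ^ q)) \<le> (s * d) ^ i * (2 ^ q / (s * a) ^ (p + q))"
      using bnd[of p q] d(1) dn by (intro mult_mono power_mono) auto
    also have "\<dots> = (2 ^ q / (s * a) ^ (p + q) * s ^ i) * d ^ i" by (simp add: power_mult_distrib)
    also have "\<dots> \<le> 2 ^ q / a ^ (p + q) * d ^ i"
      using red[OF that] d0 by (intro mult_right_mono) auto
    finally show ?thesis .
  qed
  show "cmod (Pfun \<gamma> z - Pfun \<gamma> y - dPfun \<gamma> y * (z - y)) \<le> 2 / a ^ 3 * d\<^sup>2"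
    using comb[of 2 2 1] unfolding Pfun_taylor[OF nz] by (simp add: norm_mult norm_divide norm_power numeral_eq_Suc)
  have "cmod (Pfun \<gamma> z - Pfun \<gamma> y) \<le> cmod (z - y) * (1 / \<gamma>\<^sup>2 + 1 / (cmod y * cmod z))"
    unfolding Pfun_diff[OF nz] norm_mult
    using norm_triangle_ineq4[of "1 / (complex_of_real \<gamma>)\<^sup>2" "1 / (y * z)"]
    by (intro mult_left_mono) (auto simp: norm_divide norm_power norm_mult)
  also have "\<dots> \<le> (s * d) * (1 / \<gamma>\<^sup>2 + 2 / a\<^sup>2)"
    using comb[of 0 1 1] d dn by (intro mult_mono) (auto simp: power2_eq_square)
  finally show "cmod (Pfun \<gamma> z - Pfun \<gamma> y) \<le> s * (d * (1 / \<gamma>\<^sup>2 + 2 / a\<^sup>2))" by simp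
  have "cmod (dPfun \<gamma> z) \<le> 1 / \<gamma>\<^sup>2 + 1 / (cmod z)\<^sup>2"
    unfolding dPfun_def using norm_triangle_ineq4[of "1 / (complex_of_real \<gamma>)\<^sup>2" "1 / z\<^sup>2"]
    by (simp add: norm_divide norm_power)
  then show "cmod (dPfun \<gamma> z) \<le> 1 / \<gamma>\<^sup>2 + 4 / a\<^sup>2" using comb[of 0 0 2] by (simp add: power2_eq_square)
  have "cmod (dPfun \<gamma> z - dPfun \<gamma> y) \<le> cmod (z - y) * (1 / (cmod y * (cmod z)\<^sup>2) + 1 / ((cmod y)\<^sup>2 * cmod z))"
    unfolding dPfun_diff[OF nz] norm_mult
    using norm_triangle_ineq[of "1 / (y * z\<^sup>2)" "1 / (y\<^sup>2 * z)"]
    by (intro mult_left_mono) (auto simp: norm_divide norm_power norm_mult)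
  then show "cmod (dPfun \<gamma> z - dPfun \<gamma> y) \<le> 6 / a ^ 3 * d"
    using comb[of 1 1 2] comb[of 1 2 1] by (simp add: ring_distribs numeral_3_eq_3)
  have "cmod (dPfun \<gamma> z - dPfun \<gamma> y - ddPfun y * (z - y))
      \<le> (cmod (z - y))\<^sup>2 * (1 / ((cmod y)\<^sup>2 * (cmod z)\<^sup>2) + 2 / (cmod y ^ 3 * cmod z))"
    unfolding dPfun_taylor[OF nz] norm_mult norm_minus_cancel norm_power
    using norm_triangle_ineq[of "1 / (y\<^sup>2 * z\<^sup>2)" "2 / (y ^ 3 * z)"]
    by (intro mult_left_mono) (auto simp: norm_divide norm_power norm_mult)
  also have "\<dots> = (cmod (z - y))\<^sup>2 * (1 / ((cmod y)\<^sup>2 * (cmod z)\<^sup>2))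
      + 2 * ((cmod (z - y))\<^sup>2 * (1 / (cmod y ^ 3 * cmod z ^ 1)))"
    by (simp add: distrib_left)
  also have "\<dots> \<le> 2\<^sup>2 / a ^ (2 + 2) * d\<^sup>2 + 2 * (2 ^ 1 / a ^ (3 + 1) * d\<^sup>2)"
    using comb[of 2 2 2] comb[of 2 3 1] by linarith
  also have "\<dots> = 8 / a ^ 4 * d\<^sup>2" by simp
  finally show "cmod (dPfun \<gamma> z - dPfun \<gamma> y - ddPfun y * (z - y)) \<le> 8 / a ^ 4 * d\<^sup>2" .
qed

lemma ddPfun_estimate:
  fixes y :: complex
  assumes "1 \<le> s" "0 < a" "s * a \<le> Re y"
  shows "s * cmod (ddPfun y) \<le> 2 / a ^ 3"
proof -
  have "s * a \<le> cmod y" using assms complex_Re_le_cmod[of y] by linarith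
  then have "1 / (cmod y ^ 3 * cmod y ^ 0) \<le> 2 ^ 0 / (s * a) ^ (3 + 0)"
    using assms mult_pos_pos[of s a] by (intro inverse_product_le) linarith+
  then have "s * cmod (ddPfun y) \<le> s * (2 / (s * a) ^ 3)"
    using assms by (intro mult_left_mono) (auto simp: ddPfun_def norm_divide norm_power)
  also have "\<dots> = 2 / a ^ 3 * (1 / s\<^sup>2)" using assms
    by (simp add: field_simps power2_eq_square power3_eq_cube)
  also have "\<dots> \<le> 2 / a ^ 3 * 1"
    using assms by (intro mult_left_mono) (auto simp: one_le_power)
  finally show ?thesis by simp
qed

section \<open>Sums weighted by the Laplacian symbol\<close>

context scaled_space_group
begin

text \<open>The bilinear form behind the energy, its derivatives \<open>Hmap\<close> in the scales, and
  their derivatives.\<close>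

definition qsum :: "(int^3 \<Rightarrow> complex) \<Rightarrow> coeffs \<Rightarrow> coeffs \<Rightarrow> complex" where
  "qsum q u v = (\<Sum>\<^sub>\<infinity>k\<in>UNIV - {0}. q k * u k * v (- k))"

text \<open>The growth of \<open>q\<close> is charged to the weight of the first factor; of the second
  factor only its boundedness is used.\<close>

lemma
  assumes u: "l1 u" and v: "l1 v" and q: "\<And>k. k \<noteq> 0 \<Longrightarrow> cmod (q k) \<le> B * lsize (csys S) k" and B: "0 \<le> B"
  shows qsum_abs_summable: "(\<lambda>k. q k * u k * v (- k)) abs_summable_on UNIV - {0}"
    and qsum_summable: "(\<lambda>k. q k * u k * v (- k)) summable_on UNIV - {0}"
    and qsum_bound: "cmod (qsum q u v) \<le> B * (size_const * N u * N v)"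
proof -
  have le: "norm (q k * u k * v (- k)) \<le> B * size_const * N v * (cmod (u k) * w k)" if "k \<in> UNIV - {0}" for k
  proof -
    have "cmod (v (- k)) * 1 \<le> cmod (v (- k)) * w (- k)" using w_ge_1 by (intro mult_left_mono) auto
    also have "\<dots> \<le> N v" by (rule cmod_le_N[OF v])
    finally have vN: "cmod (v (- k)) \<le> N v" by simp
    have "cmod (q k) \<le> B * lsize (csys S) k" using q that by simp
    also have "\<dots> \<le> B * (size_const * w k)" using lsize_le(2)[of k] B by (intro mult_left_mono) auto
    finally have "cmod (q k) * cmod (u k) * cmod (v (- k)) \<le> B * (size_const * w k) * cmod (u k) * N v"
      using vN B lsize_le(1) w_pos[of k]
      by (intro mult_mono mult_right_mono) (auto simp: less_imp_le)
    then show ?thesis by (simp add: norm_mult mult_ac)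
  qed
  have s: "(\<lambda>k. B * size_const * N v * (cmod (u k) * w k)) summable_on UNIV - {0}"
    by (rule summable_on_cmult_right, rule summable_on_subset_banach[OF u[unfolded l1_def]]) simp
  show a: "(\<lambda>k. q k * u k * v (- k)) abs_summable_on UNIV - {0}"
    by (rule summable_on_comparison_test[OF s le norm_ge_zero])
  then show "(\<lambda>k. q k * u k * v (- k)) summable_on UNIV - {0}" by (rule abs_summable_summable)
  have "cmod (qsum q u v) \<le> (\<Sum>\<^sub>\<infinity>k\<in>UNIV - {0}. norm (q k * u k * v (- k)))"
    unfolding qsum_def by (rule norm_infsum_bound[OF a])
  also have "\<dots> \<le> (\<Sum>\<^sub>\<infinity>k\<in>UNIV - {0}. B * size_const * N v * (cmod (u k) * w k))"
    by (rule infsum_mono[OF a s le])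
  also have "\<dots> = B * size_const * N v * (\<Sum>\<^sub>\<infinity>k\<in>UNIV - {0}. cmod (u k) * w k)"
    by (rule infsum_cmult_right')
  also have "\<dots> \<le> B * size_const * N v * N u"
  proof (rule mult_left_mono)
    show "(\<Sum>\<^sub>\<infinity>k\<in>UNIV - {0}. cmod (u k) * w k) \<le> N u"
      unfolding N_def using u w_pos summable_on_subset_banach[of _ UNIV "UNIV - {0}"]
      by (intro infsum_mono_neutral) (auto simp: l1_def less_imp_le)
    show "0 \<le> B * size_const * N v" using B lsize_le(1) N_nonneg by simp
  qed
  finally show "cmod (qsum q u v) \<le> B * (size_const * N u * N v)" by (simp add: mult_ac)
qed

end

section \<open>Taylor expansion of the zero finding map\<close>

locale zero_problem = scaled_space_group S \<nu> kb for S :: "'g crystal_group" and \<nu> kb +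
  fixes \<gamma> m :: real
  assumes gamma: "0 < \<gamma>"
begin

abbreviation lsz :: "int^3 \<Rightarrow> real" where "lsz \<equiv> lsize (csys S)"
abbreviation Del :: "int^3 \<Rightarrow> (nat \<Rightarrow> complex) \<Rightarrow> complex" where "Del \<equiv> Delta (csys S)"
abbreviation dc :: "int^3 \<Rightarrow> nat \<Rightarrow> complex" where "dc k j \<equiv> of_int (Delta_coef (csys S) k j)"
abbreviation cof :: "coeffs \<Rightarrow> coeffs" where "cof \<equiv> full_coeffs S m"

text \<open>The symbol has cost one factor \<open>lsize\<close>, so values of \<open>zmap\<close> are
  measured with the weight divided by it. The bounded orbit cardinalities are left out, and
  finite sums spare a separate statement of summability.\<close>

definition residual_bound :: "state \<Rightarrow> real \<Rightarrow> bool" where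
  "residual_bound y B \<longleftrightarrow> (\<forall>j\<in>J. cmod (fst y j) \<le> B) \<and>
     (\<forall>F. finite F \<longrightarrow> F \<subseteq> Z0 S \<longrightarrow> (\<Sum>k\<in>F. cmod (snd y k) * w k / lsz k) \<le> B)"

lemma cmod_dc_le: "j \<in> J \<Longrightarrow> cmod (dc k j) \<le> lsz k"
  using Delta_coef_le_lsize[of j "csys S" k] Delta_coef_nonneg[of j "csys S" k] by simp

text \<open>\<open>DH\<close> and \<open>DF\<close> are the derivatives of the two components of
  \<open>zmap\<close> at the scales \<open>\<kappa>\<close> and the lattice coefficients
  \<open>c\<close>, in the direction \<open>(h, u)\<close>.\<close>

definition DH :: "(nat \<Rightarrow> complex) \<Rightarrow> coeffs \<Rightarrow> (nat \<Rightarrow> complex) \<Rightarrow> coeffs \<Rightarrow> nat \<Rightarrow> complex" where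
  "DH \<kappa> c h u j = (if j \<in> J then 1/2 * (qsum (\<lambda>k. ddPfun (Del k \<kappa>) * Del k h * dc k j) c c
     + qsum (\<lambda>k. dPfun \<gamma> (Del k \<kappa>) * dc k j) u c + qsum (\<lambda>k. dPfun \<gamma> (Del k \<kappa>) * dc k j) c u) else 0)"

definition Dcube :: "coeffs \<Rightarrow> coeffs \<Rightarrow> coeffs" where
  "Dcube c u k = dconv u (dconv c c) k + dconv c (dconv u c) k + dconv c (dconv c u) k"

definition DF :: "(nat \<Rightarrow> complex) \<Rightarrow> coeffs \<Rightarrow> (nat \<Rightarrow> complex) \<Rightarrow> coeffs \<Rightarrow> coeffs" where
  "DF \<kappa> c h u k = (if k \<in> Z0 S then of_nat (card (Orb S k)) *
     (dPfun \<gamma> (Del k \<kappa>) * Del k h * c k + Pfun \<gamma> (Del k \<kappa>) * u k + Dcube c u k) else 0)"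

definition DZ :: "state \<Rightarrow> state \<Rightarrow> state" where
  "DZ x v = (DH (fst x) (cof (snd x)) (fst v) (sigma S (snd v)),
             DF (fst x) (cof (snd x)) (fst v) (sigma S (snd v)))"

lemma CJ_pos_Re_ge:
  assumes "\<kappa> \<in> CJ_pos S"
  obtains a where "0 < a" "\<forall>j\<in>J. a \<le> Re (\<kappa> j)" "\<forall>k. lsz k * a \<le> Re (Del k \<kappa>)"
proof (rule that[of "Min ((\<lambda>j. Re (\<kappa> j)) ` J)"])
  show "0 < Min ((\<lambda>j. Re (\<kappa> j)) ` J)" using J_ne assms by (auto simp: CJ_pos_def)
  show ge: "\<forall>j\<in>J. Min ((\<lambda>j. Re (\<kappa> j)) ` J) \<le> Re (\<kappa> j)" by simp
  show "\<forall>k. lsz k * Min ((\<lambda>j. Re (\<kappa> j)) ` J) \<le> Re (Del k \<kappa>)"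
    by (intro allI Re_Delta_ge bspec[OF ge])
qed

lemma CJ_cmod_le:
  obtains M where "0 \<le> M" "\<forall>k. cmod (Del k \<kappa>) \<le> lsz k * M"
proof (rule that[of "Max ((\<lambda>j. cmod (\<kappa> j)) ` J)"])
  have le: "\<forall>j\<in>J. cmod (\<kappa> j) \<le> Max ((\<lambda>j. cmod (\<kappa> j)) ` J)" by simp
  obtain j where "j \<in> J" using J_ne by blast
  then show "0 \<le> Max ((\<lambda>j. cmod (\<kappa> j)) ` J)" using bspec[OF le] norm_ge_zero order_trans by blast
  show "\<forall>k. cmod (Del k \<kappa>) \<le> lsz k * Max ((\<lambda>j. cmod (\<kappa> j)) ` J)"
    by (intro allI cmod_Delta_le bspec[OF le])
qed

lemma Del_nz:
  assumes "\<kappa> \<in> CJ_pos S" "k \<noteq> 0" shows "Del k \<kappa> \<noteq> 0"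
proof -
  obtain a where "0 < a" and "\<forall>j\<in>J. a \<le> Re (\<kappa> j)" and ge: "\<forall>k. lsz k * a \<le> Re (Del k \<kappa>)"
    by (rule CJ_pos_Re_ge[OF assms(1)])
  moreover have "0 < lsz k * a" using lsize_ge_1[OF assms(2), of "csys S"] \<open>0 < a\<close> by simp
  ultimately have "0 < Re (Del k \<kappa>)" by (meson less_le_trans)
  then show ?thesis by auto
qed

definition kmax :: real where "kmax = Max (kb ` J)"

lemma kmax: "j \<in> J \<Longrightarrow> kb j \<le> kmax" "0 < kmax"
proof -
  show 1: "kb j \<le> kmax" if "j \<in> J" for j using that by (simp add: kmax_def)
  obtain j where "j \<in> J" using J_ne by blast
  then show "0 < kmax" using 1[of j] kb_pos[of j] by linarith
qed

lemma cmod_le_kmax: assumes "j \<in> J" "CJ_norm S kb h \<le> n" shows "cmod (h j) \<le> n * kmax"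
proof -
  have "cmod (h j) \<le> CJ_norm S kb h * kb j" by (rule cmod_le_CJ_norm[OF assms(1)])
  also have "\<dots> \<le> n * kmax"
    using assms(2) kmax(1)[OF assms(1)] kb_pos[OF assms(1)] CJ_norm_nonneg[of h]
    by (intro mult_mono) auto
  finally show ?thesis .
qed

lemma Del_le_kmax: "CJ_norm S kb h \<le> n \<Longrightarrow> cmod (Del k h) \<le> lsz k * (n * kmax)"
  by (intro cmod_Delta_le cmod_le_kmax)

lemma residual_sum_bound:
  assumes u: "l1 u" and v: "l1 v" and t: "l1 t" and nn: "0 \<le> a" "0 \<le> b"
    and le: "\<And>k. k \<in> Z0 S \<Longrightarrow> cmod (f k) \<le> lsz k * (a * cmod (u k) + b * cmod (v k)) + cmod (t k)"
    and F: "finite F" "F \<subseteq> Z0 S"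
  shows "(\<Sum>k\<in>F. cmod (of_nat (card (Orb S k)) * f k) * w k / lsz k)
    \<le> real (card (carrier S)) * (a * N u + b * N v + N t)"
proof -
  let ?G = "real (card (carrier S))"
  have "(\<Sum>k\<in>F. cmod (of_nat (card (Orb S k)) * f k) * w k / lsz k)
    \<le> (\<Sum>k\<in>F. ?G * (a * (cmod (u k) * w k) + b * (cmod (v k) * w k) + cmod (t k) * w k))"
  proof (rule sum_mono)
    fix k assume k: "k \<in> F"
    then have k0: "k \<noteq> 0" and kZ: "k \<in> Z0 S" using F by (auto simp: Z0_def)
    have l: "1 \<le> lsz k" by (rule lsize_ge_1[OF k0])
    have "cmod (of_nat (card (Orb S k)) * f k) \<le> ?G * cmod (f k)"
      using card_Orb_le[of k] by (simp add: norm_mult mult_right_mono)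
    also have "\<dots> \<le> ?G * (lsz k * (a * cmod (u k) + b * cmod (v k)) + cmod (t k))"
      by (intro mult_left_mono le kZ) simp
    also have "\<dots> \<le> ?G * (lsz k * (a * cmod (u k) + b * cmod (v k) + cmod (t k)))"
      using mult_right_mono[OF l norm_ge_zero[of "t k"]] by (intro mult_left_mono) (auto simp: distrib_left)
    finally have "cmod (of_nat (card (Orb S k)) * f k) * w k
      \<le> ?G * (lsz k * (a * cmod (u k) + b * cmod (v k) + cmod (t k))) * w k"
      using w_pos[of k] by (intro mult_right_mono) auto
    then have "cmod (of_nat (card (Orb S k)) * f k) * w k / lsz k
      \<le> ?G * (lsz k * (a * cmod (u k) + b * cmod (v k) + cmod (t k))) * w k / lsz k"
      using l by (intro divide_right_mono) auto
    also have "\<dots> = ?G * (a * cmod (u k) + b * cmod (v k) + cmod (t k)) * w k" using l by simp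
    also have "\<dots> = ?G * (a * (cmod (u k) * w k) + b * (cmod (v k) * w k) + cmod (t k) * w k)"
      by (simp add: algebra_simps)
    finally show "cmod (of_nat (card (Orb S k)) * f k) * w k / lsz k
      \<le> ?G * (a * (cmod (u k) * w k) + b * (cmod (v k) * w k) + cmod (t k) * w k)" .
  qed
  also have "\<dots> = ?G * (a * (\<Sum>k\<in>F. cmod (u k) * w k) + b * (\<Sum>k\<in>F. cmod (v k) * w k)
      + (\<Sum>k\<in>F. cmod (t k) * w k))"
    by (simp add: sum.distrib flip: sum_distrib_left)
  also have "\<dots> \<le> ?G * (a * N u + b * N v + N t)"
    using nn finite_sum_le_N[OF u F(1)] finite_sum_le_N[OF v F(1)] finite_sum_le_N[OF t F(1)]
    by (intro mult_left_mono add_mono) auto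
  finally show ?thesis .
qed

lemma zmap_eq:
  assumes "\<kappa> \<in> CJ_pos S"
  shows "zmap S \<gamma> m (\<kappa>, b) =
    (\<lambda>j. if j \<in> J then 1/2 * qsum (\<lambda>k. dPfun \<gamma> (Del k \<kappa>) * dc k j) (cof b) (cof b) else 0,
     \<lambda>k. if k \<in> Z0 S then of_nat (card (Orb S k)) * (Pfun \<gamma> (Del k \<kappa>) * cof b k
       + dconv (cof b) (dconv (cof b) (cof b)) k) else 0)"
proof -
  have "(\<Sum>\<^sub>\<infinity>k\<in>UNIV - {0}. deriv (Pfun \<gamma>) (Del k \<kappa>) * dc k j * cof b k * cof b (- k))
    = qsum (\<lambda>k. dPfun \<gamma> (Del k \<kappa>) * dc k j) (cof b) (cof b)" for j
    unfolding qsum_def by (intro infsum_cong) (simp add: deriv_Pfun Del_nz[OF assms])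
  then show ?thesis by (auto simp: zmap_def Hmap_def Fmap_def Let_def fun_eq_iff)
qed

lemma l1_cof: "b \<in> X0s S \<nu> kb \<Longrightarrow> l1 (cof b)"
  by (intro l1_full_coeffs X0s_Xs)

lemma l1_sig: "b \<in> X0s S \<nu> kb \<Longrightarrow> l1 (sigma S b)"
  by (intro l1_sigma X0s_Xs)

lemma N_sig: "b \<in> X0s S \<nu> kb \<Longrightarrow> XN b \<le> n \<Longrightarrow> N (sigma S b) \<le> n"
  using N_sigma[OF X0s_Xs] order_trans by blast

lemma cof_add: "cof (b + \<eta>) = (\<lambda>k. cof b k + sigma S \<eta> k)"
  unfolding full_coeffs_eq[abs_def] plus_fun_def sigma_add by (simp add: add.assoc)

lemma l1_Dcube: "l1 c \<Longrightarrow> l1 u \<Longrightarrow> l1 (Dcube c u)"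
  unfolding Dcube_def[abs_def] by (intro l1_add l1_dconv)

lemma N_dconv3:
  assumes "l1 c" "l1 d" "l1 e" shows "N (dconv c (dconv d e)) \<le> N c * (N d * N e)"
  using N_dconv[OF assms(1) l1_dconv[OF assms(2,3)]] mult_left_mono[OF N_dconv[OF assms(2,3)] N_nonneg[of c]]
  by linarith

lemma N_Dcube: assumes "l1 c" "l1 u" shows "N (Dcube c u) \<le> 3 * (N c)\<^sup>2 * N u"
proof -
  have "N (Dcube c u) \<le> N (dconv u (dconv c c)) + N (dconv c (dconv u c)) + N (dconv c (dconv c u))"
    unfolding Dcube_def[abs_def] using assms
    by (intro order_trans[OF N_add] add_right_mono N_add l1_add l1_dconv)
  also have "\<dots> \<le> N u * (N c * N c) + N c * (N u * N c) + N c * (N c * N u)"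
    using assms by (intro add_mono N_dconv3)
  finally show ?thesis by (simp add: power2_eq_square algebra_simps)
qed

text \<open>The part of the convolution cube of \<open>c + u\<close> that is of degree at least two in
  \<open>u\<close>.\<close>

definition cube_rem :: "coeffs \<Rightarrow> coeffs \<Rightarrow> coeffs" where
  "cube_rem c u k = Dcube u c k + dconv u (dconv u u) k"

lemma cube_expand:
  assumes "l1 c" "l1 u"
  shows "dconv (\<lambda>k. c k + u k) (dconv (\<lambda>k. c k + u k) (\<lambda>k. c k + u k)) k
    = dconv c (dconv c c) k + Dcube c u k + cube_rem c u k"
proof -
  let ?s = "\<lambda>k. c k + u k"
  have "dconv ?s ?s = (\<lambda>k. (dconv c c k + dconv u c k) + (dconv c u k + dconv u u k))"
    using assms by (simp add: dconv_add_left dconv_add_right l1_add add_ac)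
  then show ?thesis using assms
    by (simp add: dconv_add_left dconv_add_right l1_add l1_dconv Dcube_def cube_rem_def)
qed

lemma l1_cube_rem: "l1 c \<Longrightarrow> l1 u \<Longrightarrow> l1 (cube_rem c u)"
  unfolding cube_rem_def[abs_def] by (intro l1_add l1_Dcube l1_dconv)

lemma N_cube_rem:
  assumes "l1 c" "l1 u" "N u \<le> n" "n \<le> 1" shows "N (cube_rem c u) \<le> (3 * N c + 1) * n\<^sup>2"
proof -
  have u: "0 \<le> N u" "N u \<le> 1" using N_nonneg assms by auto
  have sq: "(N u)\<^sup>2 \<le> n\<^sup>2" using assms(3) u by (intro power_mono) auto
  have "N (cube_rem c u) \<le> N (Dcube u c) + N (dconv u (dconv u u))"
    unfolding cube_rem_def[abs_def] using assms by (intro N_add l1_Dcube l1_dconv)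
  also have "\<dots> \<le> 3 * (N u)\<^sup>2 * N c + N u * (N u * N u)"
    using assms by (intro add_mono N_Dcube N_dconv3)
  also have "\<dots> \<le> 3 * (N u)\<^sup>2 * N c + 1 * (N u * N u)"
    using u by (intro add_left_mono mult_right_mono) auto
  also have "\<dots> = (3 * N c + 1) * (N u)\<^sup>2" by (simp add: power2_eq_square algebra_simps)
  also have "\<dots> \<le> (3 * N c + 1) * n\<^sup>2" using sq N_nonneg[of c] by (intro mult_left_mono) auto
  finally show ?thesis .
qed

text \<open>The form and both its arguments vary. Removing the value and the terms of first order leaves
  sums that are each of second order in the increments.\<close>

lemma qsum_taylor:
  assumes c: "l1 c" and u: "l1 u" and B: "0 \<le> B"
    and q: "\<And>k. k \<noteq> 0 \<Longrightarrow> cmod (q k) \<le> B * lsz k" "\<And>k. k \<noteq> 0 \<Longrightarrow> cmod (r k) \<le> B * lsz k"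
      "\<And>k. k \<noteq> 0 \<Longrightarrow> cmod (q' k) \<le> B * lsz k"
  shows "qsum q' (\<lambda>k. c k + u k) (\<lambda>k. c k + u k) - qsum q c c - (qsum r c c + qsum q u c + qsum q c u)
    = qsum (\<lambda>k. q' k - q k - r k) c c + qsum (\<lambda>k. q' k - q k) u c + qsum (\<lambda>k. q' k - q k) c u
      + qsum q' u u"
proof -
  have B3: "0 \<le> 3 * B" "0 \<le> 2 * B" using B by auto
  have q3: "cmod (q' k - q k - r k) \<le> 3 * B * lsz k" "cmod (q' k - q k) \<le> 2 * B * lsz k" if "k \<noteq> 0" for k
    using q[OF that] norm_triangle_ineq4[of "q' k - q k" "r k"] norm_triangle_ineq4[of "q' k" "q k"]
    by linarith+
  note s = qsum_summable[OF _ _ q(1) B] qsum_summable[OF _ _ q(2) B] qsum_summable[OF _ _ q(3) B]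
    qsum_summable[OF _ _ q3(1) B3(1)] qsum_summable[OF _ _ q3(2) B3(2)]
  have "qsum q' (\<lambda>k. c k + u k) (\<lambda>k. c k + u k) =
     qsum q c c + (qsum r c c + qsum q u c + qsum q c u) +
     (qsum (\<lambda>k. q' k - q k - r k) c c + qsum (\<lambda>k. q' k - q k) u c + qsum (\<lambda>k. q' k - q k) c u
      + qsum q' u u)"
    unfolding qsum_def
    by (simp add: infsum_add[symmetric] summable_on_add s c u)
       (intro infsum_cong, simp add: algebra_simps)
  then show ?thesis by simp
qed

text \<open>The radius \<open>\<delta>\<close> keeps the perturbation of the scales below half of their
  smallest real part, which is what \<open>scalar_estimates\<close> asks for, simultaneously for
  all indices.\<close>

lemma zmap_remainder:
  assumes \<kappa>: "\<kappa> \<in> CJ_pos S" and b: "b \<in> X0s S \<nu> kb"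
  obtains C \<delta> where "0 < \<delta>" "0 \<le> C"
    "\<forall>h \<eta> n. h \<in> CJ S \<longrightarrow> \<eta> \<in> X0s S \<nu> kb \<longrightarrow> CJ_norm S kb h \<le> n \<longrightarrow> XN \<eta> \<le> n \<longrightarrow> n \<le> \<delta> \<longrightarrow>
      \<kappa> + h \<in> CJ_pos S \<and>
      residual_bound (zmap S \<gamma> m (\<kappa> + h, b + \<eta>) - zmap S \<gamma> m (\<kappa>, b) - DZ (\<kappa>, b) (h, \<eta>)) (C * n\<^sup>2)"
proof -
  obtain a where a: "0 < a" and aj: "\<forall>j\<in>J. a \<le> Re (\<kappa> j)"
    and Re': "\<forall>k. lsz k * a \<le> Re (Del k \<kappa>)" by (rule CJ_pos_Re_ge[OF \<kappa>])
  have Re: "lsz k * a \<le> Re (Del k \<kappa>)" for k using Re' by (rule spec)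
  define \<delta> where "\<delta> = min 1 (a / (2 * kmax))"
  have \<delta>: "0 < \<delta>" "\<delta> \<le> 1" using a kmax(2) by (simp_all add: \<delta>_def)
  have "\<delta> * kmax \<le> a / (2 * kmax) * kmax" using kmax(2) by (intro mult_right_mono) (simp_all add: \<delta>_def)
  also have "\<dots> = a / 2" using kmax(2) by simp
  finally have \<delta>3: "\<delta> * kmax \<le> a / 2" .
  let ?c = "cof b" let ?G = "real (card (carrier S))"
  have c: "l1 ?c" by (rule l1_cof[OF b])
  \<comment> \<open>\<open>CP\<close> bounds the derivative of \<open>P\<close> near the symbols;
    \<open>CH\<close> and \<open>CF\<close> are the constants of the two components\<close>
  define CP where "CP = 1 / \<gamma>\<^sup>2 + 4 / a\<^sup>2"
  have CP: "0 < CP" using gamma a by (simp add: CP_def add_pos_pos)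
  define CH where "CH = 1/2 * size_const * (8 / a ^ 4 * kmax\<^sup>2 * (N ?c)\<^sup>2
      + 2 * (6 / a ^ 3 * kmax) * N ?c + CP)"
  define CF where "CF = ?G * (2 / a ^ 3 * kmax\<^sup>2 * N ?c + CP * kmax + (3 * N ?c + 1))"
  define C where "C = max CH CF"
  have CH0: "0 \<le> CH"
    using lsize_le(1) a kmax(2) N_nonneg[of ?c] CP unfolding CH_def
    by (intro mult_nonneg_nonneg add_nonneg_nonneg) auto
  show ?thesis
  proof (rule that[of \<delta> C], goal_cases)
    case 2
    show "0 \<le> C" using CH0 by (simp add: C_def)
  next
    case 3
    show ?case
    proof (intro allI impI)
    fix h \<eta> and n :: real
    assume h: "h \<in> CJ S" "CJ_norm S kb h \<le> n" and \<eta>: "\<eta> \<in> X0s S \<nu> kb" "XN \<eta> \<le> n" and n: "n \<le> \<delta>"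
    let ?u = "sigma S \<eta>"
    have n0: "0 \<le> n" using CJ_norm_nonneg h(2) order_trans by blast
    have u: "l1 ?u" and Nu: "N ?u \<le> n" using l1_sig[OF \<eta>(1)] N_sig[OF \<eta>] by auto
    have "n * kmax \<le> \<delta> * kmax" using n kmax(2) by simp
    then have d: "n * kmax \<le> a / 2" using \<delta>3 by linarith
    have pos: "\<kappa> + h \<in> CJ_pos S"
    proof -
      have "0 < Re ((\<kappa> + h) j)" if "j \<in> J" for j
      proof -
        have "\<bar>Re (h j)\<bar> \<le> a / 2"
          using abs_Re_le_cmod[of "h j"] cmod_le_kmax[OF that h(2)] d by linarith
        then show ?thesis using bspec[OF aj that] a by simp
      qed
      then show ?thesis using \<kappa> h(1) by (auto simp: CJ_pos_def CJ_def)
    qed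
    define y where "y k = Del k \<kappa>" for k
    define z where "z k = Del k (\<kappa> + h)" for k
    have zy: "z k - y k = Del k h" for k by (simp add: z_def y_def Delta_add)
    have est: "cmod (Pfun \<gamma> (z k) - Pfun \<gamma> (y k) - dPfun \<gamma> (y k) * Del k h) \<le> 2 / a ^ 3 * (n * kmax)\<^sup>2"
      "cmod (Pfun \<gamma> (z k) - Pfun \<gamma> (y k)) \<le> lsz k * (n * kmax * (1 / \<gamma>\<^sup>2 + 2 / a\<^sup>2))"
      "cmod (dPfun \<gamma> (z k)) \<le> CP"
      "cmod (dPfun \<gamma> (z k) - dPfun \<gamma> (y k)) \<le> 6 / a ^ 3 * (n * kmax)"
      "cmod (dPfun \<gamma> (z k) - dPfun \<gamma> (y k) - ddPfun (y k) * Del k h) \<le> 8 / a ^ 4 * (n * kmax)\<^sup>2"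
      if "k \<noteq> 0" for k
      using scalar_estimates(1-5)[OF lsize_ge_1[OF that] a Re[of k, folded y_def]
          Del_le_kmax[OF h(2), of k, folded zy] d, of \<gamma>, unfolded zy]
      unfolding CP_def by this
    have P1y: "cmod (dPfun \<gamma> (y k)) \<le> CP" if "k \<noteq> 0" for k
      using scalar_estimates(3)[OF lsize_ge_1[OF that] a Re[of k, folded y_def], of "y k" 0 \<gamma>] a
      by (simp add: CP_def)
    have P2y: "lsz k * cmod (ddPfun (y k)) \<le> 2 / a ^ 3" if "k \<noteq> 0" for k
      using ddPfun_estimate[OF lsize_ge_1[OF that] a Re[of k, folded y_def]] .
    define R where "R = zmap S \<gamma> m (\<kappa> + h, b + \<eta>) - zmap S \<gamma> m (\<kappa>, b) - DZ (\<kappa>, b) (h, \<eta>)"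
    have RH: "cmod (fst R j) \<le> CH * n\<^sup>2" if j: "j \<in> J" for j
    proof -
      define q where "q k = dPfun \<gamma> (y k) * dc k j" for k
      define q' where "q' k = dPfun \<gamma> (z k) * dc k j" for k
      define r where "r k = ddPfun (y k) * Del k h * dc k j" for k
      define B where "B = CP + 2 / a ^ 3 * (n * kmax)"
      have B: "0 \<le> B" "CP \<le> B" using CP a n0 kmax(2) by (auto simp: B_def)
      have dcm: "cmod (x * dc k j) \<le> t * lsz k" if "cmod x \<le> t" for x t k
        using cmod_dc_le[OF j, of k] that order_trans[OF norm_ge_zero that]
        unfolding norm_mult by (intro mult_mono) auto
      have qb: "cmod (q k) \<le> B * lsz k" "cmod (q' k) \<le> B * lsz k" if "k \<noteq> 0" for k
        unfolding q_def q'_def using P1y[OF that] est(3)[OF that] B by (auto intro!: dcm)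
      have rb: "cmod (r k) \<le> B * lsz k" if "k \<noteq> 0" for k
      proof -
        have "cmod (ddPfun (y k) * Del k h) \<le> cmod (ddPfun (y k)) * (lsz k * (n * kmax))"
          unfolding norm_mult by (intro mult_left_mono Del_le_kmax h) simp
        also have "\<dots> = (lsz k * cmod (ddPfun (y k))) * (n * kmax)" by simp
        also have "\<dots> \<le> 2 / a ^ 3 * (n * kmax)"
          using P2y[OF that] n0 kmax(2) by (intro mult_right_mono) auto
        also have "\<dots> \<le> B" using CP by (simp add: B_def)
        finally show ?thesis unfolding r_def by (rule dcm)
      qed
      have "fst R j = 1/2 * (qsum q' (cof (b + \<eta>)) (cof (b + \<eta>)) - qsum q ?c ?c
          - (qsum r ?c ?c + qsum q ?u ?c + qsum q ?c ?u))"
        using j unfolding R_def zmap_eq[OF \<kappa>] zmap_eq[OF pos] DZ_def DH_def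
          q_def[abs_def] q'_def[abs_def] r_def[abs_def] y_def z_def
        by (simp add: right_diff_distrib)
      also have "\<dots> = 1/2 * (qsum (\<lambda>k. q' k - q k - r k) ?c ?c + qsum (\<lambda>k. q' k - q k) ?u ?c
          + qsum (\<lambda>k. q' k - q k) ?c ?u + qsum q' ?u ?u)"
        unfolding cof_add using qsum_taylor[OF c u B(1) qb(1) rb qb(2)] by simp
      finally have eq: "fst R j = 1/2 * (qsum (\<lambda>k. q' k - q k - r k) ?c ?c + qsum (\<lambda>k. q' k - q k) ?u ?c
          + qsum (\<lambda>k. q' k - q k) ?c ?u + qsum q' ?u ?u)" .
      have b1: "cmod (q' k - q k - r k) \<le> (8 / a ^ 4 * (n * kmax)\<^sup>2) * lsz k" if "k \<noteq> 0" for k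
        using dcm[OF est(5)[OF that]] by (simp add: q_def q'_def r_def left_diff_distrib)
      have b2: "cmod (q' k - q k) \<le> (6 / a ^ 3 * (n * kmax)) * lsz k" if "k \<noteq> 0" for k
        using dcm[OF est(4)[OF that]] by (simp add: q_def q'_def left_diff_distrib)
      have b3: "cmod (q' k) \<le> CP * lsz k" if "k \<noteq> 0" for k
        unfolding q'_def by (rule dcm[OF est(3)[OF that]])
      have nn: "0 \<le> 8 / a ^ 4 * (n * kmax)\<^sup>2" "0 \<le> 6 / a ^ 3 * (n * kmax)" "0 \<le> CP"
        using a n0 kmax(2) CP by auto
      have Nc: "0 \<le> N ?c" "0 \<le> size_const" using N_nonneg lsize_le(1) by auto
      have uu: "N ?u * N ?u \<le> n * n" using Nu N_nonneg[of ?u] n0 by (intro mult_mono) auto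
      have uc: "N ?u * N ?c \<le> n * N ?c" using Nu Nc by (intro mult_right_mono) auto
      have "cmod (fst R j) \<le> 1/2 * (cmod (qsum (\<lambda>k. q' k - q k - r k) ?c ?c) + cmod (qsum (\<lambda>k. q' k - q k) ?u ?c)
          + cmod (qsum (\<lambda>k. q' k - q k) ?c ?u) + cmod (qsum q' ?u ?u))"
        unfolding eq norm_mult
        by (intro mult_mono order_trans[OF norm_triangle_ineq] add_mono order_refl) auto
      also have "\<dots> \<le> 1/2 * ((8 / a ^ 4 * (n * kmax)\<^sup>2) * (size_const * N ?c * N ?c)
          + (6 / a ^ 3 * (n * kmax)) * (size_const * N ?u * N ?c)
          + (6 / a ^ 3 * (n * kmax)) * (size_const * N ?c * N ?u) + CP * (size_const * N ?u * N ?u))"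
        by (intro mult_left_mono add_mono qsum_bound c u b1 b2 b3 nn) auto
      also have "\<dots> = 1/2 * size_const * (8 / a ^ 4 * kmax\<^sup>2 * (N ?c)\<^sup>2 * n\<^sup>2
          + 2 * (6 / a ^ 3 * kmax) * (n * (N ?u * N ?c)) + CP * (N ?u * N ?u))"
        by (simp add: algebra_simps power2_eq_square)
      also have "\<dots> \<le> 1/2 * size_const * (8 / a ^ 4 * kmax\<^sup>2 * (N ?c)\<^sup>2 * n\<^sup>2
          + 2 * (6 / a ^ 3 * kmax) * (n * (n * N ?c)) + CP * (n * n))"
        using Nc nn n0 kmax(2) a CP
        by (intro mult_left_mono add_mono order_refl uu uc) auto
      also have "\<dots> = CH * n\<^sup>2" by (simp add: CH_def algebra_simps power2_eq_square)
      finally show ?thesis .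
    qed
    have RF: "(\<Sum>k\<in>F. cmod (snd R k) * w k / lsz k) \<le> CF * n\<^sup>2" if F: "finite F" "F \<subseteq> Z0 S" for F
    proof -
      define f where "f k = (Pfun \<gamma> (z k) - Pfun \<gamma> (y k) - dPfun \<gamma> (y k) * Del k h) * ?c k
          + (Pfun \<gamma> (z k) - Pfun \<gamma> (y k)) * ?u k + cube_rem ?c ?u k" for k
      have Rk: "snd R k = of_nat (card (Orb S k)) * f k" if "k \<in> Z0 S" for k
      proof -
        have id: "o' * (pz * (c' + u') + (t0 + t1 + t2)) - o' * (py * c' + t0) - o' * (q * dl * c' + py * u' + t1)
          = o' * ((pz - py - q * dl) * c' + (pz - py) * u' + t2)"
          for o' pz py q dl c' u' t0 t1 t2 :: complex by (simp add: algebra_simps)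
        show ?thesis
          using that unfolding R_def zmap_eq[OF \<kappa>] zmap_eq[OF pos] DZ_def DF_def f_def y_def z_def cof_add
            cube_expand[OF c u] fst_conv snd_conv snd_diff minus_apply
          by (simp only: if_True id)
      qed
      have nn: "0 \<le> 2 / a ^ 3 * (n * kmax)\<^sup>2" "0 \<le> CP * (n * kmax)" using a n0 kmax(2) CP by auto
      have le: "cmod (f k) \<le> lsz k * (2 / a ^ 3 * (n * kmax)\<^sup>2 * cmod (?c k) + CP * (n * kmax) * cmod (?u k))
          + cmod (cube_rem ?c ?u k)" if k: "k \<in> Z0 S" for k
      proof -
        have k0: "k \<noteq> 0" using k by (simp add: Z0_def)
        have l: "1 \<le> lsz k" by (rule lsize_ge_1[OF k0])
        have "cmod (Pfun \<gamma> (z k) - Pfun \<gamma> (y k) - dPfun \<gamma> (y k) * Del k h) \<le> 1 * (2 / a ^ 3 * (n * kmax)\<^sup>2)"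
          using est(1)[OF k0] by simp
        also have "\<dots> \<le> lsz k * (2 / a ^ 3 * (n * kmax)\<^sup>2)" using l nn by (intro mult_right_mono) auto
        finally have 1: "cmod (Pfun \<gamma> (z k) - Pfun \<gamma> (y k) - dPfun \<gamma> (y k) * Del k h) * cmod (?c k)
            \<le> lsz k * (2 / a ^ 3 * (n * kmax)\<^sup>2) * cmod (?c k)" by (intro mult_right_mono) auto
        have "1 / \<gamma>\<^sup>2 + 2 / a\<^sup>2 \<le> CP" using a by (auto simp: CP_def intro!: divide_right_mono)
        then have "cmod (Pfun \<gamma> (z k) - Pfun \<gamma> (y k)) \<le> lsz k * (n * kmax * CP)"
          using l n0 kmax(2) by (intro order_trans[OF est(2)[OF k0]] mult_left_mono) auto
        then have 2: "cmod (Pfun \<gamma> (z k) - Pfun \<gamma> (y k)) * cmod (?u k) \<le> lsz k * (n * kmax * CP) * cmod (?u k)"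
          by (intro mult_right_mono) auto
        have "cmod (f k) \<le> cmod (Pfun \<gamma> (z k) - Pfun \<gamma> (y k) - dPfun \<gamma> (y k) * Del k h) * cmod (?c k)
            + cmod (Pfun \<gamma> (z k) - Pfun \<gamma> (y k)) * cmod (?u k) + cmod (cube_rem ?c ?u k)"
          unfolding f_def norm_mult[symmetric]
          by (intro order_trans[OF norm_triangle_ineq] add_mono order_refl norm_triangle_ineq)
        also have "\<dots> \<le> lsz k * (2 / a ^ 3 * (n * kmax)\<^sup>2) * cmod (?c k) + lsz k * (n * kmax * CP) * cmod (?u k)
            + cmod (cube_rem ?c ?u k)" using 1 2 by linarith
        finally show ?thesis by (simp add: algebra_simps)
      qed
      have "(\<Sum>k\<in>F. cmod (snd R k) * w k / lsz k) = (\<Sum>k\<in>F. cmod (of_nat (card (Orb S k)) * f k) * w k / lsz k)"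
        using F by (intro sum.cong) (auto simp: Rk)
      also have "\<dots> \<le> ?G * (2 / a ^ 3 * (n * kmax)\<^sup>2 * N ?c + CP * (n * kmax) * N ?u + N (cube_rem ?c ?u))"
        by (rule residual_sum_bound[OF c u l1_cube_rem[OF c u] nn le F])
      also have "\<dots> \<le> ?G * (2 / a ^ 3 * (n * kmax)\<^sup>2 * N ?c + CP * (n * kmax) * n + (3 * N ?c + 1) * n\<^sup>2)"
        using N_cube_rem[OF c u Nu] n \<delta>(2) nn(2) Nu
        by (intro mult_left_mono add_mono order_refl) auto
      also have "\<dots> = CF * n\<^sup>2" by (simp add: CF_def algebra_simps power2_eq_square)
      finally show ?thesis .
    qed
    have "CH * n\<^sup>2 \<le> C * n\<^sup>2" "CF * n\<^sup>2 \<le> C * n\<^sup>2" by (auto simp: C_def intro!: mult_right_mono)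
    then have "residual_bound R (C * n\<^sup>2)" unfolding residual_bound_def using RH RF by (meson order_trans)
    then show "\<kappa> + h \<in> CJ_pos S \<and>
      residual_bound (zmap S \<gamma> m (\<kappa> + h, b + \<eta>) - zmap S \<gamma> m (\<kappa>, b) - DZ (\<kappa>, b) (h, \<eta>)) (C * n\<^sup>2)"
      using pos by (simp add: R_def)
    qed
  qed (rule \<delta>(1))
qed

lemma qsum_add:
  assumes "l1 u" "l1 u'" "l1 v" "0 \<le> B" "\<And>k. k \<noteq> 0 \<Longrightarrow> cmod (q k) \<le> B * lsz k"
    "\<And>k. k \<noteq> 0 \<Longrightarrow> cmod (q' k) \<le> B * lsz k"
  shows "qsum (\<lambda>k. q k + q' k) u v = qsum q u v + qsum q' u v"
    and "qsum q (\<lambda>k. u k + u' k) v = qsum q u v + qsum q u' v"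
    and "qsum q v (\<lambda>k. u k + u' k) = qsum q v u + qsum q v u'"
proof -
  note s = qsum_summable[OF _ _ assms(5) assms(4)] qsum_summable[OF _ _ assms(6) assms(4)]
  show "qsum (\<lambda>k. q k + q' k) u v = qsum q u v + qsum q' u v"
    "qsum q (\<lambda>k. u k + u' k) v = qsum q u v + qsum q u' v"
    "qsum q v (\<lambda>k. u k + u' k) = qsum q v u + qsum q v u'"
    unfolding qsum_def using s assms(1-3)
    by (simp_all add: infsum_add[symmetric] distrib_left distrib_right)
qed

lemma qsum_scale:
  "qsum (\<lambda>k. a * q k) u v = a * qsum q u v"
  "qsum q (\<lambda>k. a * u k) v = a * qsum q u v"
  "qsum q u (\<lambda>k. a * v k) = a * qsum q u v"
  unfolding qsum_def infsum_cmult_right'[symmetric] by (simp_all add: mult_ac)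

lemma coefficient_bounds:
  assumes "\<kappa> \<in> CJ_pos S"
  obtains B where "0 \<le> B"
    "\<forall>k j. k \<noteq> 0 \<longrightarrow> j \<in> J \<longrightarrow> cmod (dPfun \<gamma> (Del k \<kappa>) * dc k j) \<le> B * lsz k"
    "\<forall>k j h d. k \<noteq> 0 \<longrightarrow> j \<in> J \<longrightarrow> cmod (Del k h) \<le> lsz k * d \<longrightarrow> 0 \<le> d \<longrightarrow>
       cmod (ddPfun (Del k \<kappa>) * Del k h * dc k j) \<le> (B * d) * lsz k"
    "\<forall>k. k \<noteq> 0 \<longrightarrow> cmod (dPfun \<gamma> (Del k \<kappa>)) \<le> B"
    "\<forall>k. k \<noteq> 0 \<longrightarrow> cmod (Pfun \<gamma> (Del k \<kappa>)) \<le> B * lsz k"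
proof -
  obtain a where a: "0 < a" and aj: "\<forall>j\<in>J. a \<le> Re (\<kappa> j)"
    and Re': "\<forall>k. lsz k * a \<le> Re (Del k \<kappa>)" by (rule CJ_pos_Re_ge[OF assms])
  have Re: "lsz k * a \<le> Re (Del k \<kappa>)" for k using Re' by (rule spec)
  obtain M where M0: "0 \<le> M" and M': "\<forall>k. cmod (Del k \<kappa>) \<le> lsz k * M" by (rule CJ_cmod_le)
  have M: "cmod (Del k \<kappa>) \<le> lsz k * M" for k using M' by (rule spec)
  define B1 where "B1 = 1 / \<gamma>\<^sup>2 + 4 / a\<^sup>2"
  define B2 where "B2 = 2 / a ^ 3"
  define B3 where "B3 = M / \<gamma>\<^sup>2 + 1 + 1 / a"
  define B where "B = B1 + B2 + B3"
  have nn: "0 \<le> B1" "0 \<le> B2" "0 \<le> B3" using a M0 by (auto simp: B1_def B2_def B3_def)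
  have le: "B1 \<le> B" "B2 \<le> B" "B3 \<le> B" "0 \<le> B" using nn by (auto simp: B_def)
  have p1: "cmod (dPfun \<gamma> (Del k \<kappa>)) \<le> B1" if "k \<noteq> 0" for k
    using scalar_estimates(3)[OF lsize_ge_1[OF that] a Re, of "Del k \<kappa>" 0 \<gamma>] a
    by (simp add: B1_def)
  have p2: "lsz k * cmod (ddPfun (Del k \<kappa>)) \<le> B2" if "k \<noteq> 0" for k
    using ddPfun_estimate[OF lsize_ge_1[OF that] a Re] by (simp add: B2_def)
  have p: "cmod (Pfun \<gamma> (Del k \<kappa>)) \<le> lsz k * B3" if "k \<noteq> 0" for k
  proof -
    have l: "1 \<le> lsz k" by (rule lsize_ge_1[OF that])
    have "1 * a \<le> lsz k * a" using l a by (intro mult_right_mono) auto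
    also have "\<dots> \<le> cmod (Del k \<kappa>)" using Re[of k] complex_Re_le_cmod[of "Del k \<kappa>"] by linarith
    finally have "1 / cmod (Del k \<kappa>) \<le> 1 / a" using a by (intro frac_le) auto
    moreover have "1 / a \<le> lsz k * (1 / a)" using mult_right_mono[OF l, of "1 / a"] a by simp
    moreover have "cmod (Del k \<kappa>) / \<gamma>\<^sup>2 \<le> lsz k * M / \<gamma>\<^sup>2" using M by (intro divide_right_mono) auto
    moreover have "cmod (Pfun \<gamma> (Del k \<kappa>)) \<le> cmod (Del k \<kappa>) / \<gamma>\<^sup>2 + 1 + 1 / cmod (Del k \<kappa>)"
      unfolding Pfun_def
      using norm_triangle_ineq[of "Del k \<kappa> / (of_real \<gamma>)\<^sup>2 - 1" "inverse (Del k \<kappa>)"]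
        norm_triangle_ineq4[of "Del k \<kappa> / (of_real \<gamma>)\<^sup>2" 1]
      by (simp add: norm_divide norm_power norm_inverse inverse_eq_divide)
    ultimately show ?thesis using l by (simp add: B3_def distrib_left)
  qed
  show ?thesis
  proof (rule that[of B])
    show "0 \<le> B" by (rule le)
    show "\<forall>k j. k \<noteq> 0 \<longrightarrow> j \<in> J \<longrightarrow> cmod (dPfun \<gamma> (Del k \<kappa>) * dc k j) \<le> B * lsz k"
    proof (intro allI impI)
      fix k :: "int^3" and j assume "k \<noteq> 0" "j \<in> J"
      then show "cmod (dPfun \<gamma> (Del k \<kappa>) * dc k j) \<le> B * lsz k"
        unfolding norm_mult using order_trans[OF p1 le(1)] cmod_dc_le le(4) by (intro mult_mono) auto
    qed
    show "\<forall>k. k \<noteq> 0 \<longrightarrow> cmod (dPfun \<gamma> (Del k \<kappa>)) \<le> B" using order_trans[OF p1 le(1)] by blast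
    show "\<forall>k. k \<noteq> 0 \<longrightarrow> cmod (Pfun \<gamma> (Del k \<kappa>)) \<le> B * lsz k"
    proof (intro allI impI)
      fix k :: "int^3" assume "k \<noteq> 0"
      from p[OF this] show "cmod (Pfun \<gamma> (Del k \<kappa>)) \<le> B * lsz k"
        using mult_left_mono[OF le(3) lsize_nonneg[of "csys S" k]] by (simp add: mult.commute)
    qed
    show "\<forall>k j h d. k \<noteq> 0 \<longrightarrow> j \<in> J \<longrightarrow> cmod (Del k h) \<le> lsz k * d \<longrightarrow> 0 \<le> d \<longrightarrow>
       cmod (ddPfun (Del k \<kappa>) * Del k h * dc k j) \<le> (B * d) * lsz k"
    proof (intro allI impI)
      fix k :: "int^3" and j h and d :: real
      assume k: "k \<noteq> 0" and j: "j \<in> J" and h: "cmod (Del k h) \<le> lsz k * d" and d: "0 \<le> d"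
      have "cmod (ddPfun (Del k \<kappa>)) * cmod (Del k h) \<le> cmod (ddPfun (Del k \<kappa>)) * (lsz k * d)"
        by (intro mult_left_mono h) simp
      also have "\<dots> = (lsz k * cmod (ddPfun (Del k \<kappa>))) * d" by simp
      also have "\<dots> \<le> B * d" using order_trans[OF p2[OF k] le(2)] d by (intro mult_right_mono)
      finally show "cmod (ddPfun (Del k \<kappa>) * Del k h * dc k j) \<le> (B * d) * lsz k"
        using cmod_dc_le[OF j, of k] le(4) d mult_mono[of "cmod (ddPfun (Del k \<kappa>)) * cmod (Del k h)" "B * d"
            "cmod (dc k j)" "lsz k"]
        by (simp only: norm_mult mult_nonneg_nonneg norm_ge_zero)
    qed
  qed
qed

lemma DZ_bounded:
  assumes \<kappa>: "\<kappa> \<in> CJ_pos S" and b: "b \<in> X0s S \<nu> kb"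
  obtains C where "0 \<le> C"
    "\<forall>h \<eta> n. \<eta> \<in> X0s S \<nu> kb \<longrightarrow> CJ_norm S kb h \<le> n \<longrightarrow> XN \<eta> \<le> n \<longrightarrow> residual_bound (DZ (\<kappa>, b) (h, \<eta>)) (C * n)"
proof -
  obtain B where B: "0 \<le> B"
    and q: "\<forall>k j. k \<noteq> 0 \<longrightarrow> j \<in> J \<longrightarrow> cmod (dPfun \<gamma> (Del k \<kappa>) * dc k j) \<le> B * lsz k"
    and r: "\<forall>k j h d. k \<noteq> 0 \<longrightarrow> j \<in> J \<longrightarrow> cmod (Del k h) \<le> lsz k * d \<longrightarrow> 0 \<le> d \<longrightarrow>
       cmod (ddPfun (Del k \<kappa>) * Del k h * dc k j) \<le> (B * d) * lsz k"
    and dPfun: "\<forall>k. k \<noteq> 0 \<longrightarrow> cmod (dPfun \<gamma> (Del k \<kappa>)) \<le> B"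
    and P: "\<forall>k. k \<noteq> 0 \<longrightarrow> cmod (Pfun \<gamma> (Del k \<kappa>)) \<le> B * lsz k"
    by (rule coefficient_bounds[OF \<kappa>])
  let ?c = "cof b" let ?G = "real (card (carrier S))"
  have c: "l1 ?c" by (rule l1_cof[OF b])
  define CH where "CH = 1/2 * B * size_const * (kmax * (N ?c)\<^sup>2 + 2 * N ?c)"
  define CF where "CF = ?G * (B * kmax * N ?c + B + 3 * (N ?c)\<^sup>2)"
  define C where "C = max CH CF"
  have nn: "0 \<le> size_const" "0 \<le> N ?c" "0 < kmax" using lsize_le(1) N_nonneg kmax(2) by auto
  have CH0: "0 \<le> CH" using B nn unfolding CH_def by (intro mult_nonneg_nonneg add_nonneg_nonneg) auto
  show ?thesis
  proof (rule that[of C])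
    show "0 \<le> C" using CH0 by (simp add: C_def)
    show "\<forall>h \<eta> n. \<eta> \<in> X0s S \<nu> kb \<longrightarrow> CJ_norm S kb h \<le> n \<longrightarrow> XN \<eta> \<le> n \<longrightarrow> residual_bound (DZ (\<kappa>, b) (h, \<eta>)) (C * n)"
    proof (intro allI impI)
      fix h \<eta> and n :: real
      assume \<eta>: "\<eta> \<in> X0s S \<nu> kb" "XN \<eta> \<le> n" and h: "CJ_norm S kb h \<le> n"
      let ?u = "sigma S \<eta>"
      have u: "l1 ?u" and Nu: "N ?u \<le> n" using l1_sig[OF \<eta>(1)] N_sig[OF \<eta>] by auto
      have n0: "0 \<le> n" using CJ_norm_nonneg h order_trans by blast
      have d0: "0 \<le> n * kmax" using n0 nn by simp
      have rb: "cmod (ddPfun (Del k \<kappa>) * Del k h * dc k j) \<le> (B * (n * kmax)) * lsz k" if "k \<noteq> 0" "j \<in> J" for k j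
        using r that Del_le_kmax[OF h, of k] d0 by blast
      have qb: "cmod (dPfun \<gamma> (Del k \<kappa>) * dc k j) \<le> B * lsz k" if "k \<noteq> 0" "j \<in> J" for k j
        using q that by blast
      have H: "cmod (fst (DZ (\<kappa>, b) (h, \<eta>)) j) \<le> CH * n" if j: "j \<in> J" for j
      proof -
        have uc: "N ?u * N ?c \<le> n * N ?c" using Nu nn by (intro mult_right_mono) auto
        have "cmod (fst (DZ (\<kappa>, b) (h, \<eta>)) j) \<le> 1/2 * (cmod (qsum (\<lambda>k. ddPfun (Del k \<kappa>) * Del k h * dc k j) ?c ?c)
           + cmod (qsum (\<lambda>k. dPfun \<gamma> (Del k \<kappa>) * dc k j) ?u ?c) + cmod (qsum (\<lambda>k. dPfun \<gamma> (Del k \<kappa>) * dc k j) ?c ?u))"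
          using j unfolding DZ_def DH_def fst_conv snd_conv if_P[OF j] norm_mult
          by (intro mult_mono order_trans[OF norm_triangle_ineq] add_mono order_refl norm_triangle_ineq) auto
        also have "\<dots> \<le> 1/2 * (B * (n * kmax) * (size_const * N ?c * N ?c) + B * (size_const * N ?u * N ?c)
           + B * (size_const * N ?c * N ?u))"
          using B d0 by (intro mult_left_mono add_mono qsum_bound c u rb qb j) auto
        also have "\<dots> = 1/2 * B * size_const * (kmax * (N ?c)\<^sup>2 * n + 2 * (N ?u * N ?c))"
          by (simp add: algebra_simps power2_eq_square)
        also have "\<dots> \<le> 1/2 * B * size_const * (kmax * (N ?c)\<^sup>2 * n + 2 * (n * N ?c))"
          using B nn by (intro mult_left_mono add_mono order_refl uc) auto
        also have "\<dots> = CH * n" by (simp add: CH_def algebra_simps)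
        finally show ?thesis .
      qed
      have F: "(\<Sum>k\<in>F. cmod (snd (DZ (\<kappa>, b) (h, \<eta>)) k) * w k / lsz k) \<le> CF * n"
        if F: "finite F" "F \<subseteq> Z0 S" for F
      proof -
        define f where "f k = dPfun \<gamma> (Del k \<kappa>) * Del k h * ?c k + Pfun \<gamma> (Del k \<kappa>) * ?u k + Dcube ?c ?u k" for k
        have le: "cmod (f k) \<le> lsz k * (B * (n * kmax) * cmod (?c k) + B * cmod (?u k)) + cmod (Dcube ?c ?u k)"
          if k: "k \<in> Z0 S" for k
        proof -
          have k0: "k \<noteq> 0" using k by (simp add: Z0_def)
          have "cmod (dPfun \<gamma> (Del k \<kappa>)) * cmod (Del k h) \<le> B * (lsz k * (n * kmax))"
            using dPfun k0 Del_le_kmax[OF h, of k] B by (intro mult_mono) auto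
          then have 1: "cmod (dPfun \<gamma> (Del k \<kappa>)) * cmod (Del k h) * cmod (?c k) \<le> B * (lsz k * (n * kmax)) * cmod (?c k)"
            by (intro mult_right_mono) auto
          have 2: "cmod (Pfun \<gamma> (Del k \<kappa>)) * cmod (?u k) \<le> B * lsz k * cmod (?u k)"
            using P k0 by (intro mult_right_mono) auto
          have "cmod (f k) \<le> cmod (dPfun \<gamma> (Del k \<kappa>)) * cmod (Del k h) * cmod (?c k)
              + cmod (Pfun \<gamma> (Del k \<kappa>)) * cmod (?u k) + cmod (Dcube ?c ?u k)"
            unfolding f_def norm_mult[symmetric]
            by (intro order_trans[OF norm_triangle_ineq] add_mono order_refl norm_triangle_ineq)
          then show ?thesis using 1 2 by (simp add: algebra_simps)
        qed
        have "(\<Sum>k\<in>F. cmod (snd (DZ (\<kappa>, b) (h, \<eta>)) k) * w k / lsz k)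
            = (\<Sum>k\<in>F. cmod (of_nat (card (Orb S k)) * f k) * w k / lsz k)"
          using F by (intro sum.cong) (auto simp: DZ_def DF_def f_def)
        also have "\<dots> \<le> ?G * (B * (n * kmax) * N ?c + B * N ?u + N (Dcube ?c ?u))"
          using B d0 by (intro residual_sum_bound[OF c u l1_Dcube[OF c u] _ B le F]) auto
        also have "\<dots> \<le> ?G * (B * (n * kmax) * N ?c + B * n + 3 * (N ?c)\<^sup>2 * n)"
        proof -
          have "N (Dcube ?c ?u) \<le> 3 * (N ?c)\<^sup>2 * n"
            using N_Dcube[OF c u] mult_left_mono[OF Nu, of "3 * (N ?c)\<^sup>2"] by simp
          then show ?thesis using Nu B by (intro mult_left_mono add_mono order_refl) auto
        qed
        also have "\<dots> = CF * n" by (simp add: CF_def algebra_simps)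
        finally show ?thesis .
      qed
      have "CH * n \<le> C * n" "CF * n \<le> C * n" using n0 by (auto simp: C_def intro!: mult_right_mono)
      then show "residual_bound (DZ (\<kappa>, b) (h, \<eta>)) (C * n)" unfolding residual_bound_def using H F by (meson order_trans)
    qed
  qed
qed

lemma zmap_bounded:
  assumes \<kappa>: "\<kappa> \<in> CJ_pos S" and b: "b \<in> X0s S \<nu> kb"
  obtains C where "residual_bound (zmap S \<gamma> m (\<kappa>, b)) C"
proof -
  obtain B where B: "0 \<le> B"
    and q: "\<forall>k j. k \<noteq> 0 \<longrightarrow> j \<in> J \<longrightarrow> cmod (dPfun \<gamma> (Del k \<kappa>) * dc k j) \<le> B * lsz k"
    and "\<forall>k j h d. k \<noteq> 0 \<longrightarrow> j \<in> J \<longrightarrow> cmod (Del k h) \<le> lsz k * d \<longrightarrow> 0 \<le> d \<longrightarrow>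
       cmod (ddPfun (Del k \<kappa>) * Del k h * dc k j) \<le> (B * d) * lsz k"
    and "\<forall>k. k \<noteq> 0 \<longrightarrow> cmod (dPfun \<gamma> (Del k \<kappa>)) \<le> B"
    and P: "\<forall>k. k \<noteq> 0 \<longrightarrow> cmod (Pfun \<gamma> (Del k \<kappa>)) \<le> B * lsz k"
    by (rule coefficient_bounds[OF \<kappa>])
  let ?c = "cof b" let ?c3 = "dconv ?c (dconv ?c ?c)" let ?G = "real (card (carrier S))"
  have c: "l1 ?c" by (rule l1_cof[OF b])
  have c3: "l1 ?c3" using c by (intro l1_dconv)
  define CH where "CH = B * (size_const * N ?c * N ?c)"
  define CF where "CF = ?G * (B * N ?c + 0 * N ?c + N ?c3)"
  have H: "cmod (fst (zmap S \<gamma> m (\<kappa>, b)) j) \<le> max CH CF" if j: "j \<in> J" for j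
  proof -
    have "cmod (qsum (\<lambda>k. dPfun \<gamma> (Del k \<kappa>) * dc k j) ?c ?c) \<le> CH"
      unfolding CH_def using q j B by (intro qsum_bound c) auto
    then have "cmod (qsum (\<lambda>k. dPfun \<gamma> (Del k \<kappa>) * dc k j) ?c ?c) / 2 \<le> max CH CF"
      using norm_ge_zero[of "qsum (\<lambda>k. dPfun \<gamma> (Del k \<kappa>) * dc k j) ?c ?c"] max.cobounded1[of CH CF]
      by linarith
    then show ?thesis using j by (simp add: zmap_eq[OF \<kappa>] norm_mult)
  qed
  have F: "(\<Sum>k\<in>F. cmod (snd (zmap S \<gamma> m (\<kappa>, b)) k) * w k / lsz k) \<le> max CH CF"
    if F: "finite F" "F \<subseteq> Z0 S" for F
  proof -
    define f where "f k = Pfun \<gamma> (Del k \<kappa>) * ?c k + ?c3 k" for k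
    have le: "cmod (f k) \<le> lsz k * (B * cmod (?c k) + 0 * cmod (?c k)) + cmod (?c3 k)" if "k \<in> Z0 S" for k
    proof -
      have k0: "k \<noteq> 0" using that by (simp add: Z0_def)
      have "cmod (Pfun \<gamma> (Del k \<kappa>)) * cmod (?c k) \<le> B * lsz k * cmod (?c k)"
        using P k0 by (intro mult_right_mono) auto
      then show ?thesis
        using norm_triangle_ineq[of "Pfun \<gamma> (Del k \<kappa>) * ?c k" "?c3 k"]
        by (simp add: f_def norm_mult mult_ac)
    qed
    have "(\<Sum>k\<in>F. cmod (snd (zmap S \<gamma> m (\<kappa>, b)) k) * w k / lsz k)
        = (\<Sum>k\<in>F. cmod (of_nat (card (Orb S k)) * f k) * w k / lsz k)"
      using F by (intro sum.cong) (auto simp: zmap_eq[OF \<kappa>] f_def)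
    also have "\<dots> \<le> CF" unfolding CF_def by (rule residual_sum_bound[OF c c c3 B order_refl le F])
    finally show ?thesis by simp
  qed
  show ?thesis by (rule that[of "max CH CF"]) (use H F in \<open>auto simp: residual_bound_def\<close>)
qed

lemma DZ_add:
  assumes \<kappa>: "\<kappa> \<in> CJ_pos S" and b: "b \<in> X0s S \<nu> kb"
    and v: "snd v \<in> X0s S \<nu> kb" and v': "snd v' \<in> X0s S \<nu> kb"
  shows "DZ (\<kappa>, b) (v + v') = DZ (\<kappa>, b) v + DZ (\<kappa>, b) v'"
proof -
  obtain B where B: "0 \<le> B"
    and q: "\<forall>k j. k \<noteq> 0 \<longrightarrow> j \<in> J \<longrightarrow> cmod (dPfun \<gamma> (Del k \<kappa>) * dc k j) \<le> B * lsz k"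
    and r: "\<forall>k j h d. k \<noteq> 0 \<longrightarrow> j \<in> J \<longrightarrow> cmod (Del k h) \<le> lsz k * d \<longrightarrow> 0 \<le> d \<longrightarrow>
       cmod (ddPfun (Del k \<kappa>) * Del k h * dc k j) \<le> (B * d) * lsz k"
    and "\<forall>k. k \<noteq> 0 \<longrightarrow> cmod (dPfun \<gamma> (Del k \<kappa>)) \<le> B"
    and "\<forall>k. k \<noteq> 0 \<longrightarrow> cmod (Pfun \<gamma> (Del k \<kappa>)) \<le> B * lsz k"
    by (rule coefficient_bounds[OF \<kappa>])
  let ?c = "cof b" let ?u = "sigma S (snd v)" let ?u' = "sigma S (snd v')"
  have c: "l1 ?c" by (rule l1_cof[OF b])
  have u: "l1 ?u" "l1 ?u'" using l1_sig v v' by auto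
  have su: "sigma S (snd v + snd v') = (\<lambda>k. ?u k + ?u' k)"
    by (rule ext) (simp add: plus_fun_def sigma_add)
  have H: "DH \<kappa> ?c (fst v + fst v') (\<lambda>k. ?u k + ?u' k) j = DH \<kappa> ?c (fst v) ?u j + DH \<kappa> ?c (fst v') ?u' j" for j
  proof (cases "j \<in> J")
    case True
    define d where "d = max (CJ_norm S kb (fst v)) (CJ_norm S kb (fst v')) * kmax"
    have d: "0 \<le> d" using CJ_norm_nonneg[of "fst v"] kmax(2) by (simp add: d_def le_max_iff_disj)
    have dd: "cmod (Del k (fst v)) \<le> lsz k * d" "cmod (Del k (fst v')) \<le> lsz k * d" for k
      unfolding d_def by (intro Del_le_kmax; simp)+
    have rb: "cmod (ddPfun (Del k \<kappa>) * Del k (fst v) * dc k j) \<le> (B * d) * lsz k"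
      "cmod (ddPfun (Del k \<kappa>) * Del k (fst v') * dc k j) \<le> (B * d) * lsz k" if "k \<noteq> 0" for k
      using r that True dd d by blast+
    have qb: "cmod (dPfun \<gamma> (Del k \<kappa>) * dc k j) \<le> B * lsz k" if "k \<noteq> 0" for k
      using q that True by blast
    have Bd: "0 \<le> B * d" using B d by simp
    have 1: "qsum (\<lambda>k. ddPfun (Del k \<kappa>) * Del k (fst v + fst v') * dc k j) ?c ?c =
        qsum (\<lambda>k. ddPfun (Del k \<kappa>) * Del k (fst v) * dc k j) ?c ?c + qsum (\<lambda>k. ddPfun (Del k \<kappa>) * Del k (fst v') * dc k j) ?c ?c"
      using qsum_add(1)[OF c c c Bd rb] by (simp add: Delta_add distrib_left distrib_right)
    let ?q = "\<lambda>k. dPfun \<gamma> (Del k \<kappa>) * dc k j"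
    have 2: "qsum ?q (\<lambda>k. ?u k + ?u' k) ?c = qsum ?q ?u ?c + qsum ?q ?u' ?c"
      by (rule qsum_add(2)[OF u c B qb qb])
    have 3: "qsum ?q ?c (\<lambda>k. ?u k + ?u' k) = qsum ?q ?c ?u + qsum ?q ?c ?u'"
      by (rule qsum_add(3)[OF u c B qb qb])
    show ?thesis using True unfolding DH_def 1 2 3
      by (simp add: distrib_left distrib_right add_divide_distrib)
  qed (auto simp: DH_def)
  have C: "Dcube ?c (\<lambda>k. ?u k + ?u' k) k = Dcube ?c ?u k + Dcube ?c ?u' k" for k
    using c u by (simp add: Dcube_def dconv_add_left dconv_add_right l1_dconv)
  have F: "DF \<kappa> ?c (fst v + fst v') (\<lambda>k. ?u k + ?u' k) k = DF \<kappa> ?c (fst v) ?u k + DF \<kappa> ?c (fst v') ?u' k" for k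
    unfolding DF_def C Delta_add by (simp add: distrib_left distrib_right)
  show ?thesis using H F by (simp add: DZ_def su prod_eq_iff fun_eq_iff)
qed

lemma DZ_scale:
  "DZ x (\<lambda>j. a * h j, \<lambda>k. a * \<eta> k) = (\<lambda>j. a * fst (DZ x (h, \<eta>)) j, \<lambda>k. a * snd (DZ x (h, \<eta>)) k)"
proof -
  have ddPfun: "ddPfun y * (a * d) * z = a * (ddPfun y * d * z)" for y d z by simp
  have s: "sigma S (\<lambda>k. a * \<eta> k) = (\<lambda>k. a * sigma S \<eta> k)" by (rule ext) (rule sigma_scale)
  have D: "Dcube c (\<lambda>k. a * u k) k = a * Dcube c u k" for c u k
    by (simp add: Dcube_def dconv_scale_left dconv_scale_right distrib_left)
  show ?thesis
    unfolding DZ_def DH_def DF_def fst_conv snd_conv s Delta_scale ddPfun qsum_scale D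
    by (auto simp: distrib_left fun_eq_iff)
qed

end

section \<open>Differentiability of the fixed point map\<close>

text \<open>For \<open>y > 0\<close> the sign of \<open>P y\<close> is that of \<open>y\<^sup>2 -
  \<gamma>\<^sup>2 * y + \<gamma>\<^sup>2\<close>. If \<open>\<gamma> > 2\<close>, then
  \<open>y_P \<gamma>\<close> is the larger root; if \<open>\<gamma> \<le> 2\<close>, the
  polynomial is at least \<open>(y - \<gamma>)\<^sup>2\<close>.\<close>

lemma P_quadratic_pos:
  fixes \<gamma> y :: real
  assumes \<gamma>: "0 < \<gamma>" and y: "y_P \<gamma> < y"
  shows "0 < y" "0 < y / \<gamma>\<^sup>2 - 1 + inverse y"
proof -
  have "0 < y \<and> 0 < y\<^sup>2 - \<gamma>\<^sup>2 * y + \<gamma>\<^sup>2"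
  proof (cases "\<gamma> \<le> 2")
    case True
    then have y1: "\<gamma> < y" using y by (simp add: y_P_def)
    then have y0: "0 < y" using \<gamma> by simp
    have "\<gamma> * \<gamma> * y \<le> 2 * \<gamma> * y" using True \<gamma> y0 by (intro mult_right_mono) auto
    moreover have "0 < (y - \<gamma>)\<^sup>2" using y1 by simp
    ultimately show ?thesis using y0 by (simp add: power2_eq_square algebra_simps)
  next
    case False
    then have g: "2 < \<gamma>" by simp
    define D where "D = sqrt (\<gamma> ^ 4 - 4 * \<gamma>\<^sup>2)"
    have yp: "(\<gamma>\<^sup>2 + D) / 2 < y" using y False by (simp add: y_P_def D_def)
    have "2\<^sup>2 \<le> \<gamma>\<^sup>2" using g by (intro power_mono) auto
    then have "4 * \<gamma>\<^sup>2 \<le> \<gamma>\<^sup>2 * \<gamma>\<^sup>2" by (intro mult_right_mono) auto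
    then have D: "0 \<le> D" "D\<^sup>2 = \<gamma> ^ 4 - 4 * \<gamma>\<^sup>2" by (simp_all add: D_def power2_eq_square power4_eq_xxxx)
    have "0 < (2 * y - \<gamma>\<^sup>2 - D) * (2 * y - \<gamma>\<^sup>2 + D)" using yp D(1) by (intro mult_pos_pos) auto
    also have "\<dots> = (2 * y - \<gamma>\<^sup>2)\<^sup>2 - D\<^sup>2" by (simp add: power2_eq_square algebra_simps)
    also have "\<dots> = 4 * (y\<^sup>2 - \<gamma>\<^sup>2 * y + \<gamma>\<^sup>2)"
      unfolding D(2) by (simp add: power2_eq_square power4_eq_xxxx algebra_simps)
    finally have "0 < y\<^sup>2 - \<gamma>\<^sup>2 * y + \<gamma>\<^sup>2" by simp
    moreover have "0 < (\<gamma>\<^sup>2 + D) / 2" using g D(1) by (simp add: add_pos_nonneg)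
    then have "0 < y" using yp by (rule less_trans)
    ultimately show ?thesis by simp
  qed
  then have y0: "0 < y" and q: "0 < y\<^sup>2 - \<gamma>\<^sup>2 * y + \<gamma>\<^sup>2" by auto
  show "0 < y" by (rule y0)
  have "y / \<gamma>\<^sup>2 - 1 + inverse y = (y\<^sup>2 - \<gamma>\<^sup>2 * y + \<gamma>\<^sup>2) / (\<gamma>\<^sup>2 * y)"
    using y0 \<gamma> by (simp add: field_simps power2_eq_square)
  then show "0 < y / \<gamma>\<^sup>2 - 1 + inverse y" using q y0 \<gamma> by simp
qed

locale fixed_point_problem = zero_problem S \<nu> kb \<gamma> m for S :: "'g crystal_group" and \<nu> kb \<gamma> m +
  fixes K :: real and A :: cmatrix
  assumes K: "sqrt (y_P \<gamma>) < K"
begin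

abbreviation idx :: "(nat + int^3) set" where "idx \<equiv> mat_idx S kb K"
abbreviation Ac :: "state \<Rightarrow> state" where "Ac \<equiv> Acal S \<gamma> kb K A"
abbreviation T :: "state \<Rightarrow> state" where "T \<equiv> Tmap S \<gamma> m kb K A"
abbreviation V :: "(nat \<Rightarrow> complex) cnspace" where "V \<equiv> CJ_space S kb"
abbreviation X :: "coeffs cnspace" where "X \<equiv> X0_space S \<nu> kb"

lemma finite_Z0K: "finite (Z0K S kb K)"
proof -
  obtain a where a: "0 < a" "\<forall>k. lsz k * a \<le> Delta (csys S) k kb" by (rule Delta_kb_ge)
  have "Z0K S kb K \<subseteq> {k. lsz k \<le> K\<^sup>2 / a}"
  proof
    fix k assume "k \<in> Z0K S kb K"
    then have "knorm S kb k \<le> K" by (simp add: Z0K_def)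
    then have "(knorm S kb k)\<^sup>2 \<le> K\<^sup>2" using knorm_nonneg by (intro power_mono)
    moreover have "(knorm S kb k)\<^sup>2 = Delta (csys S) k kb"
      using norm_Lmat_ivec[OF kb, of k] by (simp add: knorm_eq)
    ultimately have "lsz k * a \<le> K\<^sup>2" using a(2)[rule_format, of k] by linarith
    then show "k \<in> {k. lsz k \<le> K\<^sup>2 / a}" using a(1) by (simp add: pos_le_divide_eq)
  qed
  then show ?thesis using finite_lsize_le by (rule finite_subset)
qed

lemma finite_idx: "finite idx"
  using finite_Z0K by (simp add: mat_idx_def)

abbreviation Pb :: "int^3 \<Rightarrow> complex" where "Pb k \<equiv> Pfun \<gamma> (of_real (Delta (csys S) k kb))"

text \<open>For indices of large size the linear part of \<open>P\<close> exceeds twice its constant term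
  and gives growth like the symbol. The finitely many other tail indices have a positive
  minimum, because their symbols exceed \<open>y_P \<gamma>\<close>.\<close>

lemma tail_lower_bound:
  obtains c where "0 < c" "\<forall>k. k \<in> Z0 S \<longrightarrow> k \<notin> Z0K S kb K \<longrightarrow> c * lsz k \<le> cmod (Pb k)"
proof -
  obtain a where a: "0 < a" "\<forall>k. lsz k * a \<le> Delta (csys S) k kb" by (rule Delta_kb_ge)
  define p where "p k = Delta (csys S) k kb / \<gamma>\<^sup>2 - 1 + inverse (Delta (csys S) k kb)" for k
  have Pb: "cmod (Pb k) = \<bar>p k\<bar>" for k
  proof -
    have "Pb k = of_real (p k)" by (simp add: Pfun_def p_def)
    then show ?thesis by (simp only: norm_of_real)
  qed
  let ?tail = "{k \<in> Z0 S. k \<notin> Z0K S kb K}"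
  have pos: "0 < p k" "0 < Delta (csys S) k kb" if "k \<in> ?tail" for k
  proof -
    have "K < knorm S kb k" using that by (auto simp: Z0K_def not_le)
    then have "sqrt (y_P \<gamma>) < knorm S kb k" using K by linarith
    then have "y_P \<gamma> < Delta (csys S) k kb" by (simp add: knorm_def)
    then show "0 < p k" "0 < Delta (csys S) k kb" using P_quadratic_pos[OF gamma] unfolding p_def by auto
  qed
  \<comment> \<open>beyond this size the symbol exceeds \<open>2 * \<gamma>\<^sup>2\<close>, so the linear
    part of \<open>P\<close> exceeds 2\<close>
  define F where "F = {k \<in> ?tail. lsz k \<le> 2 * \<gamma>\<^sup>2 / a}"
  have fin: "finite F" unfolding F_def using finite_lsize_le by (rule rev_finite_subset) auto
  define c where "c = Min (insert (a / (2 * \<gamma>\<^sup>2)) ((\<lambda>k. p k / lsz k) ` F))"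
  have l: "1 \<le> lsz k" if "k \<in> ?tail" for k using that lsize_ge_1 by (auto simp: Z0_def)
  have "0 < p k / lsz k" if "k \<in> F" for k
    using pos(1)[of k] l[of k] that by (intro divide_pos_pos) (auto simp: F_def)
  then have c0: "0 < c" unfolding c_def using fin a gamma by auto
  have "c * lsz k \<le> cmod (Pb k)" if k: "k \<in> ?tail" for k
  proof (cases "k \<in> F")
    case True
    then have "c \<le> p k / lsz k" unfolding c_def using fin by (intro Min_le) auto
    then show ?thesis using l[OF k] unfolding Pb by (simp add: pos_le_divide_eq)
  next
    case False
    then have "2 * \<gamma>\<^sup>2 / a < lsz k" using k by (auto simp: F_def)
    then have "2 * \<gamma>\<^sup>2 < lsz k * a" using a(1) by (simp add: pos_divide_less_eq)
    then have "2 * \<gamma>\<^sup>2 < Delta (csys S) k kb" using a(2)[rule_format, of k] by linarith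
    then have "1 \<le> Delta (csys S) k kb / (2 * \<gamma>\<^sup>2)" using gamma by (simp add: pos_le_divide_eq)
    moreover have "0 < inverse (Delta (csys S) k kb)" using pos(2)[OF k] by simp
    moreover have "Delta (csys S) k kb / \<gamma>\<^sup>2 = 2 * (Delta (csys S) k kb / (2 * \<gamma>\<^sup>2))" by simp
    ultimately have "Delta (csys S) k kb / (2 * \<gamma>\<^sup>2) \<le> p k" unfolding p_def by linarith
    moreover have "lsz k * a / (2 * \<gamma>\<^sup>2) \<le> Delta (csys S) k kb / (2 * \<gamma>\<^sup>2)"
      using a(2) by (intro divide_right_mono) auto
    moreover have "c \<le> a / (2 * \<gamma>\<^sup>2)" unfolding c_def using fin by (intro Min_le) auto
    then have "c * lsz k \<le> a / (2 * \<gamma>\<^sup>2) * lsz k" using l[OF k] by (intro mult_right_mono) auto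
    ultimately have "c * lsz k \<le> p k" by (simp add: mult.commute)
    then show ?thesis unfolding Pb by simp
  qed
  then show ?thesis using that c0 by blast
qed

text \<open>Dividing by \<open>P\<close> on the tail regains the factor \<open>lsize\<close> that
  \<open>residual_bound\<close> gives away, and the matrix part is bounded because it has
  finitely many entries.\<close>

lemma Acal_bounded:
  obtains C where "0 \<le> C"
    "\<forall>y B. 0 \<le> B \<longrightarrow> residual_bound y B \<longrightarrow> fst (Ac y) \<in> CJ S \<and> snd (Ac y) \<in> X0s S \<nu> kb \<and>
       CJ_norm S kb (fst (Ac y)) \<le> C * B \<and> XN (snd (Ac y)) \<le> C * B"
proof -
  obtain c where c: "0 < c" "\<forall>k. k \<in> Z0 S \<longrightarrow> k \<notin> Z0K S kb K \<longrightarrow> c * lsz k \<le> cmod (Pb k)"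
    by (rule tail_lower_bound)
  \<comment> \<open>bound of an entry of \<open>y\<close> relative to \<open>B\<close>; the weight
    \<open>w\<close> is at least 1\<close>
  define g where "g l = (case l of Inl j \<Rightarrow> 1 | Inr k \<Rightarrow> lsz k)" for l :: "nat + int^3"
  define row where "row i = (\<Sum>l\<in>idx. cmod (A i l) * g l)" for i
  have g0: "0 \<le> g l" for l by (cases l) (auto simp: g_def lsize_nonneg)
  have row0: "0 \<le> row i" for i unfolding row_def by (intro sum_nonneg mult_nonneg_nonneg g0) simp
  define C1 where "C1 = (\<Sum>j\<in>J. row (Inl j) / kb j)"
  define C2 where "C2 = (\<Sum>k\<in>Z0K S kb K. row (Inr k) * om k)"
  define C where "C = max C1 (C2 + 1 / c)"
  have C10: "0 \<le> C1" unfolding C1_def using kb_pos row0 by (intro sum_nonneg divide_nonneg_pos) auto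
  show ?thesis
  proof (rule that[of C])
    show "0 \<le> C" using C10 by (simp add: C_def)
    show "\<forall>y B. 0 \<le> B \<longrightarrow> residual_bound y B \<longrightarrow> fst (Ac y) \<in> CJ S \<and> snd (Ac y) \<in> X0s S \<nu> kb \<and>
       CJ_norm S kb (fst (Ac y)) \<le> C * B \<and> XN (snd (Ac y)) \<le> C * B"
    proof (intro allI impI)
      fix y :: state and B :: real
      assume B: "0 \<le> B" and y: "residual_bound y B"
      have yF: "(\<Sum>k\<in>F. cmod (snd y k) * w k / lsz k) \<le> B" if "finite F" "F \<subseteq> Z0 S" for F
        using y that by (simp add: residual_bound_def)
      have yl: "cmod (case_sum (fst y) (snd y) l) \<le> g l * B" if "l \<in> idx" for l
      proof (cases l)
        case (Inl j)
        then show ?thesis using y that by (auto simp: residual_bound_def mat_idx_def g_def)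
      next
        case (Inr k)
        then have k: "k \<in> Z0 S" using that by (auto simp: mat_idx_def Z0K_def)
        then have l: "1 \<le> lsz k" using lsize_ge_1 by (auto simp: Z0_def)
        have "cmod (snd y k) * 1 \<le> cmod (snd y k) * w k" using w_ge_1 by (intro mult_left_mono) auto
        also have "\<dots> \<le> B * lsz k" using yF[of "{k}"] k l by (simp add: pos_divide_le_eq)
        finally show ?thesis by (simp add: Inr g_def mult.commute)
      qed
      have rowB: "cmod (\<Sum>l\<in>idx. A i l * case_sum (fst y) (snd y) l) \<le> row i * B" for i
      proof -
        have "cmod (\<Sum>l\<in>idx. A i l * case_sum (fst y) (snd y) l)
          \<le> (\<Sum>l\<in>idx. cmod (A i l) * cmod (case_sum (fst y) (snd y) l))"
          unfolding norm_mult[symmetric] by (rule norm_sum)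
        also have "\<dots> \<le> (\<Sum>l\<in>idx. cmod (A i l) * (g l * B))"
          by (intro sum_mono mult_left_mono yl) auto
        finally show ?thesis by (simp add: row_def sum_distrib_right mult.assoc)
      qed
      have f: "fst (Ac y) j = (if j \<in> J then (\<Sum>l\<in>idx. A (Inl j) l * case_sum (fst y) (snd y) l) else 0)" for j
        by (simp add: Acal_def mat_act_def Let_def)
      have CJ: "fst (Ac y) \<in> CJ S" by (simp add: CJ_def f)
      have "CJ_norm S kb (fst (Ac y)) \<le> C1 * B"
        unfolding CJ_norm_le_iff
      proof
        fix j assume j: "j \<in> J"
        have "cmod (fst (Ac y) j) \<le> row (Inl j) / kb j * B * kb j" using rowB[of "Inl j"] kb_pos[OF j] j by (simp add: f)
        also have "row (Inl j) / kb j \<le> C1" unfolding C1_def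
          by (rule member_le_sum[OF j]) (use kb_pos row0 in \<open>auto intro!: divide_nonneg_pos\<close>)
        finally show "cmod (fst (Ac y) j) \<le> C1 * B * kb j" using B kb_pos[OF j] by (auto simp: mult_right_mono)
      qed
      also have "\<dots> \<le> C * B" using B by (intro mult_right_mono) (auto simp: C_def)
      finally have n1: "CJ_norm S kb (fst (Ac y)) \<le> C * B" .
      have z: "snd (Ac y) k = 0" if "k \<notin> Z0 S" for k
        using that by (auto simp: Acal_def Z0K_def)
      have s: "(\<Sum>k\<in>F. cmod (snd (Ac y) k) * om k) \<le> (C2 + 1 / c) * B" if F: "finite F" "F \<subseteq> Zind S" for F
      proof -
        have "(\<Sum>k\<in>F \<inter> Z0K S kb K. cmod (snd (Ac y) k) * om k)
            \<le> (\<Sum>k\<in>Z0K S kb K. cmod (snd (Ac y) k) * om k)"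
          using finite_Z0K omega_ge(3) by (intro sum_mono2) (auto simp: less_imp_le)
        also have "\<dots> \<le> (\<Sum>k\<in>Z0K S kb K. row (Inr k) * B * om k)"
          using rowB omega_ge(3)
          by (intro sum_mono mult_right_mono) (auto simp: Acal_def mat_act_def Let_def less_imp_le)
        also have "\<dots> = C2 * B" unfolding C2_def sum_distrib_right by (simp add: mult_ac)
        finally have 1: "(\<Sum>k\<in>F \<inter> Z0K S kb K. cmod (snd (Ac y) k) * om k) \<le> C2 * B" .
        let ?F = "(F - Z0K S kb K) \<inter> Z0 S"
        have "(\<Sum>k\<in>F - Z0K S kb K. cmod (snd (Ac y) k) * om k) = (\<Sum>k\<in>?F. cmod (snd (Ac y) k) * om k)"
          using F z by (intro sum.mono_neutral_right) auto
        also have "\<dots> \<le> (\<Sum>k\<in>?F. 1 / c * (cmod (snd y k) * w k / lsz k))"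
        proof (rule sum_mono)
          fix k assume k: "k \<in> ?F"
          then have l: "1 \<le> lsz k" using lsize_ge_1 by (auto simp: Z0_def)
          have cl: "0 < c * lsz k" using c l by simp
          have cP: "c * lsz k \<le> cmod (Pb k)" using c(2) k by blast
          have "cmod (snd (Ac y) k) * om k = cmod (snd y k) * w k / cmod (Pb k)"
            using k card_Orb_pos[of k] by (simp add: Acal_def omega_eq norm_divide norm_mult)
          also have "\<dots> \<le> cmod (snd y k) * w k / (c * lsz k)"
            using cP cl w_pos[of k] by (intro divide_left_mono) (auto intro!: mult_pos_pos)
          finally show "cmod (snd (Ac y) k) * om k \<le> 1 / c * (cmod (snd y k) * w k / lsz k)" by simp
        qed
        also have "\<dots> = 1 / c * (\<Sum>k\<in>?F. cmod (snd y k) * w k / lsz k)" by (simp only: sum_distrib_left)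
        also have "\<dots> \<le> 1 / c * B" using yF[of ?F] F c by (intro mult_left_mono) auto
        finally have 2: "(\<Sum>k\<in>F - Z0K S kb K. cmod (snd (Ac y) k) * om k) \<le> 1 / c * B" .
        have "(\<Sum>k\<in>F. cmod (snd (Ac y) k) * om k) = (\<Sum>k\<in>F \<inter> Z0K S kb K. cmod (snd (Ac y) k) * om k)
          + (\<Sum>k\<in>F - Z0K S kb K. cmod (snd (Ac y) k) * om k)"
          by (rule sum.Int_Diff[OF F(1)])
        then show ?thesis using 1 2 by (simp add: distrib_right)
      qed
      have "(C2 + 1 / c) * B \<le> C * B" using B by (intro mult_right_mono) (auto simp: C_def)
      then show "fst (Ac y) \<in> CJ S \<and> snd (Ac y) \<in> X0s S \<nu> kb \<and>
         CJ_norm S kb (fst (Ac y)) \<le> C * B \<and> XN (snd (Ac y)) \<le> C * B"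
        using CJ n1 X0s_I[OF z s] by auto
    qed
  qed
qed

lemma Acal_add: "Ac (x + y) = Ac x + Ac y"
proof -
  have "case_sum (fst (x + y)) (snd (x + y)) l = case_sum (fst x) (snd x) l + case_sum (fst y) (snd y) l" for l
    by (cases l) auto
  then show ?thesis
    by (auto simp: Acal_def mat_act_def Let_def prod_eq_iff fun_eq_iff distrib_left sum.distrib add_divide_distrib)
qed

lemma Acal_scale: "Ac (\<lambda>j. a * h j, \<lambda>k. a * \<eta> k) = (\<lambda>j. a * fst (Ac (h, \<eta>)) j, \<lambda>k. a * snd (Ac (h, \<eta>)) k)"
proof -
  have "case_sum (fst (\<lambda>j. a * h j, \<lambda>k. a * \<eta> k)) (snd (\<lambda>j. a * h j, \<lambda>k. a * \<eta> k)) l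
      = a * case_sum (fst (h, \<eta>)) (snd (h, \<eta>)) l" for l by (cases l) auto
  then show ?thesis
    by (auto simp: Acal_def mat_act_def Let_def prod_eq_iff fun_eq_iff sum_distrib_left mult_ac)
qed

lemma Acal_minus: "Ac (x - y) = Ac x - Ac y"
  using Acal_add[of "x - y" y] by simp

definition DT :: "state \<Rightarrow> state \<Rightarrow> state" where
  "DT x v = v - Ac (DZ x v)"

lemma carP: "v \<in> vcarrier (prod_space V X) \<longleftrightarrow> fst v \<in> CJ S \<and> snd v \<in> X0s S \<nu> kb"
  by (simp add: prod_space_def CJ_space_def X0_space_def mem_Times_iff)

lemma normP: "vnorm (prod_space V X) v = max (CJ_norm S kb (fst v)) (XN (snd v))"
  by (simp add: prod_space_def CJ_space_def X0_space_def split_beta)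

lemma scaleP: "vscale (prod_space V X) a v = (\<lambda>j. a * fst v j, \<lambda>k. a * snd v k)"
  by (simp add: prod_space_def CJ_space_def X0_space_def split_beta)

lemma cn_space_P: "cn_space (prod_space V X)"
  using cn_banach_CJ cn_banach_X0 unfolding cn_banach_def by (intro cn_space_prod) auto

lemma T_carrier:
  assumes "\<kappa> \<in> CJ_pos S" "b \<in> X0s S \<nu> kb"
  shows "T (\<kappa>, b) \<in> vcarrier (prod_space V X)"
proof -
  interpret P: cn_space "prod_space V X" by (rule cn_space_P)
  obtain C where C: "residual_bound (zmap S \<gamma> m (\<kappa>, b)) C" by (rule zmap_bounded[OF assms])
  obtain j where "j \<in> J" using J_ne by blast
  then have C0: "0 \<le> C" using C norm_ge_zero order_trans unfolding residual_bound_def by blast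
  obtain D where "0 \<le> D" and D: "\<forall>y B. 0 \<le> B \<longrightarrow> residual_bound y B \<longrightarrow> fst (Ac y) \<in> CJ S \<and> snd (Ac y) \<in> X0s S \<nu> kb \<and>
       CJ_norm S kb (fst (Ac y)) \<le> D * B \<and> XN (snd (Ac y)) \<le> D * B" by (rule Acal_bounded)
  have "Ac (zmap S \<gamma> m (\<kappa>, b)) \<in> vcarrier (prod_space V X)" using D[rule_format, OF C0 C] by (simp add: carP)
  moreover have "(\<kappa>, b) \<in> vcarrier (prod_space V X)" using assms by (auto simp: carP CJ_pos_def)
  ultimately show ?thesis unfolding Tmap_def by (intro P.diff_mem)
qed

text \<open>The operator \<open>Acal\<close> is linear and carries the quadratic remainder of
  \<open>zmap\<close> into the space.\<close>

lemma T_has_fderiv: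
  assumes \<kappa>: "\<kappa> \<in> CJ_pos S" and b: "b \<in> X0s S \<nu> kb"
  shows "has_fderiv (prod_space V X) (prod_space V X) (CJ_pos S \<times> X0s S \<nu> kb) T (DT (\<kappa>, b)) (\<kappa>, b)"
proof -
  let ?P = "prod_space V X" let ?x = "(\<kappa>, b)"
  interpret P: cn_space ?P by (rule cn_space_P)
  obtain D where D0: "0 \<le> D" and D: "\<forall>y B. 0 \<le> B \<longrightarrow> residual_bound y B \<longrightarrow> fst (Ac y) \<in> CJ S \<and> snd (Ac y) \<in> X0s S \<nu> kb \<and>
       CJ_norm S kb (fst (Ac y)) \<le> D * B \<and> XN (snd (Ac y)) \<le> D * B" by (rule Acal_bounded)
  have DP: "Ac y \<in> vcarrier ?P" "vnorm ?P (Ac y) \<le> D * B" if "0 \<le> B" "residual_bound y B" for y B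
    using D[rule_format, OF that] by (simp_all add: carP normP)
  obtain C1 where C1: "0 \<le> C1" "\<forall>h \<eta> n. \<eta> \<in> X0s S \<nu> kb \<longrightarrow> CJ_norm S kb h \<le> n \<longrightarrow> XN \<eta> \<le> n \<longrightarrow>
      residual_bound (DZ ?x (h, \<eta>)) (C1 * n)" by (rule DZ_bounded[OF \<kappa> b])
  have Zb: "residual_bound (DZ ?x v) (C1 * vnorm ?P v)" if "v \<in> vcarrier ?P" for v
  proof -
    have "residual_bound (DZ ?x (fst v, snd v)) (C1 * vnorm ?P v)"
      by (rule C1(2)[rule_format]) (use that in \<open>simp_all add: carP normP\<close>)
    then show ?thesis by simp
  qed
  have ADZ: "Ac (DZ ?x v) \<in> vcarrier ?P" "vnorm ?P (Ac (DZ ?x v)) \<le> D * (C1 * vnorm ?P v)"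
    if "v \<in> vcarrier ?P" for v
    using DP[OF _ Zb[OF that]] C1(1) P.norm_nonneg[OF that] by auto
  have bop: "bounded_op ?P ?P (DT ?x)"
    unfolding bounded_op_def
  proof (intro conjI ballI allI exI)
    fix v assume v: "v \<in> vcarrier ?P"
    show "DT ?x v \<in> vcarrier ?P" unfolding DT_def using v ADZ(1) by (intro P.diff_mem) auto
    show "vnorm ?P (DT ?x v) \<le> (1 + D * C1) * vnorm ?P v"
      using P.norm_triangle[OF v P.minus_mem[OF ADZ(1)[OF v]]] P.norm_minus[OF ADZ(1)[OF v]] ADZ(2)[OF v]
      by (simp add: DT_def algebra_simps)
    show "DT ?x (vscale ?P a v) = vscale ?P a (DT ?x v)" for a
    proof -
      have "DZ ?x (vscale ?P a v) = (\<lambda>j. a * fst (DZ ?x v) j, \<lambda>k. a * snd (DZ ?x v) k)"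
        unfolding scaleP DZ_scale by simp
      then have "Ac (DZ ?x (vscale ?P a v)) = vscale ?P a (Ac (DZ ?x v))"
        using Acal_scale[of a "fst (DZ ?x v)" "snd (DZ ?x v)"] by (simp add: scaleP)
      then show ?thesis unfolding DT_def using P.scale_diff_right[OF v ADZ(1)[OF v]] by simp
    qed
    fix u assume u: "u \<in> vcarrier ?P"
    show "DT ?x (u + v) = DT ?x u + DT ?x v" if "v \<in> vcarrier ?P" for v
      using DZ_add[OF \<kappa> b, of u v] u that by (simp add: DT_def Acal_add carP)
  qed
  obtain C \<delta> where \<delta>: "0 < \<delta>" and C: "0 \<le> C" and rem:
    "\<forall>h \<eta> n. h \<in> CJ S \<longrightarrow> \<eta> \<in> X0s S \<nu> kb \<longrightarrow> CJ_norm S kb h \<le> n \<longrightarrow> XN \<eta> \<le> n \<longrightarrow> n \<le> \<delta> \<longrightarrow>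
      \<kappa> + h \<in> CJ_pos S \<and>
      residual_bound (zmap S \<gamma> m (\<kappa> + h, b + \<eta>) - zmap S \<gamma> m ?x - DZ ?x (h, \<eta>)) (C * n\<^sup>2)"
    by (rule zmap_remainder[OF \<kappa> b])
  show ?thesis unfolding has_fderiv_def
  proof (intro conjI allI impI bop)
    show "?x \<in> CJ_pos S \<times> X0s S \<nu> kb" using \<kappa> b by simp
    fix e :: real assume e: "0 < e"
    \<comment> \<open>the denominator \<open>D * C + 1\<close> is positive even if the constants vanish\<close>
    define d where "d = min \<delta> (e / (D * C + 1))"
    have DC: "0 \<le> D * C" using D0 C by simp
    have d: "0 < d" "d \<le> \<delta>" using \<delta> e DC by (auto simp: d_def)
    have "D * C * d \<le> (D * C + 1) * (e / (D * C + 1))" using DC d e by (intro mult_mono) (auto simp: d_def)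
    also have "\<dots> = e" using DC by simp
    finally have de: "D * C * d \<le> e" .
    show "\<exists>d>0. \<forall>v\<in>vcarrier ?P. vnorm ?P v < d \<longrightarrow> ?x + v \<in> CJ_pos S \<times> X0s S \<nu> kb \<and>
        T (?x + v) - T ?x - DT ?x v \<in> vcarrier ?P \<and>
        vnorm ?P (T (?x + v) - T ?x - DT ?x v) \<le> e * vnorm ?P v"
    proof (intro exI[of _ d] conjI ballI impI d)
      fix v assume v: "v \<in> vcarrier ?P" and small: "vnorm ?P v < d"
      define n where "n = vnorm ?P v"
      have n: "0 \<le> n" "n \<le> d" "n \<le> \<delta>" using P.norm_nonneg[OF v] small d by (auto simp: n_def)
      have vv: "fst v \<in> CJ S" "snd v \<in> X0s S \<nu> kb" "CJ_norm S kb (fst v) \<le> n" "XN (snd v) \<le> n"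
        using v by (auto simp: carP normP n_def)
      note R = rem[rule_format, OF vv n(3)]
      have xv: "(\<kappa> + fst v, b + snd v) = ?x + v" by (simp add: plus_prod_def)
      have Y: "residual_bound (zmap S \<gamma> m (?x + v) - zmap S \<gamma> m ?x - DZ ?x v) (C * n\<^sup>2)" using R by (simp add: xv)
      show "?x + v \<in> CJ_pos S \<times> X0s S \<nu> kb" using R X0s_add[OF b vv(2)] by (simp add: plus_prod_def)
      have eq: "T (?x + v) - T ?x - DT ?x v = - Ac (zmap S \<gamma> m (?x + v) - zmap S \<gamma> m ?x - DZ ?x v)"
        by (simp add: Tmap_def DT_def Acal_minus)
      note B = DP[OF _ Y]
      have Bm: "Ac (zmap S \<gamma> m (?x + v) - zmap S \<gamma> m ?x - DZ ?x v) \<in> vcarrier ?P" using B(1) C by simp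
      show "T (?x + v) - T ?x - DT ?x v \<in> vcarrier ?P" unfolding eq by (rule P.minus_mem[OF Bm])
      have "vnorm ?P (T (?x + v) - T ?x - DT ?x v) \<le> D * (C * n\<^sup>2)"
        unfolding eq P.norm_minus[OF Bm] using B(2) C by simp
      also have "\<dots> = (D * C * n) * n" by (simp add: power2_eq_square)
      also have "\<dots> \<le> e * n"
        using mult_left_mono[OF n(2) DC] de n(1) by (intro mult_right_mono) auto
      finally show "vnorm ?P (T (?x + v) - T ?x - DT ?x v) \<le> e * vnorm ?P v" by (simp add: n_def)
    qed
  qed
qed

end

section \<open>Invariance under conjugation\<close>

context space_group
begin

text \<open>The phases are multiplicative and the index action additive in \<open>k\<close>, so the group
  acts on convolutions factor by factor.\<close>

lemma symmetric_dconv: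
  assumes "symmetric c" "symmetric d" shows "symmetric (dconv c d)"
  unfolding symmetric_def
proof (intro ballI allI)
  fix g k assume g: "g \<in> carrier S"
  have t: "alpha S g k * (c (beta S g q) * d (beta S g k - beta S g q)) = c q * d (k - q)" for q
  proof -
    have "alpha S g k = alpha S g q * alpha S g (k - q)" using alpha_add[OF g, of q "k - q"] by simp
    moreover have "beta S g k - beta S g q = beta S g (k - q)"
      using beta_add[OF g, of "k - q" q] by simp
    ultimately have "alpha S g k * (c (beta S g q) * d (beta S g k - beta S g q))
      = (alpha S g q * c (beta S g q)) * (alpha S g (k - q) * d (beta S g (k - q)))" by simp
    moreover have "alpha S g q * c (beta S g q) = c q"
      "alpha S g (k - q) * d (beta S g (k - q)) = d (k - q)"
      using assms g by (simp_all add: symmetric_def)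
    ultimately show ?thesis by (simp only:)
  qed
  have "dconv c d (beta S g k) = (\<Sum>\<^sub>\<infinity>q. c (beta S g q) * d (beta S g k - beta S g q))"
    unfolding dconv_eq
    by (rule infsum_reindex_bij_betw[OF bij_beta[OF g], symmetric])
  then have "alpha S g k * dconv c d (beta S g k)
      = (\<Sum>\<^sub>\<infinity>q. alpha S g k * (c (beta S g q) * d (beta S g k - beta S g q)))"
    by (simp add: infsum_cmult_right')
  then show "alpha S g k * dconv c d (beta S g k) = dconv c d k"
    unfolding t dconv_eq .
qed

text \<open>Coefficients of a real-valued Fourier series.\<close>

definition hermitian :: "coeffs \<Rightarrow> bool" where
  "hermitian c \<longleftrightarrow> (\<forall>k. cnj (c (- k)) = c k)"

lemma hermitian_dconv:
  assumes "hermitian c" "hermitian d" shows "hermitian (dconv c d)"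
  unfolding hermitian_def
proof
  fix k
  have b: "bij (uminus :: int^3 \<Rightarrow> int^3)" by (rule bij_uminus)
  have "cnj (dconv c d (- k)) = (\<Sum>\<^sub>\<infinity>p. cnj (c p) * cnj (d (- k - p)))"
    unfolding dconv_eq infsum_cnj[symmetric] by simp
  also have "\<dots> = (\<Sum>\<^sub>\<infinity>q. cnj (c (- q)) * cnj (d (- k - - q)))"
    by (rule infsum_reindex_bij_betw[OF b, symmetric])
  also have "\<dots> = (\<Sum>\<^sub>\<infinity>q. c q * d (k - q))"
  proof -
    have "- k - - q = - (k - q)" for q by simp
    then show ?thesis using assms by (simp only: hermitian_def)
  qed
  finally show "cnj (dconv c d (- k)) = dconv c d k" unfolding dconv_eq .
qed

lemma symmetric_reflect:
  assumes "symmetric c" shows "symmetric (\<lambda>k. cnj (c (- k)))"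
  unfolding symmetric_def
proof (intro ballI allI)
  fix g k assume g: "g \<in> carrier S"
  have "cnj (alpha S g (- k) * c (beta S g (- k))) = cnj (c (- k))"
    using assms g by (simp add: symmetric_def)
  then show "alpha S g k * cnj (c (- beta S g k)) = cnj (c (- k))"
    by (simp add: alpha_minus[OF g] beta_minus[OF g])
qed

text \<open>Reflection and conjugation preserve symmetry, so it suffices to compare with \<open>sigma S
  b\<close> on \<open>Zind\<close>, where the assumption gives the equality.\<close>

lemma hermitian_sigma:
  assumes "conj_b S b = b" shows "hermitian (sigma S b)"
proof -
  have "cnj (sigma S b (- k)) = b k" if "k \<in> Zind S" for k
    using fun_cong[OF assms, of k] that by (simp add: conj_b_def)
  then have "sigma S b = (\<lambda>k. cnj (sigma S b (- k)))"
    by (intro sigma_symmetric symmetric_reflect symmetric_sigma) simp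
  from fun_cong[OF this, symmetric] show ?thesis unfolding hermitian_def by blast
qed

lemma conj_b_eqI:
  assumes "symmetric e" "hermitian e" "\<And>k. k \<in> Zind S \<Longrightarrow> f k = e k" "\<And>k. k \<notin> Zind S \<Longrightarrow> f k = 0"
  shows "conj_b S f = f"
proof -
  have "sigma S f = e" using assms by (intro sigma_symmetric)
  then show ?thesis using assms by (auto simp: conj_b_def hermitian_def fun_eq_iff)
qed

lemma conj_b_diff: "conj_b S (b - b') = conj_b S b - conj_b S b'"
  by (auto simp: conj_b_def sigma_eq fun_eq_iff left_diff_distrib)

lemma conj_b_add: "conj_b S (b + b') = conj_b S b + conj_b S b'"
  by (auto simp: conj_b_def sigma_eq fun_eq_iff distrib_right)

lemma conj_b_multiplier:
  assumes "\<And>k. r (rep k) = r k" "\<And>k. r (- k) = r k" "\<And>k. cnj (r k) = r k"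
  shows "conj_b S (\<lambda>k. r k * b k) = (\<lambda>k. r k * conj_b S b k)"
  using assms by (auto simp: conj_b_def sigma_eq fun_eq_iff)

lemma conj_x_diff: "conj_x S (x - y) = conj_x S x - conj_x S y"
  by (simp add: conj_x_def conj_b_diff prod_eq_iff fun_eq_iff)

lemma conj_x_add: "conj_x S (x + y) = conj_x S x + conj_x S y"
  by (simp add: conj_x_def conj_b_add prod_eq_iff fun_eq_iff)

lemma card_Orb_minus: "card (Orb S (- k)) = card (Orb S k)"
proof -
  have "Orb S k = (\<lambda>g. beta S g k) ` carrier S" for k by (auto simp: orbit_def)
  then have "Orb S (- k) = uminus ` Orb S k"
    by (simp add: image_image beta_minus cong: image_cong)
  then show ?thesis by (simp add: card_image)
qed

lemma card_Orb_beta: "g \<in> carrier S \<Longrightarrow> card (Orb S (beta S g k)) = card (Orb S k)"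
  using Orb_eqI[OF beta_in_Orb] by simp

lemma card_Orb_rep: "card (Orb S (rep k)) = card (Orb S k)"
  using Orb_eqI[OF rep(2)] by simp

end

context zero_problem
begin

lemma Sinv_iff: "x \<in> Sinv S \<nu> kb \<longleftrightarrow> fst x \<in> CJ S \<and> snd x \<in> Xs S \<nu> kb \<and>
    (\<forall>j. cnj (fst x j) = fst x j) \<and> conj_b S (snd x) = snd x"
  by (cases x) (auto simp: Sinv_def conj_x_def fun_eq_iff)

lemma symmetric_cof: "symmetric (cof b)"
  unfolding full_coeffs_def by (rule symmetric_sigma)

lemma hermitian_cof:
  assumes "conj_b S b = b" shows "hermitian (cof b)"
  using hermitian_sigma[OF assms] by (simp add: full_coeffs_eq hermitian_def unit_vec_def)

text \<open>The residual of the Fourier equations at every nonzero lattice index, of which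
  \<open>Fmap\<close> records the representatives.\<close>

definition Ffull :: "(nat \<Rightarrow> complex) \<Rightarrow> coeffs \<Rightarrow> coeffs" where
  "Ffull \<kappa> c k = (if k = 0 then 0 else Pfun \<gamma> (Del k \<kappa>) * c k + dconv c (dconv c c) k)"

lemma symmetric_Ffull: assumes "symmetric c" shows "symmetric (Ffull \<kappa> c)"
proof -
  have 3: "symmetric (dconv c (dconv c c))" using assms by (intro symmetric_dconv)
  have z: "beta S g k = 0 \<longleftrightarrow> k = 0" if "g \<in> carrier S" for g k
  proof
    assume "beta S g k = 0"
    then show "k = 0" using beta_inv(1)[OF that, of k] beta_zero[of "inv\<^bsub>S\<^esub> g"] that by simp
  qed (simp add: beta_zero[OF that])
  show ?thesis unfolding symmetric_def
  proof (intro ballI allI)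
    fix g k assume g: "g \<in> carrier S"
    have "alpha S g k * c (beta S g k) = c k"
      "alpha S g k * dconv c (dconv c c) (beta S g k) = dconv c (dconv c c) k"
      using assms 3 g by (simp_all add: symmetric_def)
    then show "alpha S g k * Ffull \<kappa> c (beta S g k) = Ffull \<kappa> c k"
      by (simp add: Ffull_def z[OF g] Delta_beta[OF g] distrib_left mult.left_commute)
  qed
qed

lemma cnj_Delta: "(\<And>j. cnj (\<kappa> j) = \<kappa> j) \<Longrightarrow> cnj (Del k \<kappa>) = Del k \<kappa>"
  by (simp add: Delta_def)

lemma hermitian_Ffull:
  assumes "hermitian c" "\<And>j. cnj (\<kappa> j) = \<kappa> j" shows "hermitian (Ffull \<kappa> c)"
proof -
  have 3: "hermitian (dconv c (dconv c c))" using assms by (intro hermitian_dconv)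
  show ?thesis using assms(1) 3 cnj_Delta[OF assms(2)]
    by (simp add: hermitian_def Ffull_def Pfun_def Delta_uminus)
qed

lemma zmap_conj:
  assumes \<kappa>: "\<kappa> \<in> CJ_pos S" and real: "\<And>j. cnj (\<kappa> j) = \<kappa> j" and b: "conj_b S b = b"
  shows "conj_x S (zmap S \<gamma> m (\<kappa>, b)) = zmap S \<gamma> m (\<kappa>, b)"
proof -
  let ?c = "cof b"
  have h: "hermitian ?c" by (rule hermitian_cof[OF b])
  have H: "cnj (qsum (\<lambda>k. dPfun \<gamma> (Del k \<kappa>) * dc k j) ?c ?c) = qsum (\<lambda>k. dPfun \<gamma> (Del k \<kappa>) * dc k j) ?c ?c" for j
  proof -
    have "cnj (?c k) = ?c (- k)" for k using h unfolding hermitian_def by (metis complex_cnj_cnj)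
    then show ?thesis
      unfolding qsum_def infsum_cnj[symmetric]
      by (intro infsum_cong) (simp add: dPfun_def cnj_Delta[OF real] mult_ac)
  qed
  define e where "e k = of_nat (card (Orb S k)) * Ffull \<kappa> ?c k" for k
  have "symmetric e"
    using symmetric_Ffull[OF symmetric_cof, of \<kappa> b]
    by (simp add: symmetric_def e_def card_Orb_beta mult.left_commute)
  moreover have "hermitian e"
    using hermitian_Ffull[OF h, of \<kappa>] real by (simp add: hermitian_def e_def card_Orb_minus)
  ultimately have "conj_b S (snd (zmap S \<gamma> m (\<kappa>, b))) = snd (zmap S \<gamma> m (\<kappa>, b))"
    by (rule conj_b_eqI) (auto simp: zmap_eq[OF \<kappa>] e_def Ffull_def Z0_def)
  moreover have "cnj (fst (zmap S \<gamma> m (\<kappa>, b)) j) = fst (zmap S \<gamma> m (\<kappa>, b)) j" for j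
    by (simp add: zmap_eq[OF \<kappa>] H)
  ultimately show ?thesis by (simp add: conj_x_def prod_eq_iff fun_eq_iff)
qed

lemma zmap_support:
  "j \<notin> J \<Longrightarrow> fst (zmap S \<gamma> m x) j = 0" "k \<notin> Z0 S \<Longrightarrow> snd (zmap S \<gamma> m x) k = 0"
  by (auto simp: zmap_def Hmap_def Fmap_def Let_def)

end

locale symmetric_fixed_point_problem = fixed_point_problem S \<nu> kb \<gamma> m K A
  for S :: "'g crystal_group" and \<nu> kb \<gamma> m K A +
  assumes A_inv: "invertible_on (mat_idx S kb K) A"
    and A_conj: "\<And>x. x \<in> CJ S \<times> X0Ks S \<nu> kb K \<Longrightarrow>
       conj_x S (mat_act S kb K A x) = mat_act S kb K A (conj_x S x)"
begin

text \<open>On the truncated part the assumption on \<open>A\<close> applies. On the tail the operator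
  multiplies by a real sequence that is even and constant on orbits, and such multipliers
  commute with the conjugation.\<close>

lemma Acal_conj:
  assumes y: "fst y \<in> CJ S" "\<And>k. k \<notin> Z0 S \<Longrightarrow> snd y k = 0" and conj: "conj_x S y = y"
  shows "conj_x S (Ac y) = Ac y"
proof -
  \<comment> \<open>truncation and tail as multipliers by sequences that are constant on orbits\<close>
  define \<phi> :: "int^3 \<Rightarrow> complex" where "\<phi> k = (if knorm S kb k \<le> K then 1 else 0)" for k
  define \<psi> where "\<psi> k = (if knorm S kb k \<le> K then 0 else 1 / (Pb k * of_nat (card (Orb S k))))" for k
  define yK where "yK = (fst y, \<lambda>k. \<phi> k * snd y k)"
  define t where "t = (\<lambda>k. \<psi> k * snd y k)"
  have cb: "conj_b S (snd y) = snd y" and cf: "\<And>j. cnj (fst y j) = fst y j"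
    using conj by (auto simp: conj_x_def prod_eq_iff fun_eq_iff)
  have D: "Delta (csys S) (rep k) kb = Delta (csys S) k kb" for k
  proof -
    obtain g where "g \<in> carrier S" "beta S g (rep k) = k" by (rule rep_obtain)
    then show ?thesis using Delta_beta[of g "rep k" kb] by simp
  qed
  have \<phi>: "conj_b S (\<lambda>k. \<phi> k * snd y k) = (\<lambda>k. \<phi> k * snd y k)"
    using conj_b_multiplier[of \<phi> "snd y"] cb by (simp add: \<phi>_def knorm_rep knorm_minus)
  have \<psi>: "conj_b S t = t"
    using conj_b_multiplier[of \<psi> "snd y"] cb unfolding t_def
    by (simp add: \<psi>_def knorm_rep knorm_minus card_Orb_rep card_Orb_minus D Delta_uminus Pfun_def)
  have yK_eq: "snd yK k = (if k \<in> Z0K S kb K then snd y k else 0)" for k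
    using y(2)[of k] by (auto simp: yK_def \<phi>_def Z0K_def)
  have act: "mat_act S kb K A y = mat_act S kb K A yK"
  proof -
    have "case_sum (fst y) (snd y) l = case_sum (fst yK) (snd yK) l" if "l \<in> idx" for l
      using that yK_eq by (auto simp: mat_idx_def yK_def)
    then have sumeq: "(\<Sum>l\<in>idx. A i l * case_sum (fst y) (snd y) l) = (\<Sum>l\<in>idx. A i l * case_sum (fst yK) (snd yK) l)" for i
      by (intro sum.cong) simp_all
    show ?thesis unfolding mat_act_def Let_def sumeq ..
  qed
  have "snd yK \<in> X0s S \<nu> kb"
  proof (rule X0s_I(1))
    show "snd yK k = 0" if "k \<notin> Z0 S" for k using that by (auto simp: yK_eq Z0K_def)
    fix F :: "(int^3) set" assume F: "finite F" "F \<subseteq> Zind S"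
    have "(\<Sum>k\<in>F. cmod (snd yK k) * om k) = (\<Sum>k\<in>F \<inter> Z0K S kb K. cmod (snd yK k) * om k)"
      using F by (intro sum.mono_neutral_right) (auto simp: yK_eq)
    also have "\<dots> \<le> (\<Sum>k\<in>Z0K S kb K. cmod (snd yK k) * om k)"
      using finite_Z0K omega_ge(3) by (intro sum_mono2) (auto simp: less_imp_le)
    finally show "(\<Sum>k\<in>F. cmod (snd yK k) * om k) \<le> (\<Sum>k\<in>Z0K S kb K. cmod (snd yK k) * om k)" .
  qed
  then have "yK \<in> CJ S \<times> X0Ks S \<nu> kb K"
    using y(1) yK_eq by (auto simp: X0Ks_def mem_Times_iff yK_def)
  moreover have "conj_x S yK = yK" using cf \<phi> by (simp add: conj_x_def yK_def)
  ultimately have K: "conj_x S (mat_act S kb K A yK) = mat_act S kb K A yK" using A_conj by metis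
  have outside: "snd (mat_act S kb K A yK) k = 0" if "k \<notin> Z0K S kb K" for k
    using that by (simp add: mat_act_def Let_def)
  have "Ac y = mat_act S kb K A yK + (0, t)"
  proof -
    have "snd (Ac y) k = snd (mat_act S kb K A yK) k + t k" for k
      using y(2)[of k] outside[of k]
      by (cases "k \<in> Z0 S"; cases "k \<in> Z0K S kb K")
        (auto simp: Acal_def act t_def \<psi>_def Z0K_def)
    then show ?thesis by (simp add: Acal_def act prod_eq_iff fun_eq_iff)
  qed
  moreover have "conj_x S (0, t) = (0, t)" using \<psi> by (simp add: conj_x_def fun_eq_iff)
  ultimately show ?thesis by (simp add: conj_x_add K)
qed

text \<open>The matrix has a left inverse, and the multipliers on the tail are nonzero by
  \<open>tail_lower_bound\<close>.\<close>

lemma Acal_injective: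
  assumes y: "\<And>j. j \<notin> J \<Longrightarrow> fst y j = 0" "\<And>k. k \<notin> Z0 S \<Longrightarrow> snd y k = 0" and 0: "Ac y = 0"
  shows "y = 0"
proof -
  let ?y = "case_sum (fst y) (snd y)"
  have row: "(\<Sum>l\<in>idx. A i l * ?y l) = 0" if "i \<in> idx" for i
  proof (cases i)
    case (Inl j)
    then show ?thesis using fun_cong[OF arg_cong[OF 0, of fst], of j] that
      by (auto simp: Acal_def mat_act_def Let_def mat_idx_def)
  next
    case (Inr k)
    then show ?thesis using fun_cong[OF arg_cong[OF 0, of snd], of k] that
      by (auto simp: Acal_def mat_act_def Let_def mat_idx_def)
  qed
  obtain B where B: "\<forall>i\<in>idx. \<forall>j\<in>idx. (\<Sum>l\<in>idx. A i l * B l j) = (if i = j then 1 else 0) \<and>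
     (\<Sum>l\<in>idx. B i l * A l j) = (if i = j then 1 else 0)"
    using A_inv unfolding invertible_on_def by blast
  have yl: "?y i = 0" if i: "i \<in> idx" for i
  proof -
    have "0 = (\<Sum>l\<in>idx. B i l * (\<Sum>j\<in>idx. A l j * ?y j))" using row by simp
    also have "\<dots> = (\<Sum>l\<in>idx. \<Sum>j\<in>idx. B i l * A l j * ?y j)" by (simp add: sum_distrib_left mult.assoc)
    also have "\<dots> = (\<Sum>j\<in>idx. \<Sum>l\<in>idx. B i l * A l j * ?y j)" by (rule sum.swap)
    also have "\<dots> = (\<Sum>j\<in>idx. (\<Sum>l\<in>idx. B i l * A l j) * ?y j)" by (simp add: sum_distrib_right)
    also have "\<dots> = (\<Sum>j\<in>idx. if i = j then ?y j else 0)" using B i by (intro sum.cong) auto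
    also have "\<dots> = ?y i" using i finite_idx by simp
    finally show ?thesis by simp
  qed
  have "fst y j = 0" for j
  proof (cases "j \<in> J")
    case True
    then have "Inl j \<in> idx" unfolding mat_idx_def by (rule InlI)
    then show ?thesis using yl[of "Inl j"] by simp
  qed (rule y(1))
  moreover have "snd y k = 0" for k
  proof (cases "k \<in> Z0 S \<and> k \<notin> Z0K S kb K")
    case True
    then have k0: "k \<noteq> 0" by (auto simp: Z0_def)
    obtain c where c: "0 < c" "\<forall>k. k \<in> Z0 S \<longrightarrow> k \<notin> Z0K S kb K \<longrightarrow> c * lsz k \<le> cmod (Pb k)"
      by (rule tail_lower_bound)
    have "0 < c * lsz k" using c(1) lsize_ge_1[OF k0, of "csys S"] by simp
    moreover have "c * lsz k \<le> cmod (Pb k)" using c(2) True by blast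
    ultimately have "Pb k \<noteq> 0" by auto
    then show ?thesis using fun_cong[OF arg_cong[OF 0, of snd], of k] True card_Orb_pos[of k]
      by (auto simp: Acal_def)
  next
    case False
    then consider "k \<notin> Z0 S" | "Inr k \<in> idx" unfolding mat_idx_def by (blast intro: InrI)
    then show ?thesis using yl[of "Inr k"] y(2)[of k] by cases simp_all
  qed
  ultimately show ?thesis by (simp add: prod_eq_iff fun_eq_iff)
qed

lemma T_conj:
  assumes \<kappa>: "\<kappa> \<in> CJ_pos S" and x: "(\<kappa>, b) \<in> Sinv S \<nu> kb"
  shows "conj_x S (T (\<kappa>, b)) = T (\<kappa>, b)"
proof -
  have r: "\<And>j. cnj (\<kappa> j) = \<kappa> j" "conj_b S b = b" and c: "conj_x S (\<kappa>, b) = (\<kappa>, b)"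
    using x by (auto simp: Sinv_iff conj_x_def)
  have "conj_x S (Ac (zmap S \<gamma> m (\<kappa>, b))) = Ac (zmap S \<gamma> m (\<kappa>, b))"
    by (rule Acal_conj[OF _ _ zmap_conj[OF \<kappa> r]]) (auto simp: zmap_support CJ_def)
  then show ?thesis unfolding Tmap_def conj_x_diff c by simp
qed

lemma zero_iff_fixed_point: "zmap S \<gamma> m x = 0 \<longleftrightarrow> T x = x"
proof
  assume "T x = x"
  then have "Ac (zmap S \<gamma> m x) = 0" by (simp add: Tmap_def)
  note Ac0 = this
  show "zmap S \<gamma> m x = 0"
  proof (rule Acal_injective)
    show "fst (zmap S \<gamma> m x) j = 0" if "j \<notin> J" for j using that by (rule zmap_support)
    show "snd (zmap S \<gamma> m x) k = 0" if "k \<notin> Z0 S" for k using that by (rule zmap_support)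
    show "Ac (zmap S \<gamma> m x) = 0" using Ac0 .
  qed
next
  assume "zmap S \<gamma> m x = 0"
  moreover have "Ac 0 = 0" using Acal_minus[of 0 0] by simp
  ultimately show "T x = x" by (simp add: Tmap_def)
qed

end

section \<open>Smooth Fourier series and the differential equation\<close>

definition fser :: "(int^3 \<Rightarrow> real^3) \<Rightarrow> coeffs \<Rightarrow> real^3 \<Rightarrow> complex" where
  "fser lam c x = (\<Sum>\<^sub>\<infinity>k. c k * iexp (lam k \<bullet> x))"

text \<open>Decay faster than every power of the wave vector: enough to differentiate termwise any number
  of times.\<close>

definition rapid :: "(int^3 \<Rightarrow> real^3) \<Rightarrow> coeffs \<Rightarrow> bool" where
  "rapid lam c \<longleftrightarrow> (\<forall>n. (\<lambda>k. norm (lam k) ^ n * cmod (c k)) summable_on UNIV)"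

text \<open>The real part makes this a function to which \<open>partial\<close> and
  \<open>laplacian\<close> apply. For hermitian coefficients it is the whole series.\<close>

definition useries :: "(int^3 \<Rightarrow> real^3) \<Rightarrow> coeffs \<Rightarrow> real^3 \<Rightarrow> real" where
  "useries lam c x = Re (fser lam c x)"

text \<open>The coefficients of the \<open>i\<close>-th partial derivative.\<close>

definition dcoef :: "(int^3 \<Rightarrow> real^3) \<Rightarrow> 3 \<Rightarrow> coeffs \<Rightarrow> coeffs" where
  "dcoef lam i c k = \<i> * of_real (lam k $ i) * c k"

lemma rapid_summable: assumes "rapid lam c" shows "c abs_summable_on UNIV"
  using assms[unfolded rapid_def, rule_format, of 0] by simp

lemma fser_abs_summable:
  assumes "rapid lam c" shows "(\<lambda>k. c k * iexp (lam k \<bullet> x)) abs_summable_on UNIV"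
  using rapid_summable[OF assms] by (simp add: norm_mult)

lemma fser_summable:
  assumes "rapid lam c" shows "(\<lambda>k. c k * iexp (lam k \<bullet> x)) summable_on UNIV"
  by (rule abs_summable_summable[OF fser_abs_summable[OF assms]])

lemma rapid_bound:
  assumes "rapid lam c" "\<And>k. cmod (d k) \<le> C * norm (lam k) ^ p * cmod (c k)"
  shows "rapid lam d"
  unfolding rapid_def
proof
  fix n
  have s: "(\<lambda>k. C * (norm (lam k) ^ (n + p) * cmod (c k))) summable_on UNIV"
    by (rule summable_on_cmult_right) (use assms(1) in \<open>simp add: rapid_def\<close>)
  have le: "norm (lam k) ^ n * cmod (d k) \<le> C * (norm (lam k) ^ (n + p) * cmod (c k))" for k
    using mult_left_mono[OF assms(2)[of k], of "norm (lam k) ^ n"] by (simp add: power_add mult_ac)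
  show "(\<lambda>k. norm (lam k) ^ n * cmod (d k)) summable_on UNIV"
    by (rule summable_on_comparison_test[OF s le]) simp
qed

lemma rapid_add:
  assumes "rapid lam c" "rapid lam d" shows "rapid lam (\<lambda>k. c k + d k)"
  unfolding rapid_def
proof
  fix n
  have s: "(\<lambda>k. norm (lam k) ^ n * cmod (c k) + norm (lam k) ^ n * cmod (d k)) summable_on UNIV"
    using assms by (intro summable_on_add) (simp_all add: rapid_def)
  show "(\<lambda>k. norm (lam k) ^ n * cmod (c k + d k)) summable_on UNIV"
    by (rule summable_on_comparison_test[OF s])
       (simp_all add: norm_triangle_ineq mult_left_mono flip: distrib_left)
qed

lemma rapid_cong_nonzero:
  assumes "rapid lam c" "\<And>k. k \<noteq> 0 \<Longrightarrow> d k = c k" shows "rapid lam d"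
  unfolding rapid_def
proof
  fix n
  have "(\<lambda>k. norm (lam k) ^ n * cmod (c k)) summable_on insert 0 (UNIV - {0})"
    using assms(1) by (simp add: rapid_def insert_absorb insert_UNIV)
  then have "(\<lambda>k. norm (lam k) ^ n * cmod (c k)) summable_on (UNIV - {0})"
    by (simp only: summable_on_insert_iff)
  then have "(\<lambda>k. norm (lam k) ^ n * cmod (d k)) summable_on (UNIV - {0})"
    by (rule summable_on_cong[THEN iffD1, rotated]) (simp add: assms(2))
  then have "(\<lambda>k. norm (lam k) ^ n * cmod (d k)) summable_on insert 0 (UNIV - {0})"
    by (simp only: summable_on_insert_iff)
  then show "(\<lambda>k. norm (lam k) ^ n * cmod (d k)) summable_on UNIV" by (simp add: insert_UNIV)
qed

lemma rapid_dcoef: "rapid lam c \<Longrightarrow> rapid lam (dcoef lam i c)"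
  by (rule rapid_bound[where C = 1 and p = 1])
     (auto simp: dcoef_def norm_mult intro!: mult_right_mono component_le_norm_cart)

lemma useries_add:
  assumes "rapid lam c" "rapid lam d"
  shows "useries lam (\<lambda>k. c k + d k) x = useries lam c x + useries lam d x"
  using fser_summable[OF assms(1), of x] fser_summable[OF assms(2), of x]
  by (simp add: useries_def fser_def distrib_right infsum_add)

lemma useries_scale: "useries lam (\<lambda>k. of_real a * c k) x = a * useries lam c x"
  by (simp add: useries_def fser_def mult.assoc infsum_cmult_right')

lemma iexp_remainder: "cmod (iexp (a + t) - iexp a - \<i> * of_real t * iexp a) \<le> t\<^sup>2 / 2"
proof -
  have "iexp (a + t) - iexp a - \<i> * of_real t * iexp a = iexp a * (iexp t - (1 + \<i> * of_real t))"
    by (simp add: exp_add algebra_simps)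
  then have "cmod (iexp (a + t) - iexp a - \<i> * of_real t * iexp a) = cmod (iexp t - (1 + \<i> * of_real t))"
    by (simp add: norm_mult)
  also have "\<dots> \<le> \<bar>t\<bar> ^ Suc 1 / fact (Suc 1)" using iexp_approx1[of t 1] by simp
  finally show ?thesis by (simp add: power2_eq_square)
qed

text \<open>The first order remainder of a plane wave is at most the square of \<open>lam k \<bullet>
  h\<close>, so the sum of all remainders is at most \<open>M * (norm h)\<^sup>2\<close> with
  the second moment \<open>M\<close> of the coefficients.\<close>

lemma useries_has_derivative:
  assumes "rapid lam c"
  shows "(useries lam c has_derivative (\<lambda>h. \<Sum>i\<in>UNIV. h $ i * useries lam (dcoef lam i c) x)) (at x)"
  unfolding has_derivative_at_alt
proof (intro conjI allI impI)
  show "bounded_linear (\<lambda>h. \<Sum>i\<in>UNIV. h $ i * useries lam (dcoef lam i c) x)"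
    by (intro bounded_linear_sum bounded_linear_mult_const bounded_linear_vec_nth)
  define M where "M = (\<Sum>\<^sub>\<infinity>k. norm (lam k) ^ 2 * cmod (c k))"
  have sM: "(\<lambda>k. norm (lam k) ^ 2 * cmod (c k)) summable_on UNIV" using assms by (simp add: rapid_def)
  have M0: "0 \<le> M" unfolding M_def by (intro infsum_nonneg) simp
  have rem: "norm (useries lam c (x + h) - useries lam c x - (\<Sum>i\<in>UNIV. h $ i * useries lam (dcoef lam i c) x))
      \<le> M * (norm h)\<^sup>2" for h
  proof -
    let ?r = "\<lambda>k. c k * (iexp (lam k \<bullet> (x + h)) - iexp (lam k \<bullet> x) - \<i> * of_real (lam k \<bullet> h) * iexp (lam k \<bullet> x))"
    have le: "norm (?r k) \<le> (norm h)\<^sup>2 * (norm (lam k) ^ 2 * cmod (c k))" for k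
    proof -
      have "cmod (iexp (lam k \<bullet> (x + h)) - iexp (lam k \<bullet> x) - \<i> * of_real (lam k \<bullet> h) * iexp (lam k \<bullet> x))
          \<le> (lam k \<bullet> h)\<^sup>2 / 2"
        unfolding inner_add_right by (rule iexp_remainder)
      also have "\<dots> \<le> (lam k \<bullet> h)\<^sup>2" by simp
      also have "\<dots> \<le> (norm (lam k) * norm h)\<^sup>2"
        using Cauchy_Schwarz_ineq2[of "lam k" h] by (intro power2_le_iff_abs_le[THEN iffD2]) auto
      finally have "cmod (c k) * cmod (iexp (lam k \<bullet> (x + h)) - iexp (lam k \<bullet> x) - \<i> * of_real (lam k \<bullet> h) * iexp (lam k \<bullet> x))
          \<le> cmod (c k) * (norm (lam k) * norm h)\<^sup>2" by (intro mult_left_mono) auto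
      then show ?thesis by (simp add: norm_mult power_mult_distrib mult_ac)
    qed
    have s: "(\<lambda>k. (norm h)\<^sup>2 * (norm (lam k) ^ 2 * cmod (c k))) summable_on UNIV"
      using sM by (rule summable_on_cmult_right)
    have rs: "?r abs_summable_on UNIV" by (rule summable_on_comparison_test[OF s le norm_ge_zero])
    have "norm (infsum ?r UNIV) \<le> (\<Sum>\<^sub>\<infinity>k. norm (?r k))" by (rule norm_infsum_bound[OF rs])
    also have "\<dots> \<le> (\<Sum>\<^sub>\<infinity>k. (norm h)\<^sup>2 * (norm (lam k) ^ 2 * cmod (c k)))" by (rule infsum_mono[OF rs s le])
    also have "\<dots> = (norm h)\<^sup>2 * M" by (simp add: M_def infsum_cmult_right')
    finally have bound: "norm (infsum ?r UNIV) \<le> (norm h)\<^sup>2 * M" .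
    note fs = fser_summable[OF assms] fser_summable[OF rapid_dcoef[OF assms]]
    have in3: "lam k \<bullet> h = lam k $ 1 * h $ 1 + lam k $ 2 * h $ 2 + lam k $ 3 * h $ 3" for k
      by (simp add: inner_vec_def sum_3)
    define a where "a i k = of_real (h $ i) * (dcoef lam i c k * iexp (lam k \<bullet> x))" for i k
    have sa: "a i summable_on UNIV" for i unfolding a_def by (intro summable_on_cmult_right fs)
    have fa: "infsum (a i) UNIV = of_real (h $ i) * fser lam (dcoef lam i c) x" for i
      unfolding a_def fser_def by (rule infsum_cmult_right')
    have id: "z * (E' - E - \<i> * of_real (l1 * h1 + l2 * h2 + l3 * h3) * E) + (z * E +
        (of_real h1 * (\<i> * of_real l1 * z * E) + (of_real h2 * (\<i> * of_real l2 * z * E)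
          + of_real h3 * (\<i> * of_real l3 * z * E)))) = z * E'" for z E E' and l1 l2 l3 h1 h2 h3 :: real
      by (simp add: algebra_simps)
    have "fser lam c (x + h) = (\<Sum>\<^sub>\<infinity>k. ?r k + (c k * iexp (lam k \<bullet> x) + (a 1 k + (a 2 k + a 3 k))))"
      unfolding fser_def a_def dcoef_def in3 by (intro infsum_cong id[symmetric])
    also have "\<dots> = infsum ?r UNIV + (fser lam c x + (infsum (a 1) UNIV + (infsum (a 2) UNIV + infsum (a 3) UNIV)))"
      unfolding fser_def using sa fs(1) abs_summable_summable[OF rs]
      by (simp only: infsum_add summable_on_add)
    finally have "fser lam c (x + h) = infsum ?r UNIV + (fser lam c x + (of_real (h$1) * fser lam (dcoef lam 1 c) x
        + (of_real (h$2) * fser lam (dcoef lam 2 c) x + of_real (h$3) * fser lam (dcoef lam 3 c) x)))"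
      unfolding fa .
    then have "useries lam c (x + h) - useries lam c x - (\<Sum>i\<in>UNIV. h $ i * useries lam (dcoef lam i c) x)
        = Re (infsum ?r UNIV)"
      by (simp add: useries_def sum_3)
    then show ?thesis using bound abs_Re_le_cmod[of "infsum ?r UNIV"] by (simp add: mult.commute)
  qed
  fix e :: real assume e: "0 < e"
  show "\<exists>d>0. \<forall>y. norm (y - x) < d \<longrightarrow> norm (useries lam c y - useries lam c x
      - (\<Sum>i\<in>UNIV. (y - x) $ i * useries lam (dcoef lam i c) x)) \<le> e * norm (y - x)"
  proof (intro exI[of _ "e / (M + 1)"] conjI allI impI)
    show "0 < e / (M + 1)" using e M0 by simp
    fix y assume y: "norm (y - x) < e / (M + 1)"
    have "M * norm (y - x) \<le> (M + 1) * (e / (M + 1))" using y M0 by (intro mult_mono) auto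
    also have "\<dots> = e" using M0 by simp
    finally have "M * (norm (y - x))\<^sup>2 \<le> e * norm (y - x)"
      by (simp add: power2_eq_square mult_right_mono flip: mult.assoc)
    then show "norm (useries lam c y - useries lam c x - (\<Sum>i\<in>UNIV. (y - x) $ i * useries lam (dcoef lam i c) x))
        \<le> e * norm (y - x)" using rem[of "y - x"] by simp
  qed
qed

lemma partial_useries:
  assumes "rapid lam c" shows "partial i (useries lam c) = useries lam (dcoef lam i c)"
proof
  fix x :: "real^3"
  have 1: "((\<lambda>t. x + t *\<^sub>R axis i 1) has_derivative (\<lambda>t. t *\<^sub>R axis i 1)) (at 0)"
    by (auto intro!: derivative_eq_intros)
  have 2: "(useries lam c has_derivative (\<lambda>h. \<Sum>j\<in>UNIV. h $ j * useries lam (dcoef lam j c) x)) (at (x + 0 *\<^sub>R axis i 1))"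
    using useries_has_derivative[OF assms, of x] by simp
  have eq: "(\<Sum>j\<in>UNIV. (t *\<^sub>R axis i 1) $ j * useries lam (dcoef lam j c) x) = useries lam (dcoef lam i c) x * t" for t
  proof -
    have "(\<Sum>j\<in>UNIV. (t *\<^sub>R axis i 1) $ j * useries lam (dcoef lam j c) x)
        = (\<Sum>j\<in>UNIV. if j = i then t * useries lam (dcoef lam j c) x else 0)"
      by (intro sum.cong) (auto simp: axis_def)
    then show ?thesis by simp
  qed
  have "((\<lambda>t. useries lam c (x + t *\<^sub>R axis i 1)) has_real_derivative useries lam (dcoef lam i c) x) (at 0)"
    using has_derivative_compose[OF 1 2] unfolding has_field_derivative_def eq .
  then show "partial i (useries lam c) x = useries lam (dcoef lam i c) x"
    unfolding partial_def by (rule DERIV_imp_deriv)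
qed

lemma C_diff_useries: "rapid lam c \<Longrightarrow> C_diff n (useries lam c)"
proof (induction n arbitrary: c)
  case 0
  then show ?case
    using has_derivative_continuous[OF useries_has_derivative[OF 0]]
    by (simp add: continuous_on_eq_continuous_within)
next
  case (Suc n)
  then show ?case
    using useries_has_derivative[OF Suc.prems]
    by (auto simp: partial_useries[OF Suc.prems] rapid_dcoef differentiable_def)
qed

lemma laplacian_useries:
  assumes "rapid lam c"
  shows "laplacian (useries lam c) x = useries lam (\<lambda>k. of_real (- (norm (lam k))\<^sup>2) * c k) x"
proof -
  have r: "rapid lam (dcoef lam i (dcoef lam i c))" for i using assms by (intro rapid_dcoef)
  have "laplacian (useries lam c) x = (\<Sum>i\<in>UNIV. useries lam (dcoef lam i (dcoef lam i c)) x)"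
    by (simp add: laplacian_def partial_useries assms rapid_dcoef)
  also have "\<dots> = useries lam (\<lambda>k. dcoef lam 1 (dcoef lam 1 c) k + dcoef lam 2 (dcoef lam 2 c) k
      + dcoef lam 3 (dcoef lam 3 c) k) x"
    using r by (simp add: sum_3 useries_add rapid_add)
  also have "(\<lambda>k. dcoef lam 1 (dcoef lam 1 c) k + dcoef lam 2 (dcoef lam 2 c) k
      + dcoef lam 3 (dcoef lam 3 c) k) = (\<lambda>k. of_real (- (norm (lam k))\<^sup>2) * c k)"
  proof
    fix k
    have "(norm (lam k))\<^sup>2 = (lam k $ 1)\<^sup>2 + (lam k $ 2)\<^sup>2 + (lam k $ 3)\<^sup>2"
      unfolding power2_norm_eq_inner by (simp add: inner_vec_def sum_3 power2_eq_square)
    then show "dcoef lam 1 (dcoef lam 1 c) k + dcoef lam 2 (dcoef lam 2 c) k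
      + dcoef lam 3 (dcoef lam 3 c) k = of_real (- (norm (lam k))\<^sup>2) * c k"
      by (simp add: dcoef_def power2_eq_square[of "_ $ _"] algebra_simps)
  qed
  finally show ?thesis .
qed

text \<open>Multiplying the coefficients by the values of the plane waves at \<open>x\<close> is
  compatible with convolution, and summing up a convolution gives the product of the sums.\<close>

lemma fser_dconv:
  assumes lam: "\<And>k l. lam (k + l) = lam k + lam l"
    and c: "c abs_summable_on UNIV" and d: "d abs_summable_on UNIV"
  shows "fser lam (dconv c d) x = fser lam c x * fser lam d x" and "dconv c d abs_summable_on UNIV"
proof -
  interpret conv_weight "\<lambda>_. 1" by standard auto
  have l1_iff: "l1 c \<longleftrightarrow> c abs_summable_on UNIV" for c by (simp add: l1_def)
  have l: "l1 (\<lambda>k. c k * iexp (lam k \<bullet> x))" "l1 (\<lambda>k. d k * iexp (lam k \<bullet> x))"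
    using c d unfolding l1_iff by (simp_all add: norm_mult)
  have "dconv (\<lambda>k. c k * iexp (lam k \<bullet> x)) (\<lambda>k. d k * iexp (lam k \<bullet> x)) k = dconv c d k * iexp (lam k \<bullet> x)" for k
  proof -
    have "iexp (lam p \<bullet> x) * iexp (lam (k - p) \<bullet> x) = iexp (lam k \<bullet> x)" for p
    proof -
      have "lam k = lam p + lam (k - p)" using lam[of p "k - p"] by simp
      then show ?thesis by (simp add: inner_add_left distrib_left exp_add)
    qed
    then have "(c p * iexp (lam p \<bullet> x)) * (d (k - p) * iexp (lam (k - p) \<bullet> x)) = c p * d (k - p) * iexp (lam k \<bullet> x)" for p
      by (metis (no_types, lifting) mult.assoc mult.left_commute)
    then show ?thesis unfolding dconv_eq infsum_cmult_left'[symmetric] by (simp only:)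
  qed
  then have "dconv (\<lambda>k. c k * iexp (lam k \<bullet> x)) (\<lambda>k. d k * iexp (lam k \<bullet> x))
      = (\<lambda>k. dconv c d k * iexp (lam k \<bullet> x))" by (rule ext)
  then show "fser lam (dconv c d) x = fser lam c x * fser lam d x"
    using infsum_dconv[OF l] unfolding fser_def by (simp only:)
  show "dconv c d abs_summable_on UNIV" using l1_dconv[of c d] c d by (simp add: l1_iff)
qed

text \<open>Put \<open>y k = (norm (lam k))\<^sup>2\<close>. Multiplied by \<open>y k\<close>, the
  \<open>k\<close>-th equation is the \<open>k\<close>-th Fourier coefficient of the
  differential equation. The coefficients of the cube decay rapidly because the equations
  express them through those of the series; the function under the outer Laplacian then has the
  coefficients \<open>c k / y k\<close> at nonzero indices, and its Laplacian removes the
  denominator.\<close>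

theorem fourier_solves_pde:
  fixes lam :: "int^3 \<Rightarrow> real^3" and \<gamma> m \<delta> :: real
  assumes lam: "\<And>k l. lam (k + l) = lam k + lam l"
    and \<delta>: "0 < \<delta>" "\<And>k. k \<noteq> 0 \<Longrightarrow> \<delta> \<le> (norm (lam k))\<^sup>2"
    and c: "rapid lam c" and c0: "c 0 = of_real m" and real: "\<And>x. Im (fser lam c x) = 0"
    and zero: "\<And>k. k \<noteq> 0 \<Longrightarrow> Pfun \<gamma> (of_real ((norm (lam k))\<^sup>2)) * c k + dconv c (dconv c c) k = 0"
  shows "solves_pde \<gamma> m (useries lam c)"
proof -
  let ?u = "useries lam c" let ?y = "\<lambda>k. (norm (lam k))\<^sup>2" let ?c3 = "dconv c (dconv c c)"
  have lam0: "lam 0 = 0" using lam[of 0 0] by simp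
  have cs: "c abs_summable_on UNIV" by (rule rapid_summable[OF c])
  have cube: "?u x ^ 3 = useries lam ?c3 x" for x
  proof -
    have "fser lam ?c3 x = fser lam c x ^ 3"
      using fser_dconv[OF lam cs fser_dconv(2)[OF lam cs cs]] fser_dconv(1)[OF lam cs cs]
      by (simp add: power3_eq_cube)
    also have "fser lam c x = of_real (?u x)" using real[of x] by (simp add: useries_def complex_eq_iff)
    finally have "fser lam ?c3 x = of_real (?u x ^ 3)" by simp
    then show ?thesis by (simp only: useries_def[of lam ?c3] Re_complex_of_real)
  qed
  \<comment> \<open>coefficients of the Laplacian of the series\<close>
  define d1 where "d1 k = of_real (- ?y k) * c k" for k
  have r1: "rapid lam d1" unfolding d1_def
    by (rule rapid_bound[OF c, where C = 1 and p = 2]) (simp add: norm_mult norm_power)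
  define g where "g k = (if k = 0 then 0 else c k / of_real (?y k))" for k
  have rg: "rapid lam g"
  proof (rule rapid_bound[OF c, where C = "1 / \<delta>" and p = 0])
    fix k
    have "cmod (c k) / ?y k \<le> cmod (c k) / \<delta>" if "k \<noteq> 0"
      using \<delta>(1) \<delta>(2)[OF that] by (intro divide_left_mono) (auto intro!: mult_pos_pos)
    then show "cmod (g k) \<le> 1 / \<delta> * norm (lam k) ^ 0 * cmod (c k)"
      using \<delta>(1) by (simp add: g_def norm_divide norm_power)
  qed
  have c3: "?c3 k = of_real (1 / \<gamma>\<^sup>2) * d1 k + c k + of_real (- 1) * g k" if "k \<noteq> 0" for k
  proof -
    have "?c3 k = - (Pfun \<gamma> (of_real (?y k)) * c k)" using zero[OF that] by (simp only: eq_neg_iff_add_eq_0 add.commute)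
    also have "\<dots> = of_real (1 / \<gamma>\<^sup>2) * d1 k + c k + of_real (- 1) * g k"
      using that unfolding Pfun_def d1_def g_def by (simp add: divide_inverse ring_distribs mult_ac)
    finally show ?thesis .
  qed
  have sc: "rapid lam (\<lambda>k. of_real a * f k)" if "rapid lam f" for a :: real and f
    by (rule rapid_bound[OF that, where C = "\<bar>a\<bar>" and p = 0]) (simp add: norm_mult)
  have r3: "rapid lam ?c3"
    by (rule rapid_cong_nonzero[OF _ c3]) (intro rapid_add sc r1 rg c)
  \<comment> \<open>coefficients of the function under the outer Laplacian\<close>
  define d where "d k = of_real (1 / \<gamma>\<^sup>2) * d1 k + (c k + of_real (- 1) * ?c3 k)" for k
  have rd: "rapid lam d" unfolding d_def by (intro rapid_add sc r1 r3 c)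
  have inner: "laplacian ?u y / \<gamma>\<^sup>2 + ?u y - ?u y ^ 3 = useries lam d y" for y
  proof -
    have "useries lam d y = 1 / \<gamma>\<^sup>2 * useries lam d1 y + (?u y + (- 1) * useries lam ?c3 y)"
      unfolding d_def by (simp only: useries_add[OF sc[OF r1] rapid_add[OF c sc[OF r3]]]
          useries_add[OF c sc[OF r3]] useries_scale)
    then show ?thesis unfolding cube laplacian_useries[OF c] d1_def[abs_def] by simp
  qed
  have "of_real (- ?y k) * d k = of_real m * unit_vec 0 k + of_real (- 1) * c k" for k
  proof (cases "k = 0")
    case False
    have "d k = g k" using c3[OF False] by (simp add: d_def)
    moreover have "of_real (?y k) \<noteq> (0::complex)" using \<delta>(1) \<delta>(2)[OF False] by auto
    ultimately show ?thesis using False by (simp add: g_def unit_vec_def)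
  qed (simp add: lam0 c0 unit_vec_def)
  then have "(\<lambda>k. of_real (- ?y k) * d k) = (\<lambda>k. of_real m * unit_vec 0 k + of_real (- 1) * c k)" by blast
  moreover have ru: "rapid lam (unit_vec 0)"
    by (rule rapid_cong_nonzero[of lam "\<lambda>_. 0"]) (simp_all add: rapid_def unit_vec_def)
  moreover have "useries lam (unit_vec 0) x = 1" for x
  proof -
    have "fser lam (unit_vec 0) x = (\<Sum>\<^sub>\<infinity>k\<in>{0}. unit_vec 0 k * iexp (lam k \<bullet> x))"
      unfolding fser_def by (rule infsum_cong_neutral) (auto simp: unit_vec_def)
    then show ?thesis by (simp add: useries_def unit_vec_def lam0)
  qed
  ultimately have "laplacian (useries lam d) x = m - ?u x" for x
    unfolding laplacian_useries[OF rd]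
    by (simp only: useries_add[OF sc[OF ru] sc[OF c]] useries_scale)
  then show ?thesis unfolding solves_pde_def inner using C_diff_useries[OF c] by simp
qed

section \<open>Stationary energy and solutions from zeros\<close>

context zero_problem
begin

text \<open>Only the quadratic part of the energy depends on the scales. Expanding \<open>P\<close> in the
  \<open>j\<close>-th scale, the term of first order is \<open>Hmap\<close>, which vanishes, and
  the rest is quadratic in the increment.\<close>

lemma Energy_stationary:
  assumes \<kappa>: "\<kappa> \<in> CJ_pos S" and b: "b \<in> X0s S \<nu> kb" and zero: "fst (zmap S \<gamma> m (\<kappa>, b)) j = 0"
    and j: "j \<in> J"
  shows "((\<lambda>z. Energy (csys S) \<gamma> m (\<kappa>(j := z)) (cof b)) has_field_derivative 0) (at (\<kappa> j))"
proof -
  let ?c = "cof b"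
  have c: "l1 ?c" by (rule l1_cof[OF b])
  obtain a where a: "0 < a" and aj: "\<forall>j\<in>J. a \<le> Re (\<kappa> j)"
    and Re': "\<forall>k. lsz k * a \<le> Re (Del k \<kappa>)" by (rule CJ_pos_Re_ge[OF \<kappa>])
  have Re: "lsz k * a \<le> Re (Del k \<kappa>)" for k using Re' by (rule spec)
  obtain B where B: "0 \<le> B"
    and q: "\<forall>k j. k \<noteq> 0 \<longrightarrow> j \<in> J \<longrightarrow> cmod (dPfun \<gamma> (Del k \<kappa>) * dc k j) \<le> B * lsz k"
    and "\<forall>k j h d. k \<noteq> 0 \<longrightarrow> j \<in> J \<longrightarrow> cmod (Del k h) \<le> lsz k * d \<longrightarrow> 0 \<le> d \<longrightarrow>
       cmod (ddPfun (Del k \<kappa>) * Del k h * dc k j) \<le> (B * d) * lsz k"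
    and "\<forall>k. k \<noteq> 0 \<longrightarrow> cmod (dPfun \<gamma> (Del k \<kappa>)) \<le> B"
    and P: "\<forall>k. k \<noteq> 0 \<longrightarrow> cmod (Pfun \<gamma> (Del k \<kappa>)) \<le> B * lsz k"
    by (rule coefficient_bounds[OF \<kappa>])
  \<comment> \<open>the part that does not depend on the scales\<close>
  define R where "R = 1/4 * dconv ?c (dconv ?c (dconv ?c ?c)) 0 + (1 - 2 * (of_real m)\<^sup>2) / 4"
  define M where "M = 2 / a ^ 3 * (size_const * N ?c * N ?c)"
  have M0: "0 \<le> M" using a lsize_le(1) N_nonneg[of ?c] by (simp add: M_def)
  have E: "Energy (csys S) \<gamma> m \<kappa>' ?c = 1/2 * qsum (\<lambda>k. Pfun \<gamma> (Del k \<kappa>')) ?c ?c + R" for \<kappa>'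
    by (simp add: Energy_def qsum_def R_def)
  have H0: "qsum (\<lambda>k. dPfun \<gamma> (Del k \<kappa>) * dc k j) ?c ?c = 0"
    using zero j by (simp add: zmap_eq[OF \<kappa>])
  have est: "cmod (Energy (csys S) \<gamma> m (\<kappa>(j := z)) ?c - Energy (csys S) \<gamma> m (\<kappa>(j := \<kappa> j)) ?c) \<le> M * (cmod (z - \<kappa> j))\<^sup>2"
    if small: "cmod (z - \<kappa> j) \<le> a / 2" for z
  proof -
    define t where "t = z - \<kappa> j"
    have D: "Del k (\<kappa>(j := z)) - Del k \<kappa> = dc k j * t" for k
    proof -
      have "Del k (\<kappa>(j := z)) = (\<Sum>i\<in>J. dc k i * \<kappa> i + (if i = j then dc k i * t else 0))"
        unfolding Delta_def by (intro sum.cong) (auto simp: t_def algebra_simps)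
      then show ?thesis using j by (simp add: sum.distrib Delta_def)
    qed
    have Dle: "cmod (Del k (\<kappa>(j := z)) - Del k \<kappa>) \<le> lsz k * cmod t" for k
      unfolding D norm_mult using cmod_dc_le[OF j, of k] by (intro mult_right_mono) auto
    define r where "r k = Pfun \<gamma> (Del k (\<kappa>(j := z))) - Pfun \<gamma> (Del k \<kappa>) - dPfun \<gamma> (Del k \<kappa>) * (dc k j * t)" for k
    have r: "cmod (r k) \<le> (2 / a ^ 3 * (cmod t)\<^sup>2) * lsz k" if k: "k \<noteq> 0" for k
    proof -
      have l: "1 \<le> lsz k" by (rule lsize_ge_1[OF k])
      have "cmod (r k) \<le> 2 / a ^ 3 * (cmod t)\<^sup>2"
        using scalar_estimates(1)[OF l a Re Dle, of \<gamma>] small unfolding r_def D by (simp add: t_def)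
      also have "\<dots> \<le> (2 / a ^ 3 * (cmod t)\<^sup>2) * lsz k"
        using mult_left_mono[OF l, of "2 / a ^ 3 * (cmod t)\<^sup>2"] a by simp
      finally show ?thesis .
    qed
    define B' where "B' = B + B * cmod t + 2 / a ^ 3 * (cmod t)\<^sup>2"
    have B': "0 \<le> B'" using B a by (simp add: B'_def)
    have P': "cmod (Pfun \<gamma> (Del k \<kappa>)) \<le> B' * lsz k"
      and q': "cmod (t * (dPfun \<gamma> (Del k \<kappa>) * dc k j)) \<le> B' * lsz k"
      and r': "cmod (r k) \<le> B' * lsz k" if k: "k \<noteq> 0" for k
    proof -
      have lz: "0 \<le> lsz k" by (rule lsize_nonneg)
      have le: "B \<le> B'" "B * cmod t \<le> B'" "2 / a ^ 3 * (cmod t)\<^sup>2 \<le> B'" using B a by (simp_all add: B'_def)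
      show "cmod (Pfun \<gamma> (Del k \<kappa>)) \<le> B' * lsz k"
        using P[rule_format, OF k] mult_right_mono[OF le(1) lz] by linarith
      have "cmod (t * (dPfun \<gamma> (Del k \<kappa>) * dc k j)) \<le> cmod t * (B * lsz k)"
        unfolding norm_mult[of t] using q[rule_format, OF k j] by (intro mult_left_mono) auto
      then show "cmod (t * (dPfun \<gamma> (Del k \<kappa>) * dc k j)) \<le> B' * lsz k"
        using mult_right_mono[OF le(2) lz] by (simp add: mult_ac)
      show "cmod (r k) \<le> B' * lsz k" using r[OF k] mult_right_mono[OF le(3) lz] by linarith
    qed
    have s: "cmod (t * (dPfun \<gamma> (Del k \<kappa>) * dc k j) + r k) \<le> (2 * B') * lsz k"
      and ddPfun': "cmod (Pfun \<gamma> (Del k \<kappa>)) \<le> (2 * B') * lsz k" if k: "k \<noteq> 0" for k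
      using q'[OF k] r'[OF k] P'[OF k] norm_triangle_ineq[of "t * (dPfun \<gamma> (Del k \<kappa>) * dc k j)" "r k"]
        mult_nonneg_nonneg[OF B' lsize_nonneg[of "csys S" k]] by linarith+
    have "(\<lambda>k. Pfun \<gamma> (Del k (\<kappa>(j := z)))) = (\<lambda>k. Pfun \<gamma> (Del k \<kappa>) + (t * (dPfun \<gamma> (Del k \<kappa>) * dc k j) + r k))"
      by (simp add: r_def fun_eq_iff)
    then have "qsum (\<lambda>k. Pfun \<gamma> (Del k (\<kappa>(j := z)))) ?c ?c
        = qsum (\<lambda>k. Pfun \<gamma> (Del k \<kappa>)) ?c ?c + qsum (\<lambda>k. t * (dPfun \<gamma> (Del k \<kappa>) * dc k j) + r k) ?c ?c"
      using qsum_add(1)[OF c c c _ ddPfun' s] B' by simp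
    also have "qsum (\<lambda>k. t * (dPfun \<gamma> (Del k \<kappa>) * dc k j) + r k) ?c ?c
        = qsum (\<lambda>k. t * (dPfun \<gamma> (Del k \<kappa>) * dc k j)) ?c ?c + qsum r ?c ?c"
      using qsum_add(1)[OF c c c B' q' r'] .
    also have "qsum (\<lambda>k. t * (dPfun \<gamma> (Del k \<kappa>) * dc k j)) ?c ?c = 0"
      unfolding qsum_scale(1)[of t "\<lambda>k. dPfun \<gamma> (Del k \<kappa>) * dc k j"] H0 by simp
    finally have qz: "qsum (\<lambda>k. Pfun \<gamma> (Del k (\<kappa>(j := z)))) ?c ?c
        = qsum (\<lambda>k. Pfun \<gamma> (Del k \<kappa>)) ?c ?c + (0 + qsum r ?c ?c)" .
    have "Energy (csys S) \<gamma> m (\<kappa>(j := z)) ?c - Energy (csys S) \<gamma> m (\<kappa>(j := \<kappa> j)) ?c = 1/2 * qsum r ?c ?c"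
      unfolding E fun_upd_triv qz by (simp add: algebra_simps)
    then have "cmod (Energy (csys S) \<gamma> m (\<kappa>(j := z)) ?c - Energy (csys S) \<gamma> m (\<kappa>(j := \<kappa> j)) ?c)
        = cmod (1/2 * qsum r ?c ?c)" by (rule arg_cong)
    also have "\<dots> = cmod (qsum r ?c ?c) / 2" by (simp add: norm_mult)
    also have "\<dots> \<le> cmod (qsum r ?c ?c)" by simp
    also have "\<dots> \<le> (2 / a ^ 3 * (cmod t)\<^sup>2) * (size_const * N ?c * N ?c)"
      using a by (intro qsum_bound c r) auto
    finally show ?thesis by (simp add: M_def t_def mult_ac)
  qed
  show ?thesis unfolding has_field_derivative_def has_derivative_at_alt
  proof (intro conjI allI impI)
    show "bounded_linear ((*) (0::complex))" by (rule bounded_linear_mult_right)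
    fix e :: real assume e: "0 < e"
    show "\<exists>d>0. \<forall>z. norm (z - \<kappa> j) < d \<longrightarrow> norm (Energy (csys S) \<gamma> m (\<kappa>(j := z)) ?c
        - Energy (csys S) \<gamma> m (\<kappa>(j := \<kappa> j)) ?c - 0 * (z - \<kappa> j)) \<le> e * norm (z - \<kappa> j)"
    proof (intro exI[of _ "min (a / 2) (e / (M + 1))"] conjI allI impI)
      show "0 < min (a / 2) (e / (M + 1))" using a e M0 by simp
      fix z assume z: "norm (z - \<kappa> j) < min (a / 2) (e / (M + 1))"
      have "M * norm (z - \<kappa> j) \<le> (M + 1) * (e / (M + 1))" using z M0 by (intro mult_mono) auto
      also have "\<dots> = e" using M0 by simp
      finally have "M * (norm (z - \<kappa> j))\<^sup>2 \<le> e * norm (z - \<kappa> j)"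
        by (simp add: power2_eq_square mult_right_mono flip: mult.assoc)
      then show "norm (Energy (csys S) \<gamma> m (\<kappa>(j := z)) ?c
        - Energy (csys S) \<gamma> m (\<kappa>(j := \<kappa> j)) ?c - 0 * (z - \<kappa> j)) \<le> e * norm (z - \<kappa> j)"
        using est[of z] z by simp
    qed
  qed
qed

text \<open>The residual is a symmetric sequence, so it vanishes everywhere as soon as it vanishes at the
  representatives.\<close>

lemma Ffull_zero:
  assumes \<kappa>: "\<kappa> \<in> CJ_pos S" and zero: "zmap S \<gamma> m (\<kappa>, b) = 0"
  shows "Ffull \<kappa> (cof b) = (\<lambda>_. 0)"
proof -
  have F: "Ffull \<kappa> (cof b) k = 0" if "k \<in> Zind S" for k
  proof (cases "k = 0")
    case False
    then have k: "k \<in> Z0 S" using that by (simp add: Z0_def)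
    have "snd (zmap S \<gamma> m (\<kappa>, b)) k = 0" using zero by simp
    then show ?thesis using k card_Orb_pos[of k] False by (simp add: zmap_eq[OF \<kappa>] Ffull_def)
  qed (simp add: Ffull_def)
  have "sigma S (\<lambda>_. 0) = Ffull \<kappa> (cof b)"
    by (rule sigma_symmetric[OF symmetric_Ffull[OF symmetric_cof]]) (simp add: F)
  moreover have "sigma S (\<lambda>_. 0) = (\<lambda>_. 0)" by (simp add: sigma_eq fun_eq_iff)
  ultimately show ?thesis by simp
qed

text \<open>Wave vectors for two choices of scales are comparable in length, and the exponential weight
  dominates all powers of the length.\<close>

lemma rapid_l1:
  assumes \<kappa>: "pos_scales (csys S) \<kappa>" and c: "l1 c"
  shows "rapid (\<lambda>k. Lmat (csys S) \<kappa> *v ivec k) c"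
  unfolding rapid_def
proof
  fix n
  obtain a where a: "0 < a" and lower: "\<forall>k. lsz k * a \<le> Delta (csys S) k kb" by (rule Delta_kb_ge)
  define M where "M = Max (\<kappa> ` J)"
  have M: "\<And>j. j \<in> J \<Longrightarrow> \<kappa> j \<le> M" by (auto simp: M_def)
  obtain j where "j \<in> J" using J_ne by blast
  then have "\<kappa> j \<le> M" "0 < \<kappa> j" using M \<kappa> by (simp_all add: pos_scales_def)
  then have M0: "0 \<le> M" by linarith
  define C where "C = sqrt (M / a)"
  have C0: "0 \<le> C" using M0 a by (simp add: C_def)
  have "norm (Lmat (csys S) \<kappa> *v ivec k) \<le> C * knorm S kb k" for k
  proof -
    have nn: "0 \<le> real_of_int (Delta_coef (csys S) k j)" if "j \<in> J" for j
      using Delta_coef_nonneg[OF that] by simp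
    have "Delta (csys S) k \<kappa> \<le> lsz k * M"
      unfolding lsize_sum Delta_def sum_distrib_right by (intro sum_mono mult_left_mono M nn)
    also have "\<dots> = lsz k * a * (M / a)" using a by simp
    also have "\<dots> \<le> Delta (csys S) k kb * (M / a)"
      using lower M0 a by (intro mult_right_mono) auto
    finally have "(norm (Lmat (csys S) \<kappa> *v ivec k))\<^sup>2 \<le> (knorm S kb k)\<^sup>2 * (M / a)"
      unfolding norm_Lmat_ivec[OF \<kappa>] knorm_eq norm_Lmat_ivec[OF kb] .
    also have "\<dots> = (C * knorm S kb k)\<^sup>2" using M0 a by (simp add: C_def power_mult_distrib)
    finally show ?thesis by (rule power2_le_imp_le[OF _ mult_nonneg_nonneg[OF C0 knorm_nonneg]])
  qed
  then have le: "norm (Lmat (csys S) \<kappa> *v ivec k) ^ n * cmod (c k) \<le> C ^ n * (fact n / ln \<nu> ^ n) * (cmod (c k) * w k)" for k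
  proof -
    have "norm (Lmat (csys S) \<kappa> *v ivec k) ^ n \<le> (C * knorm S kb k) ^ n"
      using \<open>\<And>k. norm (Lmat (csys S) \<kappa> *v ivec k) \<le> C * knorm S kb k\<close> by (intro power_mono) auto
    also have "\<dots> = C ^ n * knorm S kb k ^ n" by (rule power_mult_distrib)
    also have "\<dots> \<le> C ^ n * (fact n / ln \<nu> ^ n * w k)"
      using C0 power_le_powr[OF nu knorm_nonneg] by (intro mult_left_mono) auto
    finally have "norm (Lmat (csys S) \<kappa> *v ivec k) ^ n * cmod (c k) \<le> C ^ n * (fact n / ln \<nu> ^ n * w k) * cmod (c k)"
      by (intro mult_right_mono) auto
    then show ?thesis by (simp add: mult_ac)
  qed
  have s: "(\<lambda>k. C ^ n * (fact n / ln \<nu> ^ n) * (cmod (c k) * w k)) summable_on UNIV"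
    using c unfolding l1_def by (rule summable_on_cmult_right)
  show "(\<lambda>k. norm (Lmat (csys S) \<kappa> *v ivec k) ^ n * cmod (c k)) summable_on UNIV"
    by (rule summable_on_comparison_test[OF s le]) (intro mult_nonneg_nonneg zero_le_power norm_ge_zero)
qed

end

context space_group
begin

text \<open>Reindexing the series by \<open>beta S g\<close> turns the rotation into one of the wave
  vectors; the phase that the shift produces is \<open>alpha\<close>, which the symmetry of the
  coefficients cancels.\<close>

lemma fser_group_invariant:
  assumes \<kappa>: "pos_scales (csys S) \<kappa>" and c: "symmetric c" and g: "g \<in> carrier S"
  shows "fser (\<lambda>k. Lmat (csys S) \<kappa> *v ivec k) c (act S \<kappa> g x) = fser (\<lambda>k. Lmat (csys S) \<kappa> *v ivec k) c x"
proof -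
  let ?L = "Lmat (csys S) \<kappa>"
  have t: "c (beta S g q) * iexp ((?L *v ivec (beta S g q)) \<bullet> act S \<kappa> g x) = c q * iexp ((?L *v ivec q) \<bullet> x)" for q
  proof -
    have "(?L *v ivec (beta S g q)) \<bullet> act S \<kappa> g x
      = (?L *v ivec q) \<bullet> x + 2 * pi * (ivec (beta S g q) \<bullet> shift S g)"
      unfolding act_def inner_add_right inner_scaleR_right inner_dual_lattice[OF invertible_Lmat[OF \<kappa>]]
      by (simp add: Lmat_beta[OF g \<kappa>] inner_lin[OF g])
    then have "iexp ((?L *v ivec (beta S g q)) \<bullet> act S \<kappa> g x) = iexp ((?L *v ivec q) \<bullet> x) * alpha S g q"
      by (simp add: alpha_def exp_add[symmetric] algebra_simps)
    moreover have "alpha S g q * c (beta S g q) = c q" using c g by (simp add: symmetric_def)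
    ultimately show ?thesis by (metis (no_types, lifting) mult.assoc mult.commute)
  qed
  have "fser (\<lambda>k. ?L *v ivec k) c (act S \<kappa> g x)
      = (\<Sum>\<^sub>\<infinity>q. c (beta S g q) * iexp ((?L *v ivec (beta S g q)) \<bullet> act S \<kappa> g x))"
    unfolding fser_def by (rule infsum_reindex_bij_betw[OF bij_beta[OF g], symmetric])
  then show ?thesis unfolding t fser_def .
qed

end

text \<open>Periods change phases by integer multiples of \<open>2 * pi\<close>. The translates cover the
  space because a point is reduced by the integer parts of its coordinates in the basis of
  periods.\<close>

lemma period_domain_fser:
  assumes \<kappa>: "pos_scales s \<kappa>"
  shows "period_domain (period_lattice s \<kappa>) (Omega s \<kappa>) (useries (\<lambda>k. Lmat s \<kappa> *v ivec k) c)"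
proof -
  let ?L = "Lmat s \<kappa>" let ?T = "transpose (matrix_inv (Lmat s \<kappa>))"
  have inv: "invertible ?L" by (rule invertible_Lmat[OF \<kappa>])
  have per: "useries (\<lambda>k. ?L *v ivec k) c (x + (2 * pi) *\<^sub>R (?T *v ivec n)) = useries (\<lambda>k. ?L *v ivec k) c x" for x n
  proof -
    have "iexp ((?L *v ivec k) \<bullet> (x + (2 * pi) *\<^sub>R (?T *v ivec n))) = iexp ((?L *v ivec k) \<bullet> x)" for k
    proof -
      obtain z where z: "ivec k \<bullet> ivec n = of_int z" using inner_ivec_Ints by (metis Ints_cases)
      have "(?L *v ivec k) \<bullet> (x + (2 * pi) *\<^sub>R (?T *v ivec n)) = (?L *v ivec k) \<bullet> x + 2 * pi * of_int z"
        unfolding inner_add_right inner_scaleR_right inner_dual_lattice[OF inv] z ..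
      moreover have "exp (\<i> * of_real (2 * pi * of_int z)) = 1"
        using exp_integer_2pi[of "of_int z"] by (simp add: algebra_simps)
      ultimately show ?thesis by (simp add: distrib_left exp_add)
    qed
    then show ?thesis by (simp add: useries_def fser_def)
  qed
  have "x \<in> (\<Union>v\<in>period_lattice s \<kappa>. (\<lambda>y. y + v) ` Omega s \<kappa>)" for x
  proof -
    define y where "y = (1 / (2 * pi)) *\<^sub>R (transpose ?L *v x)"
    define n :: "int^3" where "n = (\<chi> i. \<lfloor>y $ i\<rfloor>)"
    define f where "f = y - ivec n"
    have TL: "?T *v (transpose ?L *v x) = x"
      using matrix_inv_mult(1)[OF inv]
      by (simp add: matrix_vector_mul_assoc matrix_transpose_mul[symmetric] transpose_mat del: transpose_matrix_vector)
    have "x = (2 * pi) *\<^sub>R (?T *v y)"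
      unfolding y_def matrix_vector_mult_scaleR TL by simp
    also have "y = f + ivec n" by (simp add: f_def)
    finally have x: "x = (2 * pi) *\<^sub>R (?T *v f) + (2 * pi) *\<^sub>R (?T *v ivec n)"
      by (simp only: matrix_vector_right_distrib scaleR_add_right)
    have "0 \<le> f $ i \<and> f $ i \<le> 1" for i
      unfolding f_def n_def ivec_def by simp linarith
    then have "(2 * pi) *\<^sub>R (?T *v f) \<in> Omega s \<kappa>" unfolding Omega_def by blast
    moreover have "(2 * pi) *\<^sub>R (?T *v ivec n) \<in> period_lattice s \<kappa>" unfolding period_lattice_def by blast
    ultimately show ?thesis using x by blast
  qed
  then show ?thesis using per unfolding period_domain_def period_lattice_def by blast
qed

lemma fser_real:
  assumes lam: "\<And>k. lam (- k) = - lam k" and herm: "\<And>k. cnj (c (- k)) = c k"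
  shows "Im (fser lam c x) = 0"
proof -
  have b: "bij (uminus :: int^3 \<Rightarrow> int^3)" by (rule bij_uminus)
  have "cnj (fser lam c x) = (\<Sum>\<^sub>\<infinity>k. cnj (c k) * cnj (iexp (lam k \<bullet> x)))"
    by (simp add: fser_def flip: infsum_cnj)
  also have "\<dots> = (\<Sum>\<^sub>\<infinity>k. cnj (c (- k)) * cnj (iexp (lam (- k) \<bullet> x)))"
    by (rule infsum_reindex_bij_betw[OF b, symmetric])
  also have "\<dots> = fser lam c x"
    by (simp add: fser_def lam herm exp_cnj)
  finally show ?thesis by (metis Reals_cnj_iff complex_is_Real_iff)
qed

section \<open>Zeros in the ball\<close>

context symmetric_fixed_point_problem
begin

lemma cball2_S_eq:
  "cball2_S S \<nu> kb r x = {y \<in> Sinv S \<nu> kb \<inter> vcarrier (prod_space V X).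
     vnorm V (fst y - fst x) \<le> r $ 1 \<and> vnorm X (snd y - snd x) \<le> r $ 2}"
  by (auto simp: cball2_S_def cball2_def carP mem_Times_iff) (auto simp: CJ_space_def X0_space_def)

lemma Sinv_convex:
  assumes x: "x \<in> Sinv S \<nu> kb" "x \<in> vcarrier (prod_space V X)"
    and y: "y \<in> Sinv S \<nu> kb" "y \<in> vcarrier (prod_space V X)"
  shows "x + vscale (prod_space V X) (of_real t) (y - x) \<in> Sinv S \<nu> kb"
proof -
  interpret P: cn_space "prod_space V X" by (rule cn_space_P)
  let ?z = "x + vscale (prod_space V X) (of_real t) (y - x)"
  have "?z \<in> vcarrier (prod_space V X)" using x y by (intro P.add_mem P.scale_mem P.diff_mem)
  then have "fst ?z \<in> CJ S" "snd ?z \<in> Xs S \<nu> kb" using X0s_Xs by (auto simp: carP)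
  moreover have "conj_x S ?z = ?z"
  proof -
    have "conj_x S x = x" "conj_x S y = y" using x y by (simp_all add: Sinv_def)
    then have "conj_x S (y - x) = y - x" by (simp add: conj_x_diff)
    then have f: "\<And>j. cnj (fst (y - x) j) = fst (y - x) j" and s: "conj_b S (snd (y - x)) = snd (y - x)"
      unfolding conj_x_def prod_eq_iff fun_eq_iff by simp_all
    have "conj_b S (\<lambda>k. of_real t * snd (y - x) k) = (\<lambda>k. of_real t * snd (y - x) k)"
      using conj_b_multiplier[of "\<lambda>_. of_real t" "snd (y - x)"] s by simp
    then have "conj_x S (vscale (prod_space V X) (of_real t) (y - x)) = vscale (prod_space V X) (of_real t) (y - x)"
      using f by (simp only: conj_x_def scaleP fst_conv snd_conv complex_cnj_mult complex_cnj_complex_of_real)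
    then show ?thesis using \<open>conj_x S x = x\<close> by (simp only: conj_x_add)
  qed
  ultimately show ?thesis by (simp add: Sinv_def mem_Times_iff)
qed

text \<open>Norm convergence implies convergence of each coordinate, and self-conjugacy is a family of
  equations that involve finitely many coordinates each.\<close>

lemma Sinv_closed:
  assumes s: "\<And>n::nat. s n \<in> Sinv S \<nu> kb \<inter> vcarrier (prod_space V X)"
    and y: "y \<in> vcarrier (prod_space V X)"
    and lim: "(\<lambda>n. vnorm (prod_space V X) (s n - y)) \<longlonglongrightarrow> 0"
  shows "y \<in> Sinv S \<nu> kb"
proof -
  interpret P: cn_space "prod_space V X" by (rule cn_space_P)
  have sy: "s n - y \<in> vcarrier (prod_space V X)" for n using s y P.diff_mem by blast
  have f: "(\<lambda>n. fst (s n) j) \<longlonglongrightarrow> fst y j" if j: "j \<in> J" for j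
  proof -
    have lim': "(\<lambda>n. vnorm (prod_space V X) (s n - y) * kmax) \<longlonglongrightarrow> 0"
      using tendsto_mult[OF lim tendsto_const] by simp
    have "(\<lambda>n. fst (s n) j - fst y j) \<longlonglongrightarrow> 0"
    proof (rule Lim_null_comparison[OF _ lim'])
      have "cmod (fst (s n) j - fst y j) \<le> vnorm (prod_space V X) (s n - y) * kmax" for n
        using cmod_le_kmax[OF j, of "fst (s n - y)" "vnorm (prod_space V X) (s n - y)"]
        by (simp add: normP)
      then show "\<forall>\<^sub>F n in sequentially. cmod (fst (s n) j - fst y j) \<le> vnorm (prod_space V X) (s n - y) * kmax"
        by simp
    qed
    then show ?thesis by (rule LIM_zero_cancel)
  qed
  have g: "(\<lambda>n. snd (s n) k) \<longlonglongrightarrow> snd y k" for k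
  proof -
    have "(\<lambda>n. snd (s n) k - snd y k) \<longlonglongrightarrow> 0"
    proof (rule Lim_null_comparison[OF _ lim])
      have "cmod (snd (s n) k - snd y k) \<le> vnorm (prod_space V X) (s n - y)" for n
        using cmod_le_XN[of "snd (s n - y)" k] sy[of n] by (simp add: normP carP)
      then show "\<forall>\<^sub>F n in sequentially. cmod (snd (s n) k - snd y k) \<le> vnorm (prod_space V X) (s n - y)"
        by simp
    qed
    then show ?thesis by (rule LIM_zero_cancel)
  qed
  have cf: "cnj (fst (s n) j) = fst (s n) j" and cs: "conj_b S (snd (s n)) = snd (s n)" for n j
    using s[of n] by (auto simp: Sinv_iff)
  have "cnj (fst y j) = fst y j" for j
  proof (cases "j \<in> J")
    case True
    have "(\<lambda>n. cnj (fst (s n) j)) \<longlonglongrightarrow> cnj (fst y j)" by (intro tendsto_cnj f True)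
    then show ?thesis unfolding cf using f[OF True] LIMSEQ_unique by blast
  next
    case False
    then show ?thesis using y by (auto simp: carP CJ_def)
  qed
  moreover have "conj_b S (snd y) k = snd y k" for k
  proof (cases "k \<in> Zind S")
    case True
    have "(\<lambda>n. sigma S (snd (s n)) (- k)) \<longlonglongrightarrow> sigma S (snd y) (- k)"
      unfolding sigma_eq by (cases "rep (- k) \<in> Zind S") (simp_all add: tendsto_mult_right g)
    then have "(\<lambda>n. conj_b S (snd (s n)) k) \<longlonglongrightarrow> conj_b S (snd y) k"
      using True by (simp add: conj_b_def tendsto_cnj)
    then show ?thesis unfolding cs using g[of k] LIMSEQ_unique by blast
  next
    case False
    then show ?thesis using y by (auto simp: conj_b_def carP X0s_iff Z0_def)
  qed
  moreover have "fst y \<in> CJ S" "snd y \<in> Xs S \<nu> kb" using y X0s_Xs by (auto simp: carP)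
  ultimately show ?thesis by (simp add: Sinv_iff fun_eq_iff)
qed

text \<open>The norm measures scales relative to \<open>kb\<close>, so a radius below 1 keeps their real
  parts positive.\<close>

lemma ball_CJ_pos:
  assumes xbar: "\<And>j. fst xbar j = of_real (kb j)" and r: "r $ 1 < 1"
    and y: "y \<in> cball2_S S \<nu> kb r xbar"
  shows "fst y \<in> CJ_pos S"
proof -
  have n: "CJ_norm S kb (fst y - fst xbar) \<le> r $ 1" and C: "fst y \<in> CJ S"
    using y by (auto simp: cball2_S_def cball2_def)
  have "0 < Re (fst y j)" if j: "j \<in> J" for j
  proof -
    have "cmod (fst y j - of_real (kb j)) \<le> r $ 1 * kb j"
      using n j unfolding CJ_norm_le_iff by (simp add: xbar)
    moreover have "r $ 1 * kb j < kb j" using r kb_pos[OF j] by simp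
    moreover have "\<bar>Re (fst y j - of_real (kb j))\<bar> \<le> cmod (fst y j - of_real (kb j))" by (rule abs_Re_le_cmod)
    ultimately show ?thesis by simp
  qed
  then show ?thesis using C by (simp add: CJ_pos_def)
qed

lemma zero_gives_solution:
  assumes \<kappa>: "\<kappa> \<in> CJ_pos S" and inv: "(\<kappa>, b) \<in> Sinv S \<nu> kb" and b: "b \<in> X0s S \<nu> kb"
    and zero: "zmap S \<gamma> m (\<kappa>, b) = 0"
  shows "\<exists>khat. (\<forall>j. \<kappa> j = complex_of_real (khat j)) \<and> pos_scales (csys S) khat \<and>
     (\<exists>u :: real^3 \<Rightarrow> real.
        (\<forall>x. ((\<lambda>k. full_coeffs S m b k * exp (\<i> * of_real ((Lmat (csys S) khat *v ivec k) \<bullet> x)))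
               has_sum complex_of_real (u x)) UNIV) \<and>
        group_invariant S khat u \<and>
        period_domain (period_lattice (csys S) khat) (Omega (csys S) khat) u \<and>
        solves_pde \<gamma> m u)"
proof -
  define khat where "khat j = Re (\<kappa> j)" for j
  have real: "cnj (\<kappa> j) = \<kappa> j" and cb: "conj_b S b = b" for j using inv by (auto simp: Sinv_iff)
  have kk: "\<kappa> j = complex_of_real (khat j)" for j
    using real[of j] by (simp add: khat_def complex_eq_iff)
  have pos: "pos_scales (csys S) khat" using \<kappa> by (auto simp: pos_scales_def khat_def CJ_pos_def)
  let ?lam = "\<lambda>k. Lmat (csys S) khat *v ivec k"
  let ?c = "cof b" let ?u = "useries ?lam ?c"
  have c: "l1 ?c" by (rule l1_cof[OF b])
  have herm: "hermitian ?c" by (rule hermitian_cof[OF cb])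
  have rapid: "rapid ?lam ?c" by (rule rapid_l1[OF pos c])
  have Im: "Im (fser ?lam ?c x) = 0" for x
    by (rule fser_real) (use herm in \<open>simp_all add: hermitian_def linear_neg[OF matrix_vector_mul_linear]\<close>)
  have Del: "Del k \<kappa> = of_real ((norm (?lam k))\<^sup>2)" for k
  proof -
    have "\<kappa> = (\<lambda>j. complex_of_real (khat j))" using kk by (simp add: fun_eq_iff)
    then show ?thesis using norm_Lmat_ivec[OF pos, of k] by (simp only: Delta_of_real)
  qed
  obtain a where a: "0 < a" and "\<forall>j\<in>J. a \<le> Re (\<kappa> j)" and Re: "\<forall>k. lsz k * a \<le> Re (Del k \<kappa>)"
    by (rule CJ_pos_Re_ge[OF \<kappa>])
  have "solves_pde \<gamma> m ?u"
  proof (rule fourier_solves_pde)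
    show "?lam (k + l) = ?lam k + ?lam l" for k l by (simp add: matrix_vector_right_distrib)
    show "0 < a" by (rule a)
    show "a \<le> (norm (?lam k))\<^sup>2" if "k \<noteq> 0" for k
    proof -
      have "1 * a \<le> lsz k * a" using a lsize_ge_1[OF that] by (intro mult_right_mono) auto
      also have "\<dots> \<le> (norm (?lam k))\<^sup>2" using Re[rule_format, of k] unfolding Del by simp
      finally show ?thesis by simp
    qed
    show "rapid ?lam ?c" by (rule rapid)
    show "?c 0 = of_real m"
      using b sigma_Zind[OF zero_in_Zind, of b] by (simp add: full_coeffs_eq unit_vec_def X0s_def)
    show "Im (fser ?lam ?c x) = 0" for x by (rule Im)
    show "Pfun \<gamma> (of_real ((norm (?lam k))\<^sup>2)) * ?c k + dconv ?c (dconv ?c ?c) k = 0" if "k \<noteq> 0" for k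
      using fun_cong[OF Ffull_zero[OF \<kappa> zero], of k] that unfolding Ffull_def Del by simp
  qed
  moreover have "group_invariant S khat ?u"
    unfolding group_invariant_def useries_def
    by (simp add: fser_group_invariant[OF pos symmetric_cof])
  moreover have "((\<lambda>k. ?c k * iexp (?lam k \<bullet> x)) has_sum complex_of_real (?u x)) UNIV" for x
  proof -
    have "complex_of_real (?u x) = fser ?lam ?c x" using Im[of x] by (simp add: useries_def complex_eq_iff)
    then show ?thesis using has_sum_infsum[OF fser_summable[OF rapid, of x]] by (simp only: fser_def)
  qed
  ultimately show ?thesis using kk pos period_domain_fser[OF pos] by blast
qed

end

theorem theorem5p5:
  fixes S :: "'g crystal_group" and \<gamma> m \<nu> K :: real
    and kbar :: "nat \<Rightarrow> real" and xbar :: state and A :: cmatrix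
    and Y :: "real^2" and Z :: "real^2^2" and W :: "real^2^2^2"
    and rstar rhat :: "real^2"
  assumes params: "0 < \<gamma>" "-1 \<le> m" "m \<le> 1" "1 < \<nu>"
    and grp: "space_group_mod S" "is_dom S"
    and kbar: "\<And>j. fst xbar j = complex_of_real (kbar j)"
    and xbar: "xbar \<in> Sinv_pos S \<nu> kbar"
    and K: "sqrt (y_P \<gamma>) < K"
    and A_inv: "invertible_on (mat_idx S kbar K) A"
    and A_conj: "\<And>x. x \<in> CJ S \<times> X0Ks S \<nu> kbar K \<Longrightarrow>
       conj_x S (mat_act S kbar K A x) = mat_act S kbar K A (conj_x S x)"
    and rstar: "0 < rstar $ 1" "0 < rstar $ 2" "rstar $ 1 < 1"
    and pos: "\<And>i. 0 < Y $ i" "\<And>i i'. 0 < Z $ i $ i'" "\<And>i i' i''. 0 < W $ i $ i' $ i''"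
    and Y1: "CJ_norm S kbar (fst (Tmap S \<gamma> m kbar K A xbar - xbar)) \<le> Y $ 1"
    and Y2: "X_norm S \<nu> kbar (snd (Tmap S \<gamma> m kbar K A xbar - xbar)) \<le> Y $ 2"
    and Z11: "op_norm (CJ_space S kbar) (CJ_space S kbar)
       (\<lambda>h. fst (D_kappa S \<nu> kbar (Tmap S \<gamma> m kbar K A) xbar h)) \<le> Z $ 1 $ 1"
    and Z12: "op_norm (X0_space S \<nu> kbar) (CJ_space S kbar)
       (\<lambda>h. fst (D_b S \<nu> kbar (Tmap S \<gamma> m kbar K A) xbar h)) \<le> Z $ 1 $ 2"
    and Z21: "op_norm (CJ_space S kbar) (X0_space S \<nu> kbar)
       (\<lambda>h. snd (D_kappa S \<nu> kbar (Tmap S \<gamma> m kbar K A) xbar h)) \<le> Z $ 2 $ 1"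
    and Z22: "op_norm (X0_space S \<nu> kbar) (X0_space S \<nu> kbar)
       (\<lambda>h. snd (D_b S \<nu> kbar (Tmap S \<gamma> m kbar K A) xbar h)) \<le> Z $ 2 $ 2"
    and W11: "\<And>r x. 0 \<le> r $ 1 \<Longrightarrow> r $ 1 \<le> rstar $ 1 \<Longrightarrow> 0 \<le> r $ 2 \<Longrightarrow> r $ 2 \<le> rstar $ 2 \<Longrightarrow>
       x \<in> cball2_S S \<nu> kbar r xbar \<Longrightarrow>
       op_norm (CJ_space S kbar) (CJ_space S kbar)
         (\<lambda>h. fst (D_kappa S \<nu> kbar (Tmap S \<gamma> m kbar K A) x h
                   - D_kappa S \<nu> kbar (Tmap S \<gamma> m kbar K A) xbar h))
       \<le> W $ 1 $ 1 $ 1 * r $ 1 + W $ 1 $ 1 $ 2 * r $ 2"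
    and W12: "\<And>r x. 0 \<le> r $ 1 \<Longrightarrow> r $ 1 \<le> rstar $ 1 \<Longrightarrow> 0 \<le> r $ 2 \<Longrightarrow> r $ 2 \<le> rstar $ 2 \<Longrightarrow>
       x \<in> cball2_S S \<nu> kbar r xbar \<Longrightarrow>
       op_norm (X0_space S \<nu> kbar) (CJ_space S kbar)
         (\<lambda>h. fst (D_b S \<nu> kbar (Tmap S \<gamma> m kbar K A) x h
                   - D_b S \<nu> kbar (Tmap S \<gamma> m kbar K A) xbar h))
       \<le> W $ 1 $ 2 $ 1 * r $ 1 + W $ 1 $ 2 $ 2 * r $ 2"
    and W21: "\<And>r x. 0 \<le> r $ 1 \<Longrightarrow> r $ 1 \<le> rstar $ 1 \<Longrightarrow> 0 \<le> r $ 2 \<Longrightarrow> r $ 2 \<le> rstar $ 2 \<Longrightarrow>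
       x \<in> cball2_S S \<nu> kbar r xbar \<Longrightarrow>
       op_norm (CJ_space S kbar) (X0_space S \<nu> kbar)
         (\<lambda>h. snd (D_kappa S \<nu> kbar (Tmap S \<gamma> m kbar K A) x h
                   - D_kappa S \<nu> kbar (Tmap S \<gamma> m kbar K A) xbar h))
       \<le> W $ 2 $ 1 $ 1 * r $ 1 + W $ 2 $ 1 $ 2 * r $ 2"
    and W22: "\<And>r x. 0 \<le> r $ 1 \<Longrightarrow> r $ 1 \<le> rstar $ 1 \<Longrightarrow> 0 \<le> r $ 2 \<Longrightarrow> r $ 2 \<le> rstar $ 2 \<Longrightarrow>
       x \<in> cball2_S S \<nu> kbar r xbar \<Longrightarrow>
       op_norm (X0_space S \<nu> kbar) (X0_space S \<nu> kbar)
         (\<lambda>h. snd (D_b S \<nu> kbar (Tmap S \<gamma> m kbar K A) x h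
                   - D_b S \<nu> kbar (Tmap S \<gamma> m kbar K A) xbar h))
       \<le> W $ 2 $ 2 $ 1 * r $ 1 + W $ 2 $ 2 $ 2 * r $ 2"
    and rhat: "\<And>i. 0 < rhat $ i \<and> rhat $ i \<le> rstar $ i"
    and p: "p1 Y Z W rhat < 0" "p2 Y Z W rhat < 0" "p3 Z W rhat < 0" "p4 Z W rhat < 0"
  shows "\<exists>\<kappa> b khat.
     (\<kappa>, b) \<in> cball2_S S \<nu> kbar rhat xbar \<and> zmap S \<gamma> m (\<kappa>, b) = 0 \<and>
     (\<forall>x\<in>cball2_S S \<nu> kbar rhat xbar. zmap S \<gamma> m x = 0 \<longrightarrow> x = (\<kappa>, b)) \<and>
     (\<forall>j. \<kappa> j = complex_of_real (khat j)) \<and> pos_scales (csys S) khat \<and>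
     (\<exists>u :: real^3 \<Rightarrow> real.
        (\<forall>x. ((\<lambda>k. full_coeffs S m b k * exp (\<i> * of_real ((Lmat (csys S) khat *v ivec k) \<bullet> x)))
               has_sum complex_of_real (u x)) UNIV) \<and>
        group_invariant S khat u \<and>
        period_domain (period_lattice (csys S) khat) (Omega (csys S) khat) u \<and>
        solves_pde \<gamma> m u) \<and>
     (\<forall>j\<in>{1..num_scales (csys S)}.
        ((\<lambda>z. Energy (csys S) \<gamma> m (\<kappa>(j := z)) (full_coeffs S m b))
           has_field_derivative 0) (at (\<kappa> j)))"
proof -
  interpret space_group S using grp by unfold_locales
  have xb: "fst xbar \<in> CJ_pos S" "snd xbar \<in> X0s S \<nu> kbar" "xbar \<in> Sinv S \<nu> kbar"
    using xbar by (auto simp: Sinv_pos_def)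
  have "pos_scales (csys S) kbar"
    using xb(1) by (simp add: pos_scales_def CJ_pos_def kbar)
  then interpret symmetric_fixed_point_problem S \<nu> kbar \<gamma> m K A
    using params K A_inv A_conj by unfold_locales auto
  have Dv: "D_kappa S \<nu> kbar T x = fderiv V (prod_space V X) (CJ_pos S) (\<lambda>v. T (v, snd x)) (fst x)"
    and Dx: "D_b S \<nu> kbar T x = fderiv X (prod_space V X) (vcarrier X) (\<lambda>b. T (fst x, b)) (snd x)" for x
    by (simp_all add: D_kappa_def D_b_def X0_space_def)
  have r1: "rhat $ 1 < 1" using rhat[of 1] rstar(3) by linarith
  have carX: "vcarrier X = X0s S \<nu> kbar" and nV: "vnorm V = CJ_norm S kbar" and nX: "vnorm X = X_norm S \<nu> kbar"
    by (simp_all add: X0_space_def CJ_space_def)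
  have ball: "fst x \<in> CJ_pos S" "snd x \<in> X0s S \<nu> kbar" "x \<in> Sinv S \<nu> kbar"
    if "x \<in> cball2_S S \<nu> kbar rhat xbar" for x
    using ball_CJ_pos[OF kbar r1 that] that by (auto simp: cball2_S_def cball2_def)
  have ex1: "\<exists>!x. x \<in> cball2_S S \<nu> kbar rhat xbar \<and> T x = x"
    unfolding cball2_S_eq
  proof (rule radii_polynomials[where U = "CJ_pos S" and Y = Y and Z = Z and W = W and rstar = rstar])
    show "cn_banach V" by (rule cn_banach_CJ)
    show "cn_banach X" by (rule cn_banach_X0)
    show "xbar \<in> Sinv S \<nu> kbar" by (rule xb)
    show "xbar \<in> vcarrier (prod_space V X)" using xb by (auto simp: carP CJ_pos_def)
    show "x + vscale (prod_space V X) (of_real t) (y - x) \<in> Sinv S \<nu> kbar"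
      if "x \<in> Sinv S \<nu> kbar" "y \<in> Sinv S \<nu> kbar" "x \<in> vcarrier (prod_space V X)" "y \<in> vcarrier (prod_space V X)"
      for x y t using that by (intro Sinv_convex)
    show "y \<in> Sinv S \<nu> kbar" if "\<And>n::nat. s n \<in> Sinv S \<nu> kbar \<inter> vcarrier (prod_space V X)"
      "y \<in> vcarrier (prod_space V X)" "(\<lambda>n. vnorm (prod_space V X) (s n - y)) \<longlonglongrightarrow> 0" for s y
      using that by (rule Sinv_closed)
    show "\<exists>L. has_fderiv (prod_space V X) (prod_space V X) (CJ_pos S \<times> vcarrier X) T L x"
      if "x \<in> {y \<in> Sinv S \<nu> kbar \<inter> vcarrier (prod_space V X).
        vnorm V (fst y - fst xbar) \<le> rhat $ 1 \<and> vnorm X (snd y - snd xbar) \<le> rhat $ 2}" for x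
      using T_has_fderiv[OF ball(1,2)[OF that[folded cball2_S_eq]]] unfolding carX by auto
    show "T x \<in> Sinv S \<nu> kbar \<inter> vcarrier (prod_space V X)"
      if "x \<in> {y \<in> Sinv S \<nu> kbar \<inter> vcarrier (prod_space V X).
        vnorm V (fst y - fst xbar) \<le> rhat $ 1 \<and> vnorm X (snd y - snd xbar) \<le> rhat $ 2}" for x
    proof -
      note x = ball[OF that[folded cball2_S_eq]]
      have "T x \<in> vcarrier (prod_space V X)" using T_carrier[OF x(1,2)] by simp
      moreover have "conj_x S (T x) = T x" using T_conj[OF x(1), of "snd x"] x(3) by simp
      ultimately show ?thesis using X0s_Xs by (auto simp: Sinv_def carP mem_Times_iff)
    qed
    show "vnorm V (fst (T xbar - xbar)) \<le> Y $ 1" "vnorm X (snd (T xbar - xbar)) \<le> Y $ 2"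
      unfolding nV nX by (rule Y1, rule Y2)
  qed (unfold Dv[symmetric] Dx[symmetric] cball2_S_eq[symmetric] Wr_def,
       (rule pos Z11 Z12 Z21 Z22 rhat p W11 W12 W21 W22; assumption?)+)
  then obtain x where x: "x \<in> cball2_S S \<nu> kbar rhat xbar" "T x = x"
    and uniq: "\<And>y. y \<in> cball2_S S \<nu> kbar rhat xbar \<Longrightarrow> T y = y \<Longrightarrow> y = x" by blast
  obtain \<kappa> b where kb: "x = (\<kappa>, b)" by (cases x)
  have zero: "zmap S \<gamma> m (\<kappa>, b) = 0" using zero_iff_fixed_point x(2) by (simp add: kb)
  note B = ball[OF x(1), unfolded kb fst_conv snd_conv]
  have en: "\<forall>j\<in>{1..num_scales (csys S)}. ((\<lambda>z. Energy (csys S) \<gamma> m (\<kappa>(j := z)) (full_coeffs S m b))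
           has_field_derivative 0) (at (\<kappa> j))"
    using Energy_stationary[OF B(1,2)] zero by simp
  have un: "\<forall>y\<in>cball2_S S \<nu> kbar rhat xbar. zmap S \<gamma> m y = 0 \<longrightarrow> y = (\<kappa>, b)"
    using uniq zero_iff_fixed_point unfolding kb by blast
  show ?thesis using zero_gives_solution[OF B(1,3,2) zero] x(1)[unfolded kb] zero un en by blast
qed

end
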